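(* Let $H_1,H_2\in(0,1)$, $\sigma_1,\sigma_2>0$, $\delta>0$, and let $\{u(t,x): t\ge0,\,x\in\mathbb{R}\}$ be the random field $$u(t,x)=\sigma_1\int_0^t\int_{\mathbb{R}} G(t-s,x-y)\,dW^{H_1}_y\,ds+\sigma_2\int_0^t\int_{\mathbb{R}} G(t-s,x-y)\,dW^{H_2}_y\,ds .$$ For $t>0$ and $N\ge1$ put $$V_N(t)=\frac1N\sum_{k=1}^N[u(t,k\delta)]^2,\qquad \mu(t)=\sigma_1^2v_t(H_1)+\sigma_2^2v_t(H_2).$$ (i) For any $t>0$, $V_N(t)\to\mu(t)$ almost surely as $N\to\infty$. (ii) Suppose further that $H_1,H_2\in(0,\frac34)$. Then, for any distinct positive $t_1,\dots,t_n$, the random vector $$\sqrt N\,\left(V_N(t_1)-\mu(t_1),\dots,V_N(t_n)-\mu(t_n)\right)$$ converges in law, as $N\to\infty$, to the multivariate normal distribution with mean vector $0$ and covariance matrix $R=\left(r_{t_i,t_j}(H_1,H_2)\right)_{i,j=1}^n$, where $$r_{t,s}(H_1,H_2)=2\sum_{k=-\infty}^{\infty}\left[\rho^{H_1,H_2}_{t,s}(k)\right]^2,\qquad \rho^{H_1,H_2}_{t,s}(k)=\operatorname{Cov}(u(t,k\delta),u(s,0)).$$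
   Context: $W^{H_i}=\{W^{H_i}_x: x\in\mathbb{R}\}$, $i=1,2$, are two independent two-sided fractional Brownian motions with Hurst indices $H_1,H_2\in(0,1)$. $G$ is the Green's function of the heat equation $\partial_t u-\frac12\partial_{xx}u=0$: $G(t,x)=\frac{1}{\sqrt{2\pi t}}\exp\{-\frac{x^2}{2t}\}$ for $t>0$, and $G(0,x)=\delta_0(x)$. The integrals $\int_{\mathbb{R}}G(t-s,x-y)\,dW^{H_i}_y$ are pathwise Riemann–Stieltjes integrals, subsequently integrated in $s$ over $(0,t)$. The random field $u$ is the solution of the stochastic heat equation $\left(\frac{\partial u}{\partial t}-\frac12\frac{\partial^2u}{\partial x^2}\right)(t,x)=\sigma_1\dot W^{H_1}_x+\sigma_2\dot W^{H_2}_x$ with $u(0,x)=0$. Further, $v_t(H)=c_Ht^{H+1}$ with $c_H=\frac{2^{H+1}(2^H-1)\Gamma(H+\frac12)}{\sqrt{\pi}\,(H+1)}$. *)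

theory Defs
  imports "HOL-Probability.Probability"
begin

section \<open>Riemann--Stieltjes integrals\<close>

text \<open>
  The gauge is a constant radius \<open>d\<close>, so this is mesh convergence of Riemann--Stieltjes sums
  (not a Henstock integral).
\<close>

definition has_RS_integral ::
  "(real \<Rightarrow> real) \<Rightarrow> (real \<Rightarrow> real) \<Rightarrow> real \<Rightarrow> real \<Rightarrow> real \<Rightarrow> bool" where
  "has_RS_integral f g a b I \<longleftrightarrow>
     (\<forall>e>0. \<exists>d>0. \<forall>p. p tagged_division_of {a..b} \<and> (\<lambda>x. ball x d) fine p \<longrightarrow>
        \<bar>(\<Sum>(x, K)\<in>p. f x * (g (Sup K) - g (Inf K))) - I\<bar> < e)"

text \<open>Improper integral over the line: the two endpoints tend to infinity independently.\<close>

definition has_RS_integral_line :: "(real \<Rightarrow> real) \<Rightarrow> (real \<Rightarrow> real) \<Rightarrow> real \<Rightarrow> bool" where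
  "has_RS_integral_line f g I \<longleftrightarrow>
     (\<exists>F. (\<forall>a b. a \<le> b \<longrightarrow> has_RS_integral f g a b (F a b)) \<and>
          ((\<lambda>(a, b). F a b) \<longlongrightarrow> I) (at_bot \<times>\<^sub>F at_top))"

definition RS_integral_line :: "(real \<Rightarrow> real) \<Rightarrow> (real \<Rightarrow> real) \<Rightarrow> real" where
  "RS_integral_line f g =
     (if \<exists>I. has_RS_integral_line f g I then THE I. has_RS_integral_line f g I else 0)"

section \<open>Gaussian laws and fractional Brownian motion\<close>

definition cov :: "'a measure \<Rightarrow> ('a \<Rightarrow> real) \<Rightarrow> ('a \<Rightarrow> real) \<Rightarrow> real" where
  "cov M X Y =
     (\<integral>\<omega>. (X \<omega> - (\<integral>\<omega>'. X \<omega>' \<partial>M)) * (Y \<omega> - (\<integral>\<omega>'. Y \<omega>' \<partial>M)) \<partial>M)"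

text \<open>The normal law with mean \<open>m\<close> and standard deviation \<open>s \<ge> 0\<close>, a Dirac mass if \<open>s = 0\<close>.\<close>

definition normal_law :: "real \<Rightarrow> real \<Rightarrow> real measure" where
  "normal_law m s =
     (if s = 0 then return borel m else density lborel (\<lambda>x. ennreal (normal_density m s x)))"

definition gaussian_process :: "'a measure \<Rightarrow> ('i \<Rightarrow> 'a \<Rightarrow> real) \<Rightarrow> bool" where
  "gaussian_process M X \<longleftrightarrow>
     (\<forall>i. X i \<in> borel_measurable M) \<and>
     (\<forall>S c. finite S \<longrightarrow>
        (\<exists>m s. s \<ge> 0 \<and> distr M borel (\<lambda>\<omega>. \<Sum>i\<in>S. c i * X i \<omega>) = normal_law m s))"

text \<open>The normalisation \<open>W\<^sub>0 = 0\<close> (almost surely) is the case \<open>x = y = 0\<close> of the covariance.\<close>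

definition two_sided_fBm :: "'a measure \<Rightarrow> real \<Rightarrow> (real \<Rightarrow> 'a \<Rightarrow> real) \<Rightarrow> bool" where
  "two_sided_fBm M H W \<longleftrightarrow>
     gaussian_process M W \<and>
     (\<forall>x. (\<integral>\<omega>. W x \<omega> \<partial>M) = 0) \<and>
     (\<forall>x y. cov M (W x) (W y) =
        (\<bar>x\<bar> powr (2 * H) + \<bar>y\<bar> powr (2 * H) - \<bar>x - y\<bar> powr (2 * H)) / 2) \<and>
     (\<forall>\<omega>\<in>space M. continuous_on UNIV (\<lambda>x. W x \<omega>))"

definition indep_processes ::
  "'a measure \<Rightarrow> ('i \<Rightarrow> 'a \<Rightarrow> real) \<Rightarrow> ('i \<Rightarrow> 'a \<Rightarrow> real) \<Rightarrow> bool" where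
  "indep_processes M X Y \<longleftrightarrow>
     prob_space.indep_var M
       (Pi\<^sub>M UNIV (\<lambda>_. borel)) (\<lambda>\<omega> i. X i \<omega>)
       (Pi\<^sub>M UNIV (\<lambda>_. borel)) (\<lambda>\<omega> j. Y j \<omega>)"

text \<open>\<open>R\<close> may be singular, so no density is required.\<close>

definition multivariate_normal ::
  "(real ^ 'n) measure \<Rightarrow> real ^ 'n \<Rightarrow> real ^ 'n ^ 'n \<Rightarrow> bool" where
  "multivariate_normal Q m R \<longleftrightarrow>
     prob_space Q \<and> sets Q = sets borel \<and>
     (\<forall>c. \<exists>a s. s \<ge> 0 \<and> distr Q borel (\<lambda>x. c \<bullet> x) = normal_law a s) \<and>
     (\<forall>i. (\<integral>x. x $ i \<partial>Q) = m $ i) \<and>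
     (\<forall>i j. cov Q (\<lambda>x. x $ i) (\<lambda>x. x $ j) = R $ i $ j)"

definition converges_in_law ::
  "'a measure \<Rightarrow> (nat \<Rightarrow> 'a \<Rightarrow> 'b::topological_space) \<Rightarrow> 'b measure \<Rightarrow> bool" where
  "converges_in_law M X Q \<longleftrightarrow>
     (\<forall>N. X N \<in> borel_measurable M) \<and>
     (\<forall>f :: 'b \<Rightarrow> real. continuous_on UNIV f \<and> bounded (range f) \<longrightarrow>
        (\<lambda>N. \<integral>\<omega>. f (X N \<omega>) \<partial>M) \<longlonglongrightarrow> (\<integral>x. f x \<partial>Q))"

section \<open>The stochastic heat equation with additive fractional noise in space\<close>

text \<open>
  Only positive times are meaningful here: the convention that \<open>G(0, \<cdot>)\<close> is a Dirac mass is not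
  represented, and \<open>time_space_integral\<close> evaluates the kernel at \<open>t - s > 0\<close> only.
\<close>

definition heat_kernel :: "real \<Rightarrow> real \<Rightarrow> real" where
  "heat_kernel t x = 1 / sqrt (2 * pi * t) * exp (- (x\<^sup>2 / (2 * t)))"

definition time_space_integral :: "(real \<Rightarrow> 'a \<Rightarrow> real) \<Rightarrow> real \<Rightarrow> real \<Rightarrow> 'a \<Rightarrow> real" where
  "time_space_integral W t x \<omega> =
     (LINT s:{0<..<t}|lborel.
        RS_integral_line (\<lambda>y. heat_kernel (t - s) (x - y)) (\<lambda>y. W y \<omega>))"

definition fbm_const :: "real \<Rightarrow> real" where
  "fbm_const H =
     2 powr (H + 1) * (2 powr H - 1) * Gamma (H + 1 / 2) / (sqrt pi * (H + 1))"

definition fbm_var :: "real \<Rightarrow> real \<Rightarrow> real" where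
  "fbm_var t H = fbm_const H * t powr (H + 1)"

end

(*
  Integration by parts and Fubini's theorem turn the mild solution driven by a path W into
  the integral over z >= 0 of (W(x+z) - W(x-z)) P(sqrt t |xi| > z), where xi is standard normal.
  It is an almost sure limit of finite combinations of values of W, so u is a Gaussian field; u is
  stationary in x because the increments of W are. Its covariances are averages of second differences
  of |x|^(2H), hence decay like |x|^(2H-2), and at distance 0 they are explicit.

  The fourth moment formula makes the variance of V_N of order N^(-a) for some a > 0, and almost sure
  convergence follows along a polynomial subsequence and then, by monotonicity, for all N. If H1 and
  H2 are below 3/4, Gaussian integration by parts gives an approximate differential equation for the
  characteristic functions of linear combinations of the fluctuations, whose error tends to 0 because
  the covariances are square summable.
*)

theory Submission
  imports Defs
begin

section \<open>Centred Gaussian random variables\<close>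

text \<open>The limit law may be singular, so distributional statements go through characteristic
  functions, and random vectors are reduced to Levy's theorems on the line. For a quadratic form
  with diagonal weights D and covariance matrix S, the error in the differential equation is
  governed by the variance 2 tr((D S)^4) of a second quadratic form. The weights have order
  N^(-1/2), so this is a squared convolution of an l^2 sequence divided by N^2, which tends to 0.
  The threshold 3/4 is where the bound |k|^(4H-4) on the squared covariances stops being summable.
  On the path side the obstacle is the improper integral, which has the default value 0 where it
  does not exist. Chaining with high moments shows that almost every path grows at most cubically,
  and the Gaussian tails of the kernel then make the integral converge; measurability has to hold
  for all paths. The tail probability is the time integral of z/r G(r,z). Writing it as an
  expectation over xi turns integrals against it into differences of primitives at normal variables,
  hence the Gamma function in the variance.\<close>

definition centred_normal :: "'a measure \<Rightarrow> ('a \<Rightarrow> real) \<Rightarrow> real \<Rightarrow> bool" where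
  "centred_normal M X v \<longleftrightarrow>
     X \<in> borel_measurable M \<and> v \<ge> 0 \<and> distr M borel X = normal_law 0 (sqrt v)"

text \<open>Affine images of one standard variable cover the Dirac case \<open>s = 0\<close> as
  well, so integrals and characteristic functions below are computed without a case
  distinction.\<close>

lemma normal_law_eq_distr:
  assumes "s \<ge> 0"
  shows "normal_law m s = distr std_normal_distribution borel (\<lambda>x. m + s * x)"
proof (cases "s = 0")
  case True
  interpret prob_space std_normal_distribution by (rule prob_space_normal_density) simp
  show ?thesis using True by (simp add: normal_law_def)
next
  case False
  interpret prob_space std_normal_distribution by (rule prob_space_normal_density) simp
  have "distributed std_normal_distribution lborel (\<lambda>x. x) std_normal_density"
    by (simp add: distributed_def distr_id2 cong: distr_cong)
  from normal_density_affine[OF this, of s m] False assms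
  have "distributed std_normal_distribution lborel (\<lambda>x. m + s * x) (normal_density m s)"
    by simp
  then have "distr std_normal_distribution lborel (\<lambda>x. m + s * x) = density lborel (normal_density m s)"
    by (rule distributed_distr_eq_density)
  then show ?thesis using False by (simp add: normal_law_def cong: distr_cong)
qed

lemma sets_normal_law [simp, measurable_cong]: "sets (normal_law m s) = sets borel"
  by (simp add: normal_law_def)

lemma space_normal_law [simp]: "space (normal_law m s) = UNIV"
  by (simp add: normal_law_def)

lemma real_distribution_normal_law:
  assumes "s \<ge> 0" shows "real_distribution (normal_law m s)"
proof -
  interpret prob_space std_normal_distribution by (rule prob_space_normal_density) simp
  have "prob_space (normal_law m s)"
    unfolding normal_law_eq_distr[OF assms] by (rule prob_space_distr) simp
  then show ?thesis by (simp add: real_distribution_def real_distribution_axioms_def)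
qed

lemma integral_normal_law:
  fixes f :: "real \<Rightarrow> 'b::{banach, second_countable_topology}"
  assumes "s \<ge> 0" "f \<in> borel_measurable borel"
  shows "(\<integral>x. f x \<partial>normal_law m s) = (\<integral>x. f (m + s * x) \<partial>std_normal_distribution)"
  unfolding normal_law_eq_distr[OF assms(1)] using assms by (subst integral_distr) auto

lemma integrable_normal_law:
  fixes f :: "real \<Rightarrow> 'b::{banach, second_countable_topology}"
  assumes "s \<ge> 0" "f \<in> borel_measurable borel"
  shows "integrable (normal_law m s) f \<longleftrightarrow> integrable std_normal_distribution (\<lambda>x. f (m + s * x))"
  unfolding normal_law_eq_distr[OF assms(1)] using assms by (subst integrable_distr_eq) auto

lemma char_normal_law:
  assumes "s \<ge> 0"
  shows "char (normal_law m s) \<theta> = iexp (\<theta> * m) * exp (- ((\<theta> * s)\<^sup>2 / 2))"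
proof -
  have "char (normal_law m s) \<theta> = (CLINT x|std_normal_distribution. iexp (\<theta> * m) * iexp ((\<theta> * s) * x))"
    unfolding char_def using assms
    by (subst integral_normal_law) (auto simp: exp_add[symmetric] algebra_simps)
  also have "\<dots> = iexp (\<theta> * m) * char std_normal_distribution (\<theta> * s)"
    unfolding char_def by simp
  finally show ?thesis by (simp add: char_std_normal_distribution)
qed

lemma centred_normalD:
  assumes "centred_normal M X v"
  shows "X \<in> borel_measurable M" "v \<ge> 0" "distr M borel X = normal_law 0 (sqrt v)"
  using assms by (auto simp: centred_normal_def)

lemma centred_normal_integral:
  fixes f :: "real \<Rightarrow> 'b::{banach, second_countable_topology}"
  assumes "centred_normal M X v" "f \<in> borel_measurable borel"
  shows "(\<integral>\<omega>. f (X \<omega>) \<partial>M) = (\<integral>x. f (sqrt v * x) \<partial>std_normal_distribution)"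
proof -
  note c = centred_normalD[OF assms(1)]
  have "(\<integral>\<omega>. f (X \<omega>) \<partial>M) = (\<integral>x. f x \<partial>distr M borel X)"
    using c assms by (subst integral_distr) auto
  then show ?thesis using c assms by (simp add: integral_normal_law)
qed

lemma centred_normal_integrable:
  fixes f :: "real \<Rightarrow> 'b::{banach, second_countable_topology}"
  assumes "centred_normal M X v" "f \<in> borel_measurable borel"
  shows "integrable M (\<lambda>\<omega>. f (X \<omega>)) \<longleftrightarrow> integrable std_normal_distribution (\<lambda>x. f (sqrt v * x))"
proof -
  note c = centred_normalD[OF assms(1)]
  have "integrable M (\<lambda>\<omega>. f (X \<omega>)) \<longleftrightarrow> integrable (distr M borel X) f"
    using c assms by (subst integrable_distr_eq) auto
  then show ?thesis using c assms by (simp add: integrable_normal_law)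
qed

lemma centred_normal_power_integrable:
  assumes "centred_normal M X v"
  shows "integrable M (\<lambda>\<omega>. X \<omega> ^ k)"
  using integrable_std_normal_distribution_moment[of k]
  by (subst centred_normal_integrable[OF assms, of "\<lambda>x. x ^ k"]) (auto simp: power_mult_distrib)

lemma centred_normal_integrableI:
  assumes "centred_normal M X v" shows "integrable M X"
  using centred_normal_power_integrable[OF assms, of 1] by simp

lemma centred_normal_even_moment:
  assumes "centred_normal M X v"
  shows "(\<integral>\<omega>. X \<omega> ^ (2 * k) \<partial>M) = v ^ k * (fact (2 * k) / (2 ^ k * fact k))"
  using centred_normalD(2)[OF assms]
  by (subst centred_normal_integral[OF assms, of "\<lambda>x. x ^ (2 * k)"])
     (simp_all add: power_mult_distrib std_normal_distribution_even_moments(1) power_mult[of "sqrt v"])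

lemma centred_normal_mean:
  assumes "centred_normal M X v" shows "(\<integral>\<omega>. X \<omega> \<partial>M) = 0"
proof -
  have "(\<integral>\<omega>. X \<omega> \<partial>M) = sqrt v * (\<integral>x. x ^ 1 \<partial>std_normal_distribution)"
    by (subst centred_normal_integral[OF assms, of "\<lambda>x. x"]) auto
  then show ?thesis using integral_std_normal_distribution_moment_odd[of 1] by simp
qed

lemma centred_normal_variance:
  assumes "centred_normal M X v" shows "(\<integral>\<omega>. (X \<omega>)\<^sup>2 \<partial>M) = v"
  using centred_normal_even_moment[OF assms, of 1] by simp

lemma centred_normal_fourth:
  assumes "centred_normal M X v" shows "(\<integral>\<omega>. X \<omega> ^ 4 \<partial>M) = 3 * v\<^sup>2"
  using centred_normal_even_moment[OF assms, of 2] by (simp add: fact_numeral)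

lemma centred_normal_char:
  assumes "centred_normal M X v"
  shows "(\<integral>\<omega>. iexp (\<theta> * X \<omega>) \<partial>M) = exp (- (\<theta>\<^sup>2 * v / 2))"
proof -
  note c = centred_normalD[OF assms]
  have "(\<integral>\<omega>. iexp (\<theta> * X \<omega>) \<partial>M) = char (distr M borel X) \<theta>"
    unfolding char_def using c by (subst integral_distr) auto
  then show ?thesis using c by (simp add: char_normal_law power_mult_distrib)
qed

text \<open>Levy's uniqueness theorem. Almost sure limits, sums of independent variables and linear
  forms on product measures are recognised as normal through it.\<close>

lemma centred_normal_charI:
  assumes "prob_space M" "X \<in> borel_measurable M" "v \<ge> 0"
    and "\<And>\<theta>. (\<integral>\<omega>. iexp (\<theta> * X \<omega>) \<partial>M) = exp (- (\<theta>\<^sup>2 * v / 2))"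
  shows "centred_normal M X v"
proof -
  interpret prob_space M by fact
  have "char (distr M borel X) \<theta> = char (normal_law 0 (sqrt v)) \<theta>" for \<theta>
    using assms(2,3) assms(4)[of \<theta>] unfolding char_def[of "distr M borel X"]
    by (subst integral_distr) (auto simp: char_normal_law power_mult_distrib)
  moreover have "real_distribution (distr M borel X)"
    using assms(2) by simp
  ultimately have "distr M borel X = normal_law 0 (sqrt v)"
    using real_distribution_normal_law[of "sqrt v" 0] assms(3)
    by (intro Levy_uniqueness) auto
  then show ?thesis using assms by (simp add: centred_normal_def)
qed

text \<open>The variances converge because the characteristic functions do so at a point where the
  limit is not zero.\<close>

lemma centred_normal_AE_limit:
  assumes M: "prob_space M" and X: "\<And>n. centred_normal M (X n) (v n)"
    and L[measurable]: "L \<in> borel_measurable M"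
    and lim: "AE \<omega> in M. (\<lambda>n. X n \<omega>) \<longlonglongrightarrow> L \<omega>"
  shows "\<exists>v. centred_normal M L v"
proof -
  interpret prob_space M by fact
  note [measurable] = centred_normalD(1)[OF X]
  define \<phi> where "\<phi> \<theta> = (\<integral>\<omega>. iexp (\<theta> * L \<omega>) \<partial>M)" for \<theta> :: real
  have conv: "(\<lambda>n. complex_of_real (exp (- (\<theta>\<^sup>2 * v n / 2)))) \<longlonglongrightarrow> \<phi> \<theta>" for \<theta>
  proof -
    have "(\<lambda>n. \<integral>\<omega>. iexp (\<theta> * X n \<omega>) \<partial>M) \<longlonglongrightarrow> \<phi> \<theta>"
      unfolding \<phi>_def
    proof (rule integral_dominated_convergence[where w="\<lambda>_. 1"])
      show "AE \<omega> in M. (\<lambda>n. iexp (\<theta> * X n \<omega>)) \<longlonglongrightarrow> iexp (\<theta> * L \<omega>)"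
        using lim by eventually_elim (intro tendsto_intros)
    qed auto
    then show ?thesis unfolding centred_normal_char[OF X] .
  qed
  have real_dist: "real_distribution (distr M borel L)" by simp
  have \<phi>_char: "\<phi> = char (distr M borel L)"
    unfolding \<phi>_def char_def by (subst integral_distr) auto
  \<comment> \<open>Continuity at 0, where the value is 1, supplies a point \<theta> > 0 at which
    the limit is positive and logarithms can be taken.\<close>
  have "isCont (\<lambda>\<theta>. Re (\<phi> \<theta>)) 0"
    unfolding \<phi>_char by (rule continuous_Re) (rule real_distribution.isCont_char[OF real_dist])
  moreover have "Re (\<phi> 0) = 1" by (simp add: \<phi>_def prob_space)
  ultimately have "((\<lambda>\<theta>. Re (\<phi> \<theta>)) \<longlongrightarrow> 1) (at 0)" by (simp add: isCont_def)
  then have "eventually (\<lambda>\<theta>. Re (\<phi> \<theta>) > 0) (at 0)"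
    by (rule order_tendstoD) simp
  then obtain d where d: "d > 0" "\<And>\<theta>. \<theta> \<noteq> 0 \<Longrightarrow> dist \<theta> 0 < d \<Longrightarrow> Re (\<phi> \<theta>) > 0"
    by (auto simp: eventually_at)
  define \<theta> where "\<theta> = d / 2"
  have \<theta>: "\<theta> > 0" "Re (\<phi> \<theta>) > 0" using d by (auto simp: \<theta>_def)
  have "(\<lambda>n. exp (- (\<theta>\<^sup>2 * v n / 2))) \<longlonglongrightarrow> Re (\<phi> \<theta>)"
    using tendsto_Re[OF conv[of \<theta>]] by simp
  then have "(\<lambda>n. ln (exp (- (\<theta>\<^sup>2 * v n / 2)))) \<longlonglongrightarrow> ln (Re (\<phi> \<theta>))"
    using \<theta> by (intro tendsto_ln) auto
  then have "(\<lambda>n. (-2 / \<theta>\<^sup>2) * - (\<theta>\<^sup>2 * v n / 2)) \<longlonglongrightarrow> (-2 / \<theta>\<^sup>2) * ln (Re (\<phi> \<theta>))"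
    by (intro tendsto_mult tendsto_const) simp
  then have v: "v \<longlonglongrightarrow> (-2 / \<theta>\<^sup>2) * ln (Re (\<phi> \<theta>))" (is "_ \<longlonglongrightarrow> ?v")
    using \<theta> by (simp add: field_simps)
  have "?v \<ge> 0"
    by (rule LIMSEQ_le_const[OF v]) (use centred_normalD(2)[OF X] in auto)
  moreover have "\<phi> \<theta>' = exp (- (\<theta>'\<^sup>2 * ?v / 2))" for \<theta>'
  proof (rule LIMSEQ_unique[OF conv])
    have "(\<lambda>n. exp (- (\<theta>'\<^sup>2 * v n / 2))) \<longlonglongrightarrow> exp (- (\<theta>'\<^sup>2 * ?v / 2))"
      by (intro tendsto_exp tendsto_minus tendsto_divide tendsto_mult tendsto_const v) simp
    then show "(\<lambda>n. complex_of_real (exp (- (\<theta>'\<^sup>2 * v n / 2)))) \<longlonglongrightarrow> complex_of_real (exp (- (\<theta>'\<^sup>2 * ?v / 2)))"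
      by (rule tendsto_of_real)
  qed
  ultimately have "centred_normal M L ?v"
    unfolding \<phi>_def by (rule centred_normal_charI[OF M L])
  then show ?thesis by blast
qed

section \<open>Gaussian spaces\<close>

text \<open>Joint normality is encoded as closure under linear combinations, so that only
  one-dimensional laws have to be mentioned.\<close>

definition gaussian_space :: "'a measure \<Rightarrow> ('a \<Rightarrow> real) set \<Rightarrow> bool" where
  "gaussian_space M V \<longleftrightarrow> V \<noteq> {} \<and>
     (\<forall>X\<in>V. \<exists>v. centred_normal M X v) \<and>
     (\<forall>X\<in>V. \<forall>Y\<in>V. \<forall>a b. (\<lambda>\<omega>. a * X \<omega> + b * Y \<omega>) \<in> V)"

lemma gaussian_space_comb:
  "gaussian_space M V \<Longrightarrow> X \<in> V \<Longrightarrow> Y \<in> V \<Longrightarrow> (\<lambda>\<omega>. a * X \<omega> + b * Y \<omega>) \<in> V"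
  unfolding gaussian_space_def by blast

lemma gaussian_space_add: "gaussian_space M V \<Longrightarrow> X \<in> V \<Longrightarrow> Y \<in> V \<Longrightarrow> (\<lambda>\<omega>. X \<omega> + Y \<omega>) \<in> V"
  using gaussian_space_comb[of M V X Y 1 1] by simp

lemma gaussian_space_diff: "gaussian_space M V \<Longrightarrow> X \<in> V \<Longrightarrow> Y \<in> V \<Longrightarrow> (\<lambda>\<omega>. X \<omega> - Y \<omega>) \<in> V"
  using gaussian_space_comb[of M V X Y 1 "-1"] by simp

lemma gaussian_space_scale: "gaussian_space M V \<Longrightarrow> X \<in> V \<Longrightarrow> (\<lambda>\<omega>. c * X \<omega>) \<in> V"
  using gaussian_space_comb[of M V X X c 0] by simp

lemma gaussian_space_zero: "gaussian_space M V \<Longrightarrow> (\<lambda>\<omega>. 0) \<in> V"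
  using gaussian_space_scale[of M V _ 0] by (auto simp: gaussian_space_def)

lemma gaussian_space_sum:
  assumes "gaussian_space M V" "finite S" "\<And>i. i \<in> S \<Longrightarrow> X i \<in> V"
  shows "(\<lambda>\<omega>. \<Sum>i\<in>S. c i * X i \<omega>) \<in> V"
  using assms(2,3)
proof (induction S rule: finite_induct)
  case empty
  then show ?case using gaussian_space_zero[OF assms(1)] by simp
next
  case (insert i S)
  then have "(\<lambda>\<omega>. c i * X i \<omega> + 1 * (\<Sum>i\<in>S. c i * X i \<omega>)) \<in> V"
    by (intro gaussian_space_comb[OF assms(1)]) auto
  then show ?case using insert by simp
qed

lemma gaussian_space_normal:
  assumes "gaussian_space M V" "X \<in> V"
  shows "centred_normal M X (\<integral>\<omega>. (X \<omega>)\<^sup>2 \<partial>M)"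
proof -
  obtain v where "centred_normal M X v" using assms unfolding gaussian_space_def by blast
  then show ?thesis using centred_normal_variance by fastforce
qed

lemma gaussian_space_measurable:
  "gaussian_space M V \<Longrightarrow> X \<in> V \<Longrightarrow> X \<in> borel_measurable M"
  using gaussian_space_normal centred_normalD(1) by blast

lemma gaussian_space_mean: "gaussian_space M V \<Longrightarrow> X \<in> V \<Longrightarrow> (\<integral>\<omega>. X \<omega> \<partial>M) = 0"
  using gaussian_space_normal centred_normal_mean by blast

lemma gaussian_space_power_integrable:
  "gaussian_space M V \<Longrightarrow> X \<in> V \<Longrightarrow> integrable M (\<lambda>\<omega>. X \<omega> ^ k)"
  using gaussian_space_normal centred_normal_power_integrable by blast

section \<open>Moments of order four\<close>

lemma gaussian_space_fourth:
  assumes "gaussian_space M V" "X \<in> V"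
  shows "(\<integral>\<omega>. X \<omega> ^ 4 \<partial>M) = 3 * (\<integral>\<omega>. (X \<omega>)\<^sup>2 \<partial>M)\<^sup>2"
  using centred_normal_fourth[OF gaussian_space_normal[OF assms]] .

lemma abs_mult_le_squares: "\<bar>a * b\<bar> \<le> (a\<^sup>2 + b\<^sup>2)" for a b :: real
proof -
  have "0 \<le> (\<bar>a\<bar> - \<bar>b\<bar>)\<^sup>2" by simp
  also have "\<dots> = a\<^sup>2 + b\<^sup>2 - 2 * \<bar>a * b\<bar>" by (simp add: power2_eq_square abs_mult algebra_simps)
  finally show ?thesis by simp
qed

lemma integrable_mult_squares:
  fixes X Y :: "'a \<Rightarrow> real"
  assumes [measurable]: "X \<in> borel_measurable M" "Y \<in> borel_measurable M"
    and "integrable M (\<lambda>\<omega>. (X \<omega>)\<^sup>2)" "integrable M (\<lambda>\<omega>. (Y \<omega>)\<^sup>2)"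
  shows "integrable M (\<lambda>\<omega>. X \<omega> * Y \<omega>)"
proof (rule Bochner_Integration.integrable_bound)
  show "integrable M (\<lambda>\<omega>. (X \<omega>)\<^sup>2 + (Y \<omega>)\<^sup>2)" using assms by auto
  show "AE \<omega> in M. norm (X \<omega> * Y \<omega>) \<le> norm ((X \<omega>)\<^sup>2 + (Y \<omega>)\<^sup>2)"
    by (intro AE_I2) (use abs_mult_le_squares in simp)
qed simp

lemma gaussian_space_mult_integrable:
  assumes "gaussian_space M V" "X \<in> V" "Y \<in> V"
  shows "integrable M (\<lambda>\<omega>. X \<omega> * Y \<omega>)"
  using assms by (intro integrable_mult_squares gaussian_space_power_integrable gaussian_space_measurable) auto

lemma gaussian_space_mult4_integrable:
  assumes "gaussian_space M V" "X \<in> V" "Y \<in> V" "Z \<in> V" "T \<in> V"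
  shows "integrable M (\<lambda>\<omega>. X \<omega> * Y \<omega> * (Z \<omega> * T \<omega>))"
proof -
  note [measurable] = gaussian_space_measurable[OF assms(1)]
  have sq: "integrable M (\<lambda>\<omega>. (X \<omega> * Y \<omega>)\<^sup>2)" if "X \<in> V" "Y \<in> V" for X Y
  proof -
    have "integrable M (\<lambda>\<omega>. (X \<omega>)\<^sup>2 * (Y \<omega>)\<^sup>2)"
      using that gaussian_space_power_integrable[OF assms(1), of _ 4]
      by (intro integrable_mult_squares) auto
    then show ?thesis by (simp add: power_mult_distrib)
  qed
  show ?thesis using assms by (intro integrable_mult_squares sq) auto
qed

text \<open>Polarisation: the fourth moments of X + Y and X - Y are three times their squared
  variances, and adding the two fourth powers leaves X^2 Y^2 as the only mixed term.\<close>

lemma gaussian_space_square_square: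
  assumes V: "gaussian_space M V" and XY: "X \<in> V" "Y \<in> V"
  shows "(\<integral>\<omega>. (X \<omega>)\<^sup>2 * (Y \<omega>)\<^sup>2 \<partial>M) =
    (\<integral>\<omega>. (X \<omega>)\<^sup>2 \<partial>M) * (\<integral>\<omega>. (Y \<omega>)\<^sup>2 \<partial>M) + 2 * (\<integral>\<omega>. X \<omega> * Y \<omega> \<partial>M)\<^sup>2"
proof -
  have i2: "integrable M (\<lambda>\<omega>. (X \<omega>)\<^sup>2)" "integrable M (\<lambda>\<omega>. (Y \<omega>)\<^sup>2)" "integrable M (\<lambda>\<omega>. X \<omega> * Y \<omega>)"
    "integrable M (\<lambda>\<omega>. X \<omega> ^ 4)" "integrable M (\<lambda>\<omega>. Y \<omega> ^ 4)"
    using gaussian_space_power_integrable[OF V] gaussian_space_mult_integrable[OF V] XY by auto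
  have i4: "integrable M (\<lambda>\<omega>. (X \<omega>)\<^sup>2 * (Y \<omega>)\<^sup>2)"
    using gaussian_space_mult4_integrable[OF V XY(1) XY(1) XY(2) XY(2)] by (simp add: power2_eq_square)
  have p: "(\<lambda>\<omega>. X \<omega> + Y \<omega>) \<in> V" "(\<lambda>\<omega>. X \<omega> - Y \<omega>) \<in> V"
    using gaussian_space_add[OF V XY] gaussian_space_diff[OF V XY] by auto
  define A B C D where "A = (\<integral>\<omega>. (X \<omega>)\<^sup>2 \<partial>M)" "B = (\<integral>\<omega>. (Y \<omega>)\<^sup>2 \<partial>M)" "C = (\<integral>\<omega>. X \<omega> * Y \<omega> \<partial>M)"
    "D = (\<integral>\<omega>. (X \<omega>)\<^sup>2 * (Y \<omega>)\<^sup>2 \<partial>M)"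
  note defs = A_B_C_D_def
  have v1: "(\<integral>\<omega>. (X \<omega> + Y \<omega>)\<^sup>2 \<partial>M) = A + 2 * C + B"
  proof -
    have "(\<integral>\<omega>. (X \<omega> + Y \<omega>)\<^sup>2 \<partial>M) = (\<integral>\<omega>. (X \<omega>)\<^sup>2 + 2 * (X \<omega> * Y \<omega>) + (Y \<omega>)\<^sup>2 \<partial>M)"
      by (intro Bochner_Integration.integral_cong) (auto simp: power2_sum)
    then show ?thesis using i2 by (simp add: defs)
  qed
  have v2: "(\<integral>\<omega>. (X \<omega> - Y \<omega>)\<^sup>2 \<partial>M) = A - 2 * C + B"
  proof -
    have "(\<integral>\<omega>. (X \<omega> - Y \<omega>)\<^sup>2 \<partial>M) = (\<integral>\<omega>. (X \<omega>)\<^sup>2 - 2 * (X \<omega> * Y \<omega>) + (Y \<omega>)\<^sup>2 \<partial>M)"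
      by (intro Bochner_Integration.integral_cong) (auto simp: power2_diff)
    then show ?thesis using i2 by (simp add: defs)
  qed
  have "(\<integral>\<omega>. (X \<omega> + Y \<omega>) ^ 4 + (X \<omega> - Y \<omega>) ^ 4 \<partial>M) =
      (\<integral>\<omega>. 2 * X \<omega> ^ 4 + 12 * ((X \<omega>)\<^sup>2 * (Y \<omega>)\<^sup>2) + 2 * Y \<omega> ^ 4 \<partial>M)"
    by (intro Bochner_Integration.integral_cong) (auto simp: power2_eq_square power4_eq_xxxx algebra_simps)
  also have "\<dots> = 6 * A\<^sup>2 + 12 * D + 6 * B\<^sup>2"
    using i2 i4 by (simp add: gaussian_space_fourth[OF V] XY defs)
  finally have "3 * (A + 2 * C + B)\<^sup>2 + 3 * (A - 2 * C + B)\<^sup>2 = 6 * A\<^sup>2 + 12 * D + 6 * B\<^sup>2"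
    using gaussian_space_power_integrable[OF V p(1), of 4] gaussian_space_power_integrable[OF V p(2), of 4]
    by (simp add: gaussian_space_fourth[OF V] p v1 v2)
  then have "D = A * B + 2 * C\<^sup>2" by (simp add: power2_eq_square algebra_simps)
  then show ?thesis by (simp add: defs)
qed

text \<open>Isserlis' formula for four variables, by polarisation in each of the two squares.\<close>

lemma gaussian_space_square_mult:
  assumes V: "gaussian_space M V" and XY: "X \<in> V" "Y \<in> V" "Z \<in> V"
  shows "(\<integral>\<omega>. (X \<omega> * Y \<omega>) * (Z \<omega>)\<^sup>2 \<partial>M) =
    (\<integral>\<omega>. X \<omega> * Y \<omega> \<partial>M) * (\<integral>\<omega>. (Z \<omega>)\<^sup>2 \<partial>M)
    + 2 * (\<integral>\<omega>. X \<omega> * Z \<omega> \<partial>M) * (\<integral>\<omega>. Y \<omega> * Z \<omega> \<partial>M)"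
proof -
  note int2 = gaussian_space_mult_integrable[OF V] and int4 = gaussian_space_mult4_integrable[OF V]
  have p: "(\<lambda>\<omega>. X \<omega> + Y \<omega>) \<in> V" "(\<lambda>\<omega>. X \<omega> - Y \<omega>) \<in> V"
    using gaussian_space_add[OF V XY(1,2)] gaussian_space_diff[OF V XY(1,2)] by auto
  have i: "integrable M (\<lambda>\<omega>. (X \<omega> + Y \<omega>)\<^sup>2 * (Z \<omega>)\<^sup>2)" "integrable M (\<lambda>\<omega>. (X \<omega> - Y \<omega>)\<^sup>2 * (Z \<omega>)\<^sup>2)"
    using int4[OF p(1) p(1) XY(3) XY(3)] int4[OF p(2) p(2) XY(3) XY(3)] by (auto simp: power2_eq_square)
  have j: "integrable M (\<lambda>\<omega>. (X \<omega> + Y \<omega>)\<^sup>2)" "integrable M (\<lambda>\<omega>. (X \<omega> - Y \<omega>)\<^sup>2)"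
    using int2[OF p(1) p(1)] int2[OF p(2) p(2)] by (auto simp: power2_eq_square)
  have k: "integrable M (\<lambda>\<omega>. X \<omega> * Z \<omega>)" "integrable M (\<lambda>\<omega>. Y \<omega> * Z \<omega>)"
    using int2 XY by auto
  have "4 * (\<integral>\<omega>. (X \<omega> * Y \<omega>) * (Z \<omega>)\<^sup>2 \<partial>M) = (\<integral>\<omega>. 4 * ((X \<omega> * Y \<omega>) * (Z \<omega>)\<^sup>2) \<partial>M)"
    by simp
  also have "\<dots> = (\<integral>\<omega>. (X \<omega> + Y \<omega>)\<^sup>2 * (Z \<omega>)\<^sup>2 - (X \<omega> - Y \<omega>)\<^sup>2 * (Z \<omega>)\<^sup>2 \<partial>M)"
    by (intro Bochner_Integration.integral_cong) (auto simp: power2_eq_square algebra_simps)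
  also have "\<dots> = (\<integral>\<omega>. (X \<omega> + Y \<omega>)\<^sup>2 * (Z \<omega>)\<^sup>2 \<partial>M) - (\<integral>\<omega>. (X \<omega> - Y \<omega>)\<^sup>2 * (Z \<omega>)\<^sup>2 \<partial>M)"
    using i by simp
  also have "\<dots> = ((\<integral>\<omega>. (X \<omega> + Y \<omega>)\<^sup>2 \<partial>M) - (\<integral>\<omega>. (X \<omega> - Y \<omega>)\<^sup>2 \<partial>M)) * (\<integral>\<omega>. (Z \<omega>)\<^sup>2 \<partial>M)
      + 2 * (\<integral>\<omega>. X \<omega> * Z \<omega> + Y \<omega> * Z \<omega> \<partial>M)\<^sup>2 - 2 * (\<integral>\<omega>. X \<omega> * Z \<omega> - Y \<omega> * Z \<omega> \<partial>M)\<^sup>2"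
    unfolding gaussian_space_square_square[OF V p(1) XY(3)] gaussian_space_square_square[OF V p(2) XY(3)]
    by (simp add: algebra_simps)
  also have "(\<integral>\<omega>. (X \<omega> + Y \<omega>)\<^sup>2 \<partial>M) - (\<integral>\<omega>. (X \<omega> - Y \<omega>)\<^sup>2 \<partial>M) = (\<integral>\<omega>. (X \<omega> + Y \<omega>)\<^sup>2 - (X \<omega> - Y \<omega>)\<^sup>2 \<partial>M)"
    using j by simp
  also have "\<dots> = (\<integral>\<omega>. 4 * (X \<omega> * Y \<omega>) \<partial>M)"
    by (intro Bochner_Integration.integral_cong) (auto simp: power2_eq_square algebra_simps)
  also have "\<dots> = 4 * (\<integral>\<omega>. X \<omega> * Y \<omega> \<partial>M)" by simp
  finally show ?thesis using k by (simp add: power2_eq_square algebra_simps)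
qed

lemma gaussian_space_isserlis:
  assumes V: "gaussian_space M V" and XY: "X \<in> V" "Y \<in> V" "Z \<in> V" "T \<in> V"
  shows "(\<integral>\<omega>. X \<omega> * Y \<omega> * (Z \<omega> * T \<omega>) \<partial>M) =
    (\<integral>\<omega>. X \<omega> * Y \<omega> \<partial>M) * (\<integral>\<omega>. Z \<omega> * T \<omega> \<partial>M)
    + (\<integral>\<omega>. X \<omega> * Z \<omega> \<partial>M) * (\<integral>\<omega>. Y \<omega> * T \<omega> \<partial>M)
    + (\<integral>\<omega>. X \<omega> * T \<omega> \<partial>M) * (\<integral>\<omega>. Y \<omega> * Z \<omega> \<partial>M)"
proof -
  note int2 = gaussian_space_mult_integrable[OF V] and int4 = gaussian_space_mult4_integrable[OF V]
  have p: "(\<lambda>\<omega>. Z \<omega> + T \<omega>) \<in> V" "(\<lambda>\<omega>. Z \<omega> - T \<omega>) \<in> V"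
    using gaussian_space_add[OF V XY(3,4)] gaussian_space_diff[OF V XY(3,4)] by auto
  have i: "integrable M (\<lambda>\<omega>. X \<omega> * Y \<omega> * (Z \<omega> + T \<omega>)\<^sup>2)" "integrable M (\<lambda>\<omega>. X \<omega> * Y \<omega> * (Z \<omega> - T \<omega>)\<^sup>2)"
    using int4[OF XY(1,2) p(1) p(1)] int4[OF XY(1,2) p(2) p(2)] by (auto simp: power2_eq_square)
  have j: "integrable M (\<lambda>\<omega>. (Z \<omega> + T \<omega>)\<^sup>2)" "integrable M (\<lambda>\<omega>. (Z \<omega> - T \<omega>)\<^sup>2)"
    using int2[OF p(1) p(1)] int2[OF p(2) p(2)] by (auto simp: power2_eq_square)
  have k: "integrable M (\<lambda>\<omega>. X \<omega> * Z \<omega>)" "integrable M (\<lambda>\<omega>. Y \<omega> * Z \<omega>)"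
     "integrable M (\<lambda>\<omega>. X \<omega> * T \<omega>)" "integrable M (\<lambda>\<omega>. Y \<omega> * T \<omega>)"
    using int2 XY by auto
  have "4 * (\<integral>\<omega>. X \<omega> * Y \<omega> * (Z \<omega> * T \<omega>) \<partial>M) = (\<integral>\<omega>. 4 * (X \<omega> * Y \<omega> * (Z \<omega> * T \<omega>)) \<partial>M)"
    by simp
  also have "\<dots> = (\<integral>\<omega>. X \<omega> * Y \<omega> * (Z \<omega> + T \<omega>)\<^sup>2 - X \<omega> * Y \<omega> * (Z \<omega> - T \<omega>)\<^sup>2 \<partial>M)"
    by (intro Bochner_Integration.integral_cong) (auto simp: power2_eq_square algebra_simps)
  also have "\<dots> = (\<integral>\<omega>. X \<omega> * Y \<omega> * (Z \<omega> + T \<omega>)\<^sup>2 \<partial>M) - (\<integral>\<omega>. X \<omega> * Y \<omega> * (Z \<omega> - T \<omega>)\<^sup>2 \<partial>M)"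
    using i by simp
  also have "\<dots> = (\<integral>\<omega>. X \<omega> * Y \<omega> \<partial>M) * ((\<integral>\<omega>. (Z \<omega> + T \<omega>)\<^sup>2 \<partial>M) - (\<integral>\<omega>. (Z \<omega> - T \<omega>)\<^sup>2 \<partial>M))
      + 2 * (\<integral>\<omega>. X \<omega> * Z \<omega> + X \<omega> * T \<omega> \<partial>M) * (\<integral>\<omega>. Y \<omega> * Z \<omega> + Y \<omega> * T \<omega> \<partial>M)
      - 2 * (\<integral>\<omega>. X \<omega> * Z \<omega> - X \<omega> * T \<omega> \<partial>M) * (\<integral>\<omega>. Y \<omega> * Z \<omega> - Y \<omega> * T \<omega> \<partial>M)"
    unfolding gaussian_space_square_mult[OF V XY(1,2) p(1)] gaussian_space_square_mult[OF V XY(1,2) p(2)]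
    by (simp add: algebra_simps)
  also have "(\<integral>\<omega>. (Z \<omega> + T \<omega>)\<^sup>2 \<partial>M) - (\<integral>\<omega>. (Z \<omega> - T \<omega>)\<^sup>2 \<partial>M) = (\<integral>\<omega>. (Z \<omega> + T \<omega>)\<^sup>2 - (Z \<omega> - T \<omega>)\<^sup>2 \<partial>M)"
    using j by simp
  also have "\<dots> = (\<integral>\<omega>. 4 * (Z \<omega> * T \<omega>) \<partial>M)"
    by (intro Bochner_Integration.integral_cong) (auto simp: power2_eq_square algebra_simps)
  also have "\<dots> = 4 * (\<integral>\<omega>. Z \<omega> * T \<omega> \<partial>M)" by simp
  finally show ?thesis using k by (simp add: algebra_simps)
qed

text \<open>Provides room for the mild solution, which is only an almost sure limit of combinations
  of path values. Almost sure convergence suffices, because \<open>centred_normal_AE_limit\<close>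
  makes the variances converge by itself.\<close>

lemma gaussian_space_AE_closure:
  assumes M: "prob_space M" and V: "gaussian_space M V"
  shows "gaussian_space M {L \<in> borel_measurable M. \<exists>X. (\<forall>n. X n \<in> V) \<and> (AE \<omega> in M. (\<lambda>n::nat. X n \<omega>) \<longlonglongrightarrow> L \<omega>)}"
    (is "gaussian_space M ?C")
  unfolding gaussian_space_def
proof (intro conjI ballI allI)
  have "(\<lambda>_. 0) \<in> ?C"
    using gaussian_space_zero[OF V] by (auto intro!: exI[of _ "\<lambda>_ _. 0"])
  then show "?C \<noteq> {}" by blast
next
  fix L assume "L \<in> ?C"
  then show "\<exists>v. centred_normal M L v"
    using centred_normal_AE_limit[OF M gaussian_space_normal[OF V]] by blast
next
  fix L K and a b :: real assume "L \<in> ?C" "K \<in> ?C"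
  then obtain X Y where [measurable]: "L \<in> borel_measurable M" "K \<in> borel_measurable M"
    and XY: "\<And>n. X n \<in> V" "\<And>n. Y n \<in> V"
    "AE \<omega> in M. (\<lambda>n::nat. X n \<omega>) \<longlonglongrightarrow> L \<omega>" "AE \<omega> in M. (\<lambda>n::nat. Y n \<omega>) \<longlonglongrightarrow> K \<omega>"
    by blast
  have "AE \<omega> in M. (\<lambda>n::nat. a * X n \<omega> + b * Y n \<omega>) \<longlonglongrightarrow> a * L \<omega> + b * K \<omega>"
    using XY(3,4) by eventually_elim (intro tendsto_intros)
  then show "(\<lambda>\<omega>. a * L \<omega> + b * K \<omega>) \<in> ?C"
    using gaussian_space_comb[OF V XY(1,2), where a=a and b=b] by (auto intro!: exI[of _ "\<lambda>n \<omega>. a * X n \<omega> + b * Y n \<omega>"])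
qed

section \<open>Characteristic functions of random vectors\<close>

text \<open>A bounded factor \<open>Z\<close> is absorbed into a change of measure, with density proportional to
  \<open>2 + Z\<close>; this reduces statements on random vectors to Levy's theorems on the real line, one
  coordinate at a time.\<close>

definition tilted_law :: "'a measure \<Rightarrow> ('a \<Rightarrow> real) \<Rightarrow> ('a \<Rightarrow> real) \<Rightarrow> real measure" where
  "tilted_law M Z X =
     distr (density M (\<lambda>\<omega>. ennreal ((2 + Z \<omega>) / (2 + (\<integral>\<omega>. Z \<omega> \<partial>M))))) borel X"

context prob_space
begin

lemma integrable_bounded_by:
  fixes f :: "'a \<Rightarrow> 'b::{banach, second_countable_topology}"
  assumes "f \<in> borel_measurable M" "\<And>\<omega>. norm (f \<omega>) \<le> B"
  shows "integrable M f"
  by (rule integrable_const_bound[of _ B]) (use assms in auto)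

text \<open>The shift by 2 keeps the density nonnegative and its normalisation positive for every
  factor with values in [-1, 1].\<close>

lemma tilt_aux:
  fixes Z :: "'a \<Rightarrow> real"
  assumes [measurable]: "Z \<in> borel_measurable M" and Z: "\<And>\<omega>. \<bar>Z \<omega>\<bar> \<le> 1"
  shows "integrable M Z" "2 + (\<integral>\<omega>. Z \<omega> \<partial>M) > 0" "\<And>\<omega>. (2 + Z \<omega>) / (2 + (\<integral>\<omega>. Z \<omega> \<partial>M)) \<ge> 0"
proof -
  show i: "integrable M Z"
    by (rule integrable_bounded_by[of _ 1]) (use Z in auto)
  have "(\<integral>\<omega>. -1 \<partial>M) \<le> (\<integral>\<omega>. Z \<omega> \<partial>M)"
    by (rule integral_mono) (use Z i in \<open>auto simp: abs_le_iff minus_le_iff\<close>)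
  then show p: "2 + (\<integral>\<omega>. Z \<omega> \<partial>M) > 0" by (simp add: prob_space)
  show "(2 + Z \<omega>) / (2 + (\<integral>\<omega>. Z \<omega> \<partial>M)) \<ge> 0" for \<omega>
    using p Z[of \<omega>] by (intro divide_nonneg_pos) (auto simp: abs_le_iff)
qed

lemma real_distribution_tilted_law:
  fixes Z :: "'a \<Rightarrow> real"
  assumes [measurable]: "Z \<in> borel_measurable M" "X \<in> borel_measurable M" and Z: "\<And>\<omega>. \<bar>Z \<omega>\<bar> \<le> 1"
  shows "real_distribution (tilted_law M Z X)"
proof -
  note a = tilt_aux[OF assms(1) Z]
  have "prob_space (density M (\<lambda>\<omega>. ennreal ((2 + Z \<omega>) / (2 + (\<integral>\<omega>. Z \<omega> \<partial>M)))))"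
  proof (rule prob_spaceI)
    have "(\<integral>\<^sup>+ \<omega>. ennreal ((2 + Z \<omega>) / (2 + (\<integral>\<omega>. Z \<omega> \<partial>M))) \<partial>M)
        = ennreal (\<integral>\<omega>. (2 + Z \<omega>) / (2 + (\<integral>\<omega>. Z \<omega> \<partial>M)) \<partial>M)"
      by (intro nn_integral_eq_integral) (use a in auto)
    also have "\<dots> = 1" using a by (simp add: prob_space)
    finally show "emeasure (density M (\<lambda>\<omega>. ennreal ((2 + Z \<omega>) / (2 + (\<integral>\<omega>. Z \<omega> \<partial>M)))))
        (space (density M (\<lambda>\<omega>. ennreal ((2 + Z \<omega>) / (2 + (\<integral>\<omega>. Z \<omega> \<partial>M)))))) = 1"
      by (simp add: emeasure_density cong: nn_integral_cong)
  qed
  then show ?thesis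
    unfolding tilted_law_def
    by (simp add: real_distribution_def real_distribution_axioms_def prob_space.prob_space_distr)
qed

lemma integral_tilted_law:
  fixes Z :: "'a \<Rightarrow> real" and f :: "real \<Rightarrow> 'b::{banach, second_countable_topology}"
  assumes [measurable]: "Z \<in> borel_measurable M" "X \<in> borel_measurable M" "f \<in> borel_measurable borel"
    and Z: "\<And>\<omega>. \<bar>Z \<omega>\<bar> \<le> 1" and f: "\<And>x. norm (f x) \<le> B"
  shows "(2 + (\<integral>\<omega>. Z \<omega> \<partial>M)) *\<^sub>R (\<integral>x. f x \<partial>tilted_law M Z X) =
    2 *\<^sub>R (\<integral>\<omega>. f (X \<omega>) \<partial>M) + (\<integral>\<omega>. Z \<omega> *\<^sub>R f (X \<omega>) \<partial>M)"
proof -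
  note a = tilt_aux[OF assms(1) Z]
  let ?c = "2 + (\<integral>\<omega>. Z \<omega> \<partial>M)"
  have "norm (Z \<omega> *\<^sub>R f x) \<le> 1 * B" for \<omega> x
    unfolding norm_scaleR by (rule mult_mono) (use Z f in auto)
  then have i: "integrable M (\<lambda>\<omega>. Z \<omega> *\<^sub>R f (X \<omega>))" "integrable M (\<lambda>\<omega>. f (X \<omega>))"
    using f by (auto intro!: integrable_bounded_by)
  have "(\<integral>x. f x \<partial>tilted_law M Z X) = (\<integral>\<omega>. ((2 + Z \<omega>) / ?c) *\<^sub>R f (X \<omega>) \<partial>M)"
    unfolding tilted_law_def using a by (subst integral_distr) (auto simp: integral_density)
  also have "\<dots> = (\<integral>\<omega>. (1 / ?c) *\<^sub>R (2 *\<^sub>R f (X \<omega>) + Z \<omega> *\<^sub>R f (X \<omega>)) \<partial>M)"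
    by (intro Bochner_Integration.integral_cong refl) (simp add: scaleR_add_left[symmetric])
  also have "\<dots> = (1 / ?c) *\<^sub>R (2 *\<^sub>R (\<integral>\<omega>. f (X \<omega>) \<partial>M) + (\<integral>\<omega>. Z \<omega> *\<^sub>R f (X \<omega>) \<partial>M))"
    using i by simp
  finally show ?thesis using a by simp
qed

end

text \<open>Up to normalisation the characteristic function of the tilted law is twice the quantity
  in \<open>h1\<close> plus the one in \<open>h2\<close>. It therefore converges, and Levy's
  continuity theorem passes from exponentials to bounded continuous \<open>f\<close>.\<close>

lemma tilted_law_tendsto:
  fixes X Z :: "nat \<Rightarrow> 'a \<Rightarrow> real" and X' Z' :: "'b \<Rightarrow> real" and f :: "real \<Rightarrow> real"
  assumes M: "prob_space M" and Q: "prob_space Q"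
    and meas: "\<And>n. X n \<in> borel_measurable M" "\<And>n. Z n \<in> borel_measurable M"
      "X' \<in> borel_measurable Q" "Z' \<in> borel_measurable Q"
    and Z: "\<And>n \<omega>. \<bar>Z n \<omega>\<bar> \<le> 1" "\<And>\<omega>. \<bar>Z' \<omega>\<bar> \<le> 1"
    and h1: "\<And>a. (\<lambda>n. \<integral>\<omega>. iexp (a * X n \<omega>) \<partial>M) \<longlonglongrightarrow> (\<integral>\<omega>. iexp (a * X' \<omega>) \<partial>Q)"
    and h2: "\<And>a. (\<lambda>n. \<integral>\<omega>. Z n \<omega> *\<^sub>R iexp (a * X n \<omega>) \<partial>M) \<longlonglongrightarrow> (\<integral>\<omega>. Z' \<omega> *\<^sub>R iexp (a * X' \<omega>) \<partial>Q)"
    and f: "continuous_on UNIV f" "\<And>x. \<bar>f x\<bar> \<le> B"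
  shows "(\<lambda>n. 2 * (\<integral>\<omega>. f (X n \<omega>) \<partial>M) + (\<integral>\<omega>. Z n \<omega> * f (X n \<omega>) \<partial>M))
    \<longlonglongrightarrow> 2 * (\<integral>\<omega>. f (X' \<omega>) \<partial>Q) + (\<integral>\<omega>. Z' \<omega> * f (X' \<omega>) \<partial>Q)"
proof -
  interpret M: prob_space M by fact
  interpret Q: prob_space Q by fact
  have [measurable]: "f \<in> borel_measurable borel" by (rule borel_measurable_continuous_onI) fact
  have pos: "2 + (\<integral>\<omega>. Z n \<omega> \<partial>M) > 0" "2 + (\<integral>\<omega>. Z' \<omega> \<partial>Q) > 0" for n
    using M.tilt_aux(2)[OF meas(2) Z(1)] Q.tilt_aux(2)[OF meas(4) Z(2)] by auto
  have c: "(2 + (\<integral>\<omega>. Z n \<omega> \<partial>M)) *\<^sub>R char (tilted_law M (Z n) (X n)) a =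
      2 *\<^sub>R (\<integral>\<omega>. iexp (a * X n \<omega>) \<partial>M) + (\<integral>\<omega>. Z n \<omega> *\<^sub>R iexp (a * X n \<omega>) \<partial>M)" for n a
    unfolding char_def by (rule M.integral_tilted_law[where B=1]) (use meas Z in auto)
  have c': "(2 + (\<integral>\<omega>. Z' \<omega> \<partial>Q)) *\<^sub>R char (tilted_law Q Z' X') a =
      2 *\<^sub>R (\<integral>\<omega>. iexp (a * X' \<omega>) \<partial>Q) + (\<integral>\<omega>. Z' \<omega> *\<^sub>R iexp (a * X' \<omega>) \<partial>Q)" for a
    unfolding char_def by (rule Q.integral_tilted_law[where B=1]) (use meas Z in auto)
  \<comment> \<open>The normalisations converge because they are the case of frequency 0 in
    \<open>h2\<close>.\<close>
  have EZ: "(\<lambda>n. 2 + (\<integral>\<omega>. Z n \<omega> \<partial>M)) \<longlonglongrightarrow> 2 + (\<integral>\<omega>. Z' \<omega> \<partial>Q)"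
    using tendsto_Re[OF h2[of 0]] by (intro tendsto_add tendsto_const) (simp add: scaleR_conv_of_real)
  have "(\<lambda>n. inverse (2 + (\<integral>\<omega>. Z n \<omega> \<partial>M)) *\<^sub>R ((2 + (\<integral>\<omega>. Z n \<omega> \<partial>M)) *\<^sub>R char (tilted_law M (Z n) (X n)) a))
      \<longlonglongrightarrow> inverse (2 + (\<integral>\<omega>. Z' \<omega> \<partial>Q)) *\<^sub>R ((2 + (\<integral>\<omega>. Z' \<omega> \<partial>Q)) *\<^sub>R char (tilted_law Q Z' X') a)" for a
    unfolding c c' using pos(2) by (intro tendsto_intros h1 h2 EZ) auto
  then have ch: "(\<lambda>n. char (tilted_law M (Z n) (X n)) a) \<longlonglongrightarrow> char (tilted_law Q Z' X') a" for a
    using pos by (simp add: less_imp_neq[OF pos(1), symmetric] less_imp_neq[OF pos(2), symmetric])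
  have rd: "real_distribution (tilted_law M (Z n) (X n))" "real_distribution (tilted_law Q Z' X')" for n
    using meas Z by (auto intro!: M.real_distribution_tilted_law Q.real_distribution_tilted_law)
  have "(\<lambda>n. \<integral>x. f x \<partial>tilted_law M (Z n) (X n)) \<longlonglongrightarrow> (\<integral>x. f x \<partial>tilted_law Q Z' X')"
    by (rule weak_conv_imp_integral_bdd_continuous_conv[OF rd levy_continuity[OF rd ch]])
       (use f in \<open>auto simp: continuous_on_eq_continuous_at\<close>)
  from tendsto_scaleR[OF EZ this] show ?thesis
    using M.integral_tilted_law[of "Z _" "X _" f B] Q.integral_tilted_law[of Z' X' f B] meas Z f
    by simp
qed

text \<open>The factor 0 is admissible too; subtracting its instance of the preceding lemma removes
  the untilted term.\<close>

lemma tilted_tendsto_real: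
  fixes X Z :: "nat \<Rightarrow> 'a \<Rightarrow> real" and X' Z' :: "'b \<Rightarrow> real" and f :: "real \<Rightarrow> real"
  assumes M: "prob_space M" and Q: "prob_space Q"
    and meas: "\<And>n. X n \<in> borel_measurable M" "\<And>n. Z n \<in> borel_measurable M"
      "X' \<in> borel_measurable Q" "Z' \<in> borel_measurable Q"
    and Z: "\<And>n \<omega>. \<bar>Z n \<omega>\<bar> \<le> 1" "\<And>\<omega>. \<bar>Z' \<omega>\<bar> \<le> 1"
    and h1: "\<And>a. (\<lambda>n. \<integral>\<omega>. iexp (a * X n \<omega>) \<partial>M) \<longlonglongrightarrow> (\<integral>\<omega>. iexp (a * X' \<omega>) \<partial>Q)"
    and h2: "\<And>a. (\<lambda>n. \<integral>\<omega>. Z n \<omega> *\<^sub>R iexp (a * X n \<omega>) \<partial>M) \<longlonglongrightarrow> (\<integral>\<omega>. Z' \<omega> *\<^sub>R iexp (a * X' \<omega>) \<partial>Q)"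
    and f: "continuous_on UNIV f" "\<And>x. \<bar>f x\<bar> \<le> B"
  shows "(\<lambda>n. \<integral>\<omega>. Z n \<omega> * f (X n \<omega>) \<partial>M) \<longlonglongrightarrow> (\<integral>\<omega>. Z' \<omega> * f (X' \<omega>) \<partial>Q)"
proof -
  have "(\<lambda>n. 2 * (\<integral>\<omega>. f (X n \<omega>) \<partial>M) + (\<integral>\<omega>. 0 * f (X n \<omega>) \<partial>M))
      \<longlonglongrightarrow> 2 * (\<integral>\<omega>. f (X' \<omega>) \<partial>Q) + (\<integral>\<omega>. 0 * f (X' \<omega>) \<partial>Q)"
    using M Q meas h1 f by (intro tilted_law_tendsto[where B=B]) auto
  from tendsto_diff[OF tilted_law_tendsto[OF assms] this] show ?thesis by simp
qed

text \<open>A complex factor is split into real and imaginary parts. These involve the conjugate of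
  \<open>Z\<close>, whose hypothesis is \<open>h2\<close> at the frequency \<open>- a\<close>,
  conjugated.\<close>

lemma tilted_tendsto:
  fixes X :: "nat \<Rightarrow> 'a \<Rightarrow> real" and Z :: "nat \<Rightarrow> 'a \<Rightarrow> complex"
    and X' :: "'b \<Rightarrow> real" and Z' :: "'b \<Rightarrow> complex" and f :: "real \<Rightarrow> real"
  assumes M: "prob_space M" and Q: "prob_space Q"
    and meas: "\<And>n. X n \<in> borel_measurable M" "\<And>n. Z n \<in> borel_measurable M"
      "X' \<in> borel_measurable Q" "Z' \<in> borel_measurable Q"
    and Z: "\<And>n \<omega>. norm (Z n \<omega>) \<le> 1" "\<And>\<omega>. norm (Z' \<omega>) \<le> 1"
    and h1: "\<And>a. (\<lambda>n. \<integral>\<omega>. iexp (a * X n \<omega>) \<partial>M) \<longlonglongrightarrow> (\<integral>\<omega>. iexp (a * X' \<omega>) \<partial>Q)"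
    and h2: "\<And>a. (\<lambda>n. \<integral>\<omega>. Z n \<omega> * iexp (a * X n \<omega>) \<partial>M) \<longlonglongrightarrow> (\<integral>\<omega>. Z' \<omega> * iexp (a * X' \<omega>) \<partial>Q)"
    and f: "continuous_on UNIV f" "\<And>x. \<bar>f x\<bar> \<le> B"
  shows "(\<lambda>n. \<integral>\<omega>. Z n \<omega> * f (X n \<omega>) \<partial>M) \<longlonglongrightarrow> (\<integral>\<omega>. Z' \<omega> * f (X' \<omega>) \<partial>Q)"
proof -
  interpret M: prob_space M by fact
  interpret Q: prob_space Q by fact
  note [measurable] = meas
  have [measurable]: "f \<in> borel_measurable borel" by (rule borel_measurable_continuous_onI) fact
  have h3: "(\<lambda>n. \<integral>\<omega>. cnj (Z n \<omega>) * iexp (a * X n \<omega>) \<partial>M) \<longlonglongrightarrow> (\<integral>\<omega>. cnj (Z' \<omega>) * iexp (a * X' \<omega>) \<partial>Q)" for a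
  proof -
    have e: "cnj z * iexp (a * x) = cnj (z * iexp ((- a) * x))" for z x
      by (simp add: exp_cnj)
    show ?thesis unfolding e
      using tendsto_cnj[OF h2[of "- a"]] by (simp only: Bochner_Integration.integral_cnj)
  qed
  have [measurable]: "(\<lambda>\<omega>. cnj (Z n \<omega>)) \<in> borel_measurable M" "(\<lambda>\<omega>. cnj (Z' \<omega>)) \<in> borel_measurable Q" for n
    using borel_measurable_continuous_onI[OF continuous_on_cnj[OF continuous_on_id]] meas
    by (auto intro: measurable_compose)
  have iZ: "integrable M (\<lambda>\<omega>. Z n \<omega> * iexp (a * X n \<omega>))" "integrable M (\<lambda>\<omega>. cnj (Z n \<omega>) * iexp (a * X n \<omega>))"
    "integrable Q (\<lambda>\<omega>. Z' \<omega> * iexp (a * X' \<omega>))" "integrable Q (\<lambda>\<omega>. cnj (Z' \<omega>) * iexp (a * X' \<omega>))" for n a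
    using Z by (auto intro!: M.integrable_bounded_by[of _ 1] Q.integrable_bounded_by[of _ 1] simp: norm_mult)
  have re: "Re z *\<^sub>R w = (z * w + cnj z * w) / 2" for z w :: complex
    by (simp add: complex_eq_iff)
  have im: "Im z *\<^sub>R w = (z * w - cnj z * w) / (2 * \<i>)" for z w :: complex
    by (simp add: complex_eq_iff)
  have R: "(\<lambda>n. \<integral>\<omega>. Re (Z n \<omega>) * f (X n \<omega>) \<partial>M) \<longlonglongrightarrow> (\<integral>\<omega>. Re (Z' \<omega>) * f (X' \<omega>) \<partial>Q)"
  proof (rule tilted_tendsto_real[OF M Q _ _ _ _ _ _ h1 _ f])
    show "(\<lambda>n. \<integral>\<omega>. Re (Z n \<omega>) *\<^sub>R iexp (a * X n \<omega>) \<partial>M) \<longlonglongrightarrow> (\<integral>\<omega>. Re (Z' \<omega>) *\<^sub>R iexp (a * X' \<omega>) \<partial>Q)" for a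
      unfolding re using iZ by (simp del: of_real_mult) (intro tendsto_intros h2 h3, simp)
  qed (use Z abs_Re_le_cmod order_trans in \<open>auto, blast+\<close>)
  have I: "(\<lambda>n. \<integral>\<omega>. Im (Z n \<omega>) * f (X n \<omega>) \<partial>M) \<longlonglongrightarrow> (\<integral>\<omega>. Im (Z' \<omega>) * f (X' \<omega>) \<partial>Q)"
  proof (rule tilted_tendsto_real[OF M Q _ _ _ _ _ _ h1 _ f])
    show "(\<lambda>n. \<integral>\<omega>. Im (Z n \<omega>) *\<^sub>R iexp (a * X n \<omega>) \<partial>M) \<longlonglongrightarrow> (\<integral>\<omega>. Im (Z' \<omega>) *\<^sub>R iexp (a * X' \<omega>) \<partial>Q)" for a
      unfolding im using iZ by (simp del: of_real_mult) (intro tendsto_intros h2 h3, simp)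
  qed (use Z abs_Im_le_cmod order_trans in \<open>auto, blast+\<close>)
  have B0: "norm (z * complex_of_real (f x)) \<le> B" if "norm z \<le> 1" for z x
    using mult_mono[OF that f(2)[of x]] by (simp add: norm_mult)
  have iM: "integrable M (\<lambda>\<omega>. Z n \<omega> * f (X n \<omega>))" and iQ: "integrable Q (\<lambda>\<omega>. Z' \<omega> * f (X' \<omega>))" for n
    using Z B0 by (auto intro!: M.integrable_bounded_by[of _ B] Q.integrable_bounded_by[of _ B])
  have cM: "(\<integral>\<omega>. Z n \<omega> * f (X n \<omega>) \<partial>M) = Complex (\<integral>\<omega>. Re (Z n \<omega>) * f (X n \<omega>) \<partial>M) (\<integral>\<omega>. Im (Z n \<omega>) * f (X n \<omega>) \<partial>M)" for n
    using integral_Re[OF iM[of n]] integral_Im[OF iM[of n]] by (simp add: complex_eq_iff)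
  have cQ: "(\<integral>\<omega>. Z' \<omega> * f (X' \<omega>) \<partial>Q) = Complex (\<integral>\<omega>. Re (Z' \<omega>) * f (X' \<omega>) \<partial>Q) (\<integral>\<omega>. Im (Z' \<omega>) * f (X' \<omega>) \<partial>Q)"
    using integral_Re[OF iQ] integral_Im[OF iQ] by (simp add: complex_eq_iff)
  show ?thesis unfolding cM cQ by (intro tendsto_Complex R I)
qed

text \<open>The induction trades exponentials for test functions one coordinate at a time: the
  product treated so far times the remaining exponential is the bounded factor of
  \<open>tilted_tendsto\<close>. The frequency set \<open>K\<close> varies because the new
  coordinate must first be available as a frequency.\<close>

lemma iexp_char_prod_tendsto_aux:
  fixes X :: "nat \<Rightarrow> 'i \<Rightarrow> 'a \<Rightarrow> real" and X' :: "'i \<Rightarrow> 'b \<Rightarrow> real" and f :: "'i \<Rightarrow> real \<Rightarrow> real"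
  assumes M: "prob_space M" and Q: "prob_space Q"
    and meas: "\<And>n i. i \<in> I \<Longrightarrow> X n i \<in> borel_measurable M" "\<And>i. i \<in> I \<Longrightarrow> X' i \<in> borel_measurable Q"
    and ch: "\<And>K t. finite K \<Longrightarrow> K \<subseteq> I \<Longrightarrow> (\<lambda>n. \<integral>\<omega>. iexp (\<Sum>i\<in>K. t i * X n i \<omega>) \<partial>M) \<longlonglongrightarrow>
       (\<integral>\<omega>. iexp (\<Sum>i\<in>K. t i * X' i \<omega>) \<partial>Q)"
    and f: "\<And>i. continuous_on UNIV (f i)" "\<And>i x. \<bar>f i x\<bar> \<le> 1"
    and J: "finite J" "finite K" "J \<inter> K = {}" "J \<union> K \<subseteq> I"
  shows "(\<lambda>n. \<integral>\<omega>. of_real (\<Prod>i\<in>J. f i (X n i \<omega>)) * iexp (\<Sum>i\<in>K. t i * X n i \<omega>) \<partial>M) \<longlonglongrightarrow>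
       (\<integral>\<omega>. of_real (\<Prod>i\<in>J. f i (X' i \<omega>)) * iexp (\<Sum>i\<in>K. t i * X' i \<omega>) \<partial>Q)"
  using J
proof (induction J arbitrary: K t rule: finite_induct)
  case empty
  then show ?case using ch[of K t] by simp
next
  case (insert j J)
  note [measurable] = meas
  have fm[measurable]: "f i \<in> borel_measurable borel" for i
    by (rule borel_measurable_continuous_onI) (rule f)
  have j: "j \<in> I" "J \<subseteq> I" "K \<subseteq> I" "j \<notin> K" "j \<notin> J" using insert by auto
  have pr: "\<bar>\<Prod>i\<in>J. f i (g i)\<bar> \<le> 1" for g
    unfolding abs_prod by (rule prod_le_1) (use f in auto)
  have n1: "norm (complex_of_real (\<Prod>i\<in>J. f i (g i)) * iexp x) \<le> 1" for g x
    unfolding norm_mult norm_exp_i_times norm_of_real using pr by simp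
  have m1: "(\<lambda>\<omega>. of_real (\<Prod>i\<in>J. f i (X n i \<omega>)) * iexp (\<Sum>i\<in>K. t i * X n i \<omega>)) \<in> borel_measurable M" for n
  proof -
    have [measurable]: "(\<lambda>\<omega>. \<Sum>i\<in>K. t i * X n i \<omega>) \<in> borel_measurable M"
      using meas(1)[of _ n] j by (intro borel_measurable_sum borel_measurable_times) auto
    have [measurable]: "(\<lambda>\<omega>. \<Prod>i\<in>J. f i (X n i \<omega>)) \<in> borel_measurable M"
      using meas(1)[of _ n] j by (intro borel_measurable_prod measurable_compose[OF _ fm]) auto
    show ?thesis by measurable
  qed
  have m2: "(\<lambda>\<omega>. of_real (\<Prod>i\<in>J. f i (X' i \<omega>)) * iexp (\<Sum>i\<in>K. t i * X' i \<omega>)) \<in> borel_measurable Q"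
  proof -
    have [measurable]: "(\<lambda>\<omega>. \<Sum>i\<in>K. t i * X' i \<omega>) \<in> borel_measurable Q"
      using meas(2) j by (intro borel_measurable_sum borel_measurable_times) auto
    have [measurable]: "(\<lambda>\<omega>. \<Prod>i\<in>J. f i (X' i \<omega>)) \<in> borel_measurable Q"
      using meas(2) j by (intro borel_measurable_prod measurable_compose[OF _ fm]) auto
    show ?thesis by measurable
  qed
  have "(\<lambda>n. \<integral>\<omega>. of_real (\<Prod>i\<in>J. f i (X n i \<omega>)) * iexp (\<Sum>i\<in>K. t i * X n i \<omega>) * f j (X n j \<omega>) \<partial>M) \<longlonglongrightarrow>
       (\<integral>\<omega>. of_real (\<Prod>i\<in>J. f i (X' i \<omega>)) * iexp (\<Sum>i\<in>K. t i * X' i \<omega>) * f j (X' j \<omega>) \<partial>Q)"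
  proof (rule tilted_tendsto[OF M Q _ m1 _ m2, where B=1 and X="\<lambda>n. X n j" and X'="X' j" and f="f j"])
    show "(\<lambda>n. \<integral>\<omega>. iexp (a * X n j \<omega>) \<partial>M) \<longlonglongrightarrow> (\<integral>\<omega>. iexp (a * X' j \<omega>) \<partial>Q)" for a
      using ch[of "{j}" "\<lambda>_. a"] j by simp
    show "(\<lambda>n. \<integral>\<omega>. of_real (\<Prod>i\<in>J. f i (X n i \<omega>)) * iexp (\<Sum>i\<in>K. t i * X n i \<omega>) * iexp (a * X n j \<omega>) \<partial>M) \<longlonglongrightarrow>
       (\<integral>\<omega>. of_real (\<Prod>i\<in>J. f i (X' i \<omega>)) * iexp (\<Sum>i\<in>K. t i * X' i \<omega>) * iexp (a * X' j \<omega>) \<partial>Q)" for a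
    proof -
      have s: "(\<Sum>i\<in>insert j K. (t(j := a)) i * g i) = (\<Sum>i\<in>K. t i * g i) + a * g j" for g :: "'i \<Rightarrow> real"
      proof -
        have "(\<Sum>i\<in>K. (t(j := a)) i * g i) = (\<Sum>i\<in>K. t i * g i)"
          by (rule sum.cong) (use j in auto)
        then show ?thesis using insert j by simp
      qed
      have "finite (insert j K)" "J \<inter> insert j K = {}" "J \<union> insert j K \<subseteq> I" using insert j by auto
      from insert.IH[OF this, of "t(j := a)"] show ?thesis
        unfolding s by (simp add: exp_add distrib_left mult.assoc del: of_real_mult of_real_sum fun_upd_apply)
    qed
  next
    show "norm (of_real (\<Prod>i\<in>J. f i (X n i \<omega>)) * iexp (\<Sum>i\<in>K. t i * X n i \<omega>)) \<le> 1" for n \<omega> by (rule n1)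
    show "norm (of_real (\<Prod>i\<in>J. f i (X' i \<omega>)) * iexp (\<Sum>i\<in>K. t i * X' i \<omega>)) \<le> 1" for \<omega> by (rule n1)
  qed (use meas j f in auto)
  moreover have "of_real (\<Prod>i\<in>insert j J. f i (g i)) * z = of_real (\<Prod>i\<in>J. f i (g i)) * z * of_real (f j (g j))" for g and z :: complex
    using insert.hyps by simp
  ultimately show ?case by (simp only:)
qed

lemma char_tendsto_prod:
  fixes X :: "nat \<Rightarrow> 'i \<Rightarrow> 'a \<Rightarrow> real" and X' :: "'i \<Rightarrow> 'b \<Rightarrow> real" and f :: "'i \<Rightarrow> real \<Rightarrow> real"
  assumes M: "prob_space M" and Q: "prob_space Q"
    and meas: "\<And>n i. i \<in> I \<Longrightarrow> X n i \<in> borel_measurable M" "\<And>i. i \<in> I \<Longrightarrow> X' i \<in> borel_measurable Q"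
    and ch: "\<And>K t. finite K \<Longrightarrow> K \<subseteq> I \<Longrightarrow> (\<lambda>n. \<integral>\<omega>. iexp (\<Sum>i\<in>K. t i * X n i \<omega>) \<partial>M) \<longlonglongrightarrow>
       (\<integral>\<omega>. iexp (\<Sum>i\<in>K. t i * X' i \<omega>) \<partial>Q)"
    and f: "\<And>i. continuous_on UNIV (f i)" "\<And>i x. \<bar>f i x\<bar> \<le> 1"
    and I: "finite I"
  shows "(\<lambda>n. \<integral>\<omega>. (\<Prod>i\<in>I. f i (X n i \<omega>)) \<partial>M) \<longlonglongrightarrow> (\<integral>\<omega>. (\<Prod>i\<in>I. f i (X' i \<omega>)) \<partial>Q)"
  using tendsto_Re[OF iexp_char_prod_tendsto_aux[OF M Q meas ch f I, where K="{}"]]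
  by (simp del: of_real_prod)

text \<open>The half-lines generate the product \<open>\<sigma>\<close>-algebra, and their indicators are limits of
  continuous functions.\<close>

definition ramp :: "real \<Rightarrow> nat \<Rightarrow> real \<Rightarrow> real" where
  "ramp b n x = max 0 (min 1 (1 - real n * (x - b)))"

lemma ramp_tendsto: "(\<lambda>n. ramp b n x) \<longlonglongrightarrow> indicator {..b} x"
proof (cases "x \<le> b")
  case True
  then have "real n * (x - b) \<le> 0" for n by (simp add: mult_nonneg_nonpos)
  then have "ramp b n x = 1" for n by (simp add: ramp_def min_def)
  then show ?thesis using True by simp
next
  case False
  then obtain N where N: "real N * (x - b) > 1" using ex_less_of_nat_mult[of "x - b" 1] by auto
  have "eventually (\<lambda>n. ramp b n x = 0) sequentially"
    using eventually_ge_at_top[of N]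
  proof eventually_elim
    case (elim n)
    have "real N * (x - b) \<le> real n * (x - b)" using elim False by (intro mult_right_mono) auto
    then show ?case using N by (simp add: ramp_def)
  qed
  then show ?thesis using False by (simp add: tendsto_eventually)
qed

lemma ramp_bounds: "\<bar>ramp b n x\<bar> \<le> 1" by (simp add: ramp_def)

lemma continuous_ramp: "continuous_on UNIV (ramp b n)"
  unfolding ramp_def by (intro continuous_intros)

text \<open>Uniqueness obtained from convergence: \<open>char_tendsto_prod\<close> for a constant
  sequence gives equal integrals of products of continuous functions, ramps then give equal masses
  of the boxes, and these form an intersection-stable generator.\<close>

lemma measure_eqI_PiM_char:
  fixes P Q :: "('i \<Rightarrow> real) measure"
  assumes I: "finite I" and P: "prob_space P" "sets P = sets (PiM I (\<lambda>_. borel))"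
    and Q: "prob_space Q" "sets Q = sets (PiM I (\<lambda>_. borel))"
    and ch: "\<And>K t. K \<subseteq> I \<Longrightarrow> (\<integral>x. iexp (\<Sum>i\<in>K. t i * x i) \<partial>P) = (\<integral>x. iexp (\<Sum>i\<in>K. t i * x i) \<partial>Q)"
  shows "P = Q"
proof -
  interpret P: prob_space P by fact
  interpret Q: prob_space Q by fact
  note [measurable_cong] = P(2) Q(2)
  have spP: "space P = (\<Pi>\<^sub>E i\<in>I. UNIV)" "space Q = (\<Pi>\<^sub>E i\<in>I. UNIV)"
    using sets_eq_imp_space_eq[OF P(2)] sets_eq_imp_space_eq[OF Q(2)] by (auto simp: space_PiM)
  have eq_prod: "(\<integral>x. (\<Prod>i\<in>I. f i (x i)) \<partial>P) = (\<integral>x. (\<Prod>i\<in>I. f i (x i)) \<partial>Q)"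
    if "\<And>i. continuous_on UNIV (f i)" "\<And>i x. \<bar>f i x\<bar> \<le> 1" for f :: "'i \<Rightarrow> real \<Rightarrow> real"
    using char_tendsto_prod[OF P(1) Q(1), of I "\<lambda>n i x. x i" "\<lambda>i x. x i" f] that I ch
    by (simp add: LIMSEQ_const_iff)
  have box: "emeasure P (\<Pi>\<^sub>E i\<in>I. {..b i}) = emeasure Q (\<Pi>\<^sub>E i\<in>I. {..b i})" for b
  proof -
    have ind: "indicator (\<Pi>\<^sub>E i\<in>I. {..b i}) x = (\<Prod>i\<in>I. indicator {..b i} (x i) :: real)" if "x \<in> (\<Pi>\<^sub>E i\<in>I. UNIV)" for x
    proof (cases "\<forall>i\<in>I. x i \<le> b i")
      case True
      then show ?thesis using that by (auto simp: indicator_def PiE_iff)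
    next
      case False
      then have "\<exists>i\<in>I. indicator {..b i} (x i) = (0 :: real)" by (auto simp: indicator_def)
      then have "(\<Prod>i\<in>I. indicator {..b i} (x i) :: real) = 0" using I by (intro prod_zero)
      then show ?thesis using False by (auto simp: indicator_def PiE_iff)
    qed
    have lim: "(\<lambda>n. \<integral>x. (\<Prod>i\<in>I. ramp (b i) n (x i)) \<partial>R) \<longlonglongrightarrow> measure R (\<Pi>\<^sub>E i\<in>I. {..b i})"
      if "prob_space R" and R[measurable_cong]: "sets R = sets (PiM I (\<lambda>_. borel))" for R
    proof -
      interpret R: prob_space R by fact
      have sp: "space R = (\<Pi>\<^sub>E i\<in>I. UNIV)" using sets_eq_imp_space_eq[OF R] by (auto simp: space_PiM)
      have [measurable]: "ramp b n \<in> borel_measurable borel" for b n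
        by (rule borel_measurable_continuous_onI) (rule continuous_ramp)
      have "(\<lambda>n. \<integral>x. (\<Prod>i\<in>I. ramp (b i) n (x i)) \<partial>R) \<longlonglongrightarrow> (\<integral>x. (\<Prod>i\<in>I. indicator {..b i} (x i)) \<partial>R)"
      proof (rule integral_dominated_convergence[where w="\<lambda>_. 1"])
        show "AE x in R. norm (\<Prod>i\<in>I. ramp (b i) n (x i)) \<le> 1" for n
          unfolding real_norm_def abs_prod by (intro AE_I2 prod_le_1) (auto simp: ramp_bounds)
        show "AE x in R. (\<lambda>n. \<Prod>i\<in>I. ramp (b i) n (x i)) \<longlonglongrightarrow> (\<Prod>i\<in>I. indicator {..b i} (x i))"
          by (intro AE_I2 tendsto_prod ramp_tendsto)
      qed measurable
      also have "(\<integral>x. (\<Prod>i\<in>I. indicat_real {..b i} (x i)) \<partial>R) = (\<integral>x. indicat_real (\<Pi>\<^sub>E i\<in>I. {..b i}) x \<partial>R)"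
        using ind sp by (intro Bochner_Integration.integral_cong) auto
      also have "\<dots> = measure R (\<Pi>\<^sub>E i\<in>I. {..b i})"
        using sp by (simp add: Int_absorb2 PiE_mono)
      finally show ?thesis .
    qed
    have "measure P (\<Pi>\<^sub>E i\<in>I. {..b i}) = measure Q (\<Pi>\<^sub>E i\<in>I. {..b i})"
    proof (rule LIMSEQ_unique[OF lim[OF P]])
      show "(\<lambda>n. \<integral>x. (\<Prod>i\<in>I. ramp (b i) n (x i)) \<partial>P) \<longlonglongrightarrow> measure Q (\<Pi>\<^sub>E i\<in>I. {..b i})"
        using lim[OF Q] eq_prod[of "\<lambda>i. ramp (b i) _", OF continuous_ramp ramp_bounds] by simp
    qed
    then show ?thesis by (simp add: P.emeasure_eq_measure Q.emeasure_eq_measure)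
  qed
  define E where "E = {\<Pi>\<^sub>E i\<in>I. {..b i} | b :: 'i \<Rightarrow> real. True}"
  have EP: "E \<subseteq> Pow (\<Pi>\<^sub>E i\<in>I. UNIV)" by (auto simp: E_def PiE_iff)
  have sig: "sets (PiM I (\<lambda>_. borel :: real measure)) = sigma_sets (\<Pi>\<^sub>E i\<in>I. UNIV) E"
  proof -
    have "{{f \<in> \<Pi>\<^sub>E i\<in>I. (UNIV :: real set). \<forall>i\<in>j. f i \<in> A i} | A j. j \<in> {I} \<and> A \<in> Pi j (\<lambda>_. range (\<lambda>a. {..a}))} = E"
    proof (intro set_eqI iffI)
      fix S assume "S \<in> {{f \<in> \<Pi>\<^sub>E i\<in>I. (UNIV :: real set). \<forall>i\<in>j. f i \<in> A i} | A j. j \<in> {I} \<and> A \<in> Pi j (\<lambda>_. range (\<lambda>a. {..a}))}"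
      then obtain A where A: "S = {f \<in> \<Pi>\<^sub>E i\<in>I. (UNIV :: real set). \<forall>i\<in>I. f i \<in> A i}" "A \<in> Pi I (\<lambda>_. range (\<lambda>a. {..a}))"
        by blast
      then have "\<forall>i\<in>I. \<exists>a. A i = {..a}" by (auto simp: Pi_def)
      then obtain b where "\<forall>i\<in>I. A i = {..b i}" by metis
      then have "S = (\<Pi>\<^sub>E i\<in>I. {..b i})" unfolding A by (auto simp: PiE_iff extensional_def)
      then show "S \<in> E" by (auto simp: E_def)
    next
      fix S assume "S \<in> E"
      then obtain b where b: "S = (\<Pi>\<^sub>E i\<in>I. {..b i})" by (auto simp: E_def)
      show "S \<in> {{f \<in> \<Pi>\<^sub>E i\<in>I. (UNIV :: real set). \<forall>i\<in>j. f i \<in> A i} | A j. j \<in> {I} \<and> A \<in> Pi j (\<lambda>_. range (\<lambda>a. {..a}))}"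
        unfolding b by (rule CollectI, rule exI[of _ "\<lambda>i. {..b i}"], rule exI[of _ I]) (auto simp: PiE_iff extensional_def)
    qed
    moreover have "sets (PiM I (\<lambda>_. sigma (UNIV :: real set) (range (\<lambda>a. {..a})))) =
       sets (sigma (\<Pi>\<^sub>E i\<in>I. UNIV) {{f \<in> \<Pi>\<^sub>E i\<in>I. (UNIV :: real set). \<forall>i\<in>j. f i \<in> A i} | A j. j \<in> {I} \<and> A \<in> Pi j (\<lambda>_. range (\<lambda>a. {..a}))})"
    proof (rule sets_PiM_sigma)
      show "\<exists>S\<subseteq>range (\<lambda>a::real. {..a}). countable S \<and> UNIV = \<Union>S" if "i \<in> I" for i
      proof (intro exI[of _ "range (\<lambda>n::nat. {..real n})"] conjI)
        show "UNIV = (\<Union>n::nat. {..real n})" using real_arch_simple by auto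
      qed auto
    qed (use I in auto)
    ultimately show ?thesis
      unfolding borel_eq_atMost[where 'a=real, symmetric] using EP by (simp add: sets_measure_of)
  qed
  show ?thesis
  proof (rule measure_eqI_generator_eq[where E=E and \<Omega>="\<Pi>\<^sub>E i\<in>I. UNIV" and A="\<lambda>n. \<Pi>\<^sub>E i\<in>I. {..real n}"])
    show "Int_stable E"
    proof (rule Int_stableI)
      fix a b assume "a \<in> E" "b \<in> E"
      then obtain c d where "a = (\<Pi>\<^sub>E i\<in>I. {..c i})" "b = (\<Pi>\<^sub>E i\<in>I. {..d i})" by (auto simp: E_def)
      then have "a \<inter> b = (\<Pi>\<^sub>E i\<in>I. {..min (c i) (d i)})" by (auto simp: PiE_iff)
      then show "a \<inter> b \<in> E"
        unfolding E_def by (intro CollectI exI[of _ "\<lambda>i. min (c i) (d i)"]) simp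
    qed
    show "E \<subseteq> Pow (\<Pi>\<^sub>E i\<in>I. UNIV)" by (rule EP)
    show "emeasure P X = emeasure Q X" if "X \<in> E" for X using that box by (auto simp: E_def)
    show "sets P = sigma_sets (\<Pi>\<^sub>E i\<in>I. UNIV) E" "sets Q = sigma_sets (\<Pi>\<^sub>E i\<in>I. UNIV) E"
      using P(2) Q(2) sig by auto
    show "range (\<lambda>n. \<Pi>\<^sub>E i\<in>I. {..real n}) \<subseteq> E"
    proof (rule image_subsetI)
      show "(\<Pi>\<^sub>E i\<in>I. {..real n}) \<in> E" for n
        unfolding E_def by (intro CollectI exI[of _ "\<lambda>_. real n"]) simp
    qed
    show "(\<Union>n. \<Pi>\<^sub>E i\<in>I. {..real n}) = (\<Pi>\<^sub>E i\<in>I. UNIV)"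
    proof (intro equalityI subsetI)
      fix x assume x: "x \<in> (\<Pi>\<^sub>E i\<in>I. (UNIV :: real set))"
      obtain n :: nat where n: "(\<Sum>i\<in>I. \<bar>x i\<bar>) \<le> real n" using real_arch_simple by auto
      have "x i \<le> real n" if "i \<in> I" for i
      proof -
        have "\<bar>x i\<bar> \<le> (\<Sum>i\<in>I. \<bar>x i\<bar>)" using I that by (intro member_le_sum) auto
        then show ?thesis using n by linarith
      qed
      then show "x \<in> (\<Union>n. \<Pi>\<^sub>E i\<in>I. {..real n})" using x by (auto simp: PiE_iff)
    qed (auto simp: PiE_iff)
    show "emeasure P (\<Pi>\<^sub>E i\<in>I. {..real n}) \<noteq> \<infinity>" for n by simp
  qed
qed

section \<open>Gaussian vectors as linear images of independent normals\<close>

text \<open>On the vector with entry 1 at \<open>i\<close> and \<open>s\<close> at \<open>a\<close>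
  the form is affine in \<open>s\<close>. An affine function that is nonnegative everywhere has
  slope 0.\<close>

lemma psd_zero_diag:
  fixes K :: "'i \<Rightarrow> 'i \<Rightarrow> real"
  assumes S: "finite S" "a \<in> S" "i \<in> S" and sym: "\<And>i j. i \<in> S \<Longrightarrow> j \<in> S \<Longrightarrow> K i j = K j i"
    and psd: "\<And>c. (\<Sum>i\<in>S. \<Sum>j\<in>S. c i * c j * K i j) \<ge> 0" and z: "K a a = 0"
  shows "K i a = 0"
proof (cases "i = a")
  case False
  have q: "K i i + 2 * s * K i a \<ge> 0" for s
  proof -
    let ?c = "\<lambda>k. if k = i then 1 else if k = a then s else 0"
    have "(\<Sum>k\<in>S. \<Sum>l\<in>S. ?c k * ?c l * K k l) = (\<Sum>k\<in>{i,a}. \<Sum>l\<in>{i,a}. ?c k * ?c l * K k l)"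
    proof (rule sum.mono_neutral_cong_right)
      show "(\<Sum>l\<in>S. ?c k * ?c l * K k l) = (\<Sum>l\<in>{i,a}. ?c k * ?c l * K k l)" for k
        by (rule sum.mono_neutral_cong_right) (use S in auto)
    qed (use S in \<open>auto intro!: sum.neutral\<close>)
    also have "\<dots> = K i i + 2 * s * K i a"
      using False z sym[OF S(2,3)] by simp
    finally show ?thesis using psd[of ?c] by linarith
  qed
  show ?thesis
  proof (rule ccontr)
    assume n: "K i a \<noteq> 0"
    have "K i i + 2 * (- (K i i + 1) / (2 * K i a)) * K i a = -1" using n by (simp add: field_simps)
    then show False using q[of "- (K i i + 1) / (2 * K i a)"] by linarith
  qed
qed (use z in simp)

text \<open>Cholesky factorisation: a row is eliminated by completing the square. The division by
  \<open>K a a\<close> is harmless when this entry vanishes, since then so does its row.\<close>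

lemma psd_gram:
  fixes K :: "'i \<Rightarrow> 'i \<Rightarrow> real"
  assumes "finite S" and "\<And>i j. i \<in> S \<Longrightarrow> j \<in> S \<Longrightarrow> K i j = K j i"
    and "\<And>c. (\<Sum>i\<in>S. \<Sum>j\<in>S. c i * c j * K i j) \<ge> 0"
  shows "\<exists>A :: 'i \<Rightarrow> 'i \<Rightarrow> real. \<forall>i\<in>S. \<forall>j\<in>S. K i j = (\<Sum>m\<in>S. A i m * A j m)"
  using assms
proof (induction S arbitrary: K rule: finite_induct)
  case (insert a S)
  note sym = insert.prems(1) and psd = insert.prems(2)
  define K' where "K' i j = K i j - K i a * K j a / K a a" for i j
  have quad: "(\<Sum>i\<in>S. \<Sum>j\<in>S. c i * c j * K' i j) \<ge> 0" for c
  proof -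
    define b where "b = (\<Sum>i\<in>S. c i * K i a)"
    \<comment> \<open>The minimiser of the form in the coordinate \<open>a\<close>. There the form
      on \<open>insert a S\<close> equals that of the Schur complement \<open>K'\<close> on
      \<open>S\<close>; for \<open>K a a = 0\<close> division by zero gives \<open>d = 0\<close> and
      \<open>K' = K\<close>, and the argument still applies.\<close>
    define d where "d = - b / K a a"
    define w where "w = c(a := d)"
    have wS: "(\<Sum>i\<in>S. g (w i) i) = (\<Sum>i\<in>S. g (c i) i)" for g :: "real \<Rightarrow> 'i \<Rightarrow> real"
      by (rule sum.cong) (use insert.hyps in \<open>auto simp: w_def\<close>)
    have inner: "(\<Sum>j\<in>insert a S. w i * w j * K i j) = w i * (d * K i a) + (\<Sum>j\<in>S. w i * c j * K i j)" for i
      using insert.hyps wS[of "\<lambda>x j. w i * x * K i j"] by (simp add: w_def[THEN fun_cong, of a])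
    have "(\<Sum>i\<in>insert a S. \<Sum>j\<in>insert a S. w i * w j * K i j) =
      d * (d * K a a) + (\<Sum>j\<in>S. d * c j * K a j) + (\<Sum>i\<in>S. c i * (d * K i a) + (\<Sum>j\<in>S. c i * c j * K i j))"
      unfolding inner using insert.hyps wS[of "\<lambda>x i. x * (d * K i a) + (\<Sum>j\<in>S. x * c j * K i j)"]
      by (simp add: w_def[THEN fun_cong, of a])
    also have "(\<Sum>j\<in>S. d * c j * K a j) = d * b"
      unfolding b_def sum_distrib_left by (rule sum.cong) (use sym in auto)
    also have "(\<Sum>i\<in>S. c i * (d * K i a) + (\<Sum>j\<in>S. c i * c j * K i j)) = d * b + (\<Sum>i\<in>S. \<Sum>j\<in>S. c i * c j * K i j)"
      unfolding b_def sum_distrib_left sum.distrib by (simp add: ac_simps)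
    finally have "d * (d * K a a) + d * b + (d * b + (\<Sum>i\<in>S. \<Sum>j\<in>S. c i * c j * K i j)) \<ge> 0"
      using psd[of w] by simp
    then have "(\<Sum>i\<in>S. \<Sum>j\<in>S. c i * c j * K i j) - b * b / K a a \<ge> 0"
      by (cases "K a a = 0") (auto simp: d_def field_simps)
    also have "(\<Sum>i\<in>S. \<Sum>j\<in>S. c i * c j * K i j) - b * b / K a a = (\<Sum>i\<in>S. \<Sum>j\<in>S. c i * c j * K' i j)"
      unfolding b_def K'_def sum_product
      by (simp add: sum_subtractf[symmetric] sum_divide_distrib algebra_simps)
    finally show ?thesis .
  qed
  have "\<exists>A. \<forall>i\<in>S. \<forall>j\<in>S. K' i j = (\<Sum>m\<in>S. A i m * A j m)"
    by (rule insert.IH) (use sym quad in \<open>auto simp: K'_def\<close>)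
  then obtain A where A: "\<And>i j. i \<in> S \<Longrightarrow> j \<in> S \<Longrightarrow> K' i j = (\<Sum>m\<in>S. A i m * A j m)" by blast
  have Kaa: "K a a \<ge> 0"
  proof -
    let ?c = "\<lambda>i. if i = a then 1 else 0"
    have "(\<Sum>i\<in>insert a S. \<Sum>j\<in>insert a S. ?c i * ?c j * K i j) = K a a"
    proof -
      have "(\<Sum>i\<in>insert a S. \<Sum>j\<in>insert a S. ?c i * ?c j * K i j) = (\<Sum>i\<in>{a}. \<Sum>j\<in>{a}. ?c i * ?c j * K i j)"
      proof (rule sum.mono_neutral_cong_right)
        show "(\<Sum>j\<in>insert a S. ?c i * ?c j * K i j) = (\<Sum>j\<in>{a}. ?c i * ?c j * K i j)" for i
          by (rule sum.mono_neutral_cong_right) (use insert.hyps in auto)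
      qed (use insert.hyps in \<open>auto intro!: sum.neutral\<close>)
      then show ?thesis by simp
    qed
    then show ?thesis using psd[of ?c] by simp
  qed
  have Kz: "K i a = 0" if "K a a = 0" "i \<in> insert a S" for i
    by (rule psd_zero_diag[of "insert a S"]) (use insert.hyps sym psd that in auto)
  \<comment> \<open>The eliminated row over the square root of the pivot becomes the column
    \<open>a\<close> of the factor, and the row \<open>a\<close> is 0 in all other columns: the
    factor is triangular.\<close>
  define B where "B i m = (if m = a then K i a / sqrt (K a a) else if i = a then 0 else A i m)" for i m
  have "K i j = (\<Sum>m\<in>insert a S. B i m * B j m)" if ij: "i \<in> insert a S" "j \<in> insert a S" for i j
  proof -
    have "(\<Sum>m\<in>insert a S. B i m * B j m) = K i a * K j a / K a a + (\<Sum>m\<in>S. B i m * B j m)"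
      using insert.hyps Kaa by (simp add: B_def)
    also have "(\<Sum>m\<in>S. B i m * B j m) = (\<Sum>m\<in>S. if i = a \<or> j = a then 0 else A i m * A j m)"
      by (rule sum.cong) (use insert.hyps in \<open>auto simp: B_def\<close>)
    also have "K i a * K j a / K a a + \<dots> = K i j"
    proof (cases "i = a \<or> j = a")
      case True
      then show ?thesis using Kz ij sym[of i a] sym[of j a] sym[of i j] by (cases "K a a = 0") auto
    next
      case False
      then show ?thesis using A[of i j] ij by (simp add: K'_def)
    qed
    finally show ?thesis by simp
  qed
  then show ?case by (intro exI[of _ B]) blast
qed simp

abbreviation std_normal_product :: "'i set \<Rightarrow> ('i \<Rightarrow> real) measure" where
  "std_normal_product I \<equiv> PiM I (\<lambda>_. std_normal_distribution)"

lemma product_prob_space_std_normal: "product_prob_space (\<lambda>_. std_normal_distribution)"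
  using prob_space_normal_density[of 1 0] by (intro product_prob_spaceI) simp

lemma prob_space_std_normal_product: "prob_space (std_normal_product I)"
  using prob_space_normal_density[of 1 0] by (intro prob_space_PiM) simp

lemma std_normal_product_char:
  assumes "finite I"
  shows "(\<integral>x. iexp (\<Sum>i\<in>I. t i * x i) \<partial>std_normal_product I) = exp (- ((\<Sum>i\<in>I. (t i)\<^sup>2) / 2))"
proof -
  interpret product_prob_space "\<lambda>_. std_normal_distribution" by (rule product_prob_space_std_normal)
  have "(\<integral>x. iexp (\<Sum>i\<in>I. t i * x i) \<partial>std_normal_product I) = (\<integral>x. (\<Prod>i\<in>I. iexp (t i * x i)) \<partial>std_normal_product I)"
    using assms by (simp add: exp_sum sum_distrib_left)
  also have "\<dots> = (\<Prod>i\<in>I. \<integral>y. iexp (t i * y) \<partial>std_normal_distribution)"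
    using assms by (intro product_integral_prod prob_space.integrable_bounded_by[OF prob_space_normal_density, of _ _ _ 1]) auto
  also have "\<dots> = (\<Prod>i\<in>I. complex_of_real (exp (- (t i)\<^sup>2 / 2)))"
    using char_std_normal_distribution unfolding char_def by meson
  also have "\<dots> = exp (- ((\<Sum>i\<in>I. (t i)\<^sup>2) / 2))"
  proof -
    have "(\<Prod>i\<in>I. exp (- (t i)\<^sup>2 / 2)) = exp (\<Sum>i\<in>I. - (t i)\<^sup>2 / 2)" using assms by (simp add: exp_sum)
    also have "\<dots> = exp (- ((\<Sum>i\<in>I. (t i)\<^sup>2) / 2))" by (simp add: sum_divide_distrib sum_negf)
    finally show ?thesis by (simp only: of_real_prod[symmetric])
  qed
  finally show ?thesis .
qed

lemma centred_normal_std_normal_product: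
  assumes "finite I"
  shows "centred_normal (std_normal_product I) (\<lambda>x. \<Sum>i\<in>I. t i * x i) (\<Sum>i\<in>I. (t i)\<^sup>2)"
proof (rule centred_normal_charI[OF prob_space_std_normal_product])
  show "(\<Sum>i\<in>I. (t i)\<^sup>2) \<ge> 0" by (rule sum_nonneg) simp
  show "(\<integral>x. iexp (\<theta> * (\<Sum>i\<in>I. t i * x i)) \<partial>std_normal_product I) = exp (- (\<theta>\<^sup>2 * (\<Sum>i\<in>I. (t i)\<^sup>2) / 2))" for \<theta>
    using std_normal_product_char[OF assms, of "\<lambda>i. \<theta> * t i"]
    unfolding sum_distrib_left power_mult_distrib by (simp only: mult.assoc)
qed measurable

lemma gaussian_space_std_normal_product:
  assumes "finite I"
  shows "gaussian_space (std_normal_product I) (range (\<lambda>t x. \<Sum>i\<in>I. t i * x i))"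
  unfolding gaussian_space_def
proof (intro conjI ballI allI)
  fix X assume "X \<in> range (\<lambda>(t :: 'a \<Rightarrow> real) x. \<Sum>i\<in>I. t i * x i)"
  then show "\<exists>v. centred_normal (std_normal_product I) X v"
    using centred_normal_std_normal_product[OF assms] by blast
next
  fix X Y and a b :: real
  assume "X \<in> range (\<lambda>(t :: 'a \<Rightarrow> real) x. \<Sum>i\<in>I. t i * x i)" "Y \<in> range (\<lambda>(t :: 'a \<Rightarrow> real) x. \<Sum>i\<in>I. t i * x i)"
  then obtain t s where "X = (\<lambda>x. \<Sum>i\<in>I. t i * x i)" "Y = (\<lambda>x. \<Sum>i\<in>I. s i * x i)" by blast
  then show "(\<lambda>x. a * X x + b * Y x) \<in> range (\<lambda>(t :: 'a \<Rightarrow> real) x. \<Sum>i\<in>I. t i * x i)"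
    by (intro range_eqI[of _ _ "\<lambda>i. a * t i + b * s i"])
       (simp add: sum_distrib_left sum.distrib[symmetric] algebra_simps)
qed auto

text \<open>Both sides have the same characteristic function once \<open>A\<close> is a Gram factor
  of the covariance matrix. This transports integration by parts from product measure to
  \<open>M\<close>, including degenerate vectors.\<close>

lemma gaussian_space_vector_law:
  fixes X :: "'i \<Rightarrow> 'a \<Rightarrow> real"
  assumes M: "prob_space M" and V: "gaussian_space M V" and I: "finite I" and X: "\<And>i. i \<in> I \<Longrightarrow> X i \<in> V"
  shows "\<exists>A. (\<forall>i\<in>I. \<forall>j\<in>I. (\<integral>\<omega>. X i \<omega> * X j \<omega> \<partial>M) = (\<Sum>m\<in>I. A i m * A j m)) \<and>
     distr M (PiM I (\<lambda>_. borel)) (\<lambda>\<omega>. \<lambda>i\<in>I. X i \<omega>) =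
     distr (std_normal_product I) (PiM I (\<lambda>_. borel)) (\<lambda>x. \<lambda>i\<in>I. \<Sum>m\<in>I. A i m * x m)"
proof -
  interpret prob_space M by fact
  interpret N: prob_space "std_normal_product I" by (rule prob_space_std_normal_product)
  note [measurable] = gaussian_space_measurable[OF V X]
  define S where "S i j = (\<integral>\<omega>. X i \<omega> * X j \<omega> \<partial>M)" for i j
  have quad: "(\<Sum>i\<in>K. \<Sum>j\<in>K. c i * c j * S i j) = (\<integral>\<omega>. (\<Sum>i\<in>K. c i * X i \<omega>)\<^sup>2 \<partial>M)" if "K \<subseteq> I" for c K
  proof -
    have "(\<integral>\<omega>. (\<Sum>i\<in>K. c i * X i \<omega>)\<^sup>2 \<partial>M) = (\<integral>\<omega>. (\<Sum>i\<in>K. \<Sum>j\<in>K. c i * c j * (X i \<omega> * X j \<omega>)) \<partial>M)"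
      by (intro Bochner_Integration.integral_cong refl) (simp add: power2_eq_square sum_product ac_simps)
    also have "\<dots> = (\<Sum>i\<in>K. \<Sum>j\<in>K. c i * c j * S i j)"
      using gaussian_space_mult_integrable[OF V X X] that by (simp add: S_def subset_eq)
    finally show ?thesis by simp
  qed
  have "\<exists>A. \<forall>i\<in>I. \<forall>j\<in>I. S i j = (\<Sum>m\<in>I. A i m * A j m)"
  proof (rule psd_gram[OF I])
    show "(\<Sum>i\<in>I. \<Sum>j\<in>I. c i * c j * S i j) \<ge> 0" for c unfolding quad[OF subset_refl] by simp
  qed (simp_all add: S_def mult.commute)
  then obtain A where A: "\<And>i j. i \<in> I \<Longrightarrow> j \<in> I \<Longrightarrow> S i j = (\<Sum>m\<in>I. A i m * A j m)" by blast
  have "distr M (PiM I (\<lambda>_. borel)) (\<lambda>\<omega>. \<lambda>i\<in>I. X i \<omega>) =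
     distr (std_normal_product I) (PiM I (\<lambda>_. borel)) (\<lambda>x. \<lambda>i\<in>I. \<Sum>m\<in>I. A i m * x m)"
  proof (rule measure_eqI_PiM_char[OF I])
    show "prob_space (distr M (PiM I (\<lambda>_. borel)) (\<lambda>\<omega>. \<lambda>i\<in>I. X i \<omega>))"
      by (rule prob_space_distr) simp
    show "prob_space (distr (std_normal_product I) (PiM I (\<lambda>_. borel)) (\<lambda>x. \<lambda>i\<in>I. \<Sum>m\<in>I. A i m * x m))"
      by (rule N.prob_space_distr) simp
    fix K :: "'i set" and t :: "'i \<Rightarrow> real" assume K: "K \<subseteq> I"
    then have fK: "finite K" using I by (rule finite_subset)
    have Km[measurable]: "(\<lambda>x. iexp (\<Sum>i\<in>K. t i * x i)) \<in> borel_measurable (PiM I (\<lambda>_. borel))"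
    proof -
      have [measurable]: "(\<lambda>x. \<Sum>i\<in>K. t i * x i) \<in> borel_measurable (PiM I (\<lambda>_. borel))"
        using K by (intro borel_measurable_sum borel_measurable_times) auto
      show ?thesis by measurable
    qed
    have sq: "(\<Sum>m\<in>I. (\<Sum>i\<in>K. t i * A i m)\<^sup>2) = (\<Sum>i\<in>K. \<Sum>j\<in>K. t i * t j * S i j)"
    proof -
      have "(\<Sum>m\<in>I. (\<Sum>i\<in>K. t i * A i m)\<^sup>2) = (\<Sum>m\<in>I. \<Sum>i\<in>K. \<Sum>j\<in>K. t i * t j * (A i m * A j m))"
        by (simp add: power2_eq_square sum_product ac_simps)
      also have "\<dots> = (\<Sum>i\<in>K. \<Sum>m\<in>I. \<Sum>j\<in>K. t i * t j * (A i m * A j m))"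
        by (rule sum.swap)
      also have "\<dots> = (\<Sum>i\<in>K. \<Sum>j\<in>K. \<Sum>m\<in>I. t i * t j * (A i m * A j m))"
        by (intro sum.cong refl sum.swap)
      also have "\<dots> = (\<Sum>i\<in>K. \<Sum>j\<in>K. t i * t j * S i j)"
        using K by (intro sum.cong refl) (auto simp: A sum_distrib_left[symmetric] subset_eq)
      finally show ?thesis .
    qed
    have "(\<lambda>\<omega>. \<Sum>i\<in>K. t i * X i \<omega>) \<in> V"
      using K by (intro gaussian_space_sum[OF V fK] X) auto
    from centred_normal_char[OF gaussian_space_normal[OF V this], of 1]
    have "(\<integral>\<omega>. iexp (\<Sum>i\<in>K. t i * X i \<omega>) \<partial>M) = exp (- ((\<Sum>i\<in>K. \<Sum>j\<in>K. t i * t j * S i j) / 2))"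
      using quad[OF K, of t] by simp
    also have "\<dots> = (\<integral>x. iexp (\<Sum>m\<in>I. (\<Sum>i\<in>K. t i * A i m) * x m) \<partial>std_normal_product I)"
      unfolding std_normal_product_char[OF I] sq ..
    also have "\<dots> = (\<integral>x. iexp (\<Sum>i\<in>K. t i * (\<Sum>m\<in>I. A i m * x m)) \<partial>std_normal_product I)"
      by (simp add: sum_distrib_left sum_distrib_right sum.swap[of _ I K] mult.assoc del: of_real_sum)
    finally show "(\<integral>x. iexp (\<Sum>i\<in>K. t i * x i) \<partial>distr M (PiM I (\<lambda>_. borel)) (\<lambda>\<omega>. \<lambda>i\<in>I. X i \<omega>)) =
       (\<integral>x. iexp (\<Sum>i\<in>K. t i * x i) \<partial>distr (std_normal_product I) (PiM I (\<lambda>_. borel)) (\<lambda>x. \<lambda>i\<in>I. \<Sum>m\<in>I. A i m * x m))"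
      using K by (simp add: integral_distr subset_eq cong: sum.cong del: of_real_sum)
  qed simp_all
  then show ?thesis using A by (auto simp: S_def)
qed

section \<open>Gaussian integration by parts\<close>

text \<open>A crude tail bound, good enough to make the density times a linear function vanish at
  infinity.\<close>

lemma std_normal_density_le: "y \<noteq> 0 \<Longrightarrow> std_normal_density y \<le> 2 / y\<^sup>2"
proof -
  assume y: "y \<noteq> 0"
  have "y\<^sup>2 / 2 \<le> exp (y\<^sup>2 / 2)" using exp_ge_add_one_self[of "y\<^sup>2 / 2"] by linarith
  then have "exp (- (y\<^sup>2 / 2)) \<le> 2 / y\<^sup>2"
    using y by (simp add: exp_minus field_simps)
  moreover have "std_normal_density y \<le> 1 * exp (- (y\<^sup>2 / 2))"
    unfolding std_normal_density_def using pi_gt3 by (intro mult_mono) (auto simp: field_simps real_le_rsqrt)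
  ultimately show ?thesis by linarith
qed

lemma integrable_std_normal_poly_bound:
  fixes f :: "real \<Rightarrow> 'b::{banach, second_countable_topology}"
  assumes [measurable]: "f \<in> borel_measurable borel" and "\<And>y. norm (f y) \<le> C * (1 + y\<^sup>2)"
  shows "integrable std_normal_distribution f"
proof (rule Bochner_Integration.integrable_bound)
  show "integrable std_normal_distribution (\<lambda>y. C * (1 + y\<^sup>2))"
    using integrable_std_normal_distribution_moment[of 2] prob_space_normal_density[of 1 0]
    by (auto intro!: integrable_add integrable_mult_right finite_measure.integrable_const prob_space.finite_measure)
  show "AE y in std_normal_distribution. norm (f y) \<le> norm (C * (1 + y\<^sup>2))"
    using assms(2) by (intro AE_I2) (smt (verit) real_norm_def)
qed simp

text \<open>Stein's identity E[y f(y)] = E[f'(y)] for f the product of a linear function and the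
  exponential of a quadratic polynomial. This is the shape that a quadratic functional of many
  normal variables takes when all but one of them are frozen.\<close>

lemma std_normal_ibp_quadratic:
  fixes \<alpha> \<beta> c0 c1 c2 :: real and e :: "real \<Rightarrow> complex"
  defines "e \<equiv> \<lambda>y :: real. iexp (c0 + c1 * y + c2 * y\<^sup>2)"
  shows "(\<integral>y. of_real (y * (\<alpha> + \<beta> * y)) * e y \<partial>std_normal_distribution) =
    (\<integral>y. (\<beta> + \<i> * (\<alpha> + \<beta> * y) * (c1 + 2 * c2 * y)) * e y \<partial>std_normal_distribution)"
proof -
  \<comment> \<open>The claim says that \<open>h\<close> has mean 0; this holds because
    \<open>F\<close> is a primitive of the density times \<open>h\<close> and vanishes at both
    ends.\<close>
  define h where "h y = (\<beta> + \<i> * (\<alpha> + \<beta> * y) * (c1 + 2 * c2 * y)) * e y - of_real (y * (\<alpha> + \<beta> * y)) * e y" for y :: real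
  define F where "F y = of_real (std_normal_density y) * (of_real (\<alpha> + \<beta> * y) * e y)" for y :: real
  have ne[simp]: "norm (e y) = 1" for y unfolding e_def by (rule norm_exp_i_times)
  have em[measurable]: "e \<in> borel_measurable borel" unfolding e_def by measurable
  have b1: "\<bar>y\<bar> \<le> 1 + y\<^sup>2" for y :: real using abs_mult_le_squares[of 1 y] by simp
  have lin: "\<bar>a + b * y\<bar> \<le> (\<bar>a\<bar> + \<bar>b\<bar>) * (1 + \<bar>y\<bar>)" for a b y :: real
  proof -
    have "\<bar>a + b * y\<bar> \<le> \<bar>a\<bar> + \<bar>b\<bar> * \<bar>y\<bar>" by (metis abs_mult abs_triangle_ineq)
    also have "\<dots> \<le> (\<bar>a\<bar> + \<bar>b\<bar>) * (1 + \<bar>y\<bar>)" by (simp add: algebra_simps)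
    finally show ?thesis .
  qed
  have sq: "(1 + \<bar>y\<bar>) * (1 + \<bar>y\<bar>) \<le> 3 * (1 + y\<^sup>2)" for y :: real
    using b1[of y] by (simp add: algebra_simps power2_eq_square flip: abs_mult)
  have bnd: "\<bar>a + b * y\<bar> * \<bar>c + d * y\<bar> \<le> (3 * (\<bar>a\<bar> + \<bar>b\<bar>) * (\<bar>c\<bar> + \<bar>d\<bar>)) * (1 + y\<^sup>2)" for a b c d y :: real
  proof -
    have "\<bar>a + b * y\<bar> * \<bar>c + d * y\<bar> \<le> ((\<bar>a\<bar> + \<bar>b\<bar>) * (1 + \<bar>y\<bar>)) * ((\<bar>c\<bar> + \<bar>d\<bar>) * (1 + \<bar>y\<bar>))"
      by (intro mult_mono lin) auto
    also have "\<dots> = (\<bar>a\<bar> + \<bar>b\<bar>) * (\<bar>c\<bar> + \<bar>d\<bar>) * ((1 + \<bar>y\<bar>) * (1 + \<bar>y\<bar>))" by (simp add: ac_simps)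
    also have "\<dots> \<le> (\<bar>a\<bar> + \<bar>b\<bar>) * (\<bar>c\<bar> + \<bar>d\<bar>) * (3 * (1 + y\<^sup>2))"
      by (rule mult_left_mono[OF sq]) simp
    finally show ?thesis by (simp add: algebra_simps)
  qed
  have i1: "integrable std_normal_distribution (\<lambda>y. of_real (y * (\<alpha> + \<beta> * y)) * e y)"
  proof (rule integrable_std_normal_poly_bound)
    show "norm (of_real (y * (\<alpha> + \<beta> * y)) * e y) \<le> (3 * (\<bar>0\<bar> + \<bar>1\<bar>) * (\<bar>\<alpha>\<bar> + \<bar>\<beta>\<bar>)) * (1 + y\<^sup>2)" for y
      using bnd[of 0 1 y \<alpha> \<beta>] by (simp add: norm_mult abs_mult flip: of_real_mult of_real_add)
  qed simp
  have i2: "integrable std_normal_distribution (\<lambda>y. (\<beta> + \<i> * (\<alpha> + \<beta> * y) * (c1 + 2 * c2 * y)) * e y)"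
  proof (rule integrable_std_normal_poly_bound)
    fix y :: real
    have "norm ((\<beta> + \<i> * (\<alpha> + \<beta> * y) * (c1 + 2 * c2 * y)) * e y) \<le> \<bar>\<beta>\<bar> + \<bar>\<alpha> + \<beta> * y\<bar> * \<bar>c1 + 2 * c2 * y\<bar>"
      unfolding norm_mult ne mult_1_right
      by (rule order_trans[OF norm_triangle_ineq]) (simp add: norm_mult flip: of_real_mult of_real_add)
    also have "\<dots> \<le> \<bar>\<beta>\<bar> * (1 + y\<^sup>2) + (3 * (\<bar>\<alpha>\<bar> + \<bar>\<beta>\<bar>) * (\<bar>c1\<bar> + \<bar>2 * c2\<bar>)) * (1 + y\<^sup>2)"
      by (intro add_mono bnd) (simp add: algebra_simps)
    finally show "norm ((\<beta> + \<i> * (\<alpha> + \<beta> * y) * (c1 + 2 * c2 * y)) * e y) \<le> (\<bar>\<beta>\<bar> + 3 * (\<bar>\<alpha>\<bar> + \<bar>\<beta>\<bar>) * (\<bar>c1\<bar> + \<bar>2 * c2\<bar>)) * (1 + y\<^sup>2)"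
      by (simp add: algebra_simps)
  qed simp
  have ih: "integrable std_normal_distribution h" unfolding h_def using i1 i2 by auto
  have hm[measurable]: "h \<in> borel_measurable borel" unfolding h_def by measurable
  have der: "(F has_vector_derivative std_normal_density y *\<^sub>R h y) (at y)" for y
  proof -
    have d1: "(std_normal_density has_real_derivative - y * std_normal_density y) (at y)"
    proof -
      have "((\<lambda>y. exp (- y\<^sup>2 / 2)) has_real_derivative exp (- y\<^sup>2 / 2) * (- y)) (at y)"
        by (auto intro!: derivative_eq_intros)
      from DERIV_cmult[OF this, of "1 / sqrt (2 * pi)"] show ?thesis
        unfolding std_normal_density_def by (simp add: mult_ac)
    qed
    have d2: "((\<lambda>y. c0 + c1 * y + c2 * y\<^sup>2) has_real_derivative c1 + 2 * c2 * y) (at y)"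
      by (auto intro!: derivative_eq_intros)
    have d3: "(e has_vector_derivative (c1 + 2 * c2 * y) *\<^sub>R (\<i> * e y)) (at y)"
      unfolding e_def
      using vector_diff_chain_at[OF d2[unfolded has_real_derivative_iff_has_vector_derivative] has_vector_derivative_iexp]
      by (simp add: o_def)
    have d4: "((\<lambda>y. \<alpha> + \<beta> * y) has_real_derivative \<beta>) (at y)"
      by (auto intro!: derivative_eq_intros)
    have "(F has_vector_derivative of_real (std_normal_density y) * (of_real (\<alpha> + \<beta> * y) * ((c1 + 2 * c2 * y) *\<^sub>R (\<i> * e y)) + of_real \<beta> * e y)
       + of_real (- y * std_normal_density y) * (of_real (\<alpha> + \<beta> * y) * e y)) (at y)"
      unfolding F_def
      by (intro has_vector_derivative_mult has_vector_derivative_of_real d1 d3 d4)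
    then show ?thesis
      unfolding h_def by (simp add: scaleR_conv_of_real algebra_simps)
  qed
  have Fle: "norm (F y) \<le> 2 * (\<bar>\<alpha>\<bar> + \<bar>\<beta>\<bar>) / \<bar>y\<bar> * 2" if "\<bar>y\<bar> \<ge> 1" for y
  proof -
    have "norm (F y) = std_normal_density y * \<bar>\<alpha> + \<beta> * y\<bar>"
      unfolding F_def norm_mult norm_of_real by simp
    also have "\<dots> \<le> 2 / y\<^sup>2 * ((\<bar>\<alpha>\<bar> + \<bar>\<beta>\<bar>) * (1 + \<bar>y\<bar>))"
      using that by (intro mult_mono lin std_normal_density_le) auto
    also have "\<dots> \<le> 2 / y\<^sup>2 * ((\<bar>\<alpha>\<bar> + \<bar>\<beta>\<bar>) * (2 * \<bar>y\<bar>))"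
      using that by (intro mult_left_mono) auto
    also have "\<dots> = 2 * (\<bar>\<alpha>\<bar> + \<bar>\<beta>\<bar>) / \<bar>y\<bar> * 2"
    proof -
      have "2 / t\<^sup>2 * (C * (2 * t)) = 2 * C / t * 2" if "t \<ge> 1" for t C :: real
        using that by (simp add: field_simps power2_eq_square)
      from this[OF that, of "\<bar>\<alpha>\<bar> + \<bar>\<beta>\<bar>"] show ?thesis by (simp only: power2_abs)
    qed
    finally show ?thesis .
  qed
  have lim: "((\<lambda>y. 2 * (\<bar>\<alpha>\<bar> + \<bar>\<beta>\<bar>) / \<bar>y\<bar> * 2) \<longlongrightarrow> 0) G" if "G \<le> at_infinity" for G :: "real filter"
  proof -
    have "filterlim (\<lambda>y::real. \<bar>y\<bar>) at_infinity G"
      using filterlim_mono[OF filterlim_norm_at_top[where 'a=real] order_refl that]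
      by (intro filterlim_at_top_imp_at_infinity) (simp add: real_norm_def[abs_def])
    from tendsto_mult_left_zero[OF tendsto_divide_0[OF tendsto_const this]] show ?thesis .
  qed
  have "(LBINT y=-\<infinity>..\<infinity>. std_normal_density y *\<^sub>R h y) = 0 - 0"
  proof (rule interval_integral_FTC_integrable[where F=F])
    show "((F \<circ> real_of_ereal) \<longlongrightarrow> 0) (at_right (-\<infinity>))"
      unfolding ereal_tendsto_simps
      by (rule Lim_null_comparison[OF _ lim[OF at_bot_le_at_infinity]]) (rule eventually_mono[OF eventually_le_at_bot[of "-1"]], rule Fle, simp)
    show "((F \<circ> real_of_ereal) \<longlongrightarrow> 0) (at_left \<infinity>)"
      unfolding ereal_tendsto_simps
      by (rule Lim_null_comparison[OF _ lim[OF at_top_le_at_infinity]]) (rule eventually_mono[OF eventually_ge_at_top[of 1]], rule Fle, simp)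
    show "isCont (\<lambda>y. std_normal_density y *\<^sub>R h y) y" for y
      unfolding h_def e_def std_normal_density_def by (intro continuous_intros) auto
    show "set_integrable lborel (einterval (-\<infinity>) \<infinity>) (\<lambda>y. std_normal_density y *\<^sub>R h y)"
      using ih by (simp add: set_integrable_def einterval_eq_UNIV integrable_density)
  qed (use der in auto)
  then have "(\<integral>y. h y \<partial>std_normal_distribution) = 0"
    by (simp add: interval_lebesgue_integral_def set_lebesgue_integral_def einterval_eq_UNIV integral_density)
  then show ?thesis unfolding h_def using i1 i2 by simp
qed

lemma coordinate_eq_sum:
  assumes "finite I" "j \<in> I"
  shows "(\<lambda>x. x j) = (\<lambda>x :: 'i \<Rightarrow> real. \<Sum>i\<in>I. (if i = j then 1 else 0) * x i)"
proof
  fix x :: "'i \<Rightarrow> real"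
  have "(\<Sum>i\<in>I. (if i = j then 1 else 0) * x i) = (\<Sum>i\<in>{j}. (if i = j then 1 else 0) * x i)"
    by (rule sum.mono_neutral_right) (use assms in auto)
  then show "x j = (\<Sum>i\<in>I. (if i = j then 1 else 0) * x i)" by simp
qed

text \<open>Along the coordinate \<open>j\<close> the exponent is a quadratic polynomial, so the
  one-dimensional identity holds for every choice of the other coordinates; Fubini then integrates
  it over them.\<close>

lemma std_normal_product_ibp:
  fixes a :: "'i \<Rightarrow> real" and d :: "'k \<Rightarrow> real" and A :: "'k \<Rightarrow> 'i \<Rightarrow> real"
    and e :: "('i \<Rightarrow> real) \<Rightarrow> complex"
  assumes I: "finite I" "j \<in> I" and K: "finite K"
  defines "X \<equiv> \<lambda>x. \<Sum>m\<in>I. a m * x m" and "L \<equiv> \<lambda>k x. \<Sum>m\<in>I. A k m * x m"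
  defines "e \<equiv> \<lambda>x. iexp (\<Sum>k\<in>K. d k * (L k x)\<^sup>2)"
  shows "(\<integral>x. x j * X x * e x \<partial>std_normal_product I) =
    (\<integral>x. (a j + \<i> * X x * (\<Sum>k\<in>K. 2 * d k * L k x * A k j)) * e x \<partial>std_normal_product I)"
proof -
  interpret P: product_prob_space "\<lambda>_. std_normal_distribution" by (rule product_prob_space_std_normal)
  interpret N: prob_space "std_normal_product I" by (rule prob_space_std_normal_product)
  define J where "J = I - {j}"
  have J: "finite J" "j \<notin> J" "I = insert j J" using I by (auto simp: J_def)
  let ?V = "range (\<lambda>t x. \<Sum>i\<in>I. t i * x i) :: (('i \<Rightarrow> real) \<Rightarrow> real) set"
  note V = gaussian_space_std_normal_product[OF I(1)]
  have inV: "X \<in> ?V" "L k \<in> ?V" "(\<lambda>x. x j) \<in> ?V" for k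
  proof -
    show "X \<in> ?V" "L k \<in> ?V" by (auto simp: X_def L_def)
    show "(\<lambda>x. x j) \<in> ?V" unfolding coordinate_eq_sum[OF I] by (rule rangeI)
  qed
  note [measurable] = gaussian_space_measurable[OF V inV(1)] gaussian_space_measurable[OF V inV(2)] gaussian_space_measurable[OF V inV(3)]
  have em[measurable]: "e \<in> borel_measurable (std_normal_product I)" unfolding e_def by measurable
  have ne[simp]: "norm (e x) = 1" for x unfolding e_def by (rule norm_exp_i_times)
  have int_e: "integrable (std_normal_product I) (\<lambda>x. complex_of_real (f x) * e x)"
    if "integrable (std_normal_product I) f" for f
    by (rule Bochner_Integration.integrable_bound[OF that])
       (use that in \<open>auto simp: norm_mult\<close>)
  have i1: "integrable (std_normal_product I) (\<lambda>x. x j * X x * e x)"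
    using int_e[OF gaussian_space_mult_integrable[OF V inV(3) inV(1)]] by simp
  have i2: "integrable (std_normal_product I) (\<lambda>x. (a j + \<i> * X x * (\<Sum>k\<in>K. 2 * d k * L k x * A k j)) * e x)"
  proof -
    have "integrable (std_normal_product I) (\<lambda>x. of_real (a j) * e x + \<i> * (\<Sum>k\<in>K. (2 * d k * A k j) * (of_real (X x * L k x) * e x)))"
      by (intro Bochner_Integration.integrable_add Bochner_Integration.integrable_sum
        Bochner_Integration.integrable_mult_right int_e gaussian_space_mult_integrable[OF V inV(1) inV(2)] finite_measure.integrable_const prob_space.finite_measure prob_space_std_normal_product)
    then show ?thesis by (simp add: sum_distrib_left sum_distrib_right algebra_simps)
  qed
  have "(\<integral>y. (x(j:=y)) j * X (x(j:=y)) * e (x(j:=y)) \<partial>std_normal_distribution) =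
     (\<integral>y. (a j + \<i> * X (x(j:=y)) * (\<Sum>k\<in>K. 2 * d k * L k (x(j:=y)) * A k j)) * e (x(j:=y)) \<partial>std_normal_distribution)" for x
  proof -
    have lin: "(\<Sum>m\<in>I. b m * (x(j:=y)) m) = (\<Sum>m\<in>J. b m * x m) + b j * y" for b y
    proof -
      have "(\<Sum>m\<in>J. b m * (x(j:=y)) m) = (\<Sum>m\<in>J. b m * x m)" by (rule sum.cong) (use J in auto)
      then show ?thesis using J by simp
    qed
    define \<alpha> where "\<alpha> = (\<Sum>m\<in>J. a m * x m)"
    define \<gamma> where "\<gamma> k = (\<Sum>m\<in>J. A k m * x m)" for k
    define c0 c1 c2 where "c0 = (\<Sum>k\<in>K. d k * (\<gamma> k)\<^sup>2)" "c1 = (\<Sum>k\<in>K. 2 * d k * \<gamma> k * A k j)" "c2 = (\<Sum>k\<in>K. d k * (A k j)\<^sup>2)"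
    have X: "X (x(j:=y)) = \<alpha> + a j * y" for y unfolding X_def lin \<alpha>_def ..
    have L: "L k (x(j:=y)) = \<gamma> k + A k j * y" for k y unfolding L_def lin \<gamma>_def ..
    have e: "e (x(j:=y)) = iexp (c0 + c1 * y + c2 * y\<^sup>2)" for y
    proof -
      have "(\<Sum>k\<in>K. d k * (L k (x(j:=y)))\<^sup>2) = c0 + c1 * y + c2 * y\<^sup>2"
        unfolding L c0_c1_c2_def sum_distrib_right sum.distrib[symmetric]
        by (rule sum.cong) (auto simp: power2_eq_square algebra_simps)
      then show ?thesis by (simp only: e_def)
    qed
    have s: "(\<Sum>k\<in>K. 2 * d k * L k (x(j:=y)) * A k j) = c1 + 2 * c2 * y" for y
      unfolding L c0_c1_c2_def sum_distrib_right sum_distrib_left sum.distrib[symmetric]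
      by (rule sum.cong) (auto simp: power2_eq_square algebra_simps)
    have s': "(\<Sum>k\<in>K. complex_of_real (2 * d k * L k (x(j:=y)) * A k j)) = c1 + 2 * c2 * y" for y
      using arg_cong[OF s[of y], of complex_of_real] by simp
    show ?thesis
      using std_normal_ibp_quadratic[of \<alpha> "a j" c0 c1 c2]
      by (simp only: fun_upd_same X e s of_real_mult of_real_add of_real_numeral)
  qed
  then show ?thesis
    using P.product_integral_insert[OF J(1,2) i1[unfolded J(3)]] P.product_integral_insert[OF J(1,2) i2[unfolded J(3)]]
    by (simp only: J(3)[symmetric])
qed

text \<open>One of the two factors \<open>X b\<close> is expanded in independent normals and each
  coordinate is integrated by parts. The sums of products of factor entries recombine into the
  covariances \<open>S b k\<close>.\<close>

lemma gaussian_square_ibp: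
  fixes X :: "'i \<Rightarrow> 'a \<Rightarrow> real" and d :: "'i \<Rightarrow> real" and e :: "'a \<Rightarrow> complex"
  assumes M: "prob_space M" and V: "gaussian_space M V" and I: "finite I" and X: "\<And>i. i \<in> I \<Longrightarrow> X i \<in> V"
    and b: "b \<in> I"
  defines "S \<equiv> \<lambda>i j. \<integral>\<omega>. X i \<omega> * X j \<omega> \<partial>M"
  defines "e \<equiv> \<lambda>\<omega>. iexp (\<Sum>k\<in>I. d k * (X k \<omega>)\<^sup>2)"
  shows "(\<integral>\<omega>. (X b \<omega>)\<^sup>2 * e \<omega> \<partial>M) =
    S b b * (\<integral>\<omega>. e \<omega> \<partial>M) + 2 * \<i> * (\<Sum>k\<in>I. d k * S b k * (\<integral>\<omega>. X b \<omega> * X k \<omega> * e \<omega> \<partial>M))"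
proof -
  interpret prob_space M by fact
  interpret N: prob_space "std_normal_product I" by (rule prob_space_std_normal_product)
  note [measurable] = gaussian_space_measurable[OF V X]
  obtain A where "\<forall>i\<in>I. \<forall>j\<in>I. (\<integral>\<omega>. X i \<omega> * X j \<omega> \<partial>M) = (\<Sum>m\<in>I. A i m * A j m)"
    and law: "distr M (PiM I (\<lambda>_. borel)) (\<lambda>\<omega>. \<lambda>i\<in>I. X i \<omega>) =
     distr (std_normal_product I) (PiM I (\<lambda>_. borel)) (\<lambda>x. \<lambda>i\<in>I. \<Sum>m\<in>I. A i m * x m)"
    using gaussian_space_vector_law[OF M V I, of X] X by blast
  then have A: "\<And>i j. i \<in> I \<Longrightarrow> j \<in> I \<Longrightarrow> S i j = (\<Sum>m\<in>I. A i m * A j m)"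
    by (simp add: S_def)
  define L where "L k x = (\<Sum>m\<in>I. A k m * x m)" for k x
  define E where "E z = iexp (\<Sum>k\<in>I. d k * (z k)\<^sup>2)" for z :: "'i \<Rightarrow> real"
  define e' where "e' x = iexp (\<Sum>k\<in>I. d k * (L k x)\<^sup>2)" for x
  have Em[measurable]: "E \<in> borel_measurable (PiM I (\<lambda>_. borel))"
  proof -
    have [measurable]: "(\<lambda>z :: 'i \<Rightarrow> real. \<Sum>k\<in>I. d k * (z k)\<^sup>2) \<in> borel_measurable (PiM I (\<lambda>_. borel))"
      by (intro borel_measurable_sum borel_measurable_times borel_measurable_power) auto
    show ?thesis unfolding E_def by measurable
  qed
  have e_eq: "E (\<lambda>i\<in>I. X i \<omega>) = e \<omega>" "E (\<lambda>i\<in>I. L i x) = e' x" for \<omega> x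
    unfolding E_def e_def e'_def by simp_all
  have transfer: "(\<integral>\<omega>. g (\<lambda>i\<in>I. X i \<omega>) \<partial>M) = (\<integral>x. g (\<lambda>i\<in>I. L i x) \<partial>std_normal_product I)"
    if [measurable]: "g \<in> borel_measurable (PiM I (\<lambda>_. borel))" for g :: "('i \<Rightarrow> real) \<Rightarrow> complex"
  proof -
    have "(\<integral>\<omega>. g (\<lambda>i\<in>I. X i \<omega>) \<partial>M) = (\<integral>z. g z \<partial>distr M (PiM I (\<lambda>_. borel)) (\<lambda>\<omega>. \<lambda>i\<in>I. X i \<omega>))"
      by (subst integral_distr) auto
    also have "\<dots> = (\<integral>x. g (\<lambda>i\<in>I. L i x) \<partial>std_normal_product I)"
      unfolding law L_def by (subst integral_distr) auto
    finally show ?thesis .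
  qed
  have t1: "(\<integral>\<omega>. (X b \<omega>)\<^sup>2 * e \<omega> \<partial>M) = (\<integral>x. (L b x)\<^sup>2 * e' x \<partial>std_normal_product I)"
    using transfer[of "\<lambda>z. (z b)\<^sup>2 * E z"] b by (simp add: e_eq)
  have t2: "(\<integral>\<omega>. e \<omega> \<partial>M) = (\<integral>x. e' x \<partial>std_normal_product I)"
    using transfer[of E] by (simp add: e_eq)
  have t3: "(\<integral>\<omega>. X b \<omega> * X k \<omega> * e \<omega> \<partial>M) = (\<integral>x. L b x * L k x * e' x \<partial>std_normal_product I)" if "k \<in> I" for k
    using transfer[of "\<lambda>z. z b * z k * E z"] b that by (simp add: e_eq)
  let ?N = "std_normal_product I"
  let ?V = "range (\<lambda>t x. \<Sum>i\<in>I. t i * x i) :: (('i \<Rightarrow> real) \<Rightarrow> real) set"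
  note W = gaussian_space_std_normal_product[OF I]
  have inV: "L k \<in> ?V" "j \<in> I \<Longrightarrow> (\<lambda>x. x j) \<in> ?V" for k j
  proof -
    show "L k \<in> ?V" by (auto simp: L_def[abs_def])
    assume "j \<in> I"
    then show "(\<lambda>x. x j) \<in> ?V" unfolding coordinate_eq_sum[OF I \<open>j \<in> I\<close>] by (intro rangeI)
  qed
  note [measurable] = gaussian_space_measurable[OF W inV(1)] gaussian_space_measurable[OF W inV(2)]
  have em[measurable]: "e' \<in> borel_measurable ?N" unfolding e'_def by measurable
  have ne[simp]: "norm (e' x) = 1" for x unfolding e'_def by (rule norm_exp_i_times)
  have int_e: "integrable ?N (\<lambda>x. complex_of_real (f x) * e' x)" if "integrable ?N f" for f
    by (rule Bochner_Integration.integrable_bound[OF that]) (use that in \<open>auto simp: norm_mult\<close>)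
  have int_jb: "integrable ?N (\<lambda>x. x j * L b x * e' x)" if "j \<in> I" for j
    using int_e[OF gaussian_space_mult_integrable[OF W inV(2)[OF that] inV(1)]] by simp
  have int_bk: "integrable ?N (\<lambda>x. L b x * L k x * e' x)" for k
    using int_e[OF gaussian_space_mult_integrable[OF W inV(1) inV(1)]] by simp
  have int_1: "integrable ?N e'" using int_e[of "\<lambda>_. 1"] by simp
  have "(\<integral>x. (L b x)\<^sup>2 * e' x \<partial>?N) = (\<integral>x. (\<Sum>j\<in>I. A b j * (x j * L b x * e' x)) \<partial>?N)"
  proof (intro Bochner_Integration.integral_cong refl)
    fix x
    have "(\<Sum>j\<in>I. A b j * (x j * L b x * e' x)) = of_real (\<Sum>j\<in>I. A b j * x j) * (L b x * e' x)"
      by (simp add: sum_distrib_left sum_distrib_right ac_simps)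
    then show "(L b x)\<^sup>2 * e' x = (\<Sum>j\<in>I. A b j * (x j * L b x * e' x))"
      by (simp add: L_def power2_eq_square del: of_real_sum)
  qed
  also have "\<dots> = (\<Sum>j\<in>I. A b j * (\<integral>x. x j * L b x * e' x \<partial>?N))"
    using int_jb by (subst Bochner_Integration.integral_sum) auto
  also have "\<dots> = (\<Sum>j\<in>I. A b j * (\<integral>x. A b j * e' x + 2 * \<i> * (\<Sum>k\<in>I. d k * A k j * (L b x * L k x * e' x)) \<partial>?N))"
  proof (rule sum.cong[OF refl])
    fix j assume "j \<in> I"
    from std_normal_product_ibp[OF I this I, of "A b" d A]
    have "(\<integral>x. x j * L b x * e' x \<partial>?N) = (\<integral>x. (A b j + \<i> * L b x * (\<Sum>k\<in>I. 2 * d k * L k x * A k j)) * e' x \<partial>?N)"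
      unfolding L_def e'_def .
    also have "\<dots> = (\<integral>x. A b j * e' x + 2 * \<i> * (\<Sum>k\<in>I. d k * A k j * (L b x * L k x * e' x)) \<partial>?N)"
      by (intro Bochner_Integration.integral_cong refl)
         (simp add: sum_distrib_left sum_distrib_right algebra_simps)
    finally show "A b j * (\<integral>x. x j * L b x * e' x \<partial>?N) = A b j * (\<integral>x. A b j * e' x + 2 * \<i> * (\<Sum>k\<in>I. d k * A k j * (L b x * L k x * e' x)) \<partial>?N)"
      by simp
  qed
  also have "\<dots> = (\<Sum>j\<in>I. A b j * (A b j * (\<integral>x. e' x \<partial>?N) + 2 * \<i> * (\<Sum>k\<in>I. d k * A k j * (\<integral>x. L b x * L k x * e' x \<partial>?N))))"
  proof (rule sum.cong[OF refl])
    fix j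
    have "(\<integral>x. (\<Sum>k\<in>I. d k * A k j * (L b x * L k x * e' x)) \<partial>?N) = (\<Sum>k\<in>I. d k * A k j * (\<integral>x. L b x * L k x * e' x \<partial>?N))"
      using int_bk by (subst Bochner_Integration.integral_sum) auto
    moreover have "integrable ?N (\<lambda>x. \<Sum>k\<in>I. d k * A k j * (L b x * L k x * e' x))"
      using int_bk by (intro Bochner_Integration.integrable_sum integrable_mult_right) auto
    ultimately show "A b j * (\<integral>x. A b j * e' x + 2 * \<i> * (\<Sum>k\<in>I. d k * A k j * (L b x * L k x * e' x)) \<partial>?N)
       = A b j * (A b j * (\<integral>x. e' x \<partial>?N) + 2 * \<i> * (\<Sum>k\<in>I. d k * A k j * (\<integral>x. L b x * L k x * e' x \<partial>?N)))"
      using int_1 by (subst Bochner_Integration.integral_add) auto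
  qed
  also have "\<dots> = (\<Sum>j\<in>I. A b j * A b j) * (\<integral>x. e' x \<partial>?N) + 2 * \<i> * (\<Sum>k\<in>I. d k * (\<Sum>j\<in>I. A b j * A k j) * (\<integral>x. L b x * L k x * e' x \<partial>?N))"
  proof -
    define R where "R k = (\<integral>x. L b x * L k x * e' x \<partial>?N)" for k
    show ?thesis
      unfolding R_def[symmetric]
      by (simp add: distrib_left sum.distrib sum_distrib_left sum_distrib_right ac_simps) (rule sum.swap)
  qed
  also have "\<dots> = S b b * (\<integral>x. e' x \<partial>?N) + 2 * \<i> * (\<Sum>k\<in>I. d k * S b k * (\<integral>x. L b x * L k x * e' x \<partial>?N))"
    using A b by (simp cong: sum.cong)
  finally show ?thesis unfolding t1 t2 using t3 by (simp cong: sum.cong)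
qed

section \<open>Quadratic functionals of Gaussian vectors\<close>

text \<open>The second moment alone suffices: iexp h differs from 1 + i h by at most h^2 / 2, so the
  remainder is quadratic in the increment of \<theta>.\<close>

lemma char_has_vector_derivative:
  assumes M: "prob_space M" and [measurable]: "Y \<in> borel_measurable M" and Y2: "integrable M (\<lambda>\<omega>. (Y \<omega>)\<^sup>2)"
  shows "((\<lambda>\<theta>. \<integral>\<omega>. iexp (\<theta> * Y \<omega>) \<partial>M) has_vector_derivative (\<integral>\<omega>. \<i> * Y \<omega> * iexp (\<theta> * Y \<omega>) \<partial>M)) (at \<theta>)"
proof -
  interpret prob_space M by fact
  define \<phi> where "\<phi> \<theta> = (\<integral>\<omega>. iexp (\<theta> * Y \<omega>) \<partial>M)" for \<theta>
  define D where "D = (\<integral>\<omega>. \<i> * Y \<omega> * iexp (\<theta> * Y \<omega>) \<partial>M)"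
  define C where "C = (\<integral>\<omega>. (Y \<omega>)\<^sup>2 \<partial>M)"
  have iY: "integrable M Y" by (rule square_integrable_imp_integrable) (use Y2 in auto)
  have ie: "integrable M (\<lambda>\<omega>. iexp (\<eta> * Y \<omega>))" for \<eta> by (rule integrable_bounded_by[of _ 1]) auto
  have iD: "integrable M (\<lambda>\<omega>. \<i> * Y \<omega> * iexp (\<theta> * Y \<omega>))"
    by (rule Bochner_Integration.integrable_bound[OF iY]) (auto simp: norm_mult)
  have bnd: "norm (\<phi> \<eta> - \<phi> \<theta> - (\<eta> - \<theta>) *\<^sub>R D) \<le> C * \<bar>\<eta> - \<theta>\<bar>\<^sup>2" for \<eta>
  proof -
    have "\<phi> \<eta> - \<phi> \<theta> - (\<eta> - \<theta>) *\<^sub>R D = (\<integral>\<omega>. iexp (\<eta> * Y \<omega>) - iexp (\<theta> * Y \<omega>) - (\<eta> - \<theta>) *\<^sub>R (\<i> * Y \<omega> * iexp (\<theta> * Y \<omega>)) \<partial>M)"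
      unfolding \<phi>_def D_def using ie iD by simp
    also have "norm \<dots> \<le> (\<integral>\<omega>. (Y \<omega>)\<^sup>2 * \<bar>\<eta> - \<theta>\<bar>\<^sup>2 \<partial>M)"
    proof (rule order_trans[OF Bochner_Integration.integral_norm_bound Bochner_Integration.integral_mono])
      fix \<omega>
      define h where "h = (\<eta> - \<theta>) * Y \<omega>"
      have "iexp (\<eta> * Y \<omega>) - iexp (\<theta> * Y \<omega>) - (\<eta> - \<theta>) *\<^sub>R (\<i> * Y \<omega> * iexp (\<theta> * Y \<omega>)) =
         iexp (\<theta> * Y \<omega>) * (iexp h - (1 + \<i> * h))"
      proof -
        have "iexp (\<eta> * Y \<omega>) = iexp (\<theta> * Y \<omega>) * iexp h"
          unfolding h_def exp_add[symmetric] by (simp add: algebra_simps)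
        then show ?thesis by (simp add: h_def scaleR_conv_of_real algebra_simps)
      qed
      also have "norm \<dots> = norm (iexp h - (\<Sum>k\<le>1. (\<i> * h) ^ k / fact k))"
        by (simp add: norm_mult)
      also have "\<dots> \<le> \<bar>h\<bar> ^ 2 / 2"
        using iexp_approx1[of h 1] by (simp add: numeral_2_eq_2)
      also have "\<dots> \<le> (Y \<omega>)\<^sup>2 * \<bar>\<eta> - \<theta>\<bar>\<^sup>2"
        by (simp add: h_def abs_mult power_mult_distrib)
      finally show "norm (iexp (\<eta> * Y \<omega>) - iexp (\<theta> * Y \<omega>) - (\<eta> - \<theta>) *\<^sub>R (\<i> * Y \<omega> * iexp (\<theta> * Y \<omega>))) \<le> (Y \<omega>)\<^sup>2 * \<bar>\<eta> - \<theta>\<bar>\<^sup>2" .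
    qed (use Y2 ie iD in auto)
    finally show ?thesis by (simp add: C_def)
  qed
  have "((\<lambda>\<eta>. norm (\<phi> \<eta> - \<phi> \<theta> - (\<eta> - \<theta>) *\<^sub>R D) / norm (\<eta> - \<theta>)) \<longlongrightarrow> 0) (at \<theta>)"
  proof (rule Lim_null_comparison)
    show "\<forall>\<^sub>F \<eta> in at \<theta>. norm (norm (\<phi> \<eta> - \<phi> \<theta> - (\<eta> - \<theta>) *\<^sub>R D) / norm (\<eta> - \<theta>)) \<le> C * \<bar>\<eta> - \<theta>\<bar>"
    proof (rule eventually_mono[OF eventually_neq_at_within[of \<theta>]])
      fix \<eta> assume "\<eta> \<noteq> \<theta>"
      then show "norm (norm (\<phi> \<eta> - \<phi> \<theta> - (\<eta> - \<theta>) *\<^sub>R D) / norm (\<eta> - \<theta>)) \<le> C * \<bar>\<eta> - \<theta>\<bar>"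
        using bnd[of \<eta>] by (simp add: divide_le_eq power2_eq_square mult.assoc)
    qed
    have "((\<lambda>\<eta>. C * \<bar>\<eta> - \<theta>\<bar>) \<longlongrightarrow> C * \<bar>\<theta> - \<theta>\<bar>) (at \<theta>)" by (intro tendsto_intros)
    then show "((\<lambda>\<eta>. C * \<bar>\<eta> - \<theta>\<bar>) \<longlongrightarrow> 0) (at \<theta>)" by simp
  qed
  then have "(\<phi> has_vector_derivative D) (at \<theta>)"
    unfolding has_vector_derivative_def has_derivative_iff_norm
    by (simp add: bounded_linear_scaleR_left)
  then show ?thesis unfolding \<phi>_def D_def .
qed

text \<open>Centring cancels the first of the three pairings in Isserlis' formula.\<close>

lemma gaussian_space_centred_products:
  assumes M: "prob_space M" and V: "gaussian_space M V" and XY: "X \<in> V" "Y \<in> V" "Z \<in> V" "T \<in> V"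
  defines "E \<equiv> \<lambda>f. \<integral>\<omega>. f \<omega> \<partial>M"
  shows "integrable M (\<lambda>\<omega>. (X \<omega> * Y \<omega> - E (\<lambda>\<omega>. X \<omega> * Y \<omega>)) * (Z \<omega> * T \<omega> - E (\<lambda>\<omega>. Z \<omega> * T \<omega>)))"
    and "(\<integral>\<omega>. (X \<omega> * Y \<omega> - E (\<lambda>\<omega>. X \<omega> * Y \<omega>)) * (Z \<omega> * T \<omega> - E (\<lambda>\<omega>. Z \<omega> * T \<omega>)) \<partial>M) =
      E (\<lambda>\<omega>. X \<omega> * Z \<omega>) * E (\<lambda>\<omega>. Y \<omega> * T \<omega>) + E (\<lambda>\<omega>. X \<omega> * T \<omega>) * E (\<lambda>\<omega>. Y \<omega> * Z \<omega>)"
proof -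
  interpret prob_space M by fact
  define a b where "a = E (\<lambda>\<omega>. X \<omega> * Y \<omega>)" "b = E (\<lambda>\<omega>. Z \<omega> * T \<omega>)"
  have eq: "(X \<omega> * Y \<omega> - a) * (Z \<omega> * T \<omega> - b) =
     X \<omega> * Y \<omega> * (Z \<omega> * T \<omega>) - b * (X \<omega> * Y \<omega>) - a * (Z \<omega> * T \<omega>) + a * b" for \<omega>
    by (simp add: algebra_simps)
  have i: "integrable M (\<lambda>\<omega>. X \<omega> * Y \<omega> * (Z \<omega> * T \<omega>))" "integrable M (\<lambda>\<omega>. X \<omega> * Y \<omega>)" "integrable M (\<lambda>\<omega>. Z \<omega> * T \<omega>)"
    using gaussian_space_mult4_integrable[OF V XY] gaussian_space_mult_integrable[OF V] XY by auto
  show "integrable M (\<lambda>\<omega>. (X \<omega> * Y \<omega> - E (\<lambda>\<omega>. X \<omega> * Y \<omega>)) * (Z \<omega> * T \<omega> - E (\<lambda>\<omega>. Z \<omega> * T \<omega>)))"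
    unfolding a_b_def[symmetric] eq using i by auto
  show "(\<integral>\<omega>. (X \<omega> * Y \<omega> - E (\<lambda>\<omega>. X \<omega> * Y \<omega>)) * (Z \<omega> * T \<omega> - E (\<lambda>\<omega>. Z \<omega> * T \<omega>)) \<partial>M) =
      E (\<lambda>\<omega>. X \<omega> * Z \<omega>) * E (\<lambda>\<omega>. Y \<omega> * T \<omega>) + E (\<lambda>\<omega>. X \<omega> * T \<omega>) * E (\<lambda>\<omega>. Y \<omega> * Z \<omega>)"
    unfolding a_b_def[symmetric] eq using i gaussian_space_isserlis[OF V XY]
    by (simp add: prob_space) (simp add: a_b_def E_def algebra_simps)
qed

lemma sum_square_integral:
  fixes Y :: "'i \<Rightarrow> 'a \<Rightarrow> real"
  assumes "\<And>p q. p \<in> P \<Longrightarrow> q \<in> P \<Longrightarrow> integrable M (\<lambda>\<omega>. Y p \<omega> * Y q \<omega>)"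
  shows "integrable M (\<lambda>\<omega>. (\<Sum>p\<in>P. c p * Y p \<omega>)\<^sup>2)"
    and "(\<integral>\<omega>. (\<Sum>p\<in>P. c p * Y p \<omega>)\<^sup>2 \<partial>M) = (\<Sum>p\<in>P. \<Sum>q\<in>P. c p * c q * (\<integral>\<omega>. Y p \<omega> * Y q \<omega> \<partial>M))"
proof -
  have eq: "(\<Sum>p\<in>P. c p * Y p \<omega>)\<^sup>2 = (\<Sum>p\<in>P. \<Sum>q\<in>P. c p * c q * (Y p \<omega> * Y q \<omega>))" for \<omega>
    by (simp add: power2_eq_square sum_product ac_simps)
  show "integrable M (\<lambda>\<omega>. (\<Sum>p\<in>P. c p * Y p \<omega>)\<^sup>2)"
    unfolding eq using assms by auto
  show "(\<integral>\<omega>. (\<Sum>p\<in>P. c p * Y p \<omega>)\<^sup>2 \<partial>M) = (\<Sum>p\<in>P. \<Sum>q\<in>P. c p * c q * (\<integral>\<omega>. Y p \<omega> * Y q \<omega> \<partial>M))"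
    unfolding eq using assms by simp
qed

text \<open>With D the diagonal matrix of \<open>d\<close>, both pairings produce tr((D S)^4); the
  second becomes the first when \<open>e\<close> and \<open>f\<close> are exchanged.\<close>

lemma four_sum_trace:
  fixes S :: "'i \<Rightarrow> 'i \<Rightarrow> real"
  assumes sym: "\<And>a b. S a b = S b a"
  shows "(\<Sum>b\<in>I. \<Sum>k\<in>I. \<Sum>e\<in>I. \<Sum>f\<in>I. (d b * d k * S b k) * (d e * d f * S e f) * (S b e * S k f + S b f * S k e))
    = 2 * (\<Sum>k\<in>I. \<Sum>e\<in>I. d k * d e * (\<Sum>a\<in>I. d a * S k a * S a e)\<^sup>2)"
proof -
  define g where "g b k e f = (d b * d k * S b k) * (d e * d f * S e f) * (S b e * S k f)" for b k e f
  have "(d b * d k * S b k) * (d e * d f * S e f) * (S b e * S k f + S b f * S k e) = g b k e f + g b k f e" for b k e f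
    unfolding g_def using sym[of e f] by (simp add: algebra_simps)
  then have "(\<Sum>b\<in>I. \<Sum>k\<in>I. \<Sum>e\<in>I. \<Sum>f\<in>I. (d b * d k * S b k) * (d e * d f * S e f) * (S b e * S k f + S b f * S k e)) =
     (\<Sum>b\<in>I. \<Sum>k\<in>I. \<Sum>e\<in>I. \<Sum>f\<in>I. g b k e f) + (\<Sum>b\<in>I. \<Sum>k\<in>I. \<Sum>e\<in>I. \<Sum>f\<in>I. g b k f e)"
    by (simp add: sum.distrib)
  also have "(\<Sum>b\<in>I. \<Sum>k\<in>I. \<Sum>e\<in>I. \<Sum>f\<in>I. g b k f e) = (\<Sum>b\<in>I. \<Sum>k\<in>I. \<Sum>e\<in>I. \<Sum>f\<in>I. g b k e f)"
    by (rule sum.cong[OF refl], rule sum.cong[OF refl], rule sum.swap)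
  also have "(\<Sum>b\<in>I. \<Sum>k\<in>I. \<Sum>e\<in>I. \<Sum>f\<in>I. g b k e f) = (\<Sum>k\<in>I. \<Sum>b\<in>I. \<Sum>e\<in>I. \<Sum>f\<in>I. g b k e f)"
    by (rule sum.swap)
  also have "\<dots> = (\<Sum>k\<in>I. \<Sum>e\<in>I. \<Sum>b\<in>I. \<Sum>f\<in>I. g b k e f)"
    by (rule sum.cong[OF refl], rule sum.swap)
  also have "\<dots> = (\<Sum>k\<in>I. \<Sum>e\<in>I. d k * d e * (\<Sum>a\<in>I. d a * S k a * S a e)\<^sup>2)"
  proof (intro sum.cong refl)
    fix k e
    have "g b k e f = d k * d e * ((d b * S k b * S b e) * (d f * S k f * S f e))" for b f
      unfolding g_def using sym[of k b] sym[of e f] by (simp add: ac_simps)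
    moreover have "(\<Sum>a\<in>I. d a * S k a * S a e)\<^sup>2 = (\<Sum>b\<in>I. \<Sum>f\<in>I. (d b * S k b * S b e) * (d f * S k f * S f e))"
      by (simp only: power2_eq_square sum_product)
    ultimately show "(\<Sum>b\<in>I. \<Sum>f\<in>I. g b k e f) = d k * d e * (\<Sum>a\<in>I. d a * S k a * S a e)\<^sup>2"
      by (simp only: sum_distrib_left)
  qed
  finally show ?thesis by simp
qed

text \<open>Integration by parts turns the derivative of the characteristic function of a centred
  quadratic form into \<open>- 2 * \<theta>\<close> times the expectation of \<open>iexp (\<theta> * F \<omega>)\<close> against another
  quadratic form. Replacing the latter by its mean \<open>v / 2\<close> gives the differential equation of the
  normal characteristic function; the error is controlled by its standard deviation.\<close>

lemma gaussian_quadratic_char: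
  fixes X :: "'i \<Rightarrow> 'a \<Rightarrow> real" and d :: "'i \<Rightarrow> real"
  assumes M: "prob_space M" and V: "gaussian_space M V" and I: "finite I" and X: "\<And>i. i \<in> I \<Longrightarrow> X i \<in> V"
    and S: "\<And>i j. i \<in> I \<Longrightarrow> j \<in> I \<Longrightarrow> (\<integral>\<omega>. X i \<omega> * X j \<omega> \<partial>M) = S i j" and sym: "\<And>i j. S i j = S j i"
  defines "F \<equiv> \<lambda>\<omega>. \<Sum>b\<in>I. d b * ((X b \<omega>)\<^sup>2 - S b b)"
    and "v \<equiv> 2 * (\<Sum>b\<in>I. \<Sum>k\<in>I. d b * d k * (S b k)\<^sup>2)"
    and "w \<equiv> 2 * (\<Sum>b\<in>I. \<Sum>k\<in>I. d b * d k * (\<Sum>a\<in>I. d a * S b a * S a k)\<^sup>2)"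
  shows "integrable M (\<lambda>\<omega>. (F \<omega>)\<^sup>2)" "(\<integral>\<omega>. (F \<omega>)\<^sup>2 \<partial>M) = v"
    and "cmod ((\<integral>\<omega>. iexp (\<theta> * F \<omega>) \<partial>M) - exp (- (\<theta>\<^sup>2 * v / 2))) \<le> 2 * \<theta>\<^sup>2 * sqrt w"
proof -
  interpret prob_space M by fact
  note Xm[measurable] = gaussian_space_measurable[OF V X]
  define Y where "Y p \<omega> = X (fst p) \<omega> * X (snd p) \<omega> - S (fst p) (snd p)" for p \<omega>
  have Yi: "integrable M (\<lambda>\<omega>. Y p \<omega> * Y q \<omega>)" and
    Ye: "(\<integral>\<omega>. Y p \<omega> * Y q \<omega> \<partial>M) = S (fst p) (fst q) * S (snd p) (snd q) + S (fst p) (snd q) * S (snd p) (fst q)"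
    if "p \<in> I \<times> I" "q \<in> I \<times> I" for p q
  proof -
    have pq: "fst p \<in> I" "snd p \<in> I" "fst q \<in> I" "snd q \<in> I" using that by auto
    show "integrable M (\<lambda>\<omega>. Y p \<omega> * Y q \<omega>)"
      using gaussian_space_centred_products(1)[OF M V X X X X, OF pq] pq by (simp add: Y_def S)
    show "(\<integral>\<omega>. Y p \<omega> * Y q \<omega> \<partial>M) = S (fst p) (fst q) * S (snd p) (snd q) + S (fst p) (snd q) * S (snd p) (fst q)"
      using gaussian_space_centred_products(2)[OF M V X X X X, OF pq] pq by (simp add: Y_def S)
  qed
  have F: "F \<omega> = (\<Sum>b\<in>I. d b * Y (b, b) \<omega>)" for \<omega>
    unfolding F_def Y_def by (simp add: power2_eq_square)
  have Fi: "integrable M (\<lambda>\<omega>. (F \<omega>)\<^sup>2)"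
    unfolding F by (rule sum_square_integral(1)) (use Yi in auto)
  then show "integrable M (\<lambda>\<omega>. (F \<omega>)\<^sup>2)" .
  have "(\<integral>\<omega>. (F \<omega>)\<^sup>2 \<partial>M) = (\<Sum>b\<in>I. \<Sum>k\<in>I. d b * d k * (\<integral>\<omega>. Y (b, b) \<omega> * Y (k, k) \<omega> \<partial>M))"
    unfolding F by (rule sum_square_integral(2)) (use Yi in auto)
  also have "\<dots> = (\<Sum>b\<in>I. \<Sum>k\<in>I. 2 * (d b * d k * (S b k)\<^sup>2))"
    by (intro sum.cong refl) (simp add: Ye power2_eq_square)
  finally show EF: "(\<integral>\<omega>. (F \<omega>)\<^sup>2 \<partial>M) = v" by (simp add: v_def sum_distrib_left)
  have v0: "v \<ge> 0" unfolding EF[symmetric] by simp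
  \<comment> \<open>The second quadratic form, with its mean \<open>v / 2\<close> already
    subtracted.\<close>
  define G where "G \<omega> = (\<Sum>p\<in>I\<times>I. (d (fst p) * d (snd p) * S (fst p) (snd p)) * Y p \<omega>)" for \<omega>
  have Gi: "integrable M (\<lambda>\<omega>. (G \<omega>)\<^sup>2)"
    unfolding G_def by (rule sum_square_integral(1)) (use Yi in auto)
  have "(\<integral>\<omega>. (G \<omega>)\<^sup>2 \<partial>M) = (\<Sum>p\<in>I\<times>I. \<Sum>q\<in>I\<times>I. (d (fst p) * d (snd p) * S (fst p) (snd p)) * (d (fst q) * d (snd q) * S (fst q) (snd q))
     * (S (fst p) (fst q) * S (snd p) (snd q) + S (fst p) (snd q) * S (snd p) (fst q)))"
    unfolding G_def by (subst sum_square_integral(2)) (use Yi Ye in \<open>auto intro!: sum.cong\<close>)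
  also have "\<dots> = w"
    unfolding w_def four_sum_trace[OF sym, where d=d and I=I, symmetric] by (simp add: sum.cartesian_product' split_beta)
  finally have EG: "(\<integral>\<omega>. (G \<omega>)\<^sup>2 \<partial>M) = w" .
  have Ym: "Y p \<in> borel_measurable M" if "p \<in> I \<times> I" for p
    using that Xm unfolding Y_def by (auto intro!: borel_measurable_diff borel_measurable_times)
  have [measurable]: "F \<in> borel_measurable M" "G \<in> borel_measurable M"
    unfolding F G_def using Ym by (auto intro!: borel_measurable_sum borel_measurable_times)
  have G1: "integrable M G" by (rule square_integrable_imp_integrable) (use Gi in auto)
  have F1: "integrable M F" by (rule square_integrable_imp_integrable) (use Fi in auto)
  have absG: "(\<integral>\<omega>. \<bar>G \<omega>\<bar> \<partial>M) \<le> sqrt w"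
  proof (rule real_le_rsqrt)
    have "(\<integral>\<omega>. \<bar>G \<omega>\<bar> \<partial>M)\<^sup>2 \<le> (\<integral>\<omega>. \<bar>G \<omega>\<bar>\<^sup>2 \<partial>M)"
      using variance_positive[of "\<lambda>\<omega>. \<bar>G \<omega>\<bar>"] variance_eq[of "\<lambda>\<omega>. \<bar>G \<omega>\<bar>"] G1 Gi by simp
    then show "(\<integral>\<omega>. \<bar>G \<omega>\<bar> \<partial>M)\<^sup>2 \<le> w" using EG by simp
  qed
  define \<phi> where "\<phi> \<theta> = (\<integral>\<omega>. iexp (\<theta> * F \<omega>) \<partial>M)" for \<theta>
  \<comment> \<open>The left side is the derivative of \<open>\<phi>\<close>. Without the term in
    \<open>G\<close> this would be the equation \<phi>' = - \<theta> v \<phi> of the normal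
    characteristic function.\<close>
  have der: "(\<integral>\<omega>. \<i> * F \<omega> * iexp (\<theta> * F \<omega>) \<partial>M) =
     - \<theta> * v * \<phi> \<theta> - 2 * \<theta> * (\<integral>\<omega>. G \<omega> * iexp (\<theta> * F \<omega>) \<partial>M)" for \<theta> :: real
  proof -
    define e where "e \<omega> = iexp (\<Sum>k\<in>I. (\<theta> * d k) * (X k \<omega>)\<^sup>2)" for \<omega>
    define c where "c = iexp (- (\<Sum>k\<in>I. \<theta> * d k * S k k))"
    have ec: "iexp (\<theta> * F \<omega>) = c * e \<omega>" for \<omega>
      unfolding e_def c_def exp_add[symmetric] F_def
      by (simp add: sum_distrib_left sum_subtractf right_diff_distrib mult.assoc)
    have [measurable]: "e \<in> borel_measurable M"
    proof -
      have [measurable]: "(\<lambda>\<omega>. \<Sum>k\<in>I. (\<theta> * d k) * (X k \<omega>)\<^sup>2) \<in> borel_measurable M"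
        using Xm by (intro borel_measurable_sum borel_measurable_times borel_measurable_power) auto
      show ?thesis unfolding e_def by measurable
    qed
    have ne[simp]: "norm (e x) = 1" for x unfolding e_def by (rule norm_exp_i_times)
    have int_e: "integrable M (\<lambda>x. complex_of_real (f x) * e x)" if "integrable M f" for f
      by (rule Bochner_Integration.integrable_bound[OF that]) (use that in \<open>auto simp: norm_mult\<close>)
    define W where "W b k = (\<integral>\<omega>. X b \<omega> * X k \<omega> * e \<omega> \<partial>M)" for b k
    have iW: "integrable M (\<lambda>\<omega>. X b \<omega> * X k \<omega> * e \<omega>)" if "b \<in> I" "k \<in> I" for b k
      using int_e[OF gaussian_space_mult_integrable[OF V X X, OF that]] by simp
    have i1: "integrable M e" using int_e[of "\<lambda>_. 1"] by simp
    have ibp: "W b b = S b b * (\<integral>\<omega>. e \<omega> \<partial>M) + 2 * \<i> * (\<Sum>k\<in>I. (\<theta> * d k) * S b k * W b k)" if "b \<in> I" for b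
      using gaussian_square_ibp[OF M V I X that, where d="\<lambda>k. \<theta> * d k"] that
      unfolding W_def e_def by (simp add: S power2_eq_square cong: sum.cong del: of_real_sum)
    have "(\<integral>\<omega>. F \<omega> * e \<omega> \<partial>M) = (\<integral>\<omega>. (\<Sum>b\<in>I. d b * (X b \<omega> * X b \<omega> * e \<omega> - S b b * e \<omega>)) \<partial>M)"
      by (intro Bochner_Integration.integral_cong refl)
         (simp add: F_def sum_distrib_left sum_distrib_right algebra_simps power2_eq_square)
    also have "\<dots> = (\<Sum>b\<in>I. d b * (W b b - S b b * (\<integral>\<omega>. e \<omega> \<partial>M)))"
      using iW i1 by (subst Bochner_Integration.integral_sum) (auto simp: W_def)
    also have "\<dots> = (\<Sum>b\<in>I. d b * (2 * \<i> * (\<Sum>k\<in>I. (\<theta> * d k) * S b k * W b k)))"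
      using ibp by (simp cong: sum.cong)
    also have "\<dots> = 2 * \<i> * \<theta> * (\<Sum>b\<in>I. \<Sum>k\<in>I. d b * d k * S b k * W b k)"
      by (simp add: sum_distrib_left ac_simps)
    also have "(\<Sum>b\<in>I. \<Sum>k\<in>I. d b * d k * S b k * W b k) = (\<integral>\<omega>. G \<omega> * e \<omega> \<partial>M) + (v / 2) * (\<integral>\<omega>. e \<omega> \<partial>M)"
    proof -
      have "(\<integral>\<omega>. (\<Sum>p\<in>I\<times>I. of_real (d (fst p) * d (snd p) * S (fst p) (snd p)) * (X (fst p) \<omega> * X (snd p) \<omega> * e \<omega>)) \<partial>M)
          = (\<Sum>p\<in>I\<times>I. of_real (d (fst p) * d (snd p) * S (fst p) (snd p)) * W (fst p) (snd p))"
        unfolding W_def using iW by (subst Bochner_Integration.integral_sum) auto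
      also have "\<dots> = (\<Sum>b\<in>I. \<Sum>k\<in>I. d b * d k * S b k * W b k)"
        by (simp add: sum.cartesian_product' split_beta)
      also have "(\<lambda>\<omega>. (\<Sum>p\<in>I\<times>I. of_real (d (fst p) * d (snd p) * S (fst p) (snd p)) * (X (fst p) \<omega> * X (snd p) \<omega> * e \<omega>)))
          = (\<lambda>\<omega>. G \<omega> * e \<omega> + (v / 2) * e \<omega>)"
      proof
        fix \<omega>
        have "v / 2 = (\<Sum>p\<in>I\<times>I. (d (fst p) * d (snd p) * S (fst p) (snd p)) * S (fst p) (snd p))"
          unfolding v_def by (simp add: sum.cartesian_product' split_beta power2_eq_square mult.assoc)
        then have "G \<omega> + v / 2 = (\<Sum>p\<in>I\<times>I. (d (fst p) * d (snd p) * S (fst p) (snd p)) * (X (fst p) \<omega> * X (snd p) \<omega>))"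
          by (simp add: G_def Y_def right_diff_distrib sum_subtractf)
        then have "complex_of_real (G \<omega> + v / 2) * e \<omega> = of_real (\<Sum>p\<in>I\<times>I. (d (fst p) * d (snd p) * S (fst p) (snd p)) * (X (fst p) \<omega> * X (snd p) \<omega>)) * e \<omega>"
          by (simp only:)
        then show "(\<Sum>p\<in>I\<times>I. of_real (d (fst p) * d (snd p) * S (fst p) (snd p)) * (X (fst p) \<omega> * X (snd p) \<omega> * e \<omega>)) = G \<omega> * e \<omega> + (v / 2) * e \<omega>"
          by (simp add: sum_distrib_left sum_distrib_right algebra_simps)
      qed
      also have "(\<integral>\<omega>. G \<omega> * e \<omega> + (v / 2) * e \<omega> \<partial>M) = (\<integral>\<omega>. G \<omega> * e \<omega> \<partial>M) + (v / 2) * (\<integral>\<omega>. e \<omega> \<partial>M)"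
        using int_e[OF G1] i1 by simp
      finally show ?thesis by simp
    qed
    finally have "(\<integral>\<omega>. F \<omega> * e \<omega> \<partial>M) = 2 * \<i> * \<theta> * ((\<integral>\<omega>. G \<omega> * e \<omega> \<partial>M) + (v / 2) * (\<integral>\<omega>. e \<omega> \<partial>M))" .
    moreover have "(\<integral>\<omega>. \<i> * F \<omega> * iexp (\<theta> * F \<omega>) \<partial>M) = \<i> * c * (\<integral>\<omega>. F \<omega> * e \<omega> \<partial>M)"
      unfolding ec by (simp add: mult_ac flip: integral_mult_right_zero)
    moreover have "(\<integral>\<omega>. G \<omega> * iexp (\<theta> * F \<omega>) \<partial>M) = c * (\<integral>\<omega>. G \<omega> * e \<omega> \<partial>M)"
      unfolding ec by (simp add: mult_ac flip: integral_mult_right_zero)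
    moreover have "\<phi> \<theta> = c * (\<integral>\<omega>. e \<omega> \<partial>M)"
      unfolding \<phi>_def ec by simp
    moreover have "\<i> * z * (2 * \<i> * t * (g + u / 2 * h)) = - t * u * (z * h) - 2 * t * (z * g)" for z t g u h :: complex
    proof -
      have "\<i> * z * (2 * \<i> * t * (g + u / 2 * h)) = (\<i> * \<i>) * (z * (2 * t * (g + u / 2 * h)))"
        by (simp only: mult_ac)
      then show ?thesis by (simp add: distrib_left mult_ac)
    qed
    ultimately show ?thesis by simp
  qed
  \<comment> \<open>The integrating factor removes the main term, so that the derivative of
    \<open>\<psi>\<close> involves only \<open>G\<close>.\<close>
  define \<psi> where "\<psi> \<theta> = of_real (exp (\<theta>\<^sup>2 * v / 2)) * \<phi> \<theta>" for \<theta>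
  have d\<psi>: "(\<psi> has_vector_derivative (- 2 * \<theta> * exp (\<theta>\<^sup>2 * v / 2)) *\<^sub>R (\<integral>\<omega>. G \<omega> * iexp (\<theta> * F \<omega>) \<partial>M)) (at \<theta>)" for \<theta>
  proof -
    have 1: "((\<lambda>\<theta>. exp (\<theta>\<^sup>2 * v / 2)) has_real_derivative exp (\<theta>\<^sup>2 * v / 2) * (\<theta> * v)) (at \<theta>)"
      by (auto intro!: derivative_eq_intros)
    have "(\<psi> has_vector_derivative of_real (exp (\<theta>\<^sup>2 * v / 2)) * (\<integral>\<omega>. \<i> * F \<omega> * iexp (\<theta> * F \<omega>) \<partial>M) + of_real (exp (\<theta>\<^sup>2 * v / 2) * (\<theta> * v)) * \<phi> \<theta>) (at \<theta>)"
      unfolding \<psi>_def \<phi>_def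
      by (intro has_vector_derivative_mult has_vector_derivative_of_real 1 char_has_vector_derivative M Fi) simp
    then show ?thesis unfolding der by (simp add: scaleR_conv_of_real algebra_simps)
  qed
  \<comment> \<open>The mean value inequality between 0 and \<theta>. The factor
    \<open>exp (\<theta>\<^sup>2 * v / 2)\<close> lost here is exactly cancelled on returning from
    \<open>\<psi>\<close> to \<open>\<phi>\<close>, so the final bound does not grow with
    \<open>v\<close>.\<close>
  have "cmod (\<psi> \<theta> - \<psi> 0) \<le> (2 * \<bar>\<theta>\<bar> * exp (\<theta>\<^sup>2 * v / 2) * sqrt w) * norm (\<theta> - 0)"
  proof (rule differentiable_bound[of "closed_segment 0 \<theta>"])
    fix s assume s: "s \<in> closed_segment 0 \<theta>"
    then have s': "\<bar>s\<bar> \<le> \<bar>\<theta>\<bar>" by (auto simp: closed_segment_eq_real_ivl split: if_splits)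
    show "(\<psi> has_derivative (\<lambda>h. h *\<^sub>R ((- 2 * s * exp (s\<^sup>2 * v / 2)) *\<^sub>R (\<integral>\<omega>. G \<omega> * iexp (s * F \<omega>) \<partial>M)))) (at s within closed_segment 0 \<theta>)"
      using d\<psi>[of s] has_derivative_at_withinI unfolding has_vector_derivative_def by blast
    have "norm (\<integral>\<omega>. G \<omega> * iexp (s * F \<omega>) \<partial>M) \<le> (\<integral>\<omega>. \<bar>G \<omega>\<bar> \<partial>M)"
      by (rule order_trans[OF integral_norm_bound]) (simp add: norm_mult)
    also have "\<dots> \<le> sqrt w" by (rule absG)
    finally have g: "norm (\<integral>\<omega>. G \<omega> * iexp (s * F \<omega>) \<partial>M) \<le> sqrt w" .
    have "onorm (\<lambda>h. h *\<^sub>R ((- 2 * s * exp (s\<^sup>2 * v / 2)) *\<^sub>R (\<integral>\<omega>. G \<omega> * iexp (s * F \<omega>) \<partial>M)))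
       \<le> norm ((- 2 * s * exp (s\<^sup>2 * v / 2)) *\<^sub>R (\<integral>\<omega>. G \<omega> * iexp (s * F \<omega>) \<partial>M))"
      by (rule onorm_le) (simp add: abs_mult mult_ac)
    also have "\<dots> = 2 * \<bar>s\<bar> * exp (s\<^sup>2 * v / 2) * norm (\<integral>\<omega>. G \<omega> * iexp (s * F \<omega>) \<partial>M)"
      by (simp add: abs_mult)
    also have "\<dots> \<le> 2 * \<bar>\<theta>\<bar> * exp (\<theta>\<^sup>2 * v / 2) * sqrt w"
    proof (intro mult_mono g)
      have "s\<^sup>2 \<le> \<theta>\<^sup>2" using s' by (simp add: abs_le_square_iff)
      then have "s\<^sup>2 * v \<le> \<theta>\<^sup>2 * v" using v0 by (rule mult_right_mono)
      then show "exp (s\<^sup>2 * v / 2) \<le> exp (\<theta>\<^sup>2 * v / 2)" by simp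
    qed (use s' in auto)
    finally show "onorm (\<lambda>h. h *\<^sub>R ((- 2 * s * exp (s\<^sup>2 * v / 2)) *\<^sub>R (\<integral>\<omega>. G \<omega> * iexp (s * F \<omega>) \<partial>M)))
       \<le> 2 * \<bar>\<theta>\<bar> * exp (\<theta>\<^sup>2 * v / 2) * sqrt w" .
  qed auto
  moreover have "\<psi> 0 = 1" unfolding \<psi>_def \<phi>_def by (simp add: prob_space)
  ultimately have b: "cmod (\<psi> \<theta> - 1) \<le> 2 * \<theta>\<^sup>2 * sqrt w * exp (\<theta>\<^sup>2 * v / 2)"
    by (simp add: power2_eq_square ac_simps)
  have "\<phi> \<theta> - exp (- (\<theta>\<^sup>2 * v / 2)) = of_real (exp (- (\<theta>\<^sup>2 * v / 2))) * (\<psi> \<theta> - 1)"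
    unfolding \<psi>_def right_diff_distrib mult.assoc[symmetric] of_real_mult[symmetric] exp_add[symmetric] by simp
  then have "cmod (\<phi> \<theta> - exp (- (\<theta>\<^sup>2 * v / 2))) = exp (- (\<theta>\<^sup>2 * v / 2)) * cmod (\<psi> \<theta> - 1)"
    by (simp add: norm_mult)
  also have "\<dots> \<le> exp (- (\<theta>\<^sup>2 * v / 2)) * (2 * \<theta>\<^sup>2 * sqrt w * exp (\<theta>\<^sup>2 * v / 2))"
    by (rule mult_left_mono[OF b]) simp
  also have "\<dots> = 2 * \<theta>\<^sup>2 * sqrt w" by (simp add: exp_minus)
  finally show "cmod ((\<integral>\<omega>. iexp (\<theta> * F \<omega>) \<partial>M) - exp (- (\<theta>\<^sup>2 * v / 2))) \<le> 2 * \<theta>\<^sup>2 * sqrt w"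
    unfolding \<phi>_def .
qed


section \<open>Averages along differences of indices\<close>

lemma cesaro_mean:
  fixes x :: "nat \<Rightarrow> real"
  assumes "x \<longlonglongrightarrow> L"
  shows "(\<lambda>N. (\<Sum>n<N. x n) / real N) \<longlonglongrightarrow> L"
proof (rule LIMSEQ_I)
  fix r :: real assume r: "r > 0"
  obtain n0 where n0: "\<And>n. n \<ge> n0 \<Longrightarrow> \<bar>x n - L\<bar> < r / 2"
    using LIMSEQ_D[OF assms, of "r / 2"] r by auto
  define C where "C = (\<Sum>n<n0. \<bar>x n - L\<bar>)"
  have C: "C \<ge> 0" by (simp add: C_def sum_nonneg)
  obtain m :: nat where m: "real m > 2 * C / r" using reals_Archimedean2 by blast
  show "\<exists>no. \<forall>N\<ge>no. norm ((\<Sum>n<N. x n) / real N - L) < r"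
  proof (intro exI allI impI)
    fix N assume N: "N \<ge> max (max m n0) 1"
    then have "real N > 2 * C / r" using m by linarith
    then have CN: "C < r / 2 * real N" using r by (simp add: field_simps)
    have "(\<Sum>n<N. x n) / real N - L = (\<Sum>n<N. x n - L) / real N"
      using N by (simp add: sum_subtractf field_simps)
    also have "\<bar>\<dots>\<bar> \<le> (\<Sum>n<N. \<bar>x n - L\<bar>) / real N"
      using sum_abs[of "\<lambda>n. x n - L" "{..<N}"] by (simp add: abs_divide divide_right_mono)
    also have "(\<Sum>n<N. \<bar>x n - L\<bar>) = C + (\<Sum>n=n0..<N. \<bar>x n - L\<bar>)"
      unfolding C_def lessThan_atLeast0 using N by (intro sum.atLeastLessThan_concat[symmetric]) auto
    also have "(\<Sum>n=n0..<N. \<bar>x n - L\<bar>) \<le> (\<Sum>n=n0..<N. r / 2)"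
      by (rule sum_mono, rule less_imp_le, rule n0) simp
    also have "\<dots> \<le> r / 2 * real N" using r by simp
    also have "(C + r / 2 * real N) / real N < r"
      using CN N by (simp add: field_simps)
    finally show "norm ((\<Sum>n<N. x n) / real N - L) < r"
      using N by (simp add: divide_right_mono)
  qed
qed

lemma sum_int_Icc_Suc:
  fixes g :: "int \<Rightarrow> real"
  shows "(\<Sum>m=- int (Suc n)..int (Suc n). g m) = (\<Sum>m=- int n..int n. g m) + g (int (Suc n)) + g (- int (Suc n))"
proof -
  have "{- int (Suc n)..int (Suc n)} = insert (int (Suc n)) (insert (- int (Suc n)) {- int n..int n})" by auto
  then show ?thesis by simp
qed

lemma sum_int_Icc:
  fixes g :: "int \<Rightarrow> real"
  shows "(\<Sum>m=- int n..int n. g m) = g 0 + (\<Sum>k=1..n. g (int k) + g (- int k))"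
proof (induction n)
  case (Suc n)
  then show ?case unfolding sum_int_Icc_Suc by simp
qed simp

text \<open>The border added in passing from N to N + 1 contains each difference from -N to N
  exactly once. Divided by N, the double sum is thus a Cesaro mean of symmetric partial
  sums.\<close>

lemma sum_differences:
  fixes g :: "int \<Rightarrow> real"
  shows "(\<Sum>k=1..N. \<Sum>l=1..N. g (int k - int l)) = (\<Sum>n<N. \<Sum>m=- int n..int n. g m)"
proof (induction N)
  case (Suc N)
  have r: "(\<Sum>l=1..N. h (int (Suc N) - int l)) = (\<Sum>k=1..N. h (int k))" for h :: "int \<Rightarrow> real"
    by (rule sum.reindex_bij_witness[of _ "\<lambda>k. Suc N - k" "\<lambda>k. Suc N - k"]) (auto simp: of_nat_diff)
  have "(\<Sum>k=1..Suc N. \<Sum>l=1..Suc N. g (int k - int l)) =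
     (\<Sum>k=1..N. \<Sum>l=1..N. g (int k - int l)) + (\<Sum>k=1..N. g (- (int (Suc N) - int k)))
     + (\<Sum>l=1..N. g (int (Suc N) - int l)) + g 0"
    by (simp add: sum.distrib algebra_simps)
  also have "\<dots> = (\<Sum>n<N. \<Sum>m=- int n..int n. g m) + (\<Sum>m=- int N..int N. g m)"
    unfolding Suc r[of g] r[of "\<lambda>m. g (- m)"] sum_int_Icc[of g N] by (simp add: sum.distrib)
  finally show ?case by simp
qed simp

lemma sum_int_Icc_tendsto:
  fixes g :: "int \<Rightarrow> real"
  assumes "g summable_on UNIV"
  shows "(\<lambda>n. \<Sum>m=- int n..int n. g m) \<longlonglongrightarrow> (\<Sum>\<^sub>\<infinity>m. g m)"
proof -
  have "(sum g \<longlongrightarrow> (\<Sum>\<^sub>\<infinity>m. g m)) (finite_subsets_at_top UNIV)"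
    using has_sum_infsum[OF assms] by (simp add: has_sum_def)
  moreover have "filterlim (\<lambda>n. {- int n..int n}) (finite_subsets_at_top UNIV) sequentially"
    unfolding filterlim_finite_subsets_at_top
  proof (intro allI impI)
    fix X :: "int set" assume X: "finite X \<and> X \<subseteq> UNIV"
    obtain n0 :: nat where "\<forall>x\<in>X. \<bar>x\<bar> \<le> int n0"
    proof -
      have "\<bar>x\<bar> \<le> int (nat (\<Sum>x\<in>X. \<bar>x\<bar>))" if "x \<in> X" for x
        using X that member_le_sum[of x X "\<lambda>x. \<bar>x\<bar>"] by auto
      then show ?thesis using that by blast
    qed
    then show "\<forall>\<^sub>F n in sequentially. finite {- int n..int n} \<and> X \<subseteq> {- int n..int n} \<and> {- int n..int n} \<subseteq> UNIV"
      unfolding eventually_sequentially by (intro exI[of _ n0]) force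
  qed
  ultimately show ?thesis by (rule filterlim_compose)
qed

lemma average_differences_tendsto:
  fixes g :: "int \<Rightarrow> real"
  assumes "g summable_on UNIV"
  shows "(\<lambda>N. (\<Sum>k=1..N. \<Sum>l=1..N. g (int k - int l)) / real N) \<longlonglongrightarrow> (\<Sum>\<^sub>\<infinity>m. g m)"
  unfolding sum_differences by (rule cesaro_mean[OF sum_int_Icc_tendsto[OF assms]])

lemma sum_inj_le_infsum:
  fixes g :: "int \<Rightarrow> real"
  assumes "g summable_on UNIV" "\<And>m. g m \<ge> 0" "finite A" "inj_on h A"
  shows "(\<Sum>k\<in>A. g (h k)) \<le> (\<Sum>\<^sub>\<infinity>m. g m)"
proof -
  have "(\<Sum>k\<in>A. g (h k)) = sum g (h ` A)" using assms(4) by (simp add: sum.reindex)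
  also have "\<dots> \<le> infsum g UNIV" using assms by (intro finite_sum_le_infsum) auto
  finally show ?thesis by simp
qed

text \<open>Splitting off a finite window of \<open>r\<close> leaves a remainder with small \<open>\<ell>\<^sup>2\<close> norm; the window
  contributes only of order \<open>N\<close>.\<close>

lemma l2_convolution_square_tendsto:
  fixes r :: "int \<Rightarrow> real"
  assumes r0: "\<And>m. r m \<ge> 0" and sm: "(\<lambda>m. (r m)\<^sup>2) summable_on UNIV"
  shows "(\<lambda>N. (\<Sum>k=1..N. \<Sum>l=1..N. (\<Sum>m=1..N. r (int k - int m) * r (int m - int l))\<^sup>2) / (real N)\<^sup>2) \<longlonglongrightarrow> 0"
proof (rule LIMSEQ_I)
  fix \<epsilon> :: real assume \<epsilon>: "\<epsilon> > 0"
  define A where "A = (\<Sum>\<^sub>\<infinity>m. (r m)\<^sup>2)"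
  have A0: "A \<ge> 0" unfolding A_def by (rule infsum_nonneg) simp
  \<comment> \<open>The tail will cost \<open>2 * \<eta> * A\<close>, at most half of \<epsilon>;
    the \<open>+ 1\<close> covers \<open>A = 0\<close>.\<close>
  define \<eta> where "\<eta> = \<epsilon> / (4 * (A + 1))"
  have \<eta>: "\<eta> > 0" using \<epsilon> A0 by (simp add: \<eta>_def)
  have "eventually (\<lambda>F. dist (sum (\<lambda>m. (r m)\<^sup>2) F) A < \<eta>) (finite_subsets_at_top UNIV)"
    using has_sum_infsum[OF sm] \<eta> unfolding has_sum_def A_def by (rule tendstoD)
  then obtain K where K: "finite K" "dist (sum (\<lambda>m. (r m)\<^sup>2) K) A < \<eta>"
    by (auto simp: eventually_finite_subsets_at_top)
  have tail: "sum (\<lambda>m. (r m)\<^sup>2) F \<le> \<eta>" if "finite F" "F \<inter> K = {}" for F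
  proof -
    have "sum (\<lambda>m. (r m)\<^sup>2) (F \<union> K) \<le> A"
      unfolding A_def using K that sm by (intro finite_sum_le_infsum) auto
    then show ?thesis using K that by (simp add: sum.union_disjoint dist_real_def)
  qed
  \<comment> \<open>The price of the window for one \<open>k\<close>: at most \<open>card K\<close>
    indices \<open>m\<close>, each contributing \<open>2 * A * A\<close> after summation over
    \<open>l\<close>.\<close>
  define B where "B = 2 * A\<^sup>2 * real (card K)"
  have bound: "(\<Sum>k=1..N. \<Sum>l=1..N. (\<Sum>m=1..N. r (int k - int m) * r (int m - int l))\<^sup>2) \<le> B * real N + 2 * \<eta> * A * (real N)\<^sup>2" for N
  proof -
    define W where "W k = {m \<in> {1..N}. int k - int m \<in> K}" for k
    define W' where "W' k = {m \<in> {1..N}. int k - int m \<notin> K}" for k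
    have card_W: "card (W k) \<le> card K" for k
      by (rule card_inj_on_le[of "\<lambda>m. int k - int m"]) (auto simp: W_def inj_on_def K)
    have le_A: "(\<Sum>m\<in>F. (r (h m))\<^sup>2) \<le> A" if "finite F" "inj_on h F" for F :: "nat set" and h
      unfolding A_def using that sm by (intro sum_inj_le_infsum[of "\<lambda>m. (r m)\<^sup>2"]) auto
    \<comment> \<open>Cauchy--Schwarz is applied separately inside and outside the window. Inside,
      the dependence on \<open>l\<close> is kept, so that the later sum over \<open>l\<close> costs
      a factor \<open>A\<close> instead of \<open>N * A\<close>; outside, the small tail makes up
      for the crude bound.\<close>
    have one: "(\<Sum>m=1..N. r (int k - int m) * r (int m - int l))\<^sup>2 \<le> 2 * (A * (\<Sum>m\<in>W k. (r (int m - int l))\<^sup>2)) + 2 * (\<eta> * A)" for k l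
    proof -
      define x y where "x = (\<Sum>m\<in>W k. r (int k - int m) * r (int m - int l))" "y = (\<Sum>m\<in>W' k. r (int k - int m) * r (int m - int l))"
      have e: "(\<Sum>m=1..N. r (int k - int m) * r (int m - int l)) = x + y"
      proof -
        have "{1..N} = W k \<union> W' k" by (auto simp: W_def W'_def)
        then show ?thesis unfolding x_y_def
          by (simp only:) (rule sum.union_disjoint, auto simp: W_def W'_def)
      qed
      have "(x + y)\<^sup>2 \<le> 2 * x\<^sup>2 + 2 * y\<^sup>2" using sum_squares_bound[of x y] by (simp add: power2_sum)
      moreover have "x\<^sup>2 \<le> A * (\<Sum>m\<in>W k. (r (int m - int l))\<^sup>2)"
        unfolding x_y_def
        by (rule order_trans[OF Cauchy_Schwarz_ineq_sum mult_right_mono[OF le_A]]) (auto simp: W_def inj_on_def sum_nonneg)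
      moreover have "y\<^sup>2 \<le> \<eta> * A"
        unfolding x_y_def
      proof (rule order_trans[OF Cauchy_Schwarz_ineq_sum mult_mono])
        have "(\<Sum>m\<in>W' k. (r (int k - int m))\<^sup>2) = sum (\<lambda>m. (r m)\<^sup>2) ((\<lambda>m. int k - int m) ` W' k)"
          by (subst sum.reindex) (auto simp: inj_on_def)
        also have "\<dots> \<le> \<eta>" by (rule tail) (auto simp: W'_def)
        finally show "(\<Sum>m\<in>W' k. (r (int k - int m))\<^sup>2) \<le> \<eta>" .
      qed (use \<eta> in \<open>auto intro!: le_A sum_nonneg simp: W'_def inj_on_def\<close>)
      ultimately show ?thesis unfolding e by linarith
    qed
    have "(\<Sum>l=1..N. (\<Sum>m=1..N. r (int k - int m) * r (int m - int l))\<^sup>2) \<le> B + 2 * \<eta> * A * real N" for k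
    proof -
      have "(\<Sum>l=1..N. (\<Sum>m=1..N. r (int k - int m) * r (int m - int l))\<^sup>2) \<le> (\<Sum>l=1..N. 2 * (A * (\<Sum>m\<in>W k. (r (int m - int l))\<^sup>2)) + 2 * (\<eta> * A))"
        by (intro sum_mono one)
      also have "\<dots> = 2 * A * (\<Sum>l=1..N. \<Sum>m\<in>W k. (r (int m - int l))\<^sup>2) + 2 * \<eta> * A * real N"
        by (simp add: sum.distrib sum_distrib_left mult_ac)
      also have "(\<Sum>l=1..N. \<Sum>m\<in>W k. (r (int m - int l))\<^sup>2) = (\<Sum>m\<in>W k. \<Sum>l=1..N. (r (int m - int l))\<^sup>2)"
        by (rule sum.swap)
      also have "2 * A * \<dots> \<le> 2 * A * (\<Sum>m\<in>W k. A)"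
        using A0 by (intro mult_left_mono sum_mono le_A) (auto simp: inj_on_def)
      also have "\<dots> \<le> B"
      proof -
        have "2 * A * (real (card (W k)) * A) \<le> 2 * A * (real (card K) * A)"
          using A0 card_W[of k] by (intro mult_left_mono mult_right_mono) auto
        then show ?thesis by (simp add: B_def power2_eq_square mult_ac)
      qed
      finally show ?thesis by simp
    qed
    then have "(\<Sum>k=1..N. \<Sum>l=1..N. (\<Sum>m=1..N. r (int k - int m) * r (int m - int l))\<^sup>2) \<le> (\<Sum>k=1..N. B + 2 * \<eta> * A * real N)"
      by (intro sum_mono)
    then show ?thesis by (simp add: power2_eq_square algebra_simps)
  qed
  have B0: "B \<ge> 0" by (simp add: B_def)
  obtain n0 :: nat where n0: "real n0 > 2 * B / \<epsilon>" using reals_Archimedean2 by blast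
  have \<eta>A: "2 * \<eta> * A \<le> \<epsilon> / 2" using \<epsilon> A0 by (simp add: \<eta>_def field_simps)
  show "\<exists>no. \<forall>N\<ge>no. norm ((\<Sum>k=1..N. \<Sum>l=1..N. (\<Sum>m=1..N. r (int k - int m) * r (int m - int l))\<^sup>2) / (real N)\<^sup>2 - 0) < \<epsilon>"
  proof (intro exI allI impI)
    fix N assume N: "N \<ge> max n0 1"
    then have N1: "real N > 2 * B / \<epsilon>" "real N > 0" using n0 by linarith+
    have "(\<Sum>k=1..N. \<Sum>l=1..N. (\<Sum>m=1..N. r (int k - int m) * r (int m - int l))\<^sup>2) / (real N)\<^sup>2 \<le> (B * real N + 2 * \<eta> * A * (real N)\<^sup>2) / (real N)\<^sup>2"
      by (rule divide_right_mono[OF bound]) simp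
    also have "\<dots> = B / real N + 2 * \<eta> * A" using N1 by (simp add: field_simps power2_eq_square)
    also have "\<dots> < \<epsilon>"
    proof -
      have "B / real N < \<epsilon> / 2" using N1 \<epsilon> by (simp add: field_simps)
      then show ?thesis using \<eta>A by linarith
    qed
    finally show "norm ((\<Sum>k=1..N. \<Sum>l=1..N. (\<Sum>m=1..N. r (int k - int m) * r (int m - int l))\<^sup>2) / (real N)\<^sup>2 - 0) < \<epsilon>"
      by (simp add: sum_nonneg)
  qed
qed

section \<open>Asymptotic normality of averages of squares\<close>

lemma summable_on_finite_sum:
  fixes f :: "'i \<Rightarrow> 'b \<Rightarrow> real"
  assumes "finite I" "\<And>i. i \<in> I \<Longrightarrow> f i summable_on A"
  shows "(\<lambda>x. \<Sum>i\<in>I. f i x) summable_on A"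
  using assms by (induction I rule: finite_induct) (auto intro: summable_on_add)

text \<open>The lag is an integer because \<open>\<rho> i j\<close> need not be even when
  \<open>i\<close> and \<open>j\<close> differ; only the symmetry \<open>cov_sym\<close> is
  available. Joint normality of all observations is expressed by their membership in
  \<open>V\<close>.\<close>

locale stationary_gaussian =
  fixes M :: "'a measure" and V :: "('a \<Rightarrow> real) set" and X :: "nat \<Rightarrow> 'n::finite \<Rightarrow> 'a \<Rightarrow> real"
    and \<rho> :: "'n \<Rightarrow> 'n \<Rightarrow> int \<Rightarrow> real"
  assumes prob: "prob_space M" and V: "gaussian_space M V" and X: "\<And>k i. X k i \<in> V"
    and cov: "\<And>k i l j. (\<integral>\<omega>. X k i \<omega> * X l j \<omega> \<partial>M) = \<rho> i j (int k - int l)"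
begin

lemma cov_sym: "\<rho> i j m = \<rho> j i (- m)"
proof -
  have 1: "\<rho> i j m = \<rho> j i (- m)" if "m \<ge> 0" for i j m
    using cov[of "nat m" i 0 j] cov[of 0 j "nat m" i] that by (simp add: mult.commute)
  show ?thesis
  proof (cases "m \<ge> 0")
    case False
    then show ?thesis using 1[of "- m" j i] by simp
  qed (rule 1)
qed

definition fluctuation :: "nat \<Rightarrow> 'n \<Rightarrow> 'a \<Rightarrow> real" where
  "fluctuation N i \<omega> = sqrt (real N) * (1 / real N * (\<Sum>k=1..N. (X k i \<omega>)\<^sup>2) - \<rho> i i 0)"

lemma fluctuation_eq:
  assumes "N \<ge> 1"
  shows "(\<Sum>i\<in>UNIV. c i * fluctuation N i \<omega>) =
    (\<Sum>p\<in>{1..N}\<times>UNIV. (c (snd p) / sqrt (real N)) * ((X (fst p) (snd p) \<omega>)\<^sup>2 - \<rho> (snd p) (snd p) 0))"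
proof -
  have s: "sqrt (real N) * (1 / real N * x) = x / sqrt (real N)" for x
    using assms by (simp add: field_simps)
  have "fluctuation N i \<omega> = (\<Sum>k=1..N. ((X k i \<omega>)\<^sup>2 - \<rho> i i 0)) / sqrt (real N)" for i
  proof -
    have "fluctuation N i \<omega> = sqrt (real N) * (1 / real N * ((\<Sum>k=1..N. (X k i \<omega>)\<^sup>2) - real N * \<rho> i i 0))"
      unfolding fluctuation_def using assms by (simp add: field_simps)
    then show ?thesis unfolding s by (simp add: sum_subtractf)
  qed
  then have "(\<Sum>i\<in>UNIV. c i * fluctuation N i \<omega>) = (\<Sum>i\<in>UNIV. \<Sum>k=1..N. (c i / sqrt (real N)) * ((X k i \<omega>)\<^sup>2 - \<rho> i i 0))"
    by (simp add: sum_distrib_left sum_divide_distrib)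
  also have "\<dots> = (\<Sum>k=1..N. \<Sum>i\<in>UNIV. (c i / sqrt (real N)) * ((X k i \<omega>)\<^sup>2 - \<rho> i i 0))"
    by (rule sum.swap)
  finally show ?thesis by (simp add: sum.cartesian_product' split_beta)
qed

definition limit_cov :: "'n \<Rightarrow> 'n \<Rightarrow> real" where
  "limit_cov i j = 2 * (\<Sum>\<^sub>\<infinity>m. (\<rho> i j m)\<^sup>2)"

text \<open>\<open>var_term\<close> and the following \<open>rem_term\<close> are \<open>v\<close>
  and \<open>w\<close> of \<open>gaussian_quadratic_char\<close> for the index set of pairs of a
  time and a coordinate and the weights \<open>c i / sqrt N\<close>.\<close>

definition var_term :: "nat \<Rightarrow> ('n \<Rightarrow> real) \<Rightarrow> real" where
  "var_term N c = (\<Sum>i\<in>UNIV. \<Sum>j\<in>UNIV. c i * c j * (2 * ((\<Sum>k=1..N. \<Sum>l=1..N. (\<rho> i j (int k - int l))\<^sup>2) / real N)))"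

definition rem_term :: "nat \<Rightarrow> ('n \<Rightarrow> real) \<Rightarrow> real" where
  "rem_term N c = 2 * (\<Sum>p\<in>{1..N}\<times>UNIV. \<Sum>q\<in>{1..N}\<times>UNIV. (c (snd p) / sqrt (real N)) * (c (snd q) / sqrt (real N)) *
     (\<Sum>a\<in>{1..N}\<times>UNIV. (c (snd a) / sqrt (real N)) * \<rho> (snd p) (snd a) (int (fst p) - int (fst a)) * \<rho> (snd a) (snd q) (int (fst a) - int (fst q)))\<^sup>2)"

lemma sum_pairs:
  fixes f :: "nat \<times> 'n \<Rightarrow> nat \<times> 'n \<Rightarrow> real"
  shows "(\<Sum>p\<in>{1..N}\<times>UNIV. \<Sum>q\<in>{1..N}\<times>UNIV. f p q) = (\<Sum>i\<in>UNIV. \<Sum>j\<in>UNIV. \<Sum>k=1..N. \<Sum>l=1..N. f (k, i) (l, j))"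
proof -
  have e: "(\<Sum>p\<in>{1..N}\<times>UNIV. g p) = (\<Sum>i\<in>UNIV. \<Sum>k=1..N. g (k, i))" for g :: "nat \<times> 'n \<Rightarrow> real"
    by (simp add: sum.cartesian_product' split_beta) (rule sum.swap)
  have "(\<Sum>p\<in>{1..N}\<times>UNIV. \<Sum>q\<in>{1..N}\<times>UNIV. f p q) = (\<Sum>i\<in>UNIV. \<Sum>k=1..N. \<Sum>j\<in>UNIV. \<Sum>l=1..N. f (k, i) (l, j))"
    by (simp only: e)
  also have "\<dots> = (\<Sum>i\<in>UNIV. \<Sum>j\<in>UNIV. \<Sum>k=1..N. \<Sum>l=1..N. f (k, i) (l, j))"
    by (rule sum.cong[OF refl], rule sum.swap)
  finally show ?thesis .
qed

lemma fluctuation_quadratic: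
  assumes N: "N \<ge> 1"
  shows "integrable M (\<lambda>\<omega>. (\<Sum>i\<in>UNIV. c i * fluctuation N i \<omega>)\<^sup>2)"
    and "(\<integral>\<omega>. (\<Sum>i\<in>UNIV. c i * fluctuation N i \<omega>)\<^sup>2 \<partial>M) = var_term N c"
    and "cmod ((\<integral>\<omega>. iexp (\<Sum>i\<in>UNIV. c i * fluctuation N i \<omega>) \<partial>M) - exp (- (var_term N c / 2))) \<le> 2 * sqrt (rem_term N c)"
proof -
  let ?I = "{1..N} \<times> (UNIV :: 'n set)"
  have fin: "finite ?I" by simp
  have S: "(\<integral>\<omega>. X (fst p) (snd p) \<omega> * X (fst q) (snd q) \<omega> \<partial>M) = \<rho> (snd p) (snd q) (int (fst p) - int (fst q))" for p q
    by (rule cov)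
  have sym: "\<rho> (snd p) (snd q) (int (fst p) - int (fst q)) = \<rho> (snd q) (snd p) (int (fst q) - int (fst p))" for p q :: "nat \<times> 'n"
    using cov_sym[of "snd p" "snd q" "int (fst p) - int (fst q)"] by simp
  note G = gaussian_quadratic_char[OF prob V fin, where X="\<lambda>p. X (fst p) (snd p)" and d="\<lambda>p. c (snd p) / sqrt (real N)"
      and S="\<lambda>p q. \<rho> (snd p) (snd q) (int (fst p) - int (fst q))", OF X S sym]
  have v: "2 * (\<Sum>p\<in>?I. \<Sum>q\<in>?I. (c (snd p) / sqrt (real N)) * (c (snd q) / sqrt (real N)) * (\<rho> (snd p) (snd q) (int (fst p) - int (fst q)))\<^sup>2)
      = var_term N c"
  proof -
    have "(c i / sqrt (real N)) * (c j / sqrt (real N)) = c i * c j / real N" for i j by simp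
    then show ?thesis
      unfolding sum_pairs var_term_def by (simp add: sum_distrib_left sum_divide_distrib mult_ac)
  qed
  show "integrable M (\<lambda>\<omega>. (\<Sum>i\<in>UNIV. c i * fluctuation N i \<omega>)\<^sup>2)"
    unfolding fluctuation_eq[OF N] using G(1) by simp
  show "(\<integral>\<omega>. (\<Sum>i\<in>UNIV. c i * fluctuation N i \<omega>)\<^sup>2 \<partial>M) = var_term N c"
    unfolding fluctuation_eq[OF N] v[symmetric] using G(2) by simp
  show "cmod ((\<integral>\<omega>. iexp (\<Sum>i\<in>UNIV. c i * fluctuation N i \<omega>) \<partial>M) - exp (- (var_term N c / 2))) \<le> 2 * sqrt (rem_term N c)"
    unfolding fluctuation_eq[OF N] v[symmetric] rem_term_def using G(3)[of 1] by simp
qed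

context
  assumes l2: "\<And>i j. (\<lambda>m. (\<rho> i j m)\<^sup>2) summable_on UNIV"
begin

lemma var_term_tendsto: "(\<lambda>N. var_term N c) \<longlonglongrightarrow> (\<Sum>i\<in>UNIV. \<Sum>j\<in>UNIV. c i * c j * limit_cov i j)"
  unfolding var_term_def limit_cov_def
  by (intro tendsto_sum tendsto_mult tendsto_const average_differences_tendsto l2)

text \<open>All covariances are dominated by the single l^2 sequence \<open>r\<close>, so the
  remainder is at most a constant times the squared convolution of \<open>r\<close> over N^2; the
  N^2 comes from four weights of order N^(-1/2).\<close>

lemma rem_term_tendsto: "(\<lambda>N. rem_term N c) \<longlonglongrightarrow> 0"
proof -
  define r where "r m = (\<Sum>i\<in>UNIV. \<Sum>j\<in>UNIV. \<bar>\<rho> i j m\<bar>)" for m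
  have r0: "r m \<ge> 0" for m by (simp add: r_def sum_nonneg)
  have le_r: "\<bar>\<rho> i j m\<bar> \<le> r m" for i j m
  proof -
    have "\<bar>\<rho> i j m\<bar> \<le> (\<Sum>j\<in>UNIV. \<bar>\<rho> i j m\<bar>)" by (rule member_le_sum) auto
    also have "\<dots> \<le> r m" unfolding r_def by (rule member_le_sum) (auto intro: sum_nonneg)
    finally show ?thesis .
  qed
  have r2: "(\<lambda>m. (r m)\<^sup>2) summable_on UNIV"
  proof (rule summable_on_comparison_test)
    let ?n = "real (card (UNIV :: 'n set))"
    show "(\<lambda>m. ?n * (\<Sum>i\<in>UNIV. ?n * (\<Sum>j\<in>UNIV. (\<rho> i j m)\<^sup>2))) summable_on UNIV"
      by (intro summable_on_cmult_right summable_on_finite_sum l2) auto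
    fix m :: int
    have "(r m)\<^sup>2 \<le> ?n * (\<Sum>i\<in>UNIV. (\<Sum>j\<in>UNIV. \<bar>\<rho> i j m\<bar>)\<^sup>2)"
      unfolding r_def using sum_squared_le_sum_of_squares[of "\<lambda>i. \<Sum>j\<in>UNIV. \<bar>\<rho> i j m\<bar>" "UNIV :: 'n set"] by (simp add: mult.commute)
    also have "\<dots> \<le> ?n * (\<Sum>i\<in>UNIV. ?n * (\<Sum>j\<in>UNIV. \<bar>\<rho> i j m\<bar>\<^sup>2))"
      using sum_squared_le_sum_of_squares[of "\<lambda>j. \<bar>\<rho> _ j m\<bar>" "UNIV :: 'n set"]
      by (intro mult_left_mono sum_mono) (auto simp: mult.commute)
    finally show "(r m)\<^sup>2 \<le> ?n * (\<Sum>i\<in>UNIV. ?n * (\<Sum>j\<in>UNIV. (\<rho> i j m)\<^sup>2))" by simp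
  qed auto
  define D where "D = (\<Sum>i\<in>UNIV. \<bar>c i\<bar>)"
  have D: "\<bar>c i\<bar> \<le> D" for i unfolding D_def by (rule member_le_sum) auto
  define n where "n = real (card (UNIV :: 'n set))"
  have n0: "n \<ge> 0" by (simp add: n_def)
  define conv where "conv N = (\<Sum>k=1..N. \<Sum>l=1..N. (\<Sum>m=1..N. r (int k - int m) * r (int m - int l))\<^sup>2)" for N
  have bnd: "norm (rem_term N c) \<le> 2 * (n * (n * (D ^ 4 * n\<^sup>2))) * (conv N / (real N)\<^sup>2)" if N: "N \<ge> 1" for N
  proof -
    let ?d = "\<lambda>p :: nat \<times> 'n. c (snd p) / sqrt (real N)"
    have d: "\<bar>?d p\<bar> \<le> D / sqrt (real N)" for p
      using D[of "snd p"] by (simp add: abs_divide divide_right_mono)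
    have inner: "\<bar>\<Sum>a\<in>{1..N}\<times>UNIV. ?d a * \<rho> (snd p) (snd a) (int (fst p) - int (fst a)) * \<rho> (snd a) (snd q) (int (fst a) - int (fst q))\<bar>
       \<le> D / sqrt (real N) * n * (\<Sum>m=1..N. r (int (fst p) - int m) * r (int m - int (fst q)))" (is "\<bar>?T\<bar> \<le> _") for p q :: "nat \<times> 'n"
    proof -
      have "\<bar>?T\<bar> \<le> (\<Sum>a\<in>{1..N}\<times>UNIV. \<bar>?d a * \<rho> (snd p) (snd a) (int (fst p) - int (fst a)) * \<rho> (snd a) (snd q) (int (fst a) - int (fst q))\<bar>)"
        by (rule sum_abs)
      also have "\<dots> \<le> (\<Sum>a\<in>{1..N}\<times>(UNIV :: 'n set). D / sqrt (real N) * (r (int (fst p) - int (fst a)) * r (int (fst a) - int (fst q))))"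
        unfolding abs_mult mult.assoc using D[of undefined]
        by (intro sum_mono mult_mono d le_r) (auto intro: r0)
      also have "\<dots> = D / sqrt (real N) * n * (\<Sum>m=1..N. r (int (fst p) - int m) * r (int m - int (fst q)))"
        by (simp add: sum.cartesian_product' n_def sum_distrib_left mult_ac)
      finally show ?thesis .
    qed
    have D0: "D \<ge> 0" by (simp add: D_def sum_nonneg)
    have trm: "\<bar>?d p * ?d q * (\<Sum>a\<in>{1..N}\<times>UNIV. ?d a * \<rho> (snd p) (snd a) (int (fst p) - int (fst a)) * \<rho> (snd a) (snd q) (int (fst a) - int (fst q)))\<^sup>2\<bar>
      \<le> (D / sqrt (real N)) * (D / sqrt (real N)) * (D / sqrt (real N) * n * (\<Sum>m=1..N. r (int (fst p) - int m) * r (int m - int (fst q))))\<^sup>2" for p q :: "nat \<times> 'n"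
      unfolding abs_mult power_abs using D0
      by (intro mult_mono d power_mono inner) auto
    have "\<bar>rem_term N c\<bar> \<le> 2 * (\<Sum>p\<in>{1..N}\<times>UNIV. \<Sum>q\<in>{1..N}\<times>UNIV. (D / sqrt (real N)) * (D / sqrt (real N)) * (D / sqrt (real N) * n * (\<Sum>m=1..N. r (int (fst (p :: nat \<times> 'n)) - int m) * r (int m - int (fst (q :: nat \<times> 'n)))))\<^sup>2)"
      unfolding rem_term_def abs_mult
      by (intro mult_mono order_trans[OF sum_abs] sum_mono trm) auto
    also have "\<dots> = 2 * (n * (n * (\<Sum>k=1..N. \<Sum>l=1..N. (D / sqrt (real N)) * (D / sqrt (real N)) * (D / sqrt (real N) * n * (\<Sum>m=1..N. r (int k - int m) * r (int m - int l)))\<^sup>2)))"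
      unfolding sum_pairs by (simp add: n_def)
    also have "\<dots> = 2 * (n * (n * ((D / sqrt (real N)) * (D / sqrt (real N)) * (D / sqrt (real N) * n)\<^sup>2 * conv N)))"
      unfolding conv_def power_mult_distrib[of "D / sqrt (real N) * n"] by (simp add: sum_distrib_left mult_ac)
    also have "(D / sqrt (real N)) * (D / sqrt (real N)) * (D / sqrt (real N) * n)\<^sup>2 = D ^ 4 * n\<^sup>2 / (real N)\<^sup>2"
    proof -
      have "(D / sqrt (real N)) * (D / sqrt (real N)) = D * D / real N" by simp
      moreover have "(D / sqrt (real N) * n)\<^sup>2 = D\<^sup>2 * n\<^sup>2 / real N" by (simp add: power_mult_distrib power_divide)
      ultimately show ?thesis by (simp add: power2_eq_square power4_eq_xxxx)
    qed
    finally show ?thesis by simp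
  qed
  show ?thesis
  proof (rule Lim_null_comparison)
    show "\<forall>\<^sub>F N in sequentially. norm (rem_term N c) \<le> 2 * (n * (n * (D ^ 4 * n\<^sup>2))) * (conv N / (real N)\<^sup>2)"
      using eventually_ge_at_top[of 1] by eventually_elim (rule bnd)
    show "(\<lambda>N. 2 * (n * (n * (D ^ 4 * n\<^sup>2))) * (conv N / (real N)\<^sup>2)) \<longlonglongrightarrow> 0"
      unfolding conv_def by (intro tendsto_mult_right_zero l2_convolution_square_tendsto r0 r2)
  qed
qed

lemma fluctuation_char_tendsto:
  "(\<lambda>N. \<integral>\<omega>. iexp (\<Sum>i\<in>UNIV. c i * fluctuation N i \<omega>) \<partial>M) \<longlonglongrightarrow>
     exp (- ((\<Sum>i\<in>UNIV. \<Sum>j\<in>UNIV. c i * c j * limit_cov i j) / 2))"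
proof -
  have "(\<lambda>N. (\<integral>\<omega>. iexp (\<Sum>i\<in>UNIV. c i * fluctuation N i \<omega>) \<partial>M) - exp (- (var_term N c / 2))) \<longlonglongrightarrow> 0"
  proof (rule Lim_null_comparison)
    show "\<forall>\<^sub>F N in sequentially. norm ((\<integral>\<omega>. iexp (\<Sum>i\<in>UNIV. c i * fluctuation N i \<omega>) \<partial>M) - exp (- (var_term N c / 2))) \<le> 2 * sqrt (rem_term N c)"
      using eventually_ge_at_top[of 1] by eventually_elim (rule fluctuation_quadratic(3))
    show "(\<lambda>N. 2 * sqrt (rem_term N c)) \<longlonglongrightarrow> 0"
      using tendsto_real_sqrt[OF rem_term_tendsto[of c]] by (intro tendsto_mult_right_zero) simp
  qed
  moreover have "(\<lambda>N. complex_of_real (exp (- (var_term N c / 2)))) \<longlonglongrightarrow> of_real (exp (- ((\<Sum>i\<in>UNIV. \<Sum>j\<in>UNIV. c i * c j * limit_cov i j) / 2)))"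
    by (intro tendsto_of_real tendsto_exp tendsto_minus tendsto_divide var_term_tendsto tendsto_const) simp
  ultimately show ?thesis using tendsto_add by fastforce
qed

text \<open>Inherited from the variances \<open>var_term\<close>, whose limit it is.\<close>

lemma limit_cov_psd: "(\<Sum>i\<in>UNIV. \<Sum>j\<in>UNIV. c i * c j * limit_cov i j) \<ge> 0"
proof (rule LIMSEQ_le_const[OF var_term_tendsto])
  show "\<exists>N. \<forall>n\<ge>N. 0 \<le> var_term n c"
    using fluctuation_quadratic(2)[of _ c, symmetric] by (intro exI[of _ 1]) simp
qed

lemma limit_cov_sym: "limit_cov i j = limit_cov j i"
proof -
  have "(\<Sum>\<^sub>\<infinity>m. (\<rho> i j m)\<^sup>2) = (\<Sum>\<^sub>\<infinity>m. (\<rho> j i (- m))\<^sup>2)"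
    using cov_sym[of i j] by simp
  also have "\<dots> = (\<Sum>\<^sub>\<infinity>m. (\<rho> j i m)\<^sup>2)"
    using infsum_reindex[of uminus "UNIV :: int set" "\<lambda>m. (\<rho> j i m)\<^sup>2"] by (simp add: inj_def o_def surj_uminus)
  finally show ?thesis by (simp add: limit_cov_def)
qed

end

end

section \<open>Convergence in law of random vectors\<close>

lemma borel_measurable_vec_lambda [measurable (raw)]:
  fixes f :: "'n::finite \<Rightarrow> 'a \<Rightarrow> real"
  assumes "\<And>i. f i \<in> borel_measurable M"
  shows "(\<lambda>x. \<chi> i. f i x) \<in> borel_measurable M"
  using assms by (subst borel_measurable_euclidean_space) (auto simp: Basis_vec_def inner_axis)

text \<open>Levy's continuity theorem for test functions that are sums of products of functions of one
  coordinate. Polynomials in truncated coordinates are of this form, and by Stone--Weierstrass they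
  approximate every continuous function on a box; the second moments control what lies outside.\<close>

lemma borel_measurable_vec_nth [measurable (raw)]:
  fixes f :: "'a \<Rightarrow> real ^ 'n"
  assumes "f \<in> borel_measurable M"
  shows "(\<lambda>x. f x $ i) \<in> borel_measurable M"
  using assms by (rule borel_measurable_continuous_on[rotated]) (intro continuous_intros)

text \<open>A list of products makes closure under addition a concatenation and closure under
  multiplication an induction.\<close>

definition prod_sum_form :: "(real ^ 'n \<Rightarrow> real) \<Rightarrow> bool" where
  "prod_sum_form h \<longleftrightarrow> (\<exists>fs :: ('n \<Rightarrow> real \<Rightarrow> real) list.
     (\<forall>f\<in>set fs. \<forall>i. continuous_on UNIV (f i) \<and> bounded (range (f i))) \<and>
     h = (\<lambda>x. \<Sum>f\<leftarrow>fs. \<Prod>i\<in>UNIV. f i (x $ i)))"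

lemma prod_sum_form_coordinate:
  assumes "continuous_on UNIV g" "bounded (range g)"
  shows "prod_sum_form (\<lambda>x :: real ^ 'n. g (x $ i))"
  unfolding prod_sum_form_def
proof (intro exI conjI)
  let ?f = "\<lambda>j y. if j = i then g y else 1"
  show "\<forall>f\<in>set [?f]. \<forall>i. continuous_on UNIV (f i) \<and> bounded (range (f i))"
    using assms by auto
  show "(\<lambda>x :: real ^ 'n. g (x $ i)) = (\<lambda>x. \<Sum>f\<leftarrow>[?f]. \<Prod>i\<in>UNIV. f i (x $ i))"
    by simp
qed

lemma prod_sum_form_add:
  assumes "prod_sum_form g" "prod_sum_form h"
  shows "prod_sum_form (\<lambda>x. g x + h x)"
proof -
  from assms obtain fs gs where
    "\<forall>f\<in>set fs. \<forall>i. continuous_on UNIV (f i) \<and> bounded (range (f i))" "g = (\<lambda>x. \<Sum>f\<leftarrow>fs. \<Prod>i\<in>UNIV. f i (x $ i))"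
    "\<forall>f\<in>set gs. \<forall>i. continuous_on UNIV (f i) \<and> bounded (range (f i))" "h = (\<lambda>x. \<Sum>f\<leftarrow>gs. \<Prod>i\<in>UNIV. f i (x $ i))"
    unfolding prod_sum_form_def by blast
  then show ?thesis unfolding prod_sum_form_def by (intro exI[of _ "fs @ gs"]) auto
qed

lemma prod_sum_form_sum:
  fixes h :: "'i \<Rightarrow> real ^ 'n \<Rightarrow> real"
  assumes "finite I" "\<And>i. i \<in> I \<Longrightarrow> prod_sum_form (h i)"
  shows "prod_sum_form (\<lambda>x. \<Sum>i\<in>I. h i x)"
  using assms
proof (induction I rule: finite_induct)
  case empty
  then show ?case using prod_sum_form_coordinate[of "\<lambda>_. 0" undefined] by simp
qed (simp add: prod_sum_form_add)

lemma bounded_range_mult: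
  fixes f g :: "'a \<Rightarrow> real"
  assumes "bounded (range f)" "bounded (range g)"
  shows "bounded (range (\<lambda>x. f x * g x))"
proof -
  from assms obtain B C where "\<And>x. norm (f x) \<le> B" "\<And>x. norm (g x) \<le> C"
    unfolding bounded_iff by auto
  moreover from this have "0 \<le> B" using order_trans[OF norm_ge_zero] by blast
  ultimately have "norm (f x * g x) \<le> B * C" for x unfolding norm_mult
    by (intro mult_mono) auto
  then show ?thesis unfolding bounded_iff by auto
qed

lemma prod_sum_form_mult:
  fixes g h :: "real ^ 'n \<Rightarrow> real"
  assumes "prod_sum_form g" "prod_sum_form h"
  shows "prod_sum_form (\<lambda>x. g x * h x)"
proof -
  have one: "prod_sum_form (\<lambda>x :: real ^ 'n. (\<Prod>i\<in>UNIV. f i (x $ i)) * h x)"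
    if f: "\<forall>i. continuous_on UNIV (f i) \<and> bounded (range (f i))" for f
  proof -
    from assms(2) obtain gs where gs: "\<forall>f\<in>set gs. \<forall>i. continuous_on UNIV (f i) \<and> bounded (range (f i))"
      and h: "h = (\<lambda>x. \<Sum>f\<leftarrow>gs. \<Prod>i\<in>UNIV. f i (x $ i))"
      unfolding prod_sum_form_def by blast
    show ?thesis unfolding prod_sum_form_def
    proof (intro exI[of _ "map (\<lambda>g i y. f i y * g i y) gs"] conjI)
      show "\<forall>f\<in>set (map (\<lambda>g i y. f i y * g i y) gs). \<forall>i. continuous_on UNIV (f i) \<and> bounded (range (f i))"
        using f gs by (auto intro!: continuous_on_mult bounded_range_mult)
      show "(\<lambda>x. (\<Prod>i\<in>UNIV. f i (x $ i)) * h x) = (\<lambda>x. \<Sum>f\<leftarrow>map (\<lambda>g i y. f i y * g i y) gs. \<Prod>i\<in>UNIV. f i (x $ i))"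
        unfolding h by (simp add: o_def prod.distrib sum_list_const_mult)
    qed
  qed
  from assms(1) obtain fs where fs: "\<forall>f\<in>set fs. \<forall>i. continuous_on UNIV (f i) \<and> bounded (range (f i))"
    and g: "g = (\<lambda>x. \<Sum>f\<leftarrow>fs. \<Prod>i\<in>UNIV. f i (x $ i))"
    unfolding prod_sum_form_def by blast
  from fs show ?thesis unfolding g
  proof (induction fs)
    case Nil
    then show ?case using prod_sum_form_coordinate[of "\<lambda>_. 0" undefined] by simp
  next
    case (Cons f fs)
    then show ?case using prod_sum_form_add[OF one[of f]] by (simp add: distrib_right)
  qed
qed

definition truncate :: "real \<Rightarrow> real \<Rightarrow> real" where
  "truncate K y = max (- K) (min K y)"

lemma truncate_bound: "K \<ge> 0 \<Longrightarrow> \<bar>truncate K y\<bar> \<le> K"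
  by (auto simp: truncate_def)

lemma truncate_id: "\<bar>y\<bar> \<le> K \<Longrightarrow> truncate K y = y"
  by (auto simp: truncate_def)

lemma continuous_truncate: "continuous_on UNIV (truncate K)"
  unfolding truncate_def by (intro continuous_intros)

lemma bounded_truncate: "K \<ge> 0 \<Longrightarrow> bounded (range (truncate K))"
  unfolding bounded_iff using truncate_bound by auto

text \<open>The class admits bounded factors only, hence the truncation. It contains the truncated
  coordinates and constants and is closed under sums and products, so it contains all polynomials in
  them.\<close>

lemma polynomial_prod_sum_form:
  assumes "real_polynomial_function p" and K: "K \<ge> 0"
  shows "prod_sum_form (\<lambda>x :: real ^ 'n. p (\<chi> i. truncate K (x $ i)))"
  using assms(1)
proof (induction p rule: real_polynomial_function.induct)
  case (linear f)
  have "f (\<chi> i. truncate K (x $ i)) = (\<Sum>i\<in>UNIV. truncate K (x $ i) * f (axis i 1))" for x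
  proof -
    interpret bounded_linear f by fact
    have "f (\<chi> i. truncate K (x $ i)) = f (\<Sum>i\<in>UNIV. truncate K (x $ i) *\<^sub>R axis i 1)"
      using basis_expansion[of "\<chi> i. truncate K (x $ i)"] by (simp add: scalar_mult_eq_scaleR)
    then show ?thesis by (simp add: sum scaleR)
  qed
  then show ?case
    using K by (auto intro!: prod_sum_form_sum prod_sum_form_coordinate[of "\<lambda>y. truncate K y * _"]
        continuous_on_mult continuous_truncate bounded_range_mult bounded_truncate)
next
  case (const c)
  then show ?case using prod_sum_form_coordinate[of "\<lambda>_. c"] by simp
qed (auto intro: prod_sum_form_add prod_sum_form_mult)

lemma prod_sum_form_integral_tendsto:
  fixes X :: "nat \<Rightarrow> 'a \<Rightarrow> real ^ 'n"
  assumes M: "prob_space M" and Q: "prob_space Q" and sQ[measurable_cong]: "sets Q = sets borel"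
    and X[measurable]: "\<And>n. X n \<in> borel_measurable M"
    and ch: "\<And>c. (\<lambda>n. \<integral>\<omega>. iexp (c \<bullet> X n \<omega>) \<partial>M) \<longlonglongrightarrow> (\<integral>x. iexp (c \<bullet> x) \<partial>Q)"
    and h: "prod_sum_form h"
  shows "(\<lambda>n. \<integral>\<omega>. h (X n \<omega>) \<partial>M) \<longlonglongrightarrow> (\<integral>x. h x \<partial>Q)"
proof -
  interpret M: prob_space M by fact
  interpret Q: prob_space Q by fact
  have one: "(\<forall>n. integrable M (\<lambda>\<omega>. \<Prod>i\<in>UNIV. f i (X n \<omega> $ i))) \<and> integrable Q (\<lambda>x. \<Prod>i\<in>UNIV. f i (x $ i)) \<and>
      (\<lambda>n. \<integral>\<omega>. (\<Prod>i\<in>UNIV. f i (X n \<omega> $ i)) \<partial>M) \<longlonglongrightarrow> (\<integral>x. (\<Prod>i\<in>UNIV. f i (x $ i)) \<partial>Q)"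
    if f: "\<forall>i. continuous_on UNIV (f i) \<and> bounded (range (f i))" for f :: "'n \<Rightarrow> real \<Rightarrow> real"
  proof -
    have "\<forall>i. \<exists>B. \<forall>x. norm (f i x) \<le> B" using f by (auto simp: bounded_iff)
    then obtain B where B: "\<And>i x. \<bar>f i x\<bar> \<le> B i" by (auto simp: choice_iff)
    \<comment> \<open>The factors are scaled into [-1, 1] as \<open>char_tendsto_prod\<close>
      demands; the \<open>+ 1\<close> makes the divisor positive.\<close>
    define C where "C i = B i + 1" for i
    have C: "C i > 0" "\<bar>f i x\<bar> \<le> C i" for i x
      using B[of i x] by (auto simp: C_def)
    have fm[measurable]: "f i \<in> borel_measurable borel" for i
      using f by (intro borel_measurable_continuous_onI) auto
    have "(\<lambda>n. \<integral>\<omega>. (\<Prod>i\<in>UNIV. f i (X n \<omega> $ i) / C i) \<partial>M) \<longlonglongrightarrow> (\<integral>x. (\<Prod>i\<in>UNIV. f i (x $ i) / C i) \<partial>Q)"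
    proof (rule char_tendsto_prod[OF M Q, where X="\<lambda>n i \<omega>. X n \<omega> $ i" and X'="\<lambda>i x. x $ i" and f="\<lambda>i x. f i x / C i" and I=UNIV])
      show "(\<lambda>n. \<integral>\<omega>. iexp (\<Sum>i\<in>K. t i * X n \<omega> $ i) \<partial>M) \<longlonglongrightarrow> (\<integral>x. iexp (\<Sum>i\<in>K. t i * x $ i) \<partial>Q)" for K and t :: "'n \<Rightarrow> real"
      proof -
        have "(\<chi> i. if i \<in> K then t i else 0) \<bullet> x = (\<Sum>i\<in>K. t i * x $ i)" for x :: "real ^ 'n"
        proof -
          have "(\<chi> i. if i \<in> K then t i else 0) \<bullet> x = (\<Sum>i\<in>UNIV. if i \<in> K then t i * x $ i else 0)"
            unfolding inner_vec_def by (rule sum.cong) auto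
          also have "\<dots> = (\<Sum>i\<in>K. t i * x $ i)" by (simp add: sum.If_cases)
          finally show ?thesis .
        qed
        then show ?thesis using ch[of "\<chi> i. if i \<in> K then t i else 0"] by (simp only:)
      qed
      show "continuous_on UNIV (\<lambda>x. f i x / C i)" for i
        using f C(1)[of i] by (intro continuous_intros) auto
      show "\<bar>f i x / C i\<bar> \<le> 1" for i x using C(1)[of i] C(2)[of i x] by (simp add: abs_divide)
    qed auto
    from tendsto_mult[OF tendsto_const[of "\<Prod>i\<in>UNIV. C i"] this]
    have "(\<lambda>n. \<integral>\<omega>. (\<Prod>i\<in>UNIV. f i (X n \<omega> $ i)) \<partial>M) \<longlonglongrightarrow> (\<integral>x. (\<Prod>i\<in>UNIV. f i (x $ i)) \<partial>Q)"
    proof -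
      have nz: "(\<Prod>i\<in>UNIV. C i) \<noteq> 0" using C(1) by (simp add: less_imp_neq[symmetric])
      assume "(\<lambda>n. (\<Prod>i\<in>UNIV. C i) * (\<integral>\<omega>. (\<Prod>i\<in>UNIV. f i (X n \<omega> $ i) / C i) \<partial>M)) \<longlonglongrightarrow> (\<Prod>i\<in>UNIV. C i) * (\<integral>x. (\<Prod>i\<in>UNIV. f i (x $ i) / C i) \<partial>Q)"
      then show ?thesis using nz by (simp add: prod_dividef)
    qed
    moreover have "\<bar>\<Prod>i\<in>UNIV. f i (y i)\<bar> \<le> (\<Prod>i\<in>UNIV. C i)" for y
      unfolding abs_prod using C by (intro prod_mono) auto
    then have "integrable M (\<lambda>\<omega>. \<Prod>i\<in>UNIV. f i (X n \<omega> $ i))" "integrable Q (\<lambda>x. \<Prod>i\<in>UNIV. f i (x $ i))" for n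
      by (auto intro!: M.integrable_bounded_by[of _ "\<Prod>i\<in>UNIV. C i"] Q.integrable_bounded_by[of _ "\<Prod>i\<in>UNIV. C i"])
    ultimately show ?thesis by blast
  qed
  from h obtain fs where fs: "\<forall>f\<in>set fs. \<forall>i. continuous_on UNIV (f i) \<and> bounded (range (f i))"
    and h: "h = (\<lambda>x. \<Sum>f\<leftarrow>fs. \<Prod>i\<in>UNIV. f i (x $ i))"
    unfolding prod_sum_form_def by blast
  from fs have "(\<forall>n. integrable M (\<lambda>\<omega>. \<Sum>f\<leftarrow>fs. \<Prod>i\<in>UNIV. f i (X n \<omega> $ i))) \<and> integrable Q (\<lambda>x. \<Sum>f\<leftarrow>fs. \<Prod>i\<in>UNIV. f i (x $ i)) \<and>
     (\<lambda>n. \<integral>\<omega>. (\<Sum>f\<leftarrow>fs. \<Prod>i\<in>UNIV. f i (X n \<omega> $ i)) \<partial>M) \<longlonglongrightarrow> (\<integral>x. (\<Sum>f\<leftarrow>fs. \<Prod>i\<in>UNIV. f i (x $ i)) \<partial>Q)"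
  proof (induction fs)
    case (Cons f fs)
    then show ?case using one[of f] by (auto intro!: tendsto_add)
  qed simp
  then show ?thesis unfolding h by blast
qed

text \<open>A pointwise Chebyshev inequality: where truncation at \<open>K\<close> changes the
  point, the sum of squares is at least K^2.\<close>

lemma truncate_error:
  fixes f :: "real ^ 'n \<Rightarrow> real"
  assumes f: "\<And>x. \<bar>f x\<bar> \<le> C" and K: "K > 0"
  shows "\<bar>f x - f (\<chi> i. truncate K (x $ i))\<bar> \<le> 2 * C * (\<Sum>i\<in>UNIV. (x $ i)\<^sup>2) / K\<^sup>2"
proof (cases "\<forall>i. \<bar>x $ i\<bar> \<le> K")
  case True
  then have "(\<chi> i. truncate K (x $ i)) = x" by (simp add: vec_eq_iff truncate_id)
  moreover have "C \<ge> 0" using f[of x] by linarith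
  ultimately show ?thesis by (simp add: sum_nonneg)
next
  case False
  then obtain i where "\<bar>x $ i\<bar> > K" by (auto simp: not_le)
  then have "K\<^sup>2 \<le> (x $ i)\<^sup>2" using K by (simp add: abs_le_square_iff[symmetric])
  also have "\<dots> \<le> (\<Sum>i\<in>UNIV. (x $ i)\<^sup>2)" by (rule member_le_sum) auto
  finally have "1 \<le> (\<Sum>i\<in>UNIV. (x $ i)\<^sup>2) / K\<^sup>2" using K by simp
  then have "2 * C * 1 \<le> 2 * C * ((\<Sum>i\<in>UNIV. (x $ i)\<^sup>2) / K\<^sup>2)"
    using f[of x] by (intro mult_left_mono) auto
  moreover have "\<bar>f x - f (\<chi> i. truncate K (x $ i))\<bar> \<le> 2 * C"
    using f[of x] f[of "\<chi> i. truncate K (x $ i)"] by linarith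
  ultimately show ?thesis by simp
qed

lemma truncate_approximation:
  fixes f h :: "real ^ 'n \<Rightarrow> real"
  assumes R: "prob_space R" and Y[measurable]: "Y \<in> borel_measurable R"
    and [measurable]: "f \<in> borel_measurable borel" "h \<in> borel_measurable borel"
    and C: "\<And>x. \<bar>f x\<bar> \<le> C" and hb: "\<And>x. \<bar>h x\<bar> \<le> D"
    and fh: "\<And>x. \<bar>f (\<chi> i. truncate K (x $ i)) - h x\<bar> \<le> e" and K: "K > 0"
    and Y2: "\<And>i. integrable R (\<lambda>\<omega>. (Y \<omega> $ i)\<^sup>2)" "\<And>i. (\<integral>\<omega>. (Y \<omega> $ i)\<^sup>2 \<partial>R) \<le> B"
  shows "\<bar>(\<integral>\<omega>. f (Y \<omega>) \<partial>R) - (\<integral>\<omega>. h (Y \<omega>) \<partial>R)\<bar> \<le> 2 * C * (real (card (UNIV :: 'n set)) * B) / K\<^sup>2 + e"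
proof -
  interpret R: prob_space R by fact
  have C0: "C \<ge> 0" using C[of 0] by linarith
  have i: "integrable R (\<lambda>\<omega>. f (Y \<omega>))" "integrable R (\<lambda>\<omega>. h (Y \<omega>))"
    using C hb by (auto intro!: R.integrable_bounded_by)
  have "\<bar>(\<integral>\<omega>. f (Y \<omega>) \<partial>R) - (\<integral>\<omega>. h (Y \<omega>) \<partial>R)\<bar> = \<bar>\<integral>\<omega>. f (Y \<omega>) - h (Y \<omega>) \<partial>R\<bar>" using i by simp
  also have "\<dots> \<le> (\<integral>\<omega>. \<bar>f (Y \<omega>) - h (Y \<omega>)\<bar> \<partial>R)" by (rule integral_abs_bound)
  also have "\<dots> \<le> (\<integral>\<omega>. 2 * C * (\<Sum>i\<in>UNIV. (Y \<omega> $ i)\<^sup>2) / K\<^sup>2 + e \<partial>R)"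
  proof (rule Bochner_Integration.integral_mono)
    show "integrable R (\<lambda>\<omega>. 2 * C * (\<Sum>i\<in>UNIV. (Y \<omega> $ i)\<^sup>2) / K\<^sup>2 + e)"
      using Y2(1) by auto
    show "\<bar>f (Y \<omega>) - h (Y \<omega>)\<bar> \<le> 2 * C * (\<Sum>i\<in>UNIV. (Y \<omega> $ i)\<^sup>2) / K\<^sup>2 + e" for \<omega>
      using truncate_error[of f C K "Y \<omega>", OF C K] fh[of "Y \<omega>"] by linarith
  qed (use i in auto)
  also have "\<dots> = 2 * C * (\<Sum>i\<in>UNIV. \<integral>\<omega>. (Y \<omega> $ i)\<^sup>2 \<partial>R) / K\<^sup>2 + e"
    using Y2(1) by (simp add: R.prob_space)
  also have "\<dots> \<le> 2 * C * (\<Sum>i\<in>(UNIV :: 'n set). B) / K\<^sup>2 + e"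
    using C0 Y2(2) by (intro add_right_mono divide_right_mono mult_left_mono sum_mono) auto
  finally show ?thesis by simp
qed

lemma converges_in_law_charI:
  fixes X :: "nat \<Rightarrow> 'a \<Rightarrow> real ^ 'n"
  assumes M: "prob_space M" and Q: "prob_space Q" and sQ[measurable_cong]: "sets Q = sets borel"
    and X[measurable]: "\<And>n. X n \<in> borel_measurable M"
    and ch: "\<And>c. (\<lambda>n. \<integral>\<omega>. iexp (c \<bullet> X n \<omega>) \<partial>M) \<longlonglongrightarrow> (\<integral>x. iexp (c \<bullet> x) \<partial>Q)"
    and X2: "\<And>n i. integrable M (\<lambda>\<omega>. (X n \<omega> $ i)\<^sup>2)" "\<And>n i. (\<integral>\<omega>. (X n \<omega> $ i)\<^sup>2 \<partial>M) \<le> B"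
    and Q2: "\<And>i. integrable Q (\<lambda>x. (x $ i)\<^sup>2)" "\<And>i. (\<integral>x. (x $ i)\<^sup>2 \<partial>Q) \<le> B"
  shows "converges_in_law M X Q"
  unfolding converges_in_law_def
proof (intro conjI allI impI X)
  fix f :: "real ^ 'n \<Rightarrow> real" assume f: "continuous_on UNIV f \<and> bounded (range f)"
  interpret M: prob_space M by fact
  interpret Q: prob_space Q by fact
  have fm[measurable]: "f \<in> borel_measurable borel"
    using f by (intro borel_measurable_continuous_onI) auto
  obtain C where C: "\<And>x. \<bar>f x\<bar> \<le> C" using f by (auto simp: bounded_iff)
  have C0: "C \<ge> 0" using C[of 0] by linarith
  define n where "n = real (card (UNIV :: 'n set))"
  have B0: "B \<ge> 0" using Q2(2) by (rule order_trans[rotated]) simp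
  show "(\<lambda>N. \<integral>\<omega>. f (X N \<omega>) \<partial>M) \<longlonglongrightarrow> (\<integral>x. f x \<partial>Q)"
  proof (rule LIMSEQ_I)
    fix \<epsilon> :: real assume \<epsilon>: "\<epsilon> > 0"
    \<comment> \<open>Makes the truncation error at most \<epsilon>/5, with \<open>+ 1\<close> for
      positivity. The budget is two fifths for each of the two laws and one fifth, with strict
      inequality, for the convergence of the polynomial integrals.\<close>
    define K where "K = sqrt (10 * C * (n * B) / \<epsilon>) + 1"
    have K: "K > 0" "K \<ge> 0" by (simp_all add: K_def add_nonneg_pos C0 B0 n_def \<epsilon> less_imp_le)
    have K2: "2 * C * (n * B) / K\<^sup>2 \<le> \<epsilon> / 5"
    proof -
      have "10 * C * (n * B) / \<epsilon> = (sqrt (10 * C * (n * B) / \<epsilon>))\<^sup>2"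
        using C0 B0 \<epsilon> by (simp add: n_def)
      also have "\<dots> \<le> K\<^sup>2" unfolding K_def by (intro power_mono) (auto simp: C0 B0 n_def \<epsilon> less_imp_le)
      finally show ?thesis using \<epsilon> K by (simp add: field_simps)
    qed
    let ?t = "\<lambda>x :: real ^ 'n. \<chi> i. truncate K (x $ i)"
    have tm[measurable]: "?t \<in> borel_measurable borel"
      by (intro borel_measurable_continuous_onI continuous_on_vec_lambda continuous_on_compose2[OF continuous_truncate] continuous_intros) auto
    define S where "S = cbox (\<chi> i. - K) ((\<chi> i. K) :: real ^ 'n)"
    have tS: "?t x \<in> S" for x
      using truncate_bound[OF K(2)] by (auto simp: S_def mem_box_cart abs_le_iff minus_le_iff)
    obtain p where p: "real_polynomial_function p" "\<And>x. x \<in> S \<Longrightarrow> \<bar>f x - p x\<bar> < \<epsilon> / 5"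
      using Stone_Weierstrass_real_polynomial_function[of S f "\<epsilon> / 5"] f \<epsilon>
      by (auto simp: S_def compact_cbox intro: continuous_on_subset)
    define h where "h x = p (?t x)" for x
    have fh: "\<bar>f (?t x) - h x\<bar> \<le> \<epsilon> / 5" for x using p(2)[OF tS[of x]] by (simp add: h_def)
    have hm[measurable]: "h \<in> borel_measurable borel"
    proof -
      have "p \<in> borel_measurable borel"
        using continuous_on_polymonial_function[of p UNIV] p(1)
        by (intro borel_measurable_continuous_onI) (simp add: real_polynomial_function_eq)
      from measurable_compose[OF tm this] show ?thesis unfolding h_def .
    qed
    have hb: "\<bar>h x\<bar> \<le> C + \<epsilon> / 5" for x using fh[of x] C[of "?t x"] by linarith
    have key: "2 * C * (n * B) / K\<^sup>2 + \<epsilon> / 5 \<le> 2 * \<epsilon> / 5" using K2 by simp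
    have kM: "\<bar>(\<integral>\<omega>. f (X N \<omega>) \<partial>M) - (\<integral>\<omega>. h (X N \<omega>) \<partial>M)\<bar> \<le> 2 * \<epsilon> / 5" for N
      by (rule order_trans[OF truncate_approximation[OF M X fm hm C hb fh K(1) X2, folded n_def] key])
    have kQ: "\<bar>(\<integral>x. f x \<partial>Q) - (\<integral>x. h x \<partial>Q)\<bar> \<le> 2 * \<epsilon> / 5"
      by (rule order_trans[OF truncate_approximation[OF Q _ fm hm C hb fh K(1) Q2, folded n_def] key]) simp
    have "prod_sum_form h" unfolding h_def by (rule polynomial_prod_sum_form[OF p(1) K(2)])
    from prod_sum_form_integral_tendsto[OF M Q sQ X ch this]
    obtain N0 where N0: "\<And>N. N \<ge> N0 \<Longrightarrow> \<bar>(\<integral>\<omega>. h (X N \<omega>) \<partial>M) - (\<integral>x. h x \<partial>Q)\<bar> < \<epsilon> / 5"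
      using LIMSEQ_D[of _ _ "\<epsilon> / 5"] \<epsilon> by fastforce
    show "\<exists>no. \<forall>N\<ge>no. norm ((\<integral>\<omega>. f (X N \<omega>) \<partial>M) - (\<integral>x. f x \<partial>Q)) < \<epsilon>"
    proof (intro exI allI impI)
      fix N assume "N \<ge> N0"
      then show "norm ((\<integral>\<omega>. f (X N \<omega>) \<partial>M) - (\<integral>x. f x \<partial>Q)) < \<epsilon>"
        using N0[of N] kM[of N] kQ \<epsilon> unfolding real_norm_def by linarith
    qed
  qed
qed

text \<open>The law is the image of a standard normal product under a Gram factor of
  \<open>R\<close>, a construction that makes no difference between regular and singular
  matrices.\<close>

lemma multivariate_normal_exists:
  fixes R :: "'n::finite \<Rightarrow> 'n \<Rightarrow> real"
  assumes sym: "\<And>i j. R i j = R j i" and psd: "\<And>c. (\<Sum>i\<in>UNIV. \<Sum>j\<in>UNIV. c i * c j * R i j) \<ge> 0"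
  obtains Q where "multivariate_normal Q 0 (\<chi> i j. R i j)"
    "\<And>c. (\<integral>x. iexp (c \<bullet> x) \<partial>Q) = exp (- ((\<Sum>i\<in>UNIV. \<Sum>j\<in>UNIV. c $ i * c $ j * R i j) / 2))"
    "\<And>i. integrable Q (\<lambda>x. (x $ i)\<^sup>2)" "\<And>i. (\<integral>x. (x $ i)\<^sup>2 \<partial>Q) = R i i"
proof -
  obtain A :: "'n \<Rightarrow> 'n \<Rightarrow> real" where "\<forall>i\<in>UNIV. \<forall>j\<in>UNIV. R i j = (\<Sum>m\<in>UNIV. A i m * A j m)"
    using psd_gram[of "UNIV :: 'n set" R, OF finite_class.finite_UNIV sym psd] by blast
  then have A: "\<And>i j. R i j = (\<Sum>m\<in>UNIV. A i m * A j m)" by simp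
  let ?N = "std_normal_product (UNIV :: 'n set)"
  let ?V = "range (\<lambda>t x. \<Sum>i\<in>UNIV. t i * x i) :: (('n \<Rightarrow> real) \<Rightarrow> real) set"
  interpret N: prob_space ?N by (rule prob_space_std_normal_product)
  have V: "gaussian_space ?N ?V" by (rule gaussian_space_std_normal_product) simp
  define L where "L i x = (\<Sum>m\<in>UNIV. A i m * x m)" for i x
  have LV: "L i \<in> ?V" for i by (auto simp: L_def[abs_def])
  note [measurable] = gaussian_space_measurable[OF V LV]
  define Z where "Z x = (\<chi> i. L i x)" for x
  have Zm[measurable]: "Z \<in> borel_measurable ?N" unfolding Z_def by measurable
  define Q where "Q = distr ?N borel Z"
  have lin: "centred_normal ?N (\<lambda>x. c \<bullet> Z x) (\<Sum>i\<in>UNIV. \<Sum>j\<in>UNIV. c $ i * c $ j * R i j)" for c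
  proof -
    have "c \<bullet> Z x = (\<Sum>m\<in>UNIV. (\<Sum>i\<in>UNIV. c $ i * A i m) * x m)" for x
      unfolding Z_def L_def inner_vec_def
      by (simp add: sum_distrib_left sum_distrib_right mult.assoc) (rule sum.swap)
    moreover have "(\<Sum>m\<in>UNIV. (\<Sum>i\<in>UNIV. c $ i * A i m)\<^sup>2) = (\<Sum>i\<in>UNIV. \<Sum>j\<in>UNIV. c $ i * c $ j * R i j)"
    proof -
      have "(\<Sum>m\<in>UNIV. (\<Sum>i\<in>UNIV. c $ i * A i m)\<^sup>2) = (\<Sum>m\<in>UNIV. \<Sum>i\<in>UNIV. \<Sum>j\<in>UNIV. c $ i * c $ j * (A i m * A j m))"
        by (simp add: power2_eq_square sum_product ac_simps)
      also have "\<dots> = (\<Sum>i\<in>UNIV. \<Sum>m\<in>UNIV. \<Sum>j\<in>UNIV. c $ i * c $ j * (A i m * A j m))"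
        by (rule sum.swap)
      also have "\<dots> = (\<Sum>i\<in>UNIV. \<Sum>j\<in>UNIV. \<Sum>m\<in>UNIV. c $ i * c $ j * (A i m * A j m))"
        by (rule sum.cong[OF refl], rule sum.swap)
      finally show ?thesis unfolding A by (simp add: sum_distrib_left)
    qed
    ultimately show ?thesis
      using centred_normal_std_normal_product[of UNIV "\<lambda>m. \<Sum>i\<in>UNIV. c $ i * A i m"] by simp
  qed
  have mean: "(\<integral>x. L i x \<partial>?N) = 0" for i by (rule gaussian_space_mean[OF V LV])
  have int_LL: "integrable ?N (\<lambda>x. L i x * L j x)" for i j
    by (rule gaussian_space_mult_integrable[OF V LV LV])
  have LL: "(\<integral>x. L i x * L j x \<partial>?N) = R i j" for i j
  proof -
    have v: "(\<integral>x. (L i x + s * L j x)\<^sup>2 \<partial>?N) = R i i + 2 * s * R i j + s\<^sup>2 * R j j" for s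
    proof -
      have "L i x + s * L j x = (\<Sum>m\<in>UNIV. (A i m + s * A j m) * x m)" for x
        unfolding L_def by (simp add: sum_distrib_left sum.distrib distrib_right mult.assoc)
      then have "(\<integral>x. (L i x + s * L j x)\<^sup>2 \<partial>?N) = (\<Sum>m\<in>UNIV. (A i m + s * A j m)\<^sup>2)"
        using centred_normal_variance[OF centred_normal_std_normal_product[of UNIV "\<lambda>m. A i m + s * A j m"]] by simp
      also have "\<dots> = R i i + 2 * s * R i j + s\<^sup>2 * R j j"
        unfolding A sum_distrib_left sum.distrib[symmetric] by (rule sum.cong) (auto simp: power2_eq_square algebra_simps)
      finally show ?thesis .
    qed
    have vj: "(\<integral>x. (L j x)\<^sup>2 \<partial>?N) = R j j"
      using centred_normal_variance[OF centred_normal_std_normal_product[of UNIV "\<lambda>m. A j m"]]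
      unfolding L_def A by (simp add: power2_eq_square)
    have "(\<integral>x. (L i x + 1 * L j x)\<^sup>2 \<partial>?N) = (\<integral>x. L i x * L i x + 2 * (L i x * L j x) + L j x * L j x \<partial>?N)"
      by (intro Bochner_Integration.integral_cong refl) (simp add: power2_eq_square algebra_simps)
    also have "\<dots> = (\<integral>x. L i x * L i x \<partial>?N) + 2 * (\<integral>x. L i x * L j x \<partial>?N) + (\<integral>x. L j x * L j x \<partial>?N)"
      using int_LL by simp
    finally show ?thesis
      using v[of 1] v[of 0] vj by (simp add: power2_eq_square)
  qed
  have Q: "prob_space Q" unfolding Q_def by (rule N.prob_space_distr) simp
  have sQ[measurable_cong]: "sets Q = sets borel" by (simp add: Q_def)
  have iQ: "(\<integral>x. f x \<partial>Q) = (\<integral>x. f (Z x) \<partial>?N)" if [measurable]: "f \<in> borel_measurable borel"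
    for f :: "real ^ 'n \<Rightarrow> 'b::{banach, second_countable_topology}"
    unfolding Q_def by (subst integral_distr) auto
  show ?thesis
  proof
    show ch: "(\<integral>x. iexp (c \<bullet> x) \<partial>Q) = exp (- ((\<Sum>i\<in>UNIV. \<Sum>j\<in>UNIV. c $ i * c $ j * R i j) / 2))" for c
      using centred_normal_char[OF lin[of c], of 1] by (subst iQ) auto
    show "integrable Q (\<lambda>x. (x $ i)\<^sup>2)" for i
      unfolding Q_def using int_LL[of i i] by (subst integrable_distr_eq) (auto simp: Z_def power2_eq_square)
    show "(\<integral>x. (x $ i)\<^sup>2 \<partial>Q) = R i i" for i
      using LL[of i i] by (subst iQ) (auto simp: Z_def power2_eq_square)
    show "multivariate_normal Q 0 (\<chi> i j. R i j)"
      unfolding multivariate_normal_def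
    proof (intro conjI allI Q sQ)
      fix c :: "real ^ 'n"
      have "distr Q borel (\<lambda>x. c \<bullet> x) = distr ?N borel (\<lambda>x. c \<bullet> Z x)"
        unfolding Q_def by (subst distr_distr) (auto simp: o_def)
      then show "\<exists>a s. s \<ge> 0 \<and> distr Q borel (\<lambda>x. c \<bullet> x) = normal_law a s"
        using centred_normalD(2,3)[OF lin[of c]] by (intro exI[of _ 0] exI[of _ "sqrt _"]) auto
    next
      have m0: "(\<integral>x. x $ i \<partial>Q) = 0" for i using mean[of i] by (subst iQ) (auto simp: Z_def)
      then show "(\<integral>x. x $ i \<partial>Q) = 0 $ i" for i by simp
      show "cov Q (\<lambda>x. x $ i) (\<lambda>x. x $ j) = (\<chi> i j. R i j) $ i $ j" for i j
        unfolding cov_def m0 using LL[of i j] by (subst iQ) (auto simp: Z_def)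
    qed
  qed
qed

lemma (in stationary_gaussian) fluctuation_clt:
  assumes l2: "\<And>i j. (\<lambda>m. (\<rho> i j m)\<^sup>2) summable_on UNIV"
  obtains Q where "multivariate_normal Q 0 (\<chi> i j. limit_cov i j)"
    "converges_in_law M (\<lambda>N \<omega>. \<chi> i. fluctuation N i \<omega>) Q"
proof -
  interpret prob_space M by (rule prob)
  note [measurable] = gaussian_space_measurable[OF V X]
  have fm[measurable]: "fluctuation N i \<in> borel_measurable M" for N i
    unfolding fluctuation_def[abs_def] by measurable
  obtain Q where Q: "multivariate_normal Q 0 (\<chi> i j. limit_cov i j)"
    and Qch: "\<And>c. (\<integral>x. iexp (c \<bullet> x) \<partial>Q) = exp (- ((\<Sum>i\<in>UNIV. \<Sum>j\<in>UNIV. c $ i * c $ j * limit_cov i j) / 2))"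
    and Q2: "\<And>i. integrable Q (\<lambda>x. (x $ i)\<^sup>2)" "\<And>i. (\<integral>x. (x $ i)\<^sup>2 \<partial>Q) = limit_cov i i"
    using multivariate_normal_exists[of limit_cov, OF limit_cov_sym[OF l2] limit_cov_psd[OF l2]] by blast
  define \<delta> where "\<delta> i j = (if j = i then 1 else 0 :: real)" for i j :: 'n
  have \<delta>: "(\<Sum>j\<in>UNIV. \<delta> i j * g j) = g i" for i g
    by (simp add: \<delta>_def if_distrib[of "\<lambda>x. x * _"] cong: if_cong)
  \<comment> \<open>The moment bounds are demanded for every N; at N = 0 the factor
    \<open>sqrt 0\<close> makes the fluctuation vanish.\<close>
  have f0: "fluctuation 0 i \<omega> = 0" for i \<omega> by (simp add: fluctuation_def)
  have F2: "integrable M (\<lambda>\<omega>. (fluctuation N i \<omega>)\<^sup>2)" "N \<ge> 1 \<Longrightarrow> (\<integral>\<omega>. (fluctuation N i \<omega>)\<^sup>2 \<partial>M) = var_term N (\<delta> i)" for N i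
  proof -
    show "N \<ge> 1 \<Longrightarrow> (\<integral>\<omega>. (fluctuation N i \<omega>)\<^sup>2 \<partial>M) = var_term N (\<delta> i)"
      using fluctuation_quadratic(2)[of N "\<delta> i"] by (simp add: \<delta>)
    show "integrable M (\<lambda>\<omega>. (fluctuation N i \<omega>)\<^sup>2)"
      using fluctuation_quadratic(1)[of N "\<delta> i"] by (cases "N = 0") (auto simp: \<delta> f0)
  qed
  have "\<exists>B. \<forall>N. \<bar>var_term N (\<delta> i)\<bar> \<le> B" for i
    using convergent_imp_Bseq[OF convergentI[OF var_term_tendsto[OF l2, of "\<delta> i"]]] by (auto simp: Bseq_def)
  then obtain B where B: "\<And>i N. \<bar>var_term N (\<delta> i)\<bar> \<le> B i" by metis
  define C where "C = (\<Sum>i\<in>UNIV. B i + \<bar>limit_cov i i\<bar>)"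
  have B0: "B i \<ge> 0" for i using B[of 0 i] by linarith
  have C: "B i \<le> C" "limit_cov i i \<le> C" for i
  proof -
    have "B i + \<bar>limit_cov i i\<bar> \<le> C" unfolding C_def by (rule member_le_sum) (auto simp: B0 add_nonneg_nonneg)
    then show "B i \<le> C" "limit_cov i i \<le> C" using B0[of i] by linarith+
  qed
  have "converges_in_law M (\<lambda>N \<omega>. \<chi> i. fluctuation N i \<omega>) Q"
  proof (rule converges_in_law_charI[OF prob, where B=C])
    show "prob_space Q" "sets Q = sets borel" using Q by (auto simp: multivariate_normal_def)
    show "(\<lambda>\<omega>. \<chi> i. fluctuation N i \<omega>) \<in> borel_measurable M" for N by measurable
    show "(\<lambda>N. \<integral>\<omega>. iexp (c \<bullet> (\<chi> i. fluctuation N i \<omega>)) \<partial>M) \<longlonglongrightarrow> (\<integral>x. iexp (c \<bullet> x) \<partial>Q)" for c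
      using fluctuation_char_tendsto[OF l2, of "\<lambda>i. c $ i"] unfolding Qch by (simp add: inner_vec_def del: of_real_sum)
    show "integrable M (\<lambda>\<omega>. ((\<chi> i. fluctuation N i \<omega>) $ i)\<^sup>2)" for N i using F2(1) by simp
    show "(\<integral>\<omega>. ((\<chi> i. fluctuation N i \<omega>) $ i)\<^sup>2 \<partial>M) \<le> C" for N i
    proof (cases "N = 0")
      case True
      then show ?thesis using C(1)[of i] B0[of i] by (simp add: f0)
    next
      case False
      then have "(\<integral>\<omega>. ((\<chi> i. fluctuation N i \<omega>) $ i)\<^sup>2 \<partial>M) = var_term N (\<delta> i)" using F2(2)[of N i] by simp
      also have "\<dots> \<le> C" using B[of N i] C(1)[of i] by linarith
      finally show ?thesis .
    qed
    show "integrable Q (\<lambda>x. (x $ i)\<^sup>2)" "(\<integral>x. (x $ i)\<^sup>2 \<partial>Q) \<le> C" for i using Q2 C(2) by auto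
  qed
  with Q that show ?thesis by blast
qed

section \<open>A strong law along polynomial subsequences\<close>

text \<open>If k^m <= N <= (k+1)^m, monotonicity encloses \<open>s N / N\<close> between the
  averages at the two powers, up to factors that are m-th powers of k/(k+1) and (k+1)/k and tend to
  1.\<close>

lemma average_tendsto_from_powers:
  fixes s :: "nat \<Rightarrow> real"
  assumes mono: "mono s" and pos: "\<And>n. s n \<ge> 0" and m: "m \<ge> 1"
    and lim: "(\<lambda>n. s (Suc n ^ m) / real (Suc n) ^ m) \<longlonglongrightarrow> \<mu>"
  shows "(\<lambda>N. s N / real N) \<longlonglongrightarrow> \<mu>"
proof -
  define a where "a n = s (n ^ m) / real n ^ m" for n
  define lo where "lo n = a n * (real n / real (Suc n)) ^ m" for n
  define up where "up n = a (Suc n) * (real (Suc n) / real n) ^ m" for n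
  have a: "a \<longlonglongrightarrow> \<mu>" using lim by (subst filterlim_sequentially_Suc[symmetric]) (simp add: a_def)
  have q: "(\<lambda>n. real n / real (Suc n)) \<longlonglongrightarrow> 1" by (rule LIMSEQ_n_over_Suc_n)
  have q': "(\<lambda>n. real (Suc n) / real n) \<longlonglongrightarrow> 1"
  proof -
    have "(\<lambda>n. inverse (real n / real (Suc n))) \<longlonglongrightarrow> inverse 1" by (intro tendsto_intros q) simp
    then show ?thesis by simp
  qed
  have lo: "lo \<longlonglongrightarrow> \<mu>" using tendsto_mult[OF a tendsto_power[OF q, of m]] by (simp only: lo_def[abs_def] power_one mult_1_right)
  have up: "up \<longlonglongrightarrow> \<mu>" using tendsto_mult[OF LIMSEQ_Suc[OF a] tendsto_power[OF q', of m]] by (simp only: up_def[abs_def] power_one mult_1_right)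
  define k where "k N = nat \<lfloor>root m (real N)\<rfloor>" for N
  have root_pow: "root m (real N) ^ m = real N" for N using m by (intro real_root_pow_pos2) auto
  have k1: "k N ^ m \<le> N" for N
  proof -
    have "real (k N) \<le> root m (real N)" by (simp add: k_def real_root_ge_zero)
    then have "real (k N) ^ m \<le> root m (real N) ^ m" by (intro power_mono) auto
    then have "real (k N ^ m) \<le> real N" unfolding root_pow by simp
    then show ?thesis by linarith
  qed
  have k2: "N \<le> Suc (k N) ^ m" for N
  proof -
    have "root m (real N) \<le> real (Suc (k N))" by (simp add: k_def real_root_ge_zero) linarith
    then have "root m (real N) ^ m \<le> real (Suc (k N)) ^ m" using m by (intro power_mono real_root_ge_zero) auto
    then have "real N \<le> real (Suc (k N) ^ m)" unfolding root_pow by simp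
    then show ?thesis by linarith
  qed
  have k3: "k N \<ge> Z" if "N \<ge> Z ^ m" for N Z
  proof -
    have "real (Z ^ m) \<le> real N" using that by linarith
    then have "root m (real Z ^ m) \<le> root m (real N)" using m by (intro real_root_le_mono) auto
    then have "real Z \<le> root m (real N)" using m by (simp add: real_root_power_cancel)
    then show ?thesis by (simp add: k_def le_nat_floor)
  qed
  have kf: "filterlim k at_top sequentially"
    unfolding filterlim_at_top eventually_sequentially using k3 by blast
  show ?thesis
  proof (rule tendsto_sandwich[OF _ _ filterlim_compose[OF lo kf] filterlim_compose[OF up kf]])
    have ev: "\<forall>\<^sub>F N in sequentially. k N \<ge> 1 \<and> N \<ge> 1"
      using kf eventually_ge_at_top[of "1::nat"] unfolding filterlim_at_top by (intro eventually_conj) auto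
    show "\<forall>\<^sub>F N in sequentially. lo (k N) \<le> s N / real N"
      using ev
    proof eventually_elim
      case (elim N)
      have "lo (k N) = s (k N ^ m) / real (Suc (k N)) ^ m"
        using elim by (simp add: lo_def a_def power_divide)
      also have "\<dots> \<le> s N / real N"
      proof (rule frac_le)
        show "s (k N ^ m) \<le> s N" using mono k1 by (auto dest: monoD)
        show "real N \<le> real (Suc (k N)) ^ m" using k2[of N] by (metis of_nat_le_iff of_nat_power)
      qed (use pos elim in auto)
      finally show ?case .
    qed
    show "\<forall>\<^sub>F N in sequentially. s N / real N \<le> up (k N)"
      using ev
    proof eventually_elim
      case (elim N)
      have "s N / real N \<le> s (Suc (k N) ^ m) / real (k N) ^ m"
      proof (rule frac_le)
        show "s N \<le> s (Suc (k N) ^ m)" using mono k2 by (auto dest: monoD)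
        show "real (k N) ^ m \<le> real N" using k1[of N] by (metis of_nat_le_iff of_nat_power)
      qed (use pos elim in auto)
      also have "\<dots> = up (k N)"
        using elim by (simp add: up_def a_def power_divide)
      finally show ?case .
    qed
  qed
qed

lemma AE_summable_if_integrals:
  fixes f :: "nat \<Rightarrow> 'a \<Rightarrow> real"
  assumes "\<And>n. integrable M (f n)" "\<And>n \<omega>. f n \<omega> \<ge> 0" "\<And>n. (\<integral>\<omega>. f n \<omega> \<partial>M) \<le> b n" "summable b"
  shows "AE \<omega> in M. summable (\<lambda>n. f n \<omega>)"
proof -
  have [measurable]: "f n \<in> borel_measurable M" for n using assms(1) by auto
  have b0: "b n \<ge> 0" for n by (rule order_trans[OF _ assms(3)]) (simp add: assms(2))
  have "(\<integral>\<^sup>+ \<omega>. (\<Sum>n. ennreal (f n \<omega>)) \<partial>M) = (\<Sum>n. \<integral>\<^sup>+ \<omega>. ennreal (f n \<omega>) \<partial>M)"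
    by (rule nn_integral_suminf) simp
  also have "\<dots> \<le> (\<Sum>n. ennreal (b n))"
    using assms by (intro suminf_le) (auto simp: nn_integral_eq_integral ennreal_leI)
  also have "\<dots> < top"
    using suminf_ennreal2[OF b0 assms(4)] by (simp add: less_top)
  finally have "AE \<omega> in M. (\<Sum>n. ennreal (f n \<omega>)) \<noteq> \<infinity>"
    by (intro nn_integral_noteq_infinite) auto
  then show ?thesis
    by eventually_elim (use assms(2) in \<open>auto intro!: summable_suminf_not_top\<close>)
qed

lemma AE_average_tendsto:
  fixes S :: "nat \<Rightarrow> 'a \<Rightarrow> real"
  assumes mono: "\<And>\<omega>. mono (\<lambda>N. S N \<omega>)" and pos: "\<And>N \<omega>. S N \<omega> \<ge> 0"
    and int: "\<And>N. integrable M (\<lambda>\<omega>. (S N \<omega> / real N - \<mu>)\<^sup>2)"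
    and \<gamma>: "\<gamma> > 0" and bound: "\<And>N. N \<ge> 1 \<Longrightarrow> (\<integral>\<omega>. (S N \<omega> / real N - \<mu>)\<^sup>2 \<partial>M) \<le> C * real N powr (- \<gamma>)"
  shows "AE \<omega> in M. (\<lambda>N. S N \<omega> / real N) \<longlonglongrightarrow> \<mu>"
proof -
  \<comment> \<open>With \<open>m * \<gamma> >= 2\<close> the mean square errors along n^m are of
    order n^(-2), hence summable.\<close>
  define m where "m = nat \<lceil>2 / \<gamma>\<rceil> + 1"
  have m: "m \<ge> 1" "real m * \<gamma> \<ge> 2"
  proof -
    have "real m \<ge> 2 / \<gamma>" unfolding m_def by linarith
    then show "real m * \<gamma> \<ge> 2" using \<gamma> by (simp add: field_simps)
  qed (simp add: m_def)
  define T where "T n \<omega> = (S (Suc n ^ m) \<omega> / real (Suc n ^ m) - \<mu>)\<^sup>2" for n \<omega>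
  have C: "C \<ge> 0"
    using order_trans[OF Bochner_Integration.integral_nonneg bound[of 1]] by simp
  have "AE \<omega> in M. summable (\<lambda>n. T n \<omega>)"
  proof (rule AE_summable_if_integrals[where b="\<lambda>n. C * (1 / real (Suc n) ^ 2)"])
    show "(\<integral>\<omega>. T n \<omega> \<partial>M) \<le> C * (1 / real (Suc n) ^ 2)" for n
    proof -
      have "(\<integral>\<omega>. T n \<omega> \<partial>M) \<le> C * real (Suc n ^ m) powr (- \<gamma>)"
        unfolding T_def by (rule bound) simp
      also have "real (Suc n ^ m) powr (- \<gamma>) = real (Suc n) powr (- (real m * \<gamma>))"
        by (simp add: powr_powr flip: powr_realpow)
      also have "\<dots> \<le> real (Suc n) powr (- 2)"
        using m by (intro powr_mono) auto
      also have "\<dots> = 1 / real (Suc n) ^ 2"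
        by (simp add: powr_minus powr_numeral inverse_eq_divide)
      finally show ?thesis using C by (simp add: mult_left_mono)
    qed
    show "summable (\<lambda>n. C * (1 / real (Suc n) ^ 2))"
      using inverse_power_summable[of 2, where 'a=real]
      by (intro summable_mult) (subst summable_Suc_iff[of "\<lambda>n. 1 / real n ^ 2"], simp add: inverse_eq_divide)
    show "integrable M (T n)" for n unfolding T_def[abs_def] by (rule int)
  qed (simp add: T_def)
  then show ?thesis
  proof eventually_elim
    case (elim \<omega>)
    have "(\<lambda>n. sqrt (T n \<omega>)) \<longlonglongrightarrow> sqrt 0"
      by (intro tendsto_real_sqrt summable_LIMSEQ_zero elim)
    then have "(\<lambda>n. S (Suc n ^ m) \<omega> / real (Suc n ^ m) - \<mu>) \<longlonglongrightarrow> 0"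
      unfolding T_def by (simp add: tendsto_rabs_zero_iff)
    then have "(\<lambda>n. S (Suc n ^ m) \<omega> / real (Suc n) ^ m) \<longlonglongrightarrow> \<mu>"
      by (simp add: LIM_zero_iff)
    then show ?case
      by (intro average_tendsto_from_powers[OF mono pos m(1)])
  qed
qed

text \<open>The sum is split at the square root of \<open>n\<close>.\<close>

lemma sum_powr_le:
  fixes \<alpha> :: real
  assumes \<alpha>: "0 < \<alpha>" "\<alpha> \<le> 1" and n: "n \<ge> 1"
  shows "(\<Sum>k=1..n. real k powr (- \<alpha>)) \<le> 2 * real n powr (1 - \<alpha> / 2)"
proof -
  have "real k powr (- \<alpha>) \<le> (if real k \<le> sqrt (real n) then 1 else 0) + real n powr (- \<alpha> / 2)" if "k \<in> {1..n}" for k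
  proof (cases "real k \<le> sqrt (real n)")
    case True
    have "real k powr (- \<alpha>) \<le> real k powr 0" using that \<alpha> by (intro powr_mono) auto
    then show ?thesis using True that by (simp add: add_increasing2)
  next
    case False
    have "real k powr (- \<alpha>) \<le> sqrt (real n) powr (- \<alpha>)"
      using False that \<alpha> n by (intro powr_mono2') auto
    also have "\<dots> = real n powr (- \<alpha> / 2)"
      using n by (simp add: powr_half_sqrt[symmetric] powr_powr)
    finally show ?thesis using False by simp
  qed
  then have "(\<Sum>k=1..n. real k powr (- \<alpha>)) \<le> (\<Sum>k=1..n. (if real k \<le> sqrt (real n) then 1 else 0) + real n powr (- \<alpha> / 2))"
    by (rule sum_mono)
  also have "\<dots> = real (card {k \<in> {1..n}. real k \<le> sqrt (real n)}) + real n * real n powr (- \<alpha> / 2)"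
    by (simp add: sum.distrib sum.If_cases Int_def)
  also have "real (card {k \<in> {1..n}. real k \<le> sqrt (real n)}) \<le> sqrt (real n)"
  proof -
    have "{k \<in> {1..n}. real k \<le> sqrt (real n)} \<subseteq> {1..nat \<lfloor>sqrt (real n)\<rfloor>}"
      by (auto simp: le_nat_floor)
    then have "card {k \<in> {1..n}. real k \<le> sqrt (real n)} \<le> nat \<lfloor>sqrt (real n)\<rfloor>"
      using card_mono[of "{1..nat \<lfloor>sqrt (real n)\<rfloor>}"] by fastforce
    then show ?thesis by (smt (verit) of_nat_floor of_nat_mono real_sqrt_ge_zero of_nat_0_le_iff)
  qed
  also have "sqrt (real n) = real n powr (1 / 2)" by (simp add: powr_half_sqrt)
  also have "\<dots> \<le> real n powr (1 - \<alpha> / 2)" using \<alpha> n by (intro powr_mono) auto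
  also have "real n * real n powr (- \<alpha> / 2) = real n powr (1 - \<alpha> / 2)"
    using powr_add[of "real n" 1 "- \<alpha> / 2"] n by simp
  finally show ?thesis by simp
qed

text \<open>The mean square error is 2/N times an average of sums of squared covariances over
  symmetric windows. These sums are of order N^(1 - \<alpha>/2), which leaves N^(-\<alpha>/2).
  Square summability plays no part, so every Hurst index below 1 is covered.\<close>

lemma (in stationary_gaussian) average_square_AE_tendsto:
  assumes \<alpha>: "0 < \<alpha>" "\<alpha> \<le> 1" and decay: "\<And>m. m \<noteq> 0 \<Longrightarrow> (\<rho> i i m)\<^sup>2 \<le> C * real_of_int \<bar>m\<bar> powr (- \<alpha>)"
  shows "AE \<omega> in M. (\<lambda>N. 1 / real N * (\<Sum>k=1..N. (X k i \<omega>)\<^sup>2)) \<longlonglongrightarrow> \<rho> i i 0"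
proof -
  interpret prob_space M by (rule prob)
  define c where "c j = (if j = i then 1 else 0 :: real)" for j
  have c: "(\<Sum>j\<in>UNIV. c j * g j) = g i" for g
    by (simp add: c_def if_distrib[of "\<lambda>x. x * _"] cong: if_cong)
  define S where "S N \<omega> = (\<Sum>k=1..N. (X k i \<omega>)\<^sup>2)" for N \<omega>
  have fl: "(fluctuation N i \<omega>)\<^sup>2 = real N * (S N \<omega> / real N - \<rho> i i 0)\<^sup>2" for N \<omega>
    unfolding fluctuation_def S_def by (simp add: power_mult_distrib)
  have C0: "C \<ge> 0" using decay[of 1] by (intro order_trans[OF zero_le_power2]) simp
  define D where "D = (\<rho> i i 0)\<^sup>2 + 4 * C"
  have inner: "(\<Sum>m=- int n..int n. (\<rho> i i m)\<^sup>2) \<le> D * real N powr (1 - \<alpha> / 2)" if "n < N" for n N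
  proof -
    have "(\<Sum>m=- int n..int n. (\<rho> i i m)\<^sup>2) \<le> (\<Sum>m=- int N..int N. (\<rho> i i m)\<^sup>2)"
      using that by (intro sum_mono2) auto
    also have "\<dots> = (\<rho> i i 0)\<^sup>2 + (\<Sum>k=1..N. (\<rho> i i (int k))\<^sup>2 + (\<rho> i i (- int k))\<^sup>2)"
      by (rule sum_int_Icc)
    also have "\<dots> \<le> (\<rho> i i 0)\<^sup>2 + (\<Sum>k=1..N. C * real k powr (- \<alpha>) + C * real k powr (- \<alpha>))"
      using decay[of "int _"] decay[of "- int _"] by (intro add_left_mono sum_mono add_mono) auto
    also have "\<dots> = (\<rho> i i 0)\<^sup>2 + 2 * C * (\<Sum>k=1..N. real k powr (- \<alpha>))"
      unfolding sum_distrib_left by (simp add: mult.assoc)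
    also have "\<dots> \<le> (\<rho> i i 0)\<^sup>2 * real N powr (1 - \<alpha> / 2) + 2 * C * (2 * real N powr (1 - \<alpha> / 2))"
    proof (intro add_mono mult_left_mono sum_powr_le \<alpha>)
      have "1 \<le> real N powr (1 - \<alpha> / 2)" using that \<alpha> by (intro ge_one_powr_ge_zero) auto
      then show "(\<rho> i i 0)\<^sup>2 \<le> (\<rho> i i 0)\<^sup>2 * real N powr (1 - \<alpha> / 2)"
        using mult_left_mono[of 1 "real N powr (1 - \<alpha> / 2)" "(\<rho> i i 0)\<^sup>2"] by simp
    qed (use that C0 in auto)
    finally show ?thesis by (simp add: D_def algebra_simps)
  qed
  have "AE \<omega> in M. (\<lambda>N. S N \<omega> / real N) \<longlonglongrightarrow> \<rho> i i 0"
  proof (rule AE_average_tendsto[where \<gamma>="\<alpha> / 2" and C="2 * D"])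
    show "mono (\<lambda>N. S N \<omega>)" for \<omega>
      unfolding S_def by (intro monoI sum_mono2) auto
    show "S N \<omega> \<ge> 0" for N \<omega> by (simp add: S_def sum_nonneg)
    show "integrable M (\<lambda>\<omega>. (S N \<omega> / real N - \<rho> i i 0)\<^sup>2)" for N
    proof (cases "N = 0")
      case False
      then have "integrable M (\<lambda>\<omega>. (1 / real N) * (fluctuation N i \<omega>)\<^sup>2)"
        using fluctuation_quadratic(1)[of N c] by (intro integrable_mult_right) (simp add: c)
      then show ?thesis unfolding fl using False by simp
    qed simp
    fix N :: nat assume N: "N \<ge> 1"
    have "real N * (\<integral>\<omega>. (S N \<omega> / real N - \<rho> i i 0)\<^sup>2 \<partial>M) = var_term N c"
      using fluctuation_quadratic(2)[OF N, of c] unfolding c fl by simp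
    also have "var_term N c = 2 * ((\<Sum>k=1..N. \<Sum>l=1..N. (\<rho> i i (int k - int l))\<^sup>2) / real N)"
    proof -
      have "var_term N c = (\<Sum>a\<in>UNIV. c a * (\<Sum>j\<in>UNIV. c j * (2 * ((\<Sum>k=1..N. \<Sum>l=1..N. (\<rho> a j (int k - int l))\<^sup>2) / real N))))"
        unfolding var_term_def by (simp add: sum_distrib_left mult.assoc)
      then show ?thesis unfolding c .
    qed
    also have "\<dots> \<le> 2 * ((\<Sum>n<N. D * real N powr (1 - \<alpha> / 2)) / real N)"
      unfolding sum_differences[of "\<lambda>m. (\<rho> i i m)\<^sup>2"] by (intro mult_left_mono divide_right_mono sum_mono inner) auto
    also have "\<dots> = 2 * D * real N powr (1 - \<alpha> / 2)" using N by simp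
    also have "\<dots> = real N * (2 * D * real N powr (- (\<alpha> / 2)))"
      using N powr_add[of "real N" 1 "- \<alpha> / 2"] by simp
    finally show "(\<integral>\<omega>. (S N \<omega> / real N - \<rho> i i 0)\<^sup>2 \<partial>M) \<le> 2 * D * real N powr (- (\<alpha> / 2))"
      using N by simp
  qed (use \<alpha> in auto)
  then show ?thesis by (simp add: S_def)
qed

section \<open>Riemann--Stieltjes integrals of smooth functions against continuous paths\<close>

lemma tagged_division_interval:
  fixes p :: "(real \<times> real set) set"
  assumes "p tagged_division_of {a..b}" "(x, K) \<in> p"
  obtains u v where "K = {u..v}" "u \<le> x" "x \<le> v" "a \<le> u" "v \<le> b" "Inf K = u" "Sup K = v"
proof -
  have x: "x \<in> K" and sub: "K \<subseteq> {a..b}" and "\<exists>u v. K = cbox u v"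
    using tagged_division_ofD(2-4)[OF assms(1), of x K] assms(2) by auto
  then obtain u v where K: "K = {u..v}" by auto
  with x have "u \<le> x" "x \<le> v" by auto
  moreover from this K sub have "a \<le> u" "v \<le> b" by auto
  moreover have "Inf K = u" "Sup K = v" using K \<open>u \<le> x\<close> \<open>x \<le> v\<close> by auto
  ultimately show ?thesis using K that by blast
qed

text \<open>The path \<open>g\<close> is merely continuous, so the derivative falls on
  \<open>f\<close>. With \<open>P\<close> a primitive of \<open>g * f'\<close>, the increments of
  \<open>f * g - P\<close> telescope over a division, and each Riemann--Stieltjes summand differs
  from such an increment by at most the oscillation of \<open>g\<close> times the length of the
  cell, up to a constant.\<close>

lemma has_RS_integral_by_parts:
  assumes ab: "a \<le> b"
    and f: "\<And>x. x \<in> {a..b} \<Longrightarrow> (f has_real_derivative f' x) (at x within {a..b})"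
    and f': "continuous_on {a..b} f'" and g: "continuous_on {a..b} g"
  shows "has_RS_integral f g a b (f b * g b - f a * g a - integral {a..b} (\<lambda>x. g x * f' x))"
  unfolding has_RS_integral_def
proof (intro allI impI)
  fix e :: real assume e: "e > 0"
  define P where "P y = integral {a..y} (\<lambda>x. g x * f' x)" for y
  have P: "(P has_real_derivative g x * f' x) (at x within {a..b})" if "x \<in> {a..b}" for x
    unfolding P_def using that by (intro integral_has_real_derivative continuous_intros f' g)
  have Pa: "P a = 0" by (simp add: P_def)
  obtain B where B: "B > 0" "\<And>x. x \<in> {a..b} \<Longrightarrow> \<bar>f' x\<bar> \<le> B"
    using compact_imp_bounded[OF compact_continuous_image[OF f' compact_Icc]] unfolding bounded_pos by auto
  \<comment> \<open>The \<open>+ 1\<close> keeps the divisor positive and the total error strictly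
    below \<open>e\<close>, also when \<open>a = b\<close>.\<close>
  define w where "w = e / (B * (b - a) + 1)"
  have "B * (b - a) \<ge> 0" using B(1) ab by simp
  then have w: "w > 0" "w * (B * (b - a)) < e"
    using e by (auto simp: w_def divide_less_eq)
  have "uniformly_continuous_on {a..b} g" by (intro compact_uniformly_continuous g) auto
  then obtain d0 where d0: "d0 > 0" "\<And>x y. x \<in> {a..b} \<Longrightarrow> y \<in> {a..b} \<Longrightarrow> \<bar>y - x\<bar> < d0 \<Longrightarrow> \<bar>g y - g x\<bar> < w"
    unfolding uniformly_continuous_on_def dist_real_def using w(1) by metis
  have step: "\<bar>P y - P x - g c * (f y - f x)\<bar> \<le> w * B * (y - x)"
    if "a \<le> x" "x \<le> y" "y \<le> b" "c = x \<or> c = y" "y - x < d0" for x y c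
  proof -
    have "norm ((P y - g c * f y) - (P x - g c * f x)) \<le> (w * B) * norm (y - x)"
    proof (rule differentiable_bound[of "{x..y}"])
      fix z assume z: "z \<in> {x..y}"
      then have zab: "z \<in> {a..b}" "{x..y} \<subseteq> {a..b}" using that by auto
      have "((\<lambda>z. P z - g c * f z) has_real_derivative (g z - g c) * f' z) (at z within {a..b})"
        by (auto intro!: derivative_eq_intros P f zab simp: algebra_simps)
      then have "((\<lambda>z. P z - g c * f z) has_real_derivative (g z - g c) * f' z) (at z within {x..y})"
        by (rule DERIV_subset) (rule zab)
      then show "((\<lambda>z. P z - g c * f z) has_derivative (\<lambda>h. (g z - g c) * f' z * h)) (at z within {x..y})"
        by (simp add: has_field_derivative_def)
      have "\<bar>g z - g c\<bar> \<le> w" using that z by (intro less_imp_le d0) auto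
      then have "\<bar>(g z - g c) * f' z\<bar> \<le> w * B"
        unfolding abs_mult using B(2)[OF zab(1)] w by (intro mult_mono) auto
      then show "onorm (\<lambda>h. (g z - g c) * f' z * h) \<le> w * B"
        by (intro onorm_le) (simp add: abs_mult mult_right_mono)
    qed (use that in auto)
    then show ?thesis using that by (simp add: algebra_simps)
  qed
  show "\<exists>d>0. \<forall>p. p tagged_division_of {a..b} \<and> (\<lambda>x. ball x d) fine p \<longrightarrow>
       \<bar>(\<Sum>(x, K)\<in>p. f x * (g (Sup K) - g (Inf K))) - (f b * g b - f a * g a - integral {a..b} (\<lambda>x. g x * f' x))\<bar> < e"
  proof (intro exI conjI allI impI)
    show "d0 > 0" by fact
    fix p assume p: "p tagged_division_of {a..b} \<and> (\<lambda>x. ball x d0) fine p"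
    define h where "h y = f y * g y - P y" for y
    have tele: "(\<Sum>(x, K)\<in>p. k (Sup K) - k (Inf K)) = k b - k a" for k :: "real \<Rightarrow> real"
      using additive_tagged_division_1[OF ab, of p k] p by simp
    have "(\<Sum>(x, K)\<in>p. f x * (g (Sup K) - g (Inf K))) - (h b - h a)
        = (\<Sum>(x, K)\<in>p. f x * (g (Sup K) - g (Inf K)) - (h (Sup K) - h (Inf K)))"
      unfolding tele[of h, symmetric] by (simp add: sum_subtractf split_beta)
    also have "\<bar>\<dots>\<bar> \<le> (\<Sum>(x, K)\<in>p. w * B * (Sup K - Inf K))"
      unfolding split_beta
    proof (rule order_trans[OF sum_abs sum_mono])
      fix xK assume xK: "xK \<in> p"
      obtain x K where [simp]: "xK = (x, K)" by force
      obtain u v where uv: "K = {u..v}" "u \<le> x" "x \<le> v" "a \<le> u" "v \<le> b" "Inf K = u" "Sup K = v"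
        using tagged_division_interval[of p a b x K] p xK by auto
      have "K \<subseteq> ball x d0" using p xK by (auto simp: fine_def)
      moreover have "u \<in> K" "v \<in> K" using uv by auto
      ultimately have "u \<in> ball x d0" "v \<in> ball x d0" by blast+
      then have d: "x - u < d0" "v - x < d0" by (auto simp: dist_real_def)
      \<comment> \<open>The cell is split at its tag, and on each half the path is compared with its
        value at the end of the cell on that side.\<close>
      have "f x * (g v - g u) - (h v - h u) = (P v - P x - g v * (f v - f x)) + (P x - P u - g u * (f x - f u))"
        by (simp add: h_def algebra_simps)
      also have "\<bar>\<dots>\<bar> \<le> w * B * (v - x) + w * B * (x - u)"
        using step[of x v v] step[of u x u] uv d by linarith
      also have "\<dots> = w * B * (v - u)" by (simp add: algebra_simps)
      finally show "\<bar>f (fst xK) * (g (Sup (snd xK)) - g (Inf (snd xK))) - (h (Sup (snd xK)) - h (Inf (snd xK)))\<bar>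
          \<le> w * B * (Sup (snd xK) - Inf (snd xK))" by (simp add: uv(6,7))
    qed
    also have "\<dots> = w * (B * (b - a))"
      using tele[of "\<lambda>y. w * B * y"] by (simp add: algebra_simps)
    also have "\<dots> < e" by (rule w(2))
    also have "h b - h a = f b * g b - f a * g a - integral {a..b} (\<lambda>x. g x * f' x)"
      by (simp add: h_def Pa) (simp add: P_def)
    finally show "\<bar>(\<Sum>(x, K)\<in>p. f x * (g (Sup K) - g (Inf K))) - (f b * g b - f a * g a - integral {a..b} (\<lambda>x. g x * f' x))\<bar> < e" .
  qed
qed

text \<open>Cousin's lemma provides a division fine for both radii; without one the universally
  quantified condition could hold vacuously.\<close>

lemma has_RS_integral_unique:
  assumes "has_RS_integral f g a b I" "has_RS_integral f g a b J"
  shows "I = J"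
proof (rule ccontr)
  assume "I \<noteq> J"
  then have e: "\<bar>I - J\<bar> / 2 > 0" by simp
  let ?s = "\<lambda>p. \<Sum>(x, K)\<in>p. f x * (g (Sup K) - g (Inf K))"
  obtain d1 where d1: "d1 > 0" "\<And>p. p tagged_division_of {a..b} \<Longrightarrow> (\<lambda>x. ball x d1) fine p \<Longrightarrow> \<bar>?s p - I\<bar> < \<bar>I - J\<bar> / 2"
    using assms(1) e unfolding has_RS_integral_def by meson
  obtain d2 where d2: "d2 > 0" "\<And>p. p tagged_division_of {a..b} \<Longrightarrow> (\<lambda>x. ball x d2) fine p \<Longrightarrow> \<bar>?s p - J\<bar> < \<bar>I - J\<bar> / 2"
    using assms(2) e unfolding has_RS_integral_def by meson
  have "gauge (\<lambda>x::real. ball x (min d1 d2))" using d1 d2 by (intro gauge_ball) auto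
  then obtain p where p: "p tagged_division_of {a..b}" "(\<lambda>x. ball x (min d1 d2)) fine p"
    by (rule fine_division_exists_real)
  have fine: "(\<lambda>x. ball x d) fine p" if "min d1 d2 \<le> d" for d
  proof (rule fineI)
    fix x K assume "(x, K) \<in> p"
    then have "K \<subseteq> ball x (min d1 d2)" by (rule fineD[OF p(2)])
    then show "K \<subseteq> ball x d" using subset_ball[OF that] by blast
  qed
  define s where "s = ?s p"
  have "\<bar>s - I\<bar> < \<bar>I - J\<bar> / 2" "\<bar>s - J\<bar> < \<bar>I - J\<bar> / 2"
    unfolding s_def by (rule d1(2)[OF p(1) fine[OF min.cobounded1]], rule d2(2)[OF p(1) fine[OF min.cobounded2]])
  then show False using abs_triangle_ineq4[of "s - J" "s - I"] by simp
qed

text \<open>The primitive whose increments are the integrals over bounded intervals.\<close>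

definition RS_primitive :: "(real \<Rightarrow> real) \<Rightarrow> (real \<Rightarrow> real) \<Rightarrow> (real \<Rightarrow> real) \<Rightarrow> real \<Rightarrow> real" where
  "RS_primitive f f' g y = f y * g y - (LBINT x=0..ereal y. g x * f' x)"

lemma RS_primitive_increment:
  assumes f: "\<And>x. (f has_real_derivative f' x) (at x)" and f': "continuous_on UNIV f'" and g: "continuous_on UNIV g"
    and ab: "a \<le> b"
  shows "has_RS_integral f g a b (RS_primitive f f' g b - RS_primitive f f' g a)"
proof -
  have c: "continuous_on A (\<lambda>x. g x * f' x)" for A
    using continuous_on_subset[OF f'] continuous_on_subset[OF g] by (intro continuous_on_mult) auto
  have i: "interval_lebesgue_integrable lborel (ereal x) (ereal y) (\<lambda>x. g x * f' x)" for x y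
    using c[of UNIV] by (intro interval_integrable_isCont) (auto simp: continuous_on_eq_continuous_at)
  have "(LBINT x=0..ereal a. g x * f' x) + (LBINT x=ereal a..ereal b. g x * f' x) = (LBINT x=0..ereal b. g x * f' x)"
    unfolding zero_ereal_def by (rule interval_integral_sum) (simp add: i min_def max_def)
  moreover have "(LBINT x=ereal a..ereal b. g x * f' x) = integral {a..b} (\<lambda>x. g x * f' x)"
    using ab by (intro interval_integral_eq_integral borel_integrable_atLeastAtMost' c)
  ultimately have "RS_primitive f f' g b - RS_primitive f f' g a = f b * g b - f a * g a - integral {a..b} (\<lambda>x. g x * f' x)"
    unfolding RS_primitive_def by simp
  then show ?thesis
    using has_RS_integral_by_parts[OF ab has_field_derivative_at_within[OF f], where g=g]
      continuous_on_subset[OF f'] continuous_on_subset[OF g] by auto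
qed

text \<open>By uniqueness the values \<open>F a b\<close> are forced when \<open>a <= b\<close>,
  which holds eventually in the product filter.\<close>

lemma has_RS_integral_line_iff:
  assumes f: "\<And>x. (f has_real_derivative f' x) (at x)" and f': "continuous_on UNIV f'" and g: "continuous_on UNIV g"
  shows "has_RS_integral_line f g I \<longleftrightarrow>
     ((\<lambda>(a, b). RS_primitive f f' g b - RS_primitive f f' g a) \<longlongrightarrow> I) (at_bot \<times>\<^sub>F at_top)"
    (is "_ \<longleftrightarrow> (?G \<longlongrightarrow> I) _")
proof
  assume "has_RS_integral_line f g I"
  then obtain F where F: "\<And>a b. a \<le> b \<Longrightarrow> has_RS_integral f g a b (F a b)" "((\<lambda>(a, b). F a b) \<longlongrightarrow> I) (at_bot \<times>\<^sub>F at_top)"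
    unfolding has_RS_integral_line_def by blast
  have "eventually (\<lambda>ab :: real \<times> real. fst ab \<le> 0 \<and> 0 \<le> snd ab) (at_bot \<times>\<^sub>F at_top)"
    by (rule eventually_prodI[OF eventually_le_at_bot[of 0] eventually_ge_at_top[of 0]])
  then have "eventually (\<lambda>ab. (case ab of (a, b) \<Rightarrow> F a b) = ?G ab) (at_bot \<times>\<^sub>F at_top)"
  proof (eventually_elim, clarify)
    fix a b :: real assume "fst (a, b) \<le> 0" "0 \<le> snd (a, b)"
    then have "a \<le> b" by simp
    from has_RS_integral_unique[OF F(1)[OF this] RS_primitive_increment[OF f f' g this]]
    show "F a b = RS_primitive f f' g b - RS_primitive f f' g a" .
  qed
  from tendsto_cong[OF this] F(2) show "(?G \<longlongrightarrow> I) (at_bot \<times>\<^sub>F at_top)" by simp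
next
  assume "(?G \<longlongrightarrow> I) (at_bot \<times>\<^sub>F at_top)"
  then show "has_RS_integral_line f g I"
    unfolding has_RS_integral_line_def
    by (intro exI[of _ "\<lambda>a b. RS_primitive f f' g b - RS_primitive f f' g a"]) (auto intro: RS_primitive_increment assms)
qed

lemma RS_integral_line_eq:
  assumes f: "\<And>x. (f has_real_derivative f' x) (at x)" and f': "continuous_on UNIV f'" and g: "continuous_on UNIV g"
    and lim: "((\<lambda>(a, b). RS_primitive f f' g b - RS_primitive f f' g a) \<longlongrightarrow> I) (at_bot \<times>\<^sub>F at_top)"
  shows "RS_integral_line f g = I"
proof -
  note iff = has_RS_integral_line_iff[OF f f' g]
  have nt: "at_bot \<times>\<^sub>F at_top \<noteq> (bot :: (real \<times> real) filter)" by (simp add: prod_filter_eq_bot)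
  have "has_RS_integral_line f g J \<Longrightarrow> J = I" for J
    unfolding iff using tendsto_unique[OF nt _ lim] by blast
  moreover have "has_RS_integral_line f g I" unfolding iff by (rule lim)
  ultimately have "(THE J. has_RS_integral_line f g J) = I" "\<exists>J. has_RS_integral_line f g J"
    by (blast intro: the_equality)+
  then show ?thesis by (simp add: RS_integral_line_def)
qed

text \<open>Convergence of the increments at both ends can be tested on rational points; this makes the
  set where the improper integral exists measurable.\<close>

definition cauchy_ends :: "(real \<Rightarrow> real) \<Rightarrow> bool" where
  "cauchy_ends P \<longleftrightarrow> (\<forall>k::nat. \<exists>n::nat. \<forall>q\<in>\<rat>. \<forall>q'\<in>\<rat>. q > real n \<and> q' > real n \<longrightarrow>
     \<bar>P q - P q'\<bar> \<le> 1 / real (Suc k) \<and> \<bar>P (- q) - P (- q')\<bar> \<le> 1 / real (Suc k))"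

lemma rational_bound_extends:
  fixes P :: "real \<Rightarrow> real"
  assumes P: "continuous_on UNIV P" and b: "\<And>q. q \<in> \<rat> \<Longrightarrow> q > c \<Longrightarrow> \<bar>P q - z\<bar> \<le> e" and y: "y > c"
  shows "\<bar>P y - z\<bar> \<le> e"
proof (rule ccontr)
  assume "\<not> \<bar>P y - z\<bar> \<le> e"
  then have y': "y \<in> {y. \<bar>P y - z\<bar> > e} \<inter> {c<..}" using y by simp
  have "open ({y. \<bar>P y - z\<bar> > e} \<inter> {c<..})"
    by (intro open_Int open_greaterThan open_Collect_less continuous_intros P)
  then obtain d where d: "d > 0" "ball y d \<subseteq> {y. \<bar>P y - z\<bar> > e} \<inter> {c<..}"
    using y' by (meson openE)
  obtain q where "q \<in> \<rat>" "y < q" "q < y + d" using Rats_dense_in_real[of y "y + d"] d by auto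
  then have "q \<in> ball y d" by (simp add: dist_real_def)
  then have "\<bar>P q - z\<bar> > e" "q > c" using d(2) by auto
  then show False using b[OF \<open>q \<in> \<rat>\<close>] by linarith
qed

text \<open>The limit is expressed by \<open>lim\<close> along the integers, a form that is
  measurable in the path.\<close>

lemma cauchy_ends_tendsto:
  fixes P :: "real \<Rightarrow> real"
  assumes P: "continuous_on UNIV P" and C: "cauchy_ends P"
  shows "((\<lambda>(a, b). P b - P a) \<longlongrightarrow> lim (\<lambda>n. P (real n) - P (- real n))) (at_bot \<times>\<^sub>F at_top)"
proof -
  have P': "continuous_on UNIV (\<lambda>x. P (- x))"
    using P by (intro continuous_on_compose2[OF P] continuous_intros) auto
  have one: "\<exists>L. ((\<lambda>y. Q y) \<longlongrightarrow> L) at_top"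
    if Q: "continuous_on UNIV Q" and C: "\<And>k::nat. \<exists>n::nat. \<forall>q\<in>\<rat>. \<forall>q'\<in>\<rat>. q > real n \<and> q' > real n \<longrightarrow> \<bar>Q q - Q q'\<bar> \<le> 1 / real (Suc k)"
    for Q :: "real \<Rightarrow> real"
  proof -
    have real: "\<exists>n::nat. \<forall>y>real n. \<forall>y'>real n. \<bar>Q y - Q y'\<bar> \<le> 1 / real (Suc k)" for k
    proof -
      obtain n :: nat where n: "\<And>q q'. q \<in> \<rat> \<Longrightarrow> q' \<in> \<rat> \<Longrightarrow> q > real n \<Longrightarrow> q' > real n \<Longrightarrow> \<bar>Q q - Q q'\<bar> \<le> 1 / real (Suc k)"
        using C[of k] by blast
      have 1: "\<bar>Q y - Q q'\<bar> \<le> 1 / real (Suc k)" if "y > real n" "q' \<in> \<rat>" "q' > real n" for y q'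
        by (rule rational_bound_extends[OF Q n that(1)]) (use that in auto)
      have "\<bar>Q y' - Q y\<bar> \<le> 1 / real (Suc k)" if "y > real n" "y' > real n" for y y'
        by (rule rational_bound_extends[OF Q _ that(2)]) (use 1[OF that(1)] in \<open>auto simp: abs_minus_commute\<close>)
      then show ?thesis by blast
    qed
    have "Cauchy (\<lambda>n. Q (real n))"
    proof (rule metric_CauchyI)
      fix e :: real assume "e > 0"
      then obtain k where k: "1 / real (Suc k) < e" using nat_approx_posE by blast
      obtain n :: nat where n: "\<And>y y'. y > real n \<Longrightarrow> y' > real n \<Longrightarrow> \<bar>Q y - Q y'\<bar> \<le> 1 / real (Suc k)"
        using real[of k] by blast
      have "dist (Q (real m)) (Q (real l)) < e" if "m \<ge> Suc n" "l \<ge> Suc n" for m l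
        using n[of "real m" "real l"] k that by (simp add: dist_real_def)
      then show "\<exists>M. \<forall>m\<ge>M. \<forall>n\<ge>M. dist (Q (real m)) (Q (real n)) < e" by blast
    qed
    then obtain L where L: "(\<lambda>n. Q (real n)) \<longlonglongrightarrow> L" using Cauchy_convergent convergentD by blast
    have "(Q \<longlongrightarrow> L) at_top"
    proof (rule tendstoI)
      fix e :: real assume "e > 0"
      then obtain k where k: "1 / real (Suc k) < e / 2" using nat_approx_posE[of "e / 2"] by auto
      obtain n :: nat where n: "\<And>y y'. y > real n \<Longrightarrow> y' > real n \<Longrightarrow> \<bar>Q y - Q y'\<bar> \<le> 1 / real (Suc k)"
        using real[of k] by blast
      show "eventually (\<lambda>y. dist (Q y) L < e) at_top"
        using eventually_gt_at_top[of "real n"]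
      proof eventually_elim
        case (elim y)
        have "\<bar>Q y - L\<bar> \<le> 1 / real (Suc k)"
          by (rule LIMSEQ_le_const2[OF tendsto_rabs[OF tendsto_diff[OF tendsto_const L]]])
             (use n[OF elim] in \<open>auto intro!: exI[of _ "Suc n"]\<close>)
        then show ?case using k \<open>e > 0\<close> by (simp add: dist_real_def)
      qed
    qed
    then show ?thesis by blast
  qed
  have "\<exists>n::nat. \<forall>q\<in>\<rat>. \<forall>q'\<in>\<rat>. q > real n \<and> q' > real n \<longrightarrow> \<bar>P q - P q'\<bar> \<le> 1 / real (Suc k)" for k
    using C[unfolded cauchy_ends_def, rule_format, of k] by blast
  from one[OF P this] obtain L where L: "(P \<longlongrightarrow> L) at_top" by blast
  have "\<exists>n::nat. \<forall>q\<in>\<rat>. \<forall>q'\<in>\<rat>. q > real n \<and> q' > real n \<longrightarrow> \<bar>P (- q) - P (- q')\<bar> \<le> 1 / real (Suc k)" for k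
    using C[unfolded cauchy_ends_def, rule_format, of k] by blast
  from one[OF P' this] obtain K where K: "((\<lambda>x. P (- x)) \<longlongrightarrow> K) at_top" by blast
  then have K': "(P \<longlongrightarrow> K) at_bot" by (subst (asm) filterlim_at_top_mirror) simp
  have "(\<lambda>n. P (real n) - P (- real n)) \<longlonglongrightarrow> L - K"
    by (intro tendsto_diff filterlim_compose[OF L] filterlim_compose[OF K] filterlim_real_sequentially)
  then have "lim (\<lambda>n. P (real n) - P (- real n)) = L - K" by (rule limI)
  moreover have "((\<lambda>ab. P (snd ab) - P (fst ab)) \<longlongrightarrow> L - K) (at_bot \<times>\<^sub>F at_top)"
    by (intro tendsto_diff filterlim_compose[OF L filterlim_snd] filterlim_compose[OF K' filterlim_fst])
  ultimately show ?thesis by (simp add: case_prod_unfold)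
qed

text \<open>In the product filter the two endpoints vary independently; holding one of them fixed
  gives the Cauchy property at the other end.\<close>

lemma tendsto_cauchy_ends:
  fixes P :: "real \<Rightarrow> real"
  assumes "((\<lambda>(a, b). P b - P a) \<longlongrightarrow> I) (at_bot \<times>\<^sub>F at_top)"
  shows "cauchy_ends P"
  unfolding cauchy_ends_def
proof
  fix k :: nat
  have "eventually (\<lambda>ab. dist (case ab of (a, b) \<Rightarrow> P b - P a) I < 1 / real (Suc k) / 2) (at_bot \<times>\<^sub>F at_top)"
    by (rule tendstoD[OF assms]) simp
  then obtain A B where A: "eventually A at_bot" and B: "eventually B at_top"
    and AB: "\<And>a b. A a \<Longrightarrow> B b \<Longrightarrow> \<bar>P b - P a - I\<bar> < 1 / real (Suc k) / 2"
    unfolding eventually_prod_filter dist_real_def by auto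
  obtain a0 b0 where a0: "\<And>a. a \<le> a0 \<Longrightarrow> A a" and b0: "\<And>b. b \<ge> b0 \<Longrightarrow> B b"
    using A B by (auto simp: eventually_at_bot_linorder eventually_at_top_linorder)
  obtain n :: nat where n: "real n \<ge> max \<bar>a0\<bar> \<bar>b0\<bar>" using real_arch_simple by blast
  show "\<exists>n::nat. \<forall>q\<in>\<rat>. \<forall>q'\<in>\<rat>. q > real n \<and> q' > real n \<longrightarrow>
     \<bar>P q - P q'\<bar> \<le> 1 / real (Suc k) \<and> \<bar>P (- q) - P (- q')\<bar> \<le> 1 / real (Suc k)"
  proof (intro exI[of _ n] ballI impI)
    fix q q' assume q: "q > real n \<and> q' > real n"
    then have "A (- q)" "A (- q')" "B q" "B q'" using n by (auto intro!: a0 b0)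
    then show "\<bar>P q - P q'\<bar> \<le> 1 / real (Suc k) \<and> \<bar>P (- q) - P (- q')\<bar> \<le> 1 / real (Suc k)"
    proof -
      note AB[OF \<open>A (- q)\<close> \<open>B q\<close>] AB[OF \<open>A (- q)\<close> \<open>B q'\<close>] AB[OF \<open>A (- q')\<close> \<open>B q\<close>]
      then show ?thesis unfolding abs_le_iff abs_less_iff by (intro conjI; linarith)
    qed
  qed
qed

lemma continuous_RS_primitive:
  assumes f: "\<And>x. (f has_real_derivative f' x) (at x)" and f': "continuous_on UNIV f'" and g: "continuous_on UNIV g"
  shows "continuous_on UNIV (RS_primitive f f' g)"
proof -
  have c: "continuous_on A (\<lambda>x. g x * f' x)" for A
    using continuous_on_subset[OF f'] continuous_on_subset[OF g] by (intro continuous_on_mult) auto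
  have "isCont (\<lambda>y. LBINT x=0..ereal y. g x * f' x) y" for y
  proof -
    have "((\<lambda>u. LBINT x=ereal 0..ereal u. g x * f' x) has_vector_derivative g y * f' y) (at y within {min 0 y - 1..max 0 y + 1})"
      by (rule interval_integral_FTC2[where c=0]) (auto intro: c simp: min_def max_def)
    then have "((\<lambda>u. LBINT x=ereal 0..ereal u. g x * f' x) has_vector_derivative g y * f' y) (at y)"
      by (subst (asm) at_within_interior) (auto simp: min_def max_def)
    then show ?thesis by (metis has_vector_derivative_continuous zero_ereal_def)
  qed
  moreover have "continuous_on UNIV f" using f by (meson DERIV_isCont continuous_at_imp_continuous_on)
  ultimately show ?thesis
    unfolding RS_primitive_def[abs_def]
    by (intro continuous_on_diff continuous_on_mult g) (auto intro: continuous_at_imp_continuous_on)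
qed

lemma RS_integral_line_cases:
  assumes f: "\<And>x. (f has_real_derivative f' x) (at x)" and f': "continuous_on UNIV f'" and g: "continuous_on UNIV g"
  shows "RS_integral_line f g = (if cauchy_ends (RS_primitive f f' g)
     then lim (\<lambda>n. RS_primitive f f' g (real n) - RS_primitive f f' g (- real n)) else 0)"
proof (cases "cauchy_ends (RS_primitive f f' g)")
  case True
  then show ?thesis
    using RS_integral_line_eq[OF f f' g cauchy_ends_tendsto[OF continuous_RS_primitive[OF f f' g] True]] by simp
next
  case False
  then have "\<not> (\<exists>I. has_RS_integral_line f g I)"
    unfolding has_RS_integral_line_iff[OF f f' g] using tendsto_cauchy_ends by blast
  then show ?thesis using False by (simp add: RS_integral_line_def)
qed

section \<open>Measurability of the mild solution\<close>

text \<open>Minus the spatial derivative of the heat kernel. For z > 0 it is also the density in r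
  of the first time at which a Brownian motion from 0 reaches z.\<close>

definition heat_flux :: "real \<Rightarrow> real \<Rightarrow> real" where
  "heat_flux r z = z / r * heat_kernel r z"

lemma heat_kernel_0 [simp]: "heat_kernel 0 z = 0"
  by (simp add: heat_kernel_def)

text \<open>Valid for every real \<open>r\<close>, as the joint measurability argument in
  \<open>r\<close> and the sample point requires; for \<open>r = 0\<close> division by zero makes
  kernel and flux vanish.\<close>

lemma heat_kernel_has_derivative:
  "((\<lambda>y. heat_kernel r (x - y)) has_real_derivative heat_flux r (x - y)) (at y)"
proof (cases "r = 0")
  case True
  then show ?thesis by (simp add: heat_flux_def)
next
  case False
  have "((\<lambda>y. exp (- ((x - y)\<^sup>2 / (2 * r)))) has_real_derivative exp (- ((x - y)\<^sup>2 / (2 * r))) * ((x - y) / r)) (at y)"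
    using False by (auto intro!: derivative_eq_intros simp: field_simps)
  from DERIV_cmult[OF this, of "1 / sqrt (2 * pi * r)"] show ?thesis
    by (simp add: heat_kernel_def heat_flux_def mult_ac)
qed

lemma continuous_heat_flux: "continuous_on UNIV (\<lambda>y. heat_flux r (x - y))"
proof (cases "r = 0")
  case True
  then show ?thesis by (simp add: heat_flux_def)
next
  case False
  then show ?thesis unfolding heat_flux_def heat_kernel_def
    by (intro continuous_intros) auto
qed

lemma heat_kernel_measurable [measurable]: "(\<lambda>(r, z). heat_kernel r z) \<in> borel_measurable (borel \<Otimes>\<^sub>M borel)"
  unfolding heat_kernel_def by measurable

lemma heat_flux_measurable [measurable]: "(\<lambda>(r, z). heat_flux r z) \<in> borel_measurable (borel \<Otimes>\<^sub>M borel)"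
  unfolding heat_flux_def heat_kernel_def by measurable

locale continuous_process =
  fixes M :: "'a measure" and W :: "real \<Rightarrow> 'a \<Rightarrow> real"
  assumes W_measurable [measurable]: "\<And>y. W y \<in> borel_measurable M"
    and W_continuous: "\<And>\<omega>. \<omega> \<in> space M \<Longrightarrow> continuous_on UNIV (\<lambda>y. W y \<omega>)"
begin

text \<open>The process is read at the grid point of mesh 1/(n+1) below \<open>y\<close>. This is
  measurable because countably many grid points occur, and it converges by continuity of the
  paths.\<close>

lemma W_joint_measurable [measurable]: "(\<lambda>(y, \<omega>). W y \<omega>) \<in> borel_measurable (borel \<Otimes>\<^sub>M M)"
proof (rule borel_measurable_LIMSEQ_metric)
  fix n :: nat
  show "(\<lambda>p. W (real_of_int \<lfloor>real (Suc n) * fst p\<rfloor> / real (Suc n)) (snd p)) \<in> borel_measurable (borel \<Otimes>\<^sub>M M)"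
    by (rule measurable_compose_countable[where f="\<lambda>i p. W (real_of_int i / real (Suc n)) (snd p)"]) measurable
next
  fix p :: "real \<times> 'a" assume "p \<in> space (borel \<Otimes>\<^sub>M M)"
  then have c: "isCont (\<lambda>y. W y (snd p)) (fst p)"
    using W_continuous[of "snd p"] by (auto simp: space_pair_measure continuous_on_eq_continuous_at)
  have "(\<lambda>n. real_of_int \<lfloor>real (Suc n) * fst p\<rfloor> / real (Suc n)) \<longlonglongrightarrow> fst p"
  proof (rule LIMSEQ_I)
    fix e :: real assume "e > 0"
    then obtain N where N: "1 / real (Suc N) < e" using nat_approx_posE by blast
    have "\<bar>real_of_int \<lfloor>real (Suc n) * fst p\<rfloor> / real (Suc n) - fst p\<bar> < e" if "n \<ge> N" for n
    proof -
      have "\<bar>real_of_int \<lfloor>real (Suc n) * fst p\<rfloor> - real (Suc n) * fst p\<bar> \<le> 1" by linarith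
      then have "\<bar>real_of_int \<lfloor>real (Suc n) * fst p\<rfloor> - real (Suc n) * fst p\<bar> / real (Suc n) \<le> 1 / real (Suc n)"
        by (rule divide_right_mono) simp
      also have "\<bar>real_of_int \<lfloor>real (Suc n) * fst p\<rfloor> - real (Suc n) * fst p\<bar> / real (Suc n) =
          \<bar>(real_of_int \<lfloor>real (Suc n) * fst p\<rfloor> - real (Suc n) * fst p) / real (Suc n)\<bar>" by (simp add: abs_divide)
      also have "(real_of_int \<lfloor>real (Suc n) * fst p\<rfloor> - real (Suc n) * fst p) / real (Suc n) = real_of_int \<lfloor>real (Suc n) * fst p\<rfloor> / real (Suc n) - fst p"
        by (simp add: diff_divide_distrib del: of_nat_Suc)
      also have "1 / real (Suc n) \<le> 1 / real (Suc N)" using that by (intro divide_left_mono) auto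
      finally show ?thesis using N by linarith
    qed
    then show "\<exists>no. \<forall>n\<ge>no. norm (real_of_int \<lfloor>real (Suc n) * fst p\<rfloor> / real (Suc n) - fst p) < e" by auto
  qed
  from isCont_tendsto_compose[OF c this]
  show "(\<lambda>n. W (real_of_int \<lfloor>real (Suc n) * fst p\<rfloor> / real (Suc n)) (snd p)) \<longlonglongrightarrow> (case p of (y, \<omega>) \<Rightarrow> W y \<omega>)"
    by (simp add: case_prod_beta)
qed

lemma RS_integral_line_measurable:
  "(\<lambda>(r, \<omega>). RS_integral_line (\<lambda>y. heat_kernel r (x - y)) (\<lambda>y. W y \<omega>)) \<in> borel_measurable (borel \<Otimes>\<^sub>M M)"
proof -
  define P where "P y p = RS_primitive (\<lambda>y. heat_kernel (fst p) (x - y)) (\<lambda>y. heat_flux (fst p) (x - y)) (\<lambda>y. W y (snd p)) y"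
    for y and p :: "real \<times> 'a"
  have P_measurable[measurable]: "P y \<in> borel_measurable (borel \<Otimes>\<^sub>M M)" for y
    unfolding P_def RS_primitive_def interval_lebesgue_integral_def set_lebesgue_integral_def
    by measurable
  have "(\<lambda>p. if cauchy_ends (\<lambda>y. P y p) then lim (\<lambda>n. P (real n) p - P (- real n) p) else 0) \<in> borel_measurable (borel \<Otimes>\<^sub>M M)"
  proof (rule measurable_If)
    \<comment> \<open>Quantifying over the countable type \<open>rat\<close> turns the test into a
      countable combination of measurable conditions.\<close>
    have "cauchy_ends Q \<longleftrightarrow> (\<forall>k::nat. \<exists>n::nat. \<forall>q q' :: rat. of_rat q > real n \<and> of_rat q' > real n \<longrightarrow>
       \<bar>Q (of_rat q) - Q (of_rat q')\<bar> \<le> 1 / real (Suc k) \<and> \<bar>Q (- of_rat q) - Q (- of_rat q')\<bar> \<le> 1 / real (Suc k))" for Q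
      unfolding cauchy_ends_def Rats_def by simp
    then show "{p \<in> space (borel \<Otimes>\<^sub>M M). cauchy_ends (\<lambda>y. P y p)} \<in> sets (borel \<Otimes>\<^sub>M M)"
      by (simp only:) measurable
  qed measurable
  then show ?thesis
  proof (rule measurable_cong[THEN iffD1, rotated])
    fix p assume "p \<in> space ((borel :: real measure) \<Otimes>\<^sub>M M)"
    then have "snd p \<in> space M" by (auto simp: space_pair_measure)
    from RS_integral_line_cases[OF heat_kernel_has_derivative continuous_heat_flux W_continuous[OF this], of "fst p" x]
    show "(if cauchy_ends (\<lambda>y. P y p) then lim (\<lambda>n. P (real n) p - P (- real n) p) else 0) =
       (case p of (r, \<omega>) \<Rightarrow> RS_integral_line (\<lambda>y. heat_kernel r (x - y)) (\<lambda>y. W y \<omega>))"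
      by (simp add: P_def case_prod_beta)
  qed
qed

lemma time_space_integral_measurable [measurable]: "time_space_integral W t x \<in> borel_measurable M"
proof -
  have "(\<lambda>p. RS_integral_line (\<lambda>y. heat_kernel (t - snd p) (x - y)) (\<lambda>y. W y (fst p))) \<in> borel_measurable (M \<Otimes>\<^sub>M borel)"
    using measurable_compose[OF _ RS_integral_line_measurable[of x], of "\<lambda>p. (t - snd p, fst p)" "M \<Otimes>\<^sub>M borel"]
    by simp
  then have "(\<lambda>p. indicator {0<..<t} (snd p) *\<^sub>R RS_integral_line (\<lambda>y. heat_kernel (t - snd p) (x - y)) (\<lambda>y. W y (fst p))) \<in> borel_measurable (M \<Otimes>\<^sub>M lborel)"
    by measurable
  then show ?thesis
    unfolding time_space_integral_def[abs_def] set_lebesgue_integral_def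
    by (intro lborel.borel_measurable_lebesgue_integral) (simp add: case_prod_beta)
qed

end

section \<open>Polynomial growth of fractional Brownian paths\<close>

text \<open>A dyadic point of level k + 1 either has level k or is the right neighbour of such a
  point, so each level adds at most \<open>A * b ^ k\<close> and the geometric series bounds the
  total. Continuity extends the bound from dyadic points to all of [0, 1].\<close>

lemma dyadic_chaining:
  fixes g :: "real \<Rightarrow> real"
  assumes g: "continuous_on {0..1} g" and b: "0 \<le> b" "b < 1" and A: "A \<ge> 0"
    and inc: "\<And>k j. j < 2 ^ k \<Longrightarrow> \<bar>g (real (Suc j) / 2 ^ k) - g (real j / 2 ^ k)\<bar> \<le> A * b ^ k"
    and x: "x \<in> {0..1}"
  shows "\<bar>g x - g 0\<bar> \<le> A / (1 - b)"
proof -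
  have dyadic: "\<bar>g (real j / 2 ^ k) - g 0\<bar> \<le> A * (\<Sum>i\<le>k. b ^ i)" if "j \<le> 2 ^ k" for j k
    using that
  proof (induction k arbitrary: j)
    case 0
    then have "j = 0 \<or> j = 1" by auto
    then show ?case using inc[of 0 0] A by auto
  next
    case (Suc k)
    have even: "\<bar>g (real (2 * i) / 2 ^ Suc k) - g 0\<bar> \<le> A * (\<Sum>i\<le>k. b ^ i)" if "i \<le> 2 ^ k" for i
    proof -
      have "real (2 * i) / 2 ^ Suc k = real i / 2 ^ k" by simp
      then show ?thesis using Suc.IH[OF that] by simp
    qed
    have bk: "A * b ^ Suc k \<ge> 0" using A b by simp
    have S: "A * (\<Sum>i\<le>Suc k. b ^ i) = A * (\<Sum>i\<le>k. b ^ i) + A * b ^ Suc k" by (simp add: distrib_left)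
    show ?case
    proof (cases "even j")
      case True
      then obtain i where "j = 2 * i" by blast
      then show ?thesis using even[of i] Suc.prems bk unfolding S by simp
    next
      case False
      then obtain i where i: "j = Suc (2 * i)" using oddE by fastforce
      then have "i < 2 ^ k" "2 * i < 2 ^ Suc k" using Suc.prems by auto
      then show ?thesis using even[of i] inc[of "2 * i" "Suc k"] unfolding S i by linarith
    qed
  qed
  have geo: "A * (\<Sum>i\<le>k. b ^ i) \<le> A / (1 - b)" for k
  proof -
    have "(\<Sum>i\<le>k. b ^ i) = (1 - b ^ Suc k) / (1 - b)" using b by (simp add: sum_gp0)
    also have "\<dots> \<le> 1 / (1 - b)" using b by (intro divide_right_mono) auto
    finally show ?thesis using A by (metis mult_left_mono times_divide_eq_right mult.right_neutral)
  qed
  define d where "d k = real (nat \<lfloor>2 ^ k * x\<rfloor>) / 2 ^ k" for k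
  have d: "\<bar>d k - x\<bar> \<le> (1 / 2) ^ k" "d k \<in> {0..1}" "nat \<lfloor>2 ^ k * x\<rfloor> \<le> 2 ^ k" for k
  proof -
    have "0 \<le> 2 ^ k * x" "2 ^ k * x \<le> 2 ^ k" using x by auto
    then have f: "real (nat \<lfloor>2 ^ k * x\<rfloor>) \<le> 2 ^ k * x" "2 ^ k * x < real (nat \<lfloor>2 ^ k * x\<rfloor>) + 1" by linarith+
    have le: "real (nat \<lfloor>2 ^ k * x\<rfloor>) \<le> (2::real) ^ k" using \<open>2 ^ k * x \<le> 2 ^ k\<close> f(1) by linarith
    then show "nat \<lfloor>2 ^ k * x\<rfloor> \<le> 2 ^ k" by (metis of_nat_le_iff of_nat_numeral of_nat_power)
    show "d k \<in> {0..1}" unfolding d_def using divide_right_mono[OF le, of "2 ^ k"] by simp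
    have "d k - x = (real (nat \<lfloor>2 ^ k * x\<rfloor>) - 2 ^ k * x) / 2 ^ k" by (simp add: d_def field_simps)
    then have "\<bar>d k - x\<bar> = \<bar>real (nat \<lfloor>2 ^ k * x\<rfloor>) - 2 ^ k * x\<bar> / 2 ^ k" by (simp add: abs_divide)
    also have "\<dots> \<le> 1 / 2 ^ k"
    proof (rule divide_right_mono)
      show "\<bar>real (nat \<lfloor>2 ^ k * x\<rfloor>) - 2 ^ k * x\<bar> \<le> 1" using f by linarith
    qed simp
    finally show "\<bar>d k - x\<bar> \<le> (1 / 2) ^ k" by (simp add: power_divide)
  qed
  have "d \<longlonglongrightarrow> x"
  proof (rule LIM_zero_cancel, rule Lim_null_comparison)
    show "\<forall>\<^sub>F k in sequentially. norm (d k - x) \<le> (1 / 2) ^ k" using d(1) by simp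
    show "(\<lambda>k. (1 / 2 :: real) ^ k) \<longlonglongrightarrow> 0" by (intro LIMSEQ_realpow_zero) auto
  qed
  then have "(\<lambda>k. g (d k)) \<longlonglongrightarrow> g x"
    using continuous_on_tendsto_compose[OF g _ x, of d sequentially] d(2) by simp
  then have "(\<lambda>k. \<bar>g (d k) - g 0\<bar>) \<longlonglongrightarrow> \<bar>g x - g 0\<bar>" by (intro tendsto_intros)
  then show ?thesis
  proof (rule LIMSEQ_le_const2)
    show "\<exists>N. \<forall>k\<ge>N. \<bar>g (d k) - g 0\<bar> \<le> A / (1 - b)"
      using dyadic[OF d(3)] geo order_trans unfolding d_def by blast
  qed
qed

locale fractional_brownian_motion =
  fixes M :: "'a measure" and H :: real and W :: "real \<Rightarrow> 'a \<Rightarrow> real"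
  assumes prob: "prob_space M" and fbm: "two_sided_fBm M H W" and H: "0 < H" "H < 1"
begin

sublocale prob_space M by (rule prob)

sublocale continuous_process M W
  using fbm by unfold_locales (auto simp: two_sided_fBm_def gaussian_process_def)

definition fbm_cov :: "real \<Rightarrow> real \<Rightarrow> real" where
  "fbm_cov x y = (\<bar>x\<bar> powr (2 * H) + \<bar>y\<bar> powr (2 * H) - \<bar>x - y\<bar> powr (2 * H)) / 2"

lemma W_mean: "(\<integral>\<omega>. W y \<omega> \<partial>M) = 0"
  using fbm by (simp add: two_sided_fBm_def)

lemma W_product: "(\<integral>\<omega>. W x \<omega> * W y \<omega> \<partial>M) = fbm_cov x y"
  using fbm W_mean unfolding two_sided_fBm_def cov_def fbm_cov_def by simp

lemma normal_law_integrable: "integrable (normal_law m s) (\<lambda>x. x)" if "s \<ge> 0"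
proof -
  have "integrable std_normal_distribution (\<lambda>x. m + s * x)"
    using integrable_std_normal_distribution_moment[of 1] prob_space_normal_density[of 1 0]
    by (intro Bochner_Integration.integrable_add integrable_mult_right finite_measure.integrable_const prob_space.finite_measure) auto
  then show ?thesis using that by (simp add: integrable_normal_law)
qed

text \<open>The definition of a Gaussian process leaves the mean of a combination open. It is 0
  because every \<open>W y\<close> has mean 0, but a vanishing Bochner integral is informative only
  after integrability has been read off from the law of \<open>W y\<close>.\<close>

lemma W_comb_normal:
  assumes "finite S"
  shows "\<exists>v. centred_normal M (\<lambda>\<omega>. \<Sum>i\<in>S. c i * W i \<omega>) v"
proof -
  have gp: "\<exists>m s. s \<ge> 0 \<and> distr M borel (\<lambda>\<omega>. \<Sum>i\<in>S. c i * W i \<omega>) = normal_law m s" if "finite S" for S c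
    using fbm that unfolding two_sided_fBm_def gaussian_process_def by blast
  have W_int: "integrable M (W y)" for y
  proof -
    from gp[of "{y}" "\<lambda>_. 1"] obtain m s where ms: "s \<ge> 0" "distr M borel (W y) = normal_law m s" by auto
    have "integrable (distr M borel (W y)) (\<lambda>x. x)" unfolding ms(2) by (rule normal_law_integrable[OF ms(1)])
    then show ?thesis by (subst (asm) integrable_distr_eq) auto
  qed
  let ?X = "\<lambda>\<omega>. \<Sum>i\<in>S. c i * W i \<omega>"
  obtain m s where ms: "s \<ge> 0" "distr M borel ?X = normal_law m s" using gp[OF assms] by blast
  have "(\<integral>\<omega>. ?X \<omega> \<partial>M) = 0" using W_int W_mean by simp
  moreover have "(\<integral>\<omega>. ?X \<omega> \<partial>M) = m"
  proof -
    have "(\<integral>\<omega>. ?X \<omega> \<partial>M) = (\<integral>x. x \<partial>distr M borel ?X)" by (subst integral_distr) auto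
    also have "\<dots> = (\<integral>x. m + s * x \<partial>std_normal_distribution)"
      unfolding ms(2) using ms(1) by (subst integral_normal_law) auto
    also have "\<dots> = m"
    proof -
      interpret N: prob_space std_normal_distribution by (rule prob_space_normal_density) simp
      have "integrable std_normal_distribution (\<lambda>x. x)" "(\<integral>x. x \<partial>std_normal_distribution) = 0"
        using integrable_std_normal_distribution_moment[of 1] integral_std_normal_distribution_moment_odd[of 1] by auto
      then show ?thesis using N.prob_space by (subst Bochner_Integration.integral_add) auto
    qed
    finally show ?thesis .
  qed
  ultimately have "m = 0" by simp
  then have "centred_normal M ?X (s\<^sup>2)" using ms by (simp add: centred_normal_def)
  then show ?thesis by blast
qed

lemma increment_normal: "centred_normal M (\<lambda>\<omega>. W y \<omega> - W x \<omega>) (\<bar>y - x\<bar> powr (2 * H))"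
proof -
  have int: "integrable M (\<lambda>\<omega>. W x \<omega> * W y \<omega>)" for x y
  proof -
    have "integrable M (\<lambda>\<omega>. (W y \<omega>)\<^sup>2)" for y
      using W_comb_normal[of "{y}" "\<lambda>_. 1"] centred_normal_power_integrable by fastforce
    then show ?thesis by (intro integrable_mult_squares) auto
  qed
  show ?thesis
  \<comment> \<open>For \<open>x = y\<close> the index set collapses to one point and the
    combination no longer represents the increment.\<close>
  proof (cases "x = y")
    case True
    then show ?thesis using prob
      by (intro centred_normal_charI) (auto simp: prob_space)
  next
    case False
    let ?c = "\<lambda>i. if i = y then 1 else -1"
    from False have "(\<Sum>i\<in>{x, y}. ?c i * W i \<omega>) = W y \<omega> - W x \<omega>" for \<omega> by simp
    then obtain v where v: "centred_normal M (\<lambda>\<omega>. W y \<omega> - W x \<omega>) v"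
      using W_comb_normal[of "{x, y}" ?c] by auto
    have "(\<integral>\<omega>. (W y \<omega> - W x \<omega>)\<^sup>2 \<partial>M) = (\<integral>\<omega>. W y \<omega> * W y \<omega> - 2 * (W x \<omega> * W y \<omega>) + W x \<omega> * W x \<omega> \<partial>M)"
      by (intro Bochner_Integration.integral_cong) (auto simp: power2_eq_square algebra_simps)
    also have "\<dots> = \<bar>y - x\<bar> powr (2 * H)"
      using int by (simp add: W_product fbm_cov_def abs_minus_commute field_simps)
    finally show ?thesis using v centred_normal_variance[OF v] by simp
  qed
qed

text \<open>The condition on \<open>p\<close> makes the moment of order \<open>2 * p\<close> of an
  increment of length 2^(-k) at most a constant times 16^(-k). There are 2^k of them, so the weight
  4^k still leaves 2^(-k), while 1/(n+1)^2 sums over the unit intervals. Ordering the double series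
  by n + k = m makes it a Cauchy product. The sign \<sigma> selects a half-line.\<close>

lemma scaled_moment_summable:
  assumes \<sigma>: "\<bar>\<sigma>\<bar> = 1" and p: "2 * H * real p \<ge> 4"
  shows "AE \<omega> in M. summable (\<lambda>m. \<Sum>n\<le>m. 4 ^ (m - n) / (real (Suc n))\<^sup>2 *
     (\<Sum>j<2 ^ (m - n). (W (\<sigma> * (real n + real (Suc j) / 2 ^ (m - n))) \<omega> - W (\<sigma> * (real n + real j / 2 ^ (m - n))) \<omega>) ^ (2 * p)))"
proof -
  define D where "D n k j \<omega> = W (\<sigma> * (real n + real (Suc j) / 2 ^ k)) \<omega> - W (\<sigma> * (real n + real j / 2 ^ k)) \<omega>" for n k j \<omega>
  define c :: real where "c = fact (2 * p) / (2 ^ p * fact p)"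
  have Dn: "centred_normal M (D n k j) ((1 / 2 ^ k) powr (2 * H))" for n k j
  proof -
    have "\<bar>\<sigma> * (real n + real (Suc j) / 2 ^ k) - \<sigma> * (real n + real j / 2 ^ k)\<bar> = 1 / 2 ^ k"
      unfolding right_diff_distrib[symmetric] abs_mult \<sigma> by (simp add: diff_divide_distrib[symmetric])
    then show ?thesis unfolding D_def[abs_def] using increment_normal by metis
  qed
  have Di: "integrable M (\<lambda>\<omega>. D n k j \<omega> ^ (2 * p))" for n k j
    by (rule centred_normal_power_integrable[OF Dn])
  have Dm: "(\<integral>\<omega>. D n k j \<omega> ^ (2 * p) \<partial>M) \<le> c * (1 / 16) ^ k" for n k j
  proof -
    have e: "(\<integral>\<omega>. D n k j \<omega> ^ (2 * p) \<partial>M) = c * ((1 / 2 ^ k) powr (2 * H)) ^ p"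
      unfolding c_def centred_normal_even_moment[OF Dn] by simp
    have "((1 / 2 ^ k) powr (2 * H)) ^ p = (1 / 2 ^ k :: real) powr (2 * H * real p)"
      by (simp add: powr_powr[symmetric] powr_realpow)
    also have "\<dots> \<le> (1 / 2 ^ k) powr 4"
      using p by (intro powr_mono') auto
    also have "\<dots> = (1 / 16) ^ k"
    proof -
      have "((2::real) ^ k) ^ 4 = (2 ^ 4) ^ k" by (simp only: power_mult[symmetric] mult.commute)
      then show ?thesis by (simp add: powr_numeral power_divide)
    qed
    finally have "c * ((1 / 2 ^ k) powr (2 * H)) ^ p \<le> c * (1 / 16) ^ k"
      by (rule mult_left_mono) (simp add: c_def)
    then show ?thesis unfolding e .
  qed
  have "AE \<omega> in M. summable (\<lambda>m. \<Sum>n\<le>m. 4 ^ (m - n) / (real (Suc n))\<^sup>2 * (\<Sum>j<2 ^ (m - n). D n (m - n) j \<omega> ^ (2 * p)))"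
  proof (rule AE_summable_if_integrals[where b="\<lambda>m. c * (\<Sum>n\<le>m. 1 / (real (Suc n))\<^sup>2 * (1 / 2) ^ (m - n))"])
    show "integrable M (\<lambda>\<omega>. \<Sum>n\<le>m. 4 ^ (m - n) / (real (Suc n))\<^sup>2 * (\<Sum>j<2 ^ (m - n). D n (m - n) j \<omega> ^ (2 * p)))" for m
      using Di by (intro Bochner_Integration.integrable_sum integrable_mult_right) auto
    show "(\<Sum>n\<le>m. 4 ^ (m - n) / (real (Suc n))\<^sup>2 * (\<Sum>j<2 ^ (m - n). D n (m - n) j \<omega> ^ (2 * p))) \<ge> 0" for m \<omega>
      by (intro sum_nonneg mult_nonneg_nonneg) (auto simp: power_mult)
    show "(\<integral>\<omega>. (\<Sum>n\<le>m. 4 ^ (m - n) / (real (Suc n))\<^sup>2 * (\<Sum>j<2 ^ (m - n). D n (m - n) j \<omega> ^ (2 * p))) \<partial>M)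
        \<le> c * (\<Sum>n\<le>m. 1 / (real (Suc n))\<^sup>2 * (1 / 2) ^ (m - n))" for m
    proof -
      have "(\<integral>\<omega>. (\<Sum>n\<le>m. 4 ^ (m - n) / (real (Suc n))\<^sup>2 * (\<Sum>j<2 ^ (m - n). D n (m - n) j \<omega> ^ (2 * p))) \<partial>M)
         = (\<Sum>n\<le>m. 4 ^ (m - n) / (real (Suc n))\<^sup>2 * (\<Sum>j<2 ^ (m - n). \<integral>\<omega>. D n (m - n) j \<omega> ^ (2 * p) \<partial>M))"
        using Di by (subst Bochner_Integration.integral_sum) (auto simp del: of_nat_Suc)
      also have "\<dots> \<le> (\<Sum>n\<le>m. 4 ^ (m - n) / (real (Suc n))\<^sup>2 * (\<Sum>j<(2::nat) ^ (m - n). c * (1 / 16) ^ (m - n)))"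
        by (intro sum_mono mult_left_mono Dm) auto
      also have "\<dots> = (\<Sum>n\<le>m. c * (1 / (real (Suc n))\<^sup>2 * (1 / 2) ^ (m - n)))"
      proof (rule sum.cong[OF refl])
        fix n
        have "4 ^ k * (2 ^ k * (1 / 16) ^ k) = (1 / 2 :: real) ^ k" for k
          by (simp flip: power_mult_distrib)
        then show "4 ^ (m - n) / (real (Suc n))\<^sup>2 * (\<Sum>j<(2::nat) ^ (m - n). c * (1 / 16) ^ (m - n)) = c * (1 / (real (Suc n))\<^sup>2 * (1 / 2) ^ (m - n))"
          by (simp add: field_simps del: of_nat_Suc)
      qed
      finally show ?thesis by (simp add: sum_distrib_left)
    qed
    have "summable (\<lambda>n. 1 / (real (Suc n))\<^sup>2)"
      using inverse_power_summable[of 2, where 'a=real]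
      by (subst summable_Suc_iff[of "\<lambda>n. 1 / real n ^ 2"]) (simp add: inverse_eq_divide)
    then show "summable (\<lambda>m. c * (\<Sum>n\<le>m. 1 / (real (Suc n))\<^sup>2 * (1 / 2) ^ (m - n)))"
      by (intro summable_mult summable_Cauchy_product) (auto intro: summable_geometric)
  qed
  then show ?thesis unfolding D_def .
qed

text \<open>Kolmogorov's continuity argument with constants tracked over the unit intervals
  [n, n+1]: increments of level k are at most \<open>A n * b ^ k\<close> with \<open>A n\<close> of
  order n^2, chaining bounds the oscillation on the interval by the same order, and adding up n
  intervals gives n^3.\<close>

lemma path_growth_one_side:
  assumes \<sigma>: "\<bar>\<sigma>\<bar> = 1"
  shows "AE \<omega> in M. \<exists>C. \<forall>y\<ge>0. \<bar>W (\<sigma> * y) \<omega>\<bar> \<le> C * (1 + y) ^ 3"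
proof -
  define p where "p = nat \<lceil>2 / H\<rceil> + 1"
  have "real p \<ge> 2 / H" unfolding p_def by linarith
  then have p: "2 * H * real p \<ge> 4" "p \<ge> 1" using H by (auto simp: field_simps p_def)
  \<comment> \<open>The root makes \<open>b ^ (2 * p)\<close> equal to 1/4, the inverse of the
    weight 4^k per level.\<close>
  define b where "b = root (2 * p) (1 / 4)"
  have b: "0 \<le> b" "b < 1" "b ^ (2 * p) = 1 / 4"
    using p(2) by (auto simp: b_def real_root_lt_1_iff)
  show ?thesis
    using scaled_moment_summable[OF \<sigma> p(1)] AE_space[of M]
  proof eventually_elim
    case (elim \<omega>)
    define D where "D n k j = W (\<sigma> * (real n + real (Suc j) / 2 ^ k)) \<omega> - W (\<sigma> * (real n + real j / 2 ^ k)) \<omega>" for n k j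
    define F where "F m = (\<Sum>n\<le>m. 4 ^ (m - n) / (real (Suc n))\<^sup>2 * (\<Sum>j<2 ^ (m - n). D n (m - n) j ^ (2 * p)))" for m
    have sF: "summable F" using elim(1) unfolding F_def D_def .
    define Z where "Z = suminf F"
    have tn: "4 ^ k / (real (Suc n))\<^sup>2 * (\<Sum>j<2 ^ k. D n k j ^ (2 * p)) \<ge> 0" for n k
      by (intro mult_nonneg_nonneg sum_nonneg) (auto simp: power_mult)
    have F0: "F m \<ge> 0" for m unfolding F_def by (intro sum_nonneg tn)
    have FZ: "F m \<le> Z" for m
      unfolding Z_def using sum_le_suminf[OF sF, of "{m}"] F0 by simp
    have Z0: "Z \<ge> 0" using F0[of 0] FZ[of 0] by linarith
    \<comment> \<open>The factor \<open>1 + Z\<close> keeps \<open>A n\<close> at least 1, so that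
      its power of exponent \<open>2 * p\<close> still dominates Z (n+1)^2.\<close>
    define A where "A n = (1 + Z) * (real (Suc n))\<^sup>2" for n
    have A0: "A n \<ge> 0" for n using Z0 by (simp add: A_def)
    have D_le: "\<bar>D n k j\<bar> \<le> A n * b ^ k" if "j < 2 ^ k" for n k j
    proof (rule power_le_imp_le_base)
      have "4 ^ k / (real (Suc n))\<^sup>2 * D n k j ^ (2 * p) \<le> 4 ^ k / (real (Suc n))\<^sup>2 * (\<Sum>j<2 ^ k. D n k j ^ (2 * p))"
        using that by (intro mult_left_mono member_le_sum) (auto simp: power_mult)
      also have "\<dots> \<le> F (n + k)"
        unfolding F_def using member_le_sum[of n "{..n + k}" "\<lambda>n'. 4 ^ (n + k - n') / (real (Suc n'))\<^sup>2 * (\<Sum>j<2 ^ (n + k - n'). D n' (n + k - n') j ^ (2 * p))"] tn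
        by simp
      also have "\<dots> \<le> Z" by (rule FZ)
      finally have "D n k j ^ (2 * p) \<le> Z * (real (Suc n))\<^sup>2 * (1 / 4) ^ k"
        by (simp add: field_simps del: of_nat_Suc)
      also have "\<dots> \<le> A n ^ (2 * p) * (1 / 4) ^ k"
      proof (rule mult_right_mono)
        have "Z * (real (Suc n))\<^sup>2 \<le> A n" unfolding A_def by (intro mult_right_mono) auto
        also have "A n = A n ^ 1" by simp
        also have "\<dots> \<le> A n ^ (2 * p)"
        proof (rule power_increasing)
          have "1 * 1 \<le> (1 + Z) * (real (Suc n))\<^sup>2" using Z0 by (intro mult_mono) auto
          then show "1 \<le> A n" by (simp add: A_def)
        qed (use p in simp)
        finally show "Z * (real (Suc n))\<^sup>2 \<le> A n ^ (2 * p)" .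
      qed simp
      also have "\<dots> = (A n * b ^ k) ^ (2 * p)"
      proof -
        have "(b ^ k) ^ (2 * p) = (b ^ (2 * p)) ^ k" by (simp only: power_mult[symmetric] mult.commute)
        then show ?thesis by (simp only: power_mult_distrib b(3))
      qed
      finally show "\<bar>D n k j\<bar> ^ Suc (2 * p - 1) \<le> (A n * b ^ k) ^ Suc (2 * p - 1)"
        using p(2) by (simp add: power_even_abs)
      show "0 \<le> A n * b ^ k" using A0 b by simp
    qed
    have cont: "continuous_on UNIV (\<lambda>y. W y \<omega>)" using W_continuous elim(2) by blast
    have unit: "\<bar>W (\<sigma> * (real n + d)) \<omega> - W (\<sigma> * real n) \<omega>\<bar> \<le> A n / (1 - b)" if "d \<in> {0..1}" for n d
    proof -
      have "\<bar>(\<lambda>d. W (\<sigma> * (real n + d)) \<omega>) d - (\<lambda>d. W (\<sigma> * (real n + d)) \<omega>) 0\<bar> \<le> A n / (1 - b)"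
      proof (rule dyadic_chaining[OF _ b(1,2) A0 _ that])
        show "continuous_on {0..1} (\<lambda>d. W (\<sigma> * (real n + d)) \<omega>)"
          by (intro continuous_on_compose2[OF cont] continuous_intros) auto
      qed (use D_le in \<open>simp add: D_def\<close>)
      then show ?thesis by simp
    qed
    define C where "C = (1 + Z) / (1 - b)"
    have C0: "C \<ge> 0" using Z0 b by (simp add: C_def)
    have AC: "A n / (1 - b) = C * (real (Suc n))\<^sup>2" for n by (simp add: A_def C_def)
    have nat: "\<bar>W (\<sigma> * real n) \<omega>\<bar> \<le> \<bar>W 0 \<omega>\<bar> + real n * (C * (real n)\<^sup>2)" for n
    proof (induction n)
      case (Suc n)
      have "\<bar>W (\<sigma> * real (Suc n)) \<omega>\<bar> \<le> \<bar>W (\<sigma> * real n) \<omega>\<bar> + C * (real (Suc n))\<^sup>2"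
        using unit[of 1 n] unfolding AC by (simp add: add.commute)
      also have "\<dots> \<le> \<bar>W 0 \<omega>\<bar> + real n * (C * (real n)\<^sup>2) + C * (real (Suc n))\<^sup>2" using Suc by simp
      also have "real n * (C * (real n)\<^sup>2) \<le> real n * (C * (real (Suc n))\<^sup>2)"
        using C0 by (intro mult_left_mono power_mono) auto
      finally show ?case by (simp add: distrib_right)
    qed simp
    show ?case
    proof (intro exI allI impI)
      fix y :: real assume y: "y \<ge> 0"
      define n where "n = nat \<lfloor>y\<rfloor>"
      define d where "d = y - real n"
      have n: "real n \<le> y" "y < real n + 1" using y unfolding n_def by linarith+
      have d: "d \<in> {0..1}" using n by (auto simp: d_def)
      have yd: "y = real n + d" by (simp add: d_def)
      have "\<bar>W (\<sigma> * y) \<omega>\<bar> \<le> \<bar>W (\<sigma> * real n) \<omega>\<bar> + C * (real (Suc n))\<^sup>2"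
        using unit[OF d, of n] unfolding AC yd by linarith
      also have "\<dots> \<le> \<bar>W 0 \<omega>\<bar> + real n * (C * (real n)\<^sup>2) + C * (real (Suc n))\<^sup>2" using nat[of n] by simp
      also have "real n * (C * (real n)\<^sup>2) \<le> real n * (C * (real (Suc n))\<^sup>2)"
        using C0 by (intro mult_left_mono power_mono) auto
      also have "\<bar>W 0 \<omega>\<bar> + real n * (C * (real (Suc n))\<^sup>2) + C * (real (Suc n))\<^sup>2 = \<bar>W 0 \<omega>\<bar> + C * (real (Suc n)) ^ 3"
        by (simp add: power2_eq_square power3_eq_cube algebra_simps)
      also have "\<dots> \<le> \<bar>W 0 \<omega>\<bar> * (1 + y) ^ 3 + C * (1 + y) ^ 3"
        using C0 n y by (intro add_mono mult_left_mono power_mono) (auto simp: one_le_power mult_le_cancel_left1)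
      finally show "\<bar>W (\<sigma> * y) \<omega>\<bar> \<le> (\<bar>W 0 \<omega>\<bar> + C) * (1 + y) ^ 3" by (simp add: distrib_right)
    qed
  qed
qed

lemma path_growth: "AE \<omega> in M. \<exists>C\<ge>0. \<forall>y. \<bar>W y \<omega>\<bar> \<le> C * (1 + \<bar>y\<bar>) ^ 3"
proof -
  have s: "\<bar>1 :: real\<bar> = 1" "\<bar>- 1 :: real\<bar> = 1" by auto
  show ?thesis
    using path_growth_one_side[OF s(1)] path_growth_one_side[OF s(2)]
  proof eventually_elim
    case (elim \<omega>)
    then obtain C D where C: "\<And>y. y \<ge> 0 \<Longrightarrow> \<bar>W y \<omega>\<bar> \<le> C * (1 + y) ^ 3" and D: "\<And>y. y \<ge> 0 \<Longrightarrow> \<bar>W (- y) \<omega>\<bar> \<le> D * (1 + y) ^ 3"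
      by auto
    have "\<bar>W y \<omega>\<bar> \<le> max 0 (max C D) * (1 + \<bar>y\<bar>) ^ 3" for y
    proof (cases "y \<ge> 0")
      case True
      then have "C * (1 + y) ^ 3 \<le> max 0 (max C D) * (1 + y) ^ 3" by (intro mult_right_mono) auto
      from order_trans[OF C[OF True] this] True show ?thesis by simp
    next
      case False
      then have "D * (1 + - y) ^ 3 \<le> max 0 (max C D) * (1 + - y) ^ 3" by (intro mult_right_mono) auto
      with D[of "- y"] False have "\<bar>W y \<omega>\<bar> \<le> max 0 (max C D) * (1 + - y) ^ 3" by (auto intro: order_trans)
      then show ?thesis using False by simp
    qed
    then show ?case by (intro exI[of _ "max 0 (max C D)"]) auto
  qed
qed

end

section \<open>The mild solution as a weighted integral of increments\<close>

text \<open>Integrating the heat flux over time gives the tail probability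
  \<open>P(sqrt t * |\<xi>| > z)\<close> of a standard normal variable \<open>\<xi>\<close> (the hitting time law of Brownian motion).\<close>

definition heat_weight :: "real \<Rightarrow> real \<Rightarrow> real" where
  "heat_weight t z = (if z < 0 then 0 else measure std_normal_distribution {\<xi>. z < sqrt t * \<bar>\<xi>\<bar>})"

definition mild :: "real \<Rightarrow> real \<Rightarrow> (real \<Rightarrow> real) \<Rightarrow> real" where
  "mild t x w = (\<integral>z. (w (x + z) - w (x - z)) * heat_weight t z \<partial>lborel)"

interpretation N: prob_space std_normal_distribution
  by (rule prob_space_normal_density) simp

text \<open>An expectation of indicators of half-open intervals is the form to which Fubini and
  moment bounds apply; the indicator also produces the value 0 for negative
  \<open>z\<close>.\<close>

lemma heat_weight_eq_integral:
  "heat_weight t z = (\<integral>\<xi>. indicator {0..<sqrt t * \<bar>\<xi>\<bar>} z \<partial>std_normal_distribution)"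
proof (cases "z < 0")
  case True
  then show ?thesis by (simp add: heat_weight_def)
next
  case False
  have "(\<integral>\<xi>. indicat_real {0..<sqrt t * \<bar>\<xi>\<bar>} z \<partial>std_normal_distribution) = (\<integral>\<xi>. indicat_real {\<xi>. z < sqrt t * \<bar>\<xi>\<bar>} \<xi> \<partial>std_normal_distribution)"
    using False by (intro Bochner_Integration.integral_cong) (auto simp: indicator_def)
  then show ?thesis using False by (simp add: heat_weight_def)
qed

lemma heat_weight_bounds: "0 \<le> heat_weight t z" "heat_weight t z \<le> 1"
  using N.prob_le_1 by (auto simp: heat_weight_def)

lemma heat_weight_measurable [measurable]: "heat_weight t \<in> borel_measurable borel"
proof -
  have "(\<lambda>p. indicator {0..<sqrt t * \<bar>snd p\<bar>} (fst p) :: real) = (\<lambda>p. if 0 \<le> fst p \<and> fst p < sqrt t * \<bar>snd p\<bar> then 1 else 0)"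
    by (auto simp: indicator_def)
  then have "(\<lambda>p. indicator {0..<sqrt t * \<bar>snd p\<bar>} (fst p) :: real) \<in> borel_measurable (borel \<Otimes>\<^sub>M std_normal_distribution)"
    by simp
  then show ?thesis
    unfolding heat_weight_eq_integral[abs_def]
    by (intro N.borel_measurable_lebesgue_integral) (simp add: case_prod_beta)
qed

lemma integrable_std_normal_power: "integrable std_normal_distribution (\<lambda>\<xi>. (c + d * \<bar>\<xi>\<bar>) ^ m)"
proof -
  have "(c + d * \<bar>\<xi>\<bar>) ^ m = (\<Sum>k\<le>m. of_nat (m choose k) * c ^ k * d ^ (m - k) * \<bar>\<xi> ^ (m - k)\<bar>)" for \<xi>
    unfolding binomial_ring by (simp add: power_mult_distrib power_abs mult.assoc)
  then show ?thesis
    by (simp del: power_abs) (intro Bochner_Integration.integrable_sum integrable_mult_right integrable_abs integrable_std_normal_distribution_moment)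
qed

text \<open>Markov's inequality for a moment of order \<open>m\<close> of the normal
  variable.\<close>

lemma heat_weight_decay:
  obtains C where "C \<ge> 0" "\<And>z. (1 + \<bar>z\<bar>) ^ m * heat_weight t z \<le> C"
proof
  let ?C = "\<integral>\<xi>. (1 + \<bar>sqrt t\<bar> * \<bar>\<xi>\<bar>) ^ m \<partial>std_normal_distribution"
  show "?C \<ge> 0" by (intro Bochner_Integration.integral_nonneg) auto
  fix z
  have i: "integrable std_normal_distribution (\<lambda>\<xi>. indicator {0..<sqrt t * \<bar>\<xi>\<bar>} z :: real)"
  proof (rule N.integrable_const_bound[of _ 1])
    have "(\<lambda>\<xi>. indicator {0..<sqrt t * \<bar>\<xi>\<bar>} z :: real) = (\<lambda>\<xi>. if 0 \<le> z \<and> z < sqrt t * \<bar>\<xi>\<bar> then 1 else 0)"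
      by (auto simp: indicator_def)
    then show "(\<lambda>\<xi>. indicator {0..<sqrt t * \<bar>\<xi>\<bar>} z :: real) \<in> borel_measurable std_normal_distribution" by simp
  qed (auto simp: indicator_def)
  have "(1 + \<bar>z\<bar>) ^ m * heat_weight t z = (\<integral>\<xi>. (1 + \<bar>z\<bar>) ^ m * indicator {0..<sqrt t * \<bar>\<xi>\<bar>} z \<partial>std_normal_distribution)"
    unfolding heat_weight_eq_integral by simp
  also have "\<dots> \<le> ?C"
  proof (rule Bochner_Integration.integral_mono)
    fix \<xi> :: real
    show "(1 + \<bar>z\<bar>) ^ m * indicator {0..<sqrt t * \<bar>\<xi>\<bar>} z \<le> (1 + \<bar>sqrt t\<bar> * \<bar>\<xi>\<bar>) ^ m"
    proof (cases "z \<in> {0..<sqrt t * \<bar>\<xi>\<bar>}")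
      case True
      moreover have "sqrt t * \<bar>\<xi>\<bar> \<le> \<bar>sqrt t\<bar> * \<bar>\<xi>\<bar>" by (rule mult_right_mono) auto
      ultimately have "\<bar>z\<bar> \<le> \<bar>sqrt t\<bar> * \<bar>\<xi>\<bar>" by (auto simp del: real_sqrt_abs)
      then show ?thesis using True by (simp add: power_mono)
    qed simp
  qed (use i integrable_std_normal_power in auto)
  finally show "(1 + \<bar>z\<bar>) ^ m * heat_weight t z \<le> ?C" .
qed

lemma integrable_inverse_quadratic: "integrable lborel (\<lambda>x::real. 1 / (1 + x\<^sup>2))"
  using integrable_I0i_1_div_plus_square integrable_inverse_1_plus_square
  by (simp add: set_integrable_def einterval_eq_UNIV inverse_eq_divide)

text \<open>Two further powers of decay give a multiple of 1/(1 + z^2) as a majorant.\<close>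

lemma heat_weight_integrable_power: "integrable lborel (\<lambda>z. (1 + \<bar>z\<bar>) ^ m * heat_weight t z)"
proof -
  obtain C where C: "C \<ge> 0" "\<And>z. (1 + \<bar>z\<bar>) ^ (m + 2) * heat_weight t z \<le> C"
    using heat_weight_decay[where m="m + 2" and t=t] by blast
  show ?thesis
  proof (rule Bochner_Integration.integrable_bound)
    show "integrable lborel (\<lambda>z. C * (1 / (1 + z\<^sup>2)))"
      by (intro integrable_mult_right integrable_inverse_quadratic)
    have "(1 + \<bar>z\<bar>) ^ m * heat_weight t z \<le> C / (1 + z\<^sup>2)" for z :: real
    proof -
      have "1 + z\<^sup>2 \<le> (1 + \<bar>z\<bar>)\<^sup>2" by (simp add: power2_sum)
      then have "(1 + z\<^sup>2) * ((1 + \<bar>z\<bar>) ^ m * heat_weight t z) \<le> (1 + \<bar>z\<bar>)\<^sup>2 * ((1 + \<bar>z\<bar>) ^ m * heat_weight t z)"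
        by (rule mult_right_mono) (simp add: heat_weight_bounds)
      also have "\<dots> \<le> C" using C(2)[of z] by (simp add: power_add power2_eq_square mult_ac)
      finally show ?thesis by (simp add: pos_le_divide_eq add_pos_nonneg mult.commute)
    qed
    then show "AE z in lborel. norm ((1 + \<bar>z\<bar>) ^ m * heat_weight t z) \<le> norm (C * (1 / (1 + z\<^sup>2)))"
      using C(1) by (intro AE_I2) (simp add: abs_mult heat_weight_bounds add_nonneg_nonneg)
  qed simp
qed

lemma heat_weight_integrable_bound:
  assumes [measurable]: "f \<in> borel_measurable borel" and b: "\<And>z. z \<ge> 0 \<Longrightarrow> \<bar>f z\<bar> \<le> C * (1 + \<bar>z\<bar>) ^ m"
  shows "integrable lborel (\<lambda>z. f z * heat_weight t z)"
proof (rule Bochner_Integration.integrable_bound)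
  show "integrable lborel (\<lambda>z. C * ((1 + \<bar>z\<bar>) ^ m * heat_weight t z))"
    by (intro integrable_mult_right heat_weight_integrable_power)
  show "AE z in lborel. norm (f z * heat_weight t z) \<le> norm (C * ((1 + \<bar>z\<bar>) ^ m * heat_weight t z))"
  proof (intro AE_I2)
    fix z :: real
    show "norm (f z * heat_weight t z) \<le> norm (C * ((1 + \<bar>z\<bar>) ^ m * heat_weight t z))"
    proof (cases "z < 0")
      case False
      then have "\<bar>f z\<bar> * heat_weight t z \<le> C * (1 + \<bar>z\<bar>) ^ m * heat_weight t z"
        using b[of z] by (intro mult_right_mono heat_weight_bounds) auto
      then have "\<bar>f z\<bar> * heat_weight t z \<le> \<bar>C * (1 + \<bar>z\<bar>) ^ m * heat_weight t z\<bar>" by linarith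
      then show ?thesis by (simp add: abs_mult heat_weight_bounds mult.assoc)
    qed (simp add: heat_weight_def)
  qed
qed simp

text \<open>With v = z / sqrt r the weight is 1 minus the normal mass of [-v, v]. The chain rule
  gives the standard normal density at v times z / (r sqrt r), and the scaling of the heat kernel
  identifies this as the flux.\<close>

lemma heat_weight_has_derivative:
  assumes z: "z > 0" and r: "r > 0"
  shows "((\<lambda>r. heat_weight r z) has_real_derivative heat_flux r z) (at r)"
proof -
  define G where "G v = (LBINT y=0..ereal v. std_normal_density y)" for v
  have c: "continuous_on A std_normal_density" for A
    unfolding std_normal_density_def by (intro continuous_intros) auto
  have i: "interval_lebesgue_integrable lborel (ereal a) (ereal b) std_normal_density" for a b
    using c[of UNIV] by (intro interval_integrable_isCont) (auto simp: continuous_on_eq_continuous_at)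
  have dG: "(G has_real_derivative std_normal_density v) (at v)" for v
  proof -
    have "((\<lambda>u. LBINT y=ereal 0..ereal u. std_normal_density y) has_vector_derivative std_normal_density v) (at v within {min 0 v - 1..max 0 v + 1})"
      by (rule interval_integral_FTC2[where c=0]) (auto intro: c simp: min_def max_def)
    then have "((\<lambda>u. LBINT y=ereal 0..ereal u. std_normal_density y) has_vector_derivative std_normal_density v) (at v)"
      by (subst (asm) at_within_interior) (auto simp: min_def max_def)
    then show ?thesis unfolding G_def[abs_def] zero_ereal_def has_real_derivative_iff_has_vector_derivative .
  qed
  have hw: "heat_weight s z = 1 - (G (z / sqrt s) - G (- (z / sqrt s)))" if s: "s > 0" for s
  proof -
    define v where "v = z / sqrt s"
    have v: "v > 0" using z s by (simp add: v_def)
    have "z < sqrt s * \<bar>\<xi>\<bar> \<longleftrightarrow> v < \<bar>\<xi>\<bar>" for \<xi>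
      using s by (simp add: v_def pos_divide_less_eq mult.commute)
    then have "{\<xi>. z < sqrt s * \<bar>\<xi>\<bar>} = space std_normal_distribution - {-v..v}"
      by (simp add: set_eq_iff) linarith
    then have "heat_weight s z = 1 - measure std_normal_distribution {-v..v}"
      using N.prob_compl[of "{-v..v}"] z by (simp add: heat_weight_def)
    also have "measure std_normal_distribution {-v..v} = (\<integral>\<xi>. indicator {-v..v} \<xi> \<partial>std_normal_distribution)" by simp
    also have "\<dots> = (LINT y:{-v..v}|lborel. std_normal_density y)"
      unfolding set_lebesgue_integral_def by (subst integral_density) (auto simp: mult.commute)
    also have "\<dots> = (LBINT y=ereal (-v)..ereal v. std_normal_density y)"
      using v by (intro interval_integral_Icc[symmetric]) auto
    also have "\<dots> = G v - G (- v)"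
    proof -
      have "(LBINT y=0..ereal (-v). std_normal_density y) + (LBINT y=ereal (-v)..ereal v. std_normal_density y) = (LBINT y=0..ereal v. std_normal_density y)"
        unfolding zero_ereal_def by (rule interval_integral_sum) (use v i[of "-v" v] in \<open>simp add: min_def max_def\<close>)
      then show ?thesis unfolding G_def by simp
    qed
    finally show ?thesis by (simp add: v_def)
  qed
  have d1: "((\<lambda>s. z / sqrt s) has_real_derivative - (z / (2 * r * sqrt r))) (at r)"
  proof -
    have "((\<lambda>s. z / sqrt s) has_real_derivative - (z * (inverse (sqrt r) / 2)) / (sqrt r * sqrt r)) (at r)"
      using r by (auto intro!: derivative_eq_intros)
    moreover have "- (z * (inverse (sqrt r) / 2)) / (sqrt r * sqrt r) = - (z / (2 * r * sqrt r))"
      using r by (simp add: divide_simps)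
    ultimately show ?thesis by simp
  qed
  have "((\<lambda>s. 1 - (G (z / sqrt s) - G (- (z / sqrt s)))) has_real_derivative
     - (std_normal_density (z / sqrt r) * (- (z / (2 * r * sqrt r))) - std_normal_density (- (z / sqrt r)) * (- (- (z / (2 * r * sqrt r)))))) (at r)"
    using DERIV_chain2[OF dG d1] DERIV_chain2[OF dG DERIV_minus[OF d1]]
    by (auto intro!: derivative_eq_intros)
  also have "- (std_normal_density (z / sqrt r) * (- (z / (2 * r * sqrt r))) - std_normal_density (- (z / sqrt r)) * (- (- (z / (2 * r * sqrt r))))) = heat_flux r z"
    using r by (simp add: std_normal_density_def heat_flux_def heat_kernel_def power_divide real_sqrt_mult field_simps)
  finally have d: "((\<lambda>s. 1 - (G (z / sqrt s) - G (- (z / sqrt s)))) has_real_derivative heat_flux r z) (at r)" .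
  have "eventually (\<lambda>s. s > 0) (nhds r)" using r by (intro eventually_nhds_in_open[of "{0<..}", simplified]) auto
  then have ev: "eventually (\<lambda>s. heat_weight s z = 1 - (G (z / sqrt s) - G (- (z / sqrt s)))) (nhds r)"
    by eventually_elim (rule hw)
  show ?thesis using DERIV_cong_ev[OF refl ev refl] d by simp
qed

text \<open>The fundamental theorem of calculus in its version for nonnegative integrands, which
  yields integrability near r = 0 along with the value. The lower limit is 0 by Markov's inequality,
  as z times the weight is at most sqrt r E|\<xi>|.\<close>

lemma heat_flux_integral:
  assumes z: "z > 0" and t: "t > 0"
  shows "set_integrable lborel {0<..<t} (\<lambda>r. heat_flux r z)" "(LINT r:{0<..<t}|lborel. heat_flux r z) = heat_weight t z"
proof -
  have e: "einterval (ereal 0) (ereal t) = {0<..<t}" by (auto simp: einterval_def)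
  have lim0: "((\<lambda>r. heat_weight r z) \<longlongrightarrow> 0) (at_right 0)"
  proof (rule Lim_null_comparison)
    let ?E = "\<integral>\<xi>. \<bar>\<xi>\<bar> \<partial>std_normal_distribution"
    show "\<forall>\<^sub>F r in at_right 0. norm (heat_weight r z) \<le> sqrt r * ?E / z"
    proof (rule eventually_at_rightI[of 0 1])
      fix r :: real assume r: "r \<in> {0<..<1}"
      have ia: "integrable std_normal_distribution (\<lambda>\<xi>. \<bar>\<xi>\<bar>)"
        using integrable_std_normal_power[of 0 1 1] by simp
      have "z * heat_weight r z = (\<integral>\<xi>. z * indicator {0..<sqrt r * \<bar>\<xi>\<bar>} z \<partial>std_normal_distribution)"
        unfolding heat_weight_eq_integral by simp
      also have "\<dots> \<le> (\<integral>\<xi>. sqrt r * \<bar>\<xi>\<bar> \<partial>std_normal_distribution)"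
      proof (rule integral_mono_AE')
        show "integrable std_normal_distribution (\<lambda>\<xi>. sqrt r * \<bar>\<xi>\<bar>)" using ia by simp
      qed (use r in \<open>auto simp: indicator_def\<close>)
      finally show "norm (heat_weight r z) \<le> sqrt r * ?E / z"
        using z heat_weight_bounds[of r z] by (simp add: field_simps)
    qed simp
    have "((\<lambda>r. sqrt r * ?E / z) \<longlongrightarrow> sqrt 0 * ?E / z) (at_right 0)"
      using z by (intro tendsto_intros) auto
    then show "((\<lambda>r. sqrt r * ?E / z) \<longlongrightarrow> 0) (at_right 0)" by simp
  qed
  have limt: "((\<lambda>r. heat_weight r z) \<longlongrightarrow> heat_weight t z) (at_left t)"
    using DERIV_isCont[OF heat_weight_has_derivative[OF z t]]
    by (simp add: isCont_def filterlim_at_split)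
  have nn: "heat_flux r z \<ge> 0" if "r > 0" for r using z that by (simp add: heat_flux_def heat_kernel_def)
  have cont: "isCont (\<lambda>r. heat_flux r z) r" if "r > 0" for r
    unfolding heat_flux_def heat_kernel_def using that by (intro continuous_intros) auto
  note F = interval_integral_FTC_nonneg[of "ereal 0" "ereal t" "\<lambda>r. heat_weight r z" "\<lambda>r. heat_flux r z" 0 "heat_weight t z"]
  have "set_integrable lborel (einterval (ereal 0) (ereal t)) (\<lambda>r. heat_flux r z)"
    by (rule F(1)) (use t lim0 limt cont nn heat_weight_has_derivative[OF z] in \<open>auto simp: ereal_tendsto_simps\<close>)
  then show "set_integrable lborel {0<..<t} (\<lambda>r. heat_flux r z)" unfolding e .
  have "(LBINT r=ereal 0..ereal t. heat_flux r z) = heat_weight t z - 0"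
    by (rule F(2)) (use t lim0 limt cont nn heat_weight_has_derivative[OF z] in \<open>auto simp: ereal_tendsto_simps\<close>)
  then show "(LINT r:{0<..<t}|lborel. heat_flux r z) = heat_weight t z"
    using t by (simp add: interval_lebesgue_integral_def e)
qed

section \<open>Deterministic analysis of paths of cubic growth\<close>

lemma one_plus_abs_cube: "(1 + \<bar>x + z\<bar>) ^ 3 \<le> (1 + \<bar>x\<bar>) ^ 3 * (1 + \<bar>z\<bar>) ^ 3" for x z :: real
proof -
  have "1 + \<bar>x + z\<bar> \<le> (1 + \<bar>x\<bar>) * (1 + \<bar>z\<bar>)"
  proof -
    have "(1 + \<bar>x\<bar>) * (1 + \<bar>z\<bar>) = 1 + (\<bar>x\<bar> + \<bar>z\<bar>) + \<bar>x\<bar> * \<bar>z\<bar>" by (simp add: algebra_simps)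
    moreover have "0 \<le> \<bar>x\<bar> * \<bar>z\<bar>" by simp
    ultimately show ?thesis using abs_triangle_ineq[of x z] by linarith
  qed
  then have "(1 + \<bar>x + z\<bar>) ^ 3 \<le> ((1 + \<bar>x\<bar>) * (1 + \<bar>z\<bar>)) ^ 3" by (intro power_mono) auto
  then show ?thesis by (simp add: power_mult_distrib)
qed

text \<open>Isolates what the pathwise computations use; almost every fractional Brownian path
  satisfies it by \<open>path_growth\<close>.\<close>

locale tempered_path =
  fixes w :: "real \<Rightarrow> real" and C :: real
  assumes cont: "continuous_on UNIV w" and C: "C \<ge> 0" and growth: "\<And>y. \<bar>w y\<bar> \<le> C * (1 + \<bar>y\<bar>) ^ 3"
begin

lemma w_measurable [measurable]: "w \<in> borel_measurable borel"
  by (rule borel_measurable_continuous_onI) (rule cont)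

lemma shifted_growth: "\<bar>w (x + z)\<bar> \<le> C * (1 + \<bar>x\<bar>) ^ 3 * (1 + \<bar>z\<bar>) ^ 3"
  using order_trans[OF growth[of "x + z"] mult_left_mono[OF one_plus_abs_cube C]] by (simp add: mult.assoc)

lemma integrable_shift_weight:
  "integrable lborel (\<lambda>z. \<bar>w (x + z)\<bar> * heat_weight t z)" "integrable lborel (\<lambda>z. \<bar>w (x - z)\<bar> * heat_weight t z)"
proof -
  have "\<bar>w (x - z)\<bar> \<le> C * (1 + \<bar>x\<bar>) ^ 3 * (1 + \<bar>z\<bar>) ^ 3" for z using shifted_growth[of x "- z"] by simp
  then show "integrable lborel (\<lambda>z. \<bar>w (x - z)\<bar> * heat_weight t z)"
    by (intro heat_weight_integrable_bound[where m=3 and C="C * (1 + \<bar>x\<bar>) ^ 3"]) (simp, simp only: abs_idempotent)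
  show "integrable lborel (\<lambda>z. \<bar>w (x + z)\<bar> * heat_weight t z)"
    using shifted_growth[of x] by (intro heat_weight_integrable_bound[where m=3 and C="C * (1 + \<bar>x\<bar>) ^ 3"]) (simp, simp only: abs_idempotent)
qed

lemma difference_growth: "\<bar>w (x + z) - w (x - z)\<bar> \<le> 2 * (C * (1 + \<bar>x\<bar>) ^ 3) * (1 + \<bar>z\<bar>) ^ 3"
  using shifted_growth[of x z] shifted_growth[of x "- z"] by simp

text \<open>Since (1 + s)^3 <= 4 (1 + s^3), the factor \<open>z / r\<close> of the flux leads to the
  absolute normal moments of orders 1 and 4.\<close>

lemma flux_integrable:
  assumes r: "r > 0"
  shows "integrable lborel (\<lambda>z. w (x + z) * heat_flux r z)"
proof (rule Bochner_Integration.integrable_bound)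
  let ?D = "C * (1 + \<bar>x\<bar>) ^ 3"
  have hk: "heat_kernel r z = normal_density 0 (sqrt r) z" for z
    using r by (simp add: heat_kernel_def normal_density_def)
  show "integrable lborel (\<lambda>z. ?D * 4 / r * (normal_density 0 (sqrt r) z * \<bar>z - 0\<bar> ^ 1 + normal_density 0 (sqrt r) z * \<bar>z - 0\<bar> ^ 4))"
    using r by (intro integrable_mult_right Bochner_Integration.integrable_add integrable_normal_moment_abs) auto
  have "\<bar>w (x + z) * heat_flux r z\<bar> \<le> ?D * 4 / r * (normal_density 0 (sqrt r) z * \<bar>z - 0\<bar> ^ 1 + normal_density 0 (sqrt r) z * \<bar>z - 0\<bar> ^ 4)" for z
  proof -
    have "(1 + \<bar>z\<bar>) ^ 3 \<le> 4 * (1 + \<bar>z\<bar> ^ 3)"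
    proof -
      have "0 \<le> (\<bar>z\<bar> - 1)\<^sup>2 * (\<bar>z\<bar> + 1) * 3" by simp
      also have "(\<bar>z\<bar> - 1)\<^sup>2 * (\<bar>z\<bar> + 1) * 3 = 4 * (1 + \<bar>z\<bar> ^ 3) - (1 + \<bar>z\<bar>) ^ 3"
        by (simp add: power2_eq_square power3_eq_cube algebra_simps)
      finally show ?thesis by simp
    qed
    then have "\<bar>w (x + z)\<bar> \<le> ?D * (4 * (1 + \<bar>z\<bar> ^ 3))"
      using C by (intro order_trans[OF shifted_growth mult_left_mono]) auto
    then have "\<bar>w (x + z)\<bar> * (\<bar>z\<bar> / r * heat_kernel r z) \<le> ?D * (4 * (1 + \<bar>z\<bar> ^ 3)) * (\<bar>z\<bar> / r * heat_kernel r z)"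
      using r by (intro mult_right_mono) (auto simp: hk)
    also have "\<bar>w (x + z)\<bar> * (\<bar>z\<bar> / r * heat_kernel r z) = \<bar>w (x + z) * heat_flux r z\<bar>"
      using r by (simp add: heat_flux_def abs_mult hk)
    also have "?D * (4 * (1 + \<bar>z\<bar> ^ 3)) * (\<bar>z\<bar> / r * heat_kernel r z) = ?D * 4 / r * (normal_density 0 (sqrt r) z * \<bar>z - 0\<bar> ^ 1 + normal_density 0 (sqrt r) z * \<bar>z - 0\<bar> ^ 4)"
    proof -
      have "D * (4 * (1 + s ^ 3)) * (s / r * k) = D * 4 / r * (k * s ^ 1 + k * s ^ 4)" for D s k :: real
        using r by (simp add: field_simps power3_eq_cube power4_eq_xxxx)
      from this[of ?D "\<bar>z\<bar>"] show ?thesis unfolding hk diff_0_right .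
    qed
    finally show ?thesis .
  qed
  then show "AE z in lborel. norm (w (x + z) * heat_flux r z) \<le> norm (?D * 4 / r * (normal_density 0 (sqrt r) z * \<bar>z - 0\<bar> ^ 1 + normal_density 0 (sqrt r) z * \<bar>z - 0\<bar> ^ 4))"
    by (intro AE_I2) (smt (verit) real_norm_def)
  show "(\<lambda>z. w (x + z) * heat_flux r z) \<in> borel_measurable lborel"
    using measurable_Pair_compose_split[OF heat_flux_measurable, of "\<lambda>_. r" lborel "\<lambda>z. z"] by simp
qed

text \<open>From exp a >= a^2 / 2 the kernel decays at least like |z|^(-4), which beats the cubic
  growth of the path by one power.\<close>

lemma kernel_times_path_null:
  assumes r: "r > 0" and F: "F \<le> at_infinity"
  shows "((\<lambda>y. heat_kernel r (x - y) * w y) \<longlongrightarrow> 0) F"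
proof -
  let ?D = "C * (1 + \<bar>x\<bar>) ^ 3 * (64 * r\<^sup>2 / sqrt (2 * pi * r))"
  have bound: "\<bar>heat_kernel r z * w (x + z)\<bar> \<le> ?D / \<bar>z\<bar>" if z: "\<bar>z\<bar> \<ge> 1" for z
  proof -
    define a where "a = z\<^sup>2 / (2 * r)"
    have a: "a > 0" using z r by (auto simp: a_def)
    have "a\<^sup>2 / 2 \<le> exp a" using exp_lower_Taylor_quadratic[of a] a by simp
    then have "exp (- a) \<le> 2 / a\<^sup>2" using a by (simp add: exp_minus field_simps)
    also have "2 / a\<^sup>2 = 8 * r\<^sup>2 / \<bar>z\<bar> ^ 4" using r z by (simp add: a_def power_divide power_mult_distrib field_simps power_even_abs)
    finally have e: "exp (- a) \<le> 8 * r\<^sup>2 / \<bar>z\<bar> ^ 4" .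
    have "heat_kernel r z = 1 / sqrt (2 * pi * r) * exp (- a)" by (simp add: heat_kernel_def a_def)
    also have "\<dots> \<le> 1 / sqrt (2 * pi * r) * (8 * r\<^sup>2 / \<bar>z\<bar> ^ 4)" using r by (intro mult_left_mono e) auto
    finally have k: "heat_kernel r z \<le> 1 / sqrt (2 * pi * r) * (8 * r\<^sup>2 / \<bar>z\<bar> ^ 4)" .
    have k0: "heat_kernel r z \<ge> 0" using r by (simp add: heat_kernel_def)
    have "(1 + \<bar>z\<bar>) ^ 3 \<le> (2 * \<bar>z\<bar>) ^ 3" using z by (intro power_mono) auto
    then have "\<bar>w (x + z)\<bar> \<le> C * (1 + \<bar>x\<bar>) ^ 3 * (8 * \<bar>z\<bar> ^ 3)"
      using C by (intro order_trans[OF shifted_growth mult_left_mono]) (auto simp: power_mult_distrib)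
    then have "heat_kernel r z * \<bar>w (x + z)\<bar> \<le> (1 / sqrt (2 * pi * r) * (8 * r\<^sup>2 / \<bar>z\<bar> ^ 4)) * (C * (1 + \<bar>x\<bar>) ^ 3 * (8 * \<bar>z\<bar> ^ 3))"
      using k k0 r by (intro mult_mono) auto
    also have "\<dots> = ?D / \<bar>z\<bar>"
    proof -
      have "(1 / q * (8 * b / s ^ 4)) * (D * (8 * s ^ 3)) = D * (64 * b / q) / s" if "s \<noteq> 0" "q \<noteq> 0" for D s q b :: real
        using that by (simp add: field_simps power3_eq_cube power4_eq_xxxx)
      moreover have "\<bar>z\<bar> \<noteq> 0" "sqrt (2 * pi * r) \<noteq> 0" using z r by auto
      ultimately show ?thesis by blast
    qed
    finally show ?thesis using k0 by (simp add: abs_mult)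
  qed
  have "((\<lambda>z. heat_kernel r z * w (x + z)) \<longlongrightarrow> 0) at_infinity"
  proof (rule Lim_null_comparison)
    show "\<forall>\<^sub>F z in at_infinity. norm (heat_kernel r z * w (x + z)) \<le> ?D / \<bar>z\<bar>"
      unfolding eventually_at_infinity using bound by (intro exI[of _ 1]) auto
    show "((\<lambda>z. ?D / \<bar>z\<bar>) \<longlongrightarrow> 0) at_infinity"
    proof (rule tendsto_divide_0[OF tendsto_const])
      have "filterlim (\<lambda>z::real. \<bar>z\<bar>) at_top at_infinity"
        using filterlim_norm_at_top[where 'a=real] by (simp add: real_norm_def[abs_def])
      then show "filterlim (\<lambda>z::real. \<bar>z\<bar>) at_infinity at_infinity" by (rule filterlim_at_top_imp_at_infinity)
    qed
  qed
  moreover have "filterlim (\<lambda>y. y - x) at_infinity F"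
    using filterlim_mono[OF tendsto_add_filterlim_at_infinity'[OF filterlim_ident tendsto_const[of "- x"]] order_refl F] by simp
  ultimately have "((\<lambda>y. heat_kernel r (y - x) * w (x + (y - x))) \<longlongrightarrow> 0) F"
    by (rule filterlim_compose)
  then show ?thesis by (simp add: heat_kernel_def power2_commute)
qed

text \<open>The boundary terms vanish at both ends, which leaves minus the integral of the path
  against the flux at \<open>x - y\<close>. The flux is odd, so substituting y = x + z removes the
  sign.\<close>

lemma RS_integral_line_heat_kernel:
  assumes r: "r > 0"
  shows "RS_integral_line (\<lambda>y. heat_kernel r (x - y)) w = (\<integral>z. w (x + z) * heat_flux r z \<partial>lborel)"
proof -
  define g where "g y = w y * heat_flux r (x - y)" for y
  have odd: "heat_flux r (- z) = - heat_flux r z" for z by (simp add: heat_flux_def heat_kernel_def)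
  have gx: "g (x + 1 * z) = - (w (x + z) * heat_flux r z)" for z by (simp add: g_def odd)
  have gi: "integrable lborel g"
    using flux_integrable[OF r, of x] lborel_integrable_real_affine_iff[of 1 g x] unfolding gx by simp
  have gint: "(\<integral>y. g y \<partial>lborel) = - (\<integral>z. w (x + z) * heat_flux r z \<partial>lborel)"
    using lborel_integral_real_affine[of 1 g x] unfolding gx by simp
  have gs: "set_integrable lborel A g" if "A \<in> sets borel" for A
    unfolding set_integrable_def using gi that by (intro integrable_mult_indicator) auto
  let ?P = "RS_primitive (\<lambda>y. heat_kernel r (x - y)) (\<lambda>y. heat_flux r (x - y)) w"
  have P: "?P y = heat_kernel r (x - y) * w y - (LBINT y=0..ereal y. g y)" for y
    by (simp add: RS_primitive_def g_def)
  have top: "(?P \<longlongrightarrow> 0 - (LINT y:{0..}|lborel. g y)) at_top"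
    unfolding P
  proof (intro tendsto_diff kernel_times_path_null r at_top_le_at_infinity)
    have "((\<lambda>b. LINT y:{0..b}|lborel. g y) \<longlongrightarrow> (LINT y:{0..}|lborel. g y)) at_top"
      by (rule tendsto_set_lebesgue_integral_at_top) (auto intro: gs)
    moreover have "\<forall>\<^sub>F b in at_top. (LINT y:{0..b}|lborel. g y) = (LBINT y=0..ereal b. g y)"
      using eventually_ge_at_top[of "0::real"] by eventually_elim (simp add: interval_integral_Icc zero_ereal_def)
    ultimately show "((\<lambda>b. LBINT y=0..ereal b. g y) \<longlongrightarrow> (LINT y:{0..}|lborel. g y)) at_top"
      by (rule Lim_transform_eventually)
  qed
  have bot: "(?P \<longlongrightarrow> 0 - - (LINT y:{..0}|lborel. g y)) at_bot"
    unfolding P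
  proof (intro tendsto_diff kernel_times_path_null r at_bot_le_at_infinity)
    have "((\<lambda>a. LINT y:{a..0}|lborel. g y) \<longlongrightarrow> (LINT y:{..0}|lborel. g y)) at_bot"
      by (rule tendsto_set_lebesgue_integral_at_bot) (auto intro: gs)
    then have "((\<lambda>a. - (LINT y:{a..0}|lborel. g y)) \<longlongrightarrow> - (LINT y:{..0}|lborel. g y)) at_bot"
      by (rule tendsto_minus)
    moreover have "\<forall>\<^sub>F a in at_bot. - (LINT y:{a..0}|lborel. g y) = (LBINT y=0..ereal a. g y)"
      using eventually_le_at_bot[of "0::real"]
    proof eventually_elim
      case (elim a)
      have "(LBINT y=0..ereal a. g y) = - (LBINT y=ereal a..ereal 0. g y)"
        unfolding zero_ereal_def by (rule interval_integral_endpoints_reverse)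
      also have "(LBINT y=ereal a..ereal 0. g y) = (LINT y:{a..0}|lborel. g y)" using elim by (rule interval_integral_Icc)
      finally show ?case by simp
    qed
    ultimately show "((\<lambda>b. LBINT y=0..ereal b. g y) \<longlongrightarrow> - (LINT y:{..0}|lborel. g y)) at_bot"
      by (rule Lim_transform_eventually)
  qed
  have "((\<lambda>ab. ?P (snd ab) - ?P (fst ab)) \<longlongrightarrow> (0 - (LINT y:{0..}|lborel. g y)) - (0 - - (LINT y:{..0}|lborel. g y))) (at_bot \<times>\<^sub>F at_top)"
    by (intro tendsto_diff filterlim_compose[OF top filterlim_snd] filterlim_compose[OF bot filterlim_fst])
  also have "(0 - (LINT y:{0..}|lborel. g y)) - (0 - - (LINT y:{..0}|lborel. g y)) = - (\<integral>y. g y \<partial>lborel)"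
  proof -
    have "(LINT y:{..0} \<union> {0..}|lborel. g y) = (LINT y:{..0}|lborel. g y) + (LINT y:{0..}|lborel. g y)"
    proof (rule set_integral_Un_AE)
      show "AE y in lborel. \<not> (y \<in> {..0} \<and> y \<in> {0::real..})"
        using AE_lborel_singleton[of "0::real"] by eventually_elim auto
    qed (auto intro: gs)
    moreover have "{..0} \<union> {0::real..} = UNIV" by auto
    ultimately show ?thesis by (simp add: set_lebesgue_integral_def)
  qed
  finally have lim: "((\<lambda>(a, b). ?P b - ?P a) \<longlongrightarrow> - (\<integral>y. g y \<partial>lborel)) (at_bot \<times>\<^sub>F at_top)"
    by (simp add: case_prod_unfold)
  show ?thesis
    using RS_integral_line_eq[OF heat_kernel_has_derivative continuous_heat_flux cont lim] gint by simp
qed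

text \<open>By Fubini the flux is integrated over time first. The result is the weight for z > 0
  and, the flux being odd, its negative reflection for z < 0; this is why the path enters through
  \<open>w (x + z) - w (x - z)\<close>.\<close>

lemma time_integral_eq_mild:
  assumes t: "t > 0"
  shows "(LINT s:{0<..<t}|lborel. RS_integral_line (\<lambda>y. heat_kernel (t - s) (x - y)) w) = mild t x w"
proof -
  define f where "f z r = w (x + z) * (indicator {0<..<t} r * heat_flux r z)" for z r
  define h where "h z = (\<integral>r. indicator {0<..<t} r * heat_flux r z \<partial>lborel)" for z
  have odd: "heat_flux r (- z) = - heat_flux r z" for r z by (simp add: heat_flux_def heat_kernel_def)
  have h_pos: "h z = heat_weight t z" "integrable lborel (\<lambda>r. indicator {0<..<t} r * heat_flux r z)" if "z > 0" for z
    using heat_flux_integral[OF that t] by (simp_all add: h_def set_lebesgue_integral_def set_integrable_def)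
  have h_neg: "h z = - heat_weight t (- z)" "integrable lborel (\<lambda>r. indicator {0<..<t} r * heat_flux r z)" if "z < 0" for z
    using h_pos[of "- z"] that unfolding h_def odd by auto
  have i_all: "integrable lborel (\<lambda>r. indicator {0<..<t} r * heat_flux r z)" for z
  proof -
    consider "z = 0" | "z > 0" | "z < 0" by linarith
    then show ?thesis by cases (use h_pos(2) h_neg(2) in \<open>auto simp: heat_flux_def\<close>)
  qed
  have norm_int: "(\<integral>r. norm (f z r) \<partial>lborel) = \<bar>w (x + z)\<bar> * heat_weight t \<bar>z\<bar>" if "z \<noteq> 0" for z
  proof -
    have "norm (f z r) = \<bar>w (x + z)\<bar> * (indicator {0<..<t} r * heat_flux r \<bar>z\<bar>)" for r
      unfolding f_def heat_flux_def heat_kernel_def by (auto simp: abs_mult indicator_def)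
    then show ?thesis using h_pos(1)[of "\<bar>z\<bar>"] that by (simp add: h_def)
  qed
  have fm: "(\<lambda>p. f (fst p) (snd p)) \<in> borel_measurable (lborel \<Otimes>\<^sub>M lborel)"
  proof -
    have "(\<lambda>p. heat_flux (snd p) (fst p)) \<in> borel_measurable (borel \<Otimes>\<^sub>M borel)"
      unfolding heat_flux_def heat_kernel_def by measurable
    then show ?thesis unfolding f_def by measurable
  qed
  have hw_refl: "integrable lborel (\<lambda>z. \<bar>w (x + z)\<bar> * heat_weight t z)" for x
    by (rule integrable_shift_weight)
  have hw_neg: "integrable lborel (\<lambda>z. \<bar>w (x + z)\<bar> * heat_weight t (- z))"
  proof -
    have "integrable lborel (\<lambda>z. \<bar>w (x - z)\<bar> * heat_weight t z)"
      by (rule integrable_shift_weight)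
    from lborel_integrable_real_affine[OF this, of "-1" 0] show ?thesis by simp
  qed
  have hw_abs: "heat_weight t \<bar>z\<bar> = heat_weight t z + heat_weight t (- z)" if "z \<noteq> 0" for z
    using that by (cases "z > 0") (auto simp: heat_weight_def)
  have ae0: "AE z in lborel. (z::real) \<noteq> 0" using AE_lborel_singleton[of "0::real"] by simp
  have "integrable lborel (\<lambda>z. \<bar>w (x + z)\<bar> * heat_weight t z + \<bar>w (x + z)\<bar> * heat_weight t (- z))"
    using hw_refl[of x] hw_neg by (rule Bochner_Integration.integrable_add)
  moreover have "AE z in lborel. \<bar>w (x + z)\<bar> * heat_weight t z + \<bar>w (x + z)\<bar> * heat_weight t (- z) = (\<integral>r. norm (f z r) \<partial>lborel)"
    using ae0 by eventually_elim (simp add: norm_int[unfolded real_norm_def] hw_abs distrib_left)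
  moreover have nm: "(\<lambda>z. \<integral>r. norm (f z r) \<partial>lborel) \<in> borel_measurable lborel"
  proof -
    have "(\<lambda>(z, r). norm (f z r)) \<in> borel_measurable (lborel \<Otimes>\<^sub>M lborel)"
      using measurable_compose[OF fm borel_measurable_norm] by (simp add: case_prod_beta)
    then show ?thesis by (rule lborel.borel_measurable_lebesgue_integral)
  qed
  ultimately have int1: "integrable lborel (\<lambda>z. \<integral>r. norm (f z r) \<partial>lborel)"
    by (subst integrable_cong_AE[where g="\<lambda>z. \<bar>w (x + z)\<bar> * heat_weight t z + \<bar>w (x + z)\<bar> * heat_weight t (- z)"]) (auto elim: eventually_mono)
  have "integrable (lborel \<Otimes>\<^sub>M lborel) (case_prod f)"
  proof (rule lborel_pair.Fubini_integrable)
    show "case_prod f \<in> borel_measurable (lborel \<Otimes>\<^sub>M lborel)" using fm by (simp add: case_prod_beta')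
    show "integrable lborel (\<lambda>z. \<integral>r. norm (case_prod f (z, r)) \<partial>lborel)" using int1 by simp
    show "AE z in lborel. integrable lborel (\<lambda>r. case_prod f (z, r))"
      unfolding f_def using i_all by (auto intro!: AE_I2)
  qed
  from lborel_pair.Fubini_integral[OF this]
  have fub: "(\<integral>r. (\<integral>z. f z r \<partial>lborel) \<partial>lborel) = (\<integral>z. (\<integral>r. f z r \<partial>lborel) \<partial>lborel)" .
  have "(LINT s:{0<..<t}|lborel. RS_integral_line (\<lambda>y. heat_kernel (t - s) (x - y)) w) =
     (\<integral>s. indicator {0<..<t} s * (\<integral>z. w (x + z) * heat_flux (t - s) z \<partial>lborel) \<partial>lborel)"
    unfolding set_lebesgue_integral_def
    by (intro Bochner_Integration.integral_cong refl) (auto simp: indicator_def RS_integral_line_heat_kernel)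
  also have "\<dots> = (\<integral>r. indicator {0<..<t} r * (\<integral>z. w (x + z) * heat_flux r z \<partial>lborel) \<partial>lborel)"
  proof -
    have "(\<integral>r. indicator {0<..<t} r * (\<integral>z. w (x + z) * heat_flux r z \<partial>lborel) \<partial>lborel) =
       (\<integral>s. indicator {0<..<t} (t + -1 * s) * (\<integral>z. w (x + z) * heat_flux (t + -1 * s) z \<partial>lborel) \<partial>lborel)"
      by (subst lborel_integral_real_affine[of "-1" _ t]) auto
    also have "\<dots> = (\<integral>s. indicator {0<..<t} s * (\<integral>z. w (x + z) * heat_flux (t - s) z \<partial>lborel) \<partial>lborel)"
      by (intro Bochner_Integration.integral_cong refl) (auto simp: indicator_def)
    finally show ?thesis ..
  qed
  also have "\<dots> = (\<integral>r. (\<integral>z. f z r \<partial>lborel) \<partial>lborel)"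
  proof (intro Bochner_Integration.integral_cong refl)
    fix r
    have "(\<integral>z. f z r \<partial>lborel) = (\<integral>z. indicator {0<..<t} r * (w (x + z) * heat_flux r z) \<partial>lborel)"
      unfolding f_def by (simp add: mult_ac)
    then show "indicator {0<..<t} r * (\<integral>z. w (x + z) * heat_flux r z \<partial>lborel) = (\<integral>z. f z r \<partial>lborel)" by simp
  qed
  also have "\<dots> = (\<integral>z. w (x + z) * h z \<partial>lborel)"
    unfolding fub unfolding f_def h_def by simp
  also have "\<dots> = (\<integral>z. w (x + z) * heat_weight t z - w (x + z) * heat_weight t (- z) \<partial>lborel)"
  proof (rule integral_cong_AE)
    have "(\<lambda>p. indicator {0<..<t} (snd p) * heat_flux (snd p) (fst p)) \<in> borel_measurable (lborel \<Otimes>\<^sub>M lborel)"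
      unfolding heat_flux_def heat_kernel_def by measurable
    then have [measurable]: "h \<in> borel_measurable lborel"
      unfolding h_def[abs_def] by (intro lborel.borel_measurable_lebesgue_integral) (simp add: case_prod_beta)
    show "(\<lambda>z. w (x + z) * h z) \<in> borel_measurable lborel" by measurable
    show "AE z in lborel. w (x + z) * h z = w (x + z) * heat_weight t z - w (x + z) * heat_weight t (- z)"
      using ae0
    proof eventually_elim
      case (elim z)
      then show ?case using h_pos(1)[of z] h_neg(1)[of z] by (cases "z > 0") (auto simp: heat_weight_def)
    qed
  qed measurable
  also have "\<dots> = (\<integral>z. w (x + z) * heat_weight t z \<partial>lborel) - (\<integral>z. w (x + z) * heat_weight t (- z) \<partial>lborel)"
  proof (rule Bochner_Integration.integral_diff)
    show "integrable lborel (\<lambda>z. w (x + z) * heat_weight t z)"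
      by (rule Bochner_Integration.integrable_bound[OF hw_refl[of x]]) (auto simp: abs_mult heat_weight_bounds)
    show "integrable lborel (\<lambda>z. w (x + z) * heat_weight t (- z))"
      by (rule Bochner_Integration.integrable_bound[OF hw_neg]) (auto simp: abs_mult heat_weight_bounds)
  qed
  also have "(\<integral>z. w (x + z) * heat_weight t (- z) \<partial>lborel) = (\<integral>z. w (x - z) * heat_weight t z \<partial>lborel)"
    by (subst lborel_integral_real_affine[of "-1" _ 0]) auto
  also have "(\<integral>z. w (x + z) * heat_weight t z \<partial>lborel) - (\<integral>z. w (x - z) * heat_weight t z \<partial>lborel) = mild t x w"
  proof -
    have "integrable lborel (\<lambda>z. w (x + z) * heat_weight t z)" "integrable lborel (\<lambda>z. w (x - z) * heat_weight t z)"
      by (rule Bochner_Integration.integrable_bound[OF integrable_shift_weight(1)[of x t]]; simp add: abs_mult heat_weight_bounds)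
        (rule Bochner_Integration.integrable_bound[OF integrable_shift_weight(2)[of x t]]; simp add: abs_mult heat_weight_bounds)
    then show ?thesis unfolding mild_def by (simp add: left_diff_distrib)
  qed
  finally show ?thesis .
qed

end

section \<open>Second differences of powers\<close>

text \<open>By homogeneity only c = a / d matters. For c <= 1/2 the first-order Taylor terms cancel
  and the second derivative is bounded. For c > 1/2 all terms are at most quadratic because p < 2:
  the two powers cost 9 c^2 each and the constant 2 costs 8 c^2, whence 26.\<close>

lemma second_difference_bound:
  fixes p d a :: real
  assumes p: "0 < p" "p < 2" and d: "d > 0" and a: "a \<ge> 0"
  shows "\<bar>\<bar>d + a\<bar> powr p + \<bar>d - a\<bar> powr p - 2 * d powr p\<bar> \<le> 26 * d powr (p - 2) * a\<^sup>2"
proof -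
  have unit: "\<bar>\<bar>1 + c\<bar> powr p + \<bar>1 - c\<bar> powr p - 2\<bar> \<le> 26 * c\<^sup>2" if c: "c \<ge> 0" for c :: real
  proof (cases "c \<le> 1 / 2")
    case False
    have le: "y powr p \<le> (1 + c)\<^sup>2" if "0 \<le> y" "y \<le> 1 + c" for y
    proof -
      have "y powr p \<le> (1 + c) powr p" using that p by (intro powr_mono2) auto
      also have "\<dots> \<le> (1 + c) powr 2" using c p by (intro powr_mono) auto
      also have "\<dots> = (1 + c)\<^sup>2" using c by (simp add: powr_numeral)
      finally show ?thesis .
    qed
    have "(1 + c)\<^sup>2 \<le> (3 * c)\<^sup>2" using False by (intro power_mono) auto
    then have s: "(1 + c)\<^sup>2 \<le> 9 * c\<^sup>2" by (simp add: power_mult_distrib)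
    have "(1 / 2)\<^sup>2 \<le> c\<^sup>2" using False by (intro power_mono) auto
    then have q: "2 \<le> 8 * c\<^sup>2" by (simp add: power2_eq_square)
    have "\<bar>1 + c\<bar> powr p \<le> (1 + c)\<^sup>2" "\<bar>1 - c\<bar> powr p \<le> (1 + c)\<^sup>2" using c by (intro le; simp)+
    moreover have "\<bar>1 + c\<bar> powr p \<ge> 0" "\<bar>1 - c\<bar> powr p \<ge> 0" by auto
    ultimately show ?thesis using s q by linarith
  next
    case True
    show ?thesis
    proof (cases "c = 0")
      case False
      define D where "D m x = (if m = (0::nat) then (1 + x) powr p + (1 - x) powr p
        else if m = 1 then p * (1 + x) powr (p - 1) - p * (1 - x) powr (p - 1)
        else p * ((p - 1) * (1 + x) powr (p - 2)) + p * ((p - 1) * (1 - x) powr (p - 2)))" for m and x :: real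
      have up: "((\<lambda>x. (1 + x) powr q) has_real_derivative q * (1 + x) powr (q - 1)) (at x)" if "0 \<le> x" for q x :: real
        proof -
        have "((\<lambda>x. 1 + x) has_real_derivative 1) (at x)" by (auto intro!: derivative_eq_intros)
        from DERIV_chain2[where f="\<lambda>x. x powr q" and g="\<lambda>x. 1 + x", OF has_real_derivative_powr this] that
        show ?thesis by simp
      qed
      have down: "((\<lambda>x. (1 - x) powr q) has_real_derivative - (q * (1 - x) powr (q - 1))) (at x)" if "x < 1" for q x :: real
        proof -
        have "((\<lambda>x. 1 - x) has_real_derivative - 1) (at x)" by (auto intro!: derivative_eq_intros)
        from DERIV_chain2[where f="\<lambda>x. x powr q" and g="\<lambda>x. 1 - x", OF has_real_derivative_powr this] that
        show ?thesis by simp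
      qed
      have der: "(D m has_real_derivative D (Suc m) x) (at x)" if m: "m < 2" and x: "0 \<le> x" "x \<le> c" for m x
      proof -
        have x1: "x < 1" using x True by simp
        consider "m = 0" | "m = 1" using m by linarith
        then show ?thesis
        proof cases
          case 1
          have "((\<lambda>x. (1 + x) powr p + (1 - x) powr p) has_real_derivative p * (1 + x) powr (p - 1) + - (p * (1 - x) powr (p - 1))) (at x)"
            by (intro DERIV_add up down x x1)
          then show ?thesis using 1 by (simp add: D_def[abs_def])
        next
          case 2
          have "((\<lambda>x. p * (1 + x) powr (p - 1) - p * (1 - x) powr (p - 1)) has_real_derivative
             p * ((p - 1) * (1 + x) powr (p - 1 - 1)) - p * - ((p - 1) * (1 - x) powr (p - 1 - 1))) (at x)"
            by (intro DERIV_diff DERIV_cmult up down x x1)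
          then show ?thesis using 2 by (simp add: D_def[abs_def])
        qed
      qed
      obtain x where x: "0 < x" "x < c" "D 0 c = (\<Sum>m<2. D m 0 / fact m * c ^ m) + D 2 x / fact 2 * c ^ 2"
        using Maclaurin[of c 2 D "D 0"] der c False by auto
      have e: "\<bar>1 + c\<bar> powr p + \<bar>1 - c\<bar> powr p - 2 = D 2 x / 2 * c\<^sup>2"
        using x(3) c True by (simp add: D_def numeral_2_eq_2)
      have y4: "0 \<le> y powr (p - 2)" "y powr (p - 2) \<le> 4" if y: "1 / 2 \<le> y" for y :: real
      proof -
        have "y powr (p - 2) \<le> (1 / 2) powr (p - 2)" using y p by (intro powr_mono2') auto
        also have "\<dots> \<le> (1 / 2) powr (- 2)" using p by (intro powr_mono') auto
        also have "\<dots> = 4" by (simp add: powr_minus powr_numeral power2_eq_square)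
        finally show "y powr (p - 2) \<le> 4" .
      qed auto
      have "\<bar>p * (p - 1)\<bar> \<le> 2 * 1" unfolding abs_mult using p by (intro mult_mono) auto
      moreover have "\<bar>(1 + x) powr (p - 2) + (1 - x) powr (p - 2)\<bar> \<le> 8"
        using y4[of "1 + x"] y4[of "1 - x"] x True by auto
      ultimately have "\<bar>p * (p - 1)\<bar> * \<bar>(1 + x) powr (p - 2) + (1 - x) powr (p - 2)\<bar> \<le> 2 * 1 * 8"
        by (intro mult_mono) auto
      also have "\<bar>p * (p - 1)\<bar> * \<bar>(1 + x) powr (p - 2) + (1 - x) powr (p - 2)\<bar> = \<bar>D 2 x\<bar>"
        unfolding abs_mult[symmetric] by (simp add: D_def algebra_simps)
      finally have "\<bar>D 2 x / 2\<bar> \<le> 26" by simp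
      then have "\<bar>D 2 x / 2\<bar> * c\<^sup>2 \<le> 26 * c\<^sup>2" by (rule mult_right_mono) simp
      then show ?thesis unfolding e by (simp add: abs_mult)
    qed simp
  qed
  define c where "c = a / d"
  have c: "c \<ge> 0" "a = d * c" using a d by (auto simp: c_def)
  have "d + a = d * (1 + c)" "d - a = d * (1 - c)" by (simp_all add: c(2) distrib_left right_diff_distrib)
  then have "\<bar>d + a\<bar> = d * \<bar>1 + c\<bar>" "\<bar>d - a\<bar> = d * \<bar>1 - c\<bar>" using d by (simp_all add: abs_mult)
  then have "\<bar>d + a\<bar> powr p + \<bar>d - a\<bar> powr p - 2 * d powr p = d powr p * (\<bar>1 + c\<bar> powr p + \<bar>1 - c\<bar> powr p - 2)"
    using d by (simp add: powr_mult algebra_simps)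
  then have "\<bar>\<bar>d + a\<bar> powr p + \<bar>d - a\<bar> powr p - 2 * d powr p\<bar> \<le> d powr p * (26 * c\<^sup>2)"
    using unit[OF c(1)] by (simp add: abs_mult mult_left_mono)
  also have "d powr p * (26 * c\<^sup>2) = 26 * d powr (p - 2) * a\<^sup>2"
  proof -
    have "d powr p = d powr (p - 2) * d\<^sup>2" using d powr_add[of d "p - 2" 2] by (simp add: powr_numeral)
    then show ?thesis by (simp only: c(2) power_mult_distrib mult_ac)
  qed
  finally show ?thesis .
qed

text \<open>For fractional Brownian motion \<open>mixed_difference (2 * H) d z v\<close> is the covariance of increments
  over intervals of radii \<open>z\<close> and \<open>v\<close> whose centres are at distance \<open>d\<close>, so that
  \<open>mild_cov (2 * H) t s d\<close> is that of the mild solutions.\<close>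

definition mixed_difference :: "real \<Rightarrow> real \<Rightarrow> real \<Rightarrow> real \<Rightarrow> real" where
  "mixed_difference p d z v =
     (\<bar>d + z + v\<bar> powr p + \<bar>d - z - v\<bar> powr p - \<bar>d + z - v\<bar> powr p - \<bar>d - z + v\<bar> powr p) / 2"

definition mild_cov :: "real \<Rightarrow> real \<Rightarrow> real \<Rightarrow> real \<Rightarrow> real" where
  "mild_cov p t s d = (\<integral>z. (\<integral>v. mixed_difference p d z v * heat_weight s v \<partial>lborel) * heat_weight t z \<partial>lborel)"

text \<open>A mixed difference is half the difference of two symmetric second differences, of radii
  z + v and |z - v|, since their middle terms cancel.\<close>

lemma mixed_difference_bound:
  assumes p: "0 < p" "p < 2" and d: "d \<noteq> 0" and zv: "z \<ge> 0" "v \<ge> 0"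
  shows "\<bar>mixed_difference p d z v\<bar> \<le> 26 * \<bar>d\<bar> powr (p - 2) * (1 + \<bar>z\<bar>)\<^sup>2 * (1 + \<bar>v\<bar>)\<^sup>2"
proof -
  define S where "S c = \<bar>\<bar>d\<bar> + c\<bar> powr p + \<bar>\<bar>d\<bar> - c\<bar> powr p - 2 * \<bar>d\<bar> powr p" for c
  have S: "\<bar>S c\<bar> \<le> 26 * \<bar>d\<bar> powr (p - 2) * c\<^sup>2" if "c \<ge> 0" for c
    unfolding S_def using second_difference_bound[OF p _ that, of "\<bar>d\<bar>"] d by simp
  have Sd: "S c = \<bar>d + c\<bar> powr p + \<bar>d - c\<bar> powr p - 2 * \<bar>d\<bar> powr p" for c
  proof (cases "d > 0")
    case False
    then have "\<bar>\<bar>d\<bar> + c\<bar> = \<bar>d - c\<bar>" "\<bar>\<bar>d\<bar> - c\<bar> = \<bar>d + c\<bar>" by auto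
    then show ?thesis unfolding S_def by simp
  qed (simp add: S_def)
  have even: "S (- c) = S c" for c unfolding Sd by simp
  have "mixed_difference p d z v = (S (z + v) - S (z - v)) / 2"
    unfolding mixed_difference_def Sd by (simp add: algebra_simps)
  also have "S (z - v) = S \<bar>z - v\<bar>" using even[of "z - v"] by (auto simp: abs_if)
  finally have "\<bar>mixed_difference p d z v\<bar> \<le> (\<bar>S (z + v)\<bar> + \<bar>S \<bar>z - v\<bar>\<bar>) / 2"
    using abs_triangle_ineq4[of "S (z + v)" "S \<bar>z - v\<bar>"] by (simp only: abs_divide abs_numeral divide_right_mono zero_le_numeral)
  also have "\<dots> \<le> 26 * \<bar>d\<bar> powr (p - 2) * (z + v)\<^sup>2"
  proof -
    have "\<bar>z - v\<bar>\<^sup>2 \<le> (z + v)\<^sup>2" using zv by (intro power_mono) auto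
    then have "26 * \<bar>d\<bar> powr (p - 2) * \<bar>z - v\<bar>\<^sup>2 \<le> 26 * \<bar>d\<bar> powr (p - 2) * (z + v)\<^sup>2"
      by (intro mult_left_mono) auto
    moreover have "\<bar>S (z + v)\<bar> \<le> 26 * \<bar>d\<bar> powr (p - 2) * (z + v)\<^sup>2" by (rule S) (use zv in simp)
    moreover have "\<bar>S \<bar>z - v\<bar>\<bar> \<le> 26 * \<bar>d\<bar> powr (p - 2) * \<bar>z - v\<bar>\<^sup>2" by (rule S) simp
    ultimately show ?thesis by (simp only: field_sum_of_halves pos_divide_le_eq zero_less_numeral)
  qed
  also have "\<dots> \<le> 26 * \<bar>d\<bar> powr (p - 2) * ((1 + \<bar>z\<bar>) * (1 + \<bar>v\<bar>))\<^sup>2"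
  proof (intro mult_left_mono power_mono)
    have "(1 + \<bar>z\<bar>) * (1 + \<bar>v\<bar>) = 1 + z + v + z * v" using zv by (simp add: algebra_simps)
    then show "z + v \<le> (1 + \<bar>z\<bar>) * (1 + \<bar>v\<bar>)" using zv by simp
  qed (use zv in auto)
  finally show ?thesis by (simp add: power_mult_distrib mult.assoc)
qed

text \<open>Integrating the bound on mixed differences against the two weights costs only the finite
  moments in \<open>?A\<close>, which do not depend on the distance.\<close>

lemma mild_cov_bound:
  assumes p: "0 < p" "p < 2"
  obtains C where "\<And>d. d \<noteq> 0 \<Longrightarrow> \<bar>mild_cov p t s d\<bar> \<le> C * \<bar>d\<bar> powr (p - 2)"
proof
  let ?A = "\<lambda>t. \<integral>z. (1 + \<bar>z\<bar>)\<^sup>2 * heat_weight t z \<partial>lborel"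
  have hz: "heat_weight t z = 0" if "z < 0" for t z using that by (simp add: heat_weight_def)
  have A0: "0 \<le> ?A t" for t by (intro Bochner_Integration.integral_nonneg) (simp add: heat_weight_bounds)
  fix d :: real assume d: "d \<noteq> 0"
  let ?K = "26 * \<bar>d\<bar> powr (p - 2)"
  have inner: "\<bar>\<integral>v. mixed_difference p d z v * heat_weight s v \<partial>lborel\<bar> \<le> ?K * (1 + \<bar>z\<bar>)\<^sup>2 * ?A s" if z: "z \<ge> 0" for z
  proof -
    have "\<bar>\<integral>v. mixed_difference p d z v * heat_weight s v \<partial>lborel\<bar> \<le> (\<integral>v. \<bar>mixed_difference p d z v * heat_weight s v\<bar> \<partial>lborel)"
      by (rule integral_abs_bound)
    also have "\<dots> \<le> (\<integral>v. ?K * (1 + \<bar>z\<bar>)\<^sup>2 * ((1 + \<bar>v\<bar>)\<^sup>2 * heat_weight s v) \<partial>lborel)"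
    proof (rule integral_mono_AE')
      show "integrable lborel (\<lambda>v. ?K * (1 + \<bar>z\<bar>)\<^sup>2 * ((1 + \<bar>v\<bar>)\<^sup>2 * heat_weight s v))"
        by (intro integrable_mult_right heat_weight_integrable_power)
      show "AE v in lborel. \<bar>mixed_difference p d z v * heat_weight s v\<bar> \<le> ?K * (1 + \<bar>z\<bar>)\<^sup>2 * ((1 + \<bar>v\<bar>)\<^sup>2 * heat_weight s v)"
      proof (intro AE_I2)
        fix v :: real
        show "\<bar>mixed_difference p d z v * heat_weight s v\<bar> \<le> ?K * (1 + \<bar>z\<bar>)\<^sup>2 * ((1 + \<bar>v\<bar>)\<^sup>2 * heat_weight s v)"
        proof (cases "v < 0")
          case False
          then have "\<bar>mixed_difference p d z v\<bar> * heat_weight s v \<le> ?K * (1 + \<bar>z\<bar>)\<^sup>2 * (1 + \<bar>v\<bar>)\<^sup>2 * heat_weight s v"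
            using z by (intro mult_right_mono mixed_difference_bound p d heat_weight_bounds) auto
          then show ?thesis by (simp add: abs_mult heat_weight_bounds mult.assoc)
        qed (simp add: hz)
      qed
    qed (auto simp: heat_weight_bounds)
    also have "\<dots> = ?K * (1 + \<bar>z\<bar>)\<^sup>2 * ?A s" by simp
    finally show ?thesis .
  qed
  have "\<bar>mild_cov p t s d\<bar> \<le> (\<integral>z. \<bar>(\<integral>v. mixed_difference p d z v * heat_weight s v \<partial>lborel) * heat_weight t z\<bar> \<partial>lborel)"
    unfolding mild_cov_def by (rule integral_abs_bound)
  also have "\<dots> \<le> (\<integral>z. ?K * ?A s * ((1 + \<bar>z\<bar>)\<^sup>2 * heat_weight t z) \<partial>lborel)"
  proof (rule integral_mono_AE')
    show "integrable lborel (\<lambda>z. ?K * ?A s * ((1 + \<bar>z\<bar>)\<^sup>2 * heat_weight t z))"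
      by (intro integrable_mult_right heat_weight_integrable_power)
    show "AE z in lborel. \<bar>(\<integral>v. mixed_difference p d z v * heat_weight s v \<partial>lborel) * heat_weight t z\<bar> \<le> ?K * ?A s * ((1 + \<bar>z\<bar>)\<^sup>2 * heat_weight t z)"
    proof (intro AE_I2)
      fix z :: real
      show "\<bar>(\<integral>v. mixed_difference p d z v * heat_weight s v \<partial>lborel) * heat_weight t z\<bar> \<le> ?K * ?A s * ((1 + \<bar>z\<bar>)\<^sup>2 * heat_weight t z)"
      proof (cases "z < 0")
        case False
        then have "\<bar>\<integral>v. mixed_difference p d z v * heat_weight s v \<partial>lborel\<bar> * heat_weight t z \<le> ?K * (1 + \<bar>z\<bar>)\<^sup>2 * ?A s * heat_weight t z"
          by (intro mult_right_mono inner heat_weight_bounds) auto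
        then show ?thesis by (simp add: abs_mult heat_weight_bounds mult_ac)
      qed (simp add: hz)
    qed
  qed (auto simp: heat_weight_bounds A0)
  also have "\<dots> = (26 * ?A s * ?A t) * \<bar>d\<bar> powr (p - 2)" by simp
  finally show "\<bar>mild_cov p t s d\<bar> \<le> (26 * ?A s * ?A t) * \<bar>d\<bar> powr (p - 2)" .
qed

section \<open>The variance constant\<close>

text \<open>At 0 the difference quotients have size |h|^(q - 1) and vanish because q > 1. The two
  rules provide primitives of |y|^p on the whole line.\<close>

lemma abs_powr_has_derivative:
  fixes y :: real
  assumes "q > 1"
  shows "((\<lambda>y. \<bar>y\<bar> powr q) has_real_derivative q * (sgn y * \<bar>y\<bar> powr (q - 1))) (at y)"
    and "((\<lambda>y. sgn y * \<bar>y\<bar> powr q) has_real_derivative q * \<bar>y\<bar> powr (q - 1)) (at y)"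
proof -
  consider "y = 0" | "y > 0" | "y < 0" by linarith
  then have "((\<lambda>y. \<bar>y\<bar> powr q) has_real_derivative q * (sgn y * \<bar>y\<bar> powr (q - 1))) (at y) \<and>
    ((\<lambda>y. sgn y * \<bar>y\<bar> powr q) has_real_derivative q * \<bar>y\<bar> powr (q - 1)) (at y)"
  proof cases
    case 1
    have *: "((\<lambda>h::real. \<bar>h\<bar> powr (q - 1)) \<longlongrightarrow> 0) (at 0)"
    proof -
      have "((\<lambda>h::real. \<bar>h\<bar> powr (q - 1)) \<longlongrightarrow> \<bar>0\<bar> powr (q - 1)) (at 0)"
        using assms by (intro tendsto_intros) auto
      then show ?thesis by simp
    qed
    have e: "\<bar>h\<bar> powr q / \<bar>h\<bar> = \<bar>h\<bar> powr (q - 1)" if "h \<noteq> 0" for h :: real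
      using that powr_add[of "\<bar>h\<bar>" "q - 1" 1] by auto
    have "((\<lambda>h::real. \<bar>h\<bar> powr q / h) \<longlongrightarrow> 0) (at 0)"
      by (rule Lim_null_comparison[OF _ *]) (auto simp: eventually_at_filter e abs_mult abs_sgn_eq)
    moreover have "((\<lambda>h::real. sgn h * \<bar>h\<bar> powr q / h) \<longlongrightarrow> 0) (at 0)"
      by (rule Lim_null_comparison[OF _ *]) (auto simp: eventually_at_filter e abs_mult abs_sgn_eq)
    ultimately show ?thesis unfolding 1 using assms by (simp add: DERIV_def)
  next
    case 2
    have ev: "eventually (\<lambda>x. x > 0) (nhds y)" using 2 by (intro eventually_nhds_in_open[of "{0<..}", simplified]) auto
    have d: "((\<lambda>y. y powr q) has_real_derivative q * y powr (q - 1)) (at y)" by (rule has_real_derivative_powr[OF 2])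
    have "((\<lambda>y. \<bar>y\<bar> powr q) has_real_derivative q * y powr (q - 1)) (at y)"
      by (rule DERIV_cong_ev[OF refl _ refl, THEN iffD2, OF _ d]) (use ev in \<open>auto elim: eventually_mono\<close>)
    moreover have "((\<lambda>y. sgn y * \<bar>y\<bar> powr q) has_real_derivative q * y powr (q - 1)) (at y)"
      by (rule DERIV_cong_ev[OF refl _ refl, THEN iffD2, OF _ d]) (use ev in \<open>auto elim: eventually_mono\<close>)
    ultimately show ?thesis using 2 by simp
  next
    case 3
    have ev: "eventually (\<lambda>x. x < 0) (nhds y)" using 3 by (intro eventually_nhds_in_open[of "{..<0}", simplified]) auto
    have d: "((\<lambda>y. (- y) powr q) has_real_derivative q * (- y) powr (q - 1) * - 1) (at y)"
      by (rule DERIV_chain2[where f="\<lambda>x. x powr q" and g=uminus, OF has_real_derivative_powr]) (use 3 in \<open>auto intro!: derivative_eq_intros\<close>)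
    have "((\<lambda>y. \<bar>y\<bar> powr q) has_real_derivative q * (- y) powr (q - 1) * - 1) (at y)"
      by (rule DERIV_cong_ev[OF refl _ refl, THEN iffD2, OF _ d]) (use ev in \<open>auto elim: eventually_mono\<close>)
    moreover have "((\<lambda>y. sgn y * \<bar>y\<bar> powr q) has_real_derivative - (q * (- y) powr (q - 1) * - 1)) (at y)"
      by (rule DERIV_cong_ev[OF refl _ refl, THEN iffD2, OF _ DERIV_minus[OF d]]) (use ev in \<open>auto elim: eventually_mono\<close>)
    ultimately show ?thesis using 3 by simp
  qed
  then show "((\<lambda>y. \<bar>y\<bar> powr q) has_real_derivative q * (sgn y * \<bar>y\<bar> powr (q - 1))) (at y)"
    "((\<lambda>y. sgn y * \<bar>y\<bar> powr q) has_real_derivative q * \<bar>y\<bar> powr (q - 1)) (at y)" by auto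
qed

lemma abs_powr_le_power:
  fixes y q :: real
  assumes "0 \<le> q" "q \<le> real n"
  shows "\<bar>y\<bar> powr q \<le> (1 + \<bar>y\<bar>) ^ n"
proof -
  have "\<bar>y\<bar> powr q \<le> (1 + \<bar>y\<bar>) powr q" using assms by (intro powr_mono2) auto
  also have "\<dots> \<le> (1 + \<bar>y\<bar>) powr (real n)" using assms by (intro powr_mono) auto
  also have "\<dots> = (1 + \<bar>y\<bar>) ^ n" by (simp add: powr_realpow)
  finally show ?thesis .
qed

text \<open>The substitution u = x^2 / 2 turns the half-line integral into the Gamma integral at (q
  + 1) / 2, and evenness doubles it.\<close>

lemma std_normal_abs_moment:
  fixes q :: real
  assumes q: "q > 0"
  shows "integrable std_normal_distribution (\<lambda>\<xi>. \<bar>\<xi>\<bar> powr q)"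
    and "(\<integral>\<xi>. \<bar>\<xi>\<bar> powr q \<partial>std_normal_distribution) = 2 powr (q / 2) * Gamma ((q + 1) / 2) / sqrt pi"
proof -
  show int: "integrable std_normal_distribution (\<lambda>\<xi>. \<bar>\<xi>\<bar> powr q)"
  proof (rule Bochner_Integration.integrable_bound[OF integrable_std_normal_power[of 1 1 "nat \<lceil>q\<rceil>"]])
    have "q \<le> real (nat \<lceil>q\<rceil>)" by linarith
    then show "AE \<xi> in std_normal_distribution. norm (\<bar>\<xi>\<bar> powr q) \<le> norm ((1 + 1 * \<bar>\<xi>\<bar>) ^ nat \<lceil>q\<rceil>)"
      using abs_powr_le_power[of q] q by (intro AE_I2) auto
  qed simp
  define s where "s = (q + 1) / 2"
  have s: "s > 0" "s - 1 = (q - 1) / 2" using q by (auto simp: s_def field_simps)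
  define f where "f u = u powr (s - 1) / exp u" for u :: real
  have sub: "f (x\<^sup>2 / 2) * x = 2 * sqrt pi * 2 powr (- (q / 2)) * (std_normal_density x * \<bar>x\<bar> powr q)" if x: "x > 0" for x
  proof -
    have e1: "(x\<^sup>2 / 2) powr (s - 1) = x powr (q - 1) * 2 powr (- ((q - 1) / 2))"
    proof -
      have "(x\<^sup>2) powr ((q - 1) / 2) = (x powr 2) powr ((q - 1) / 2)" using x by (simp add: powr_numeral)
      also have "\<dots> = x powr (q - 1)" unfolding powr_powr by (rule arg_cong[where f="(powr) x"]) simp
      finally have "(x\<^sup>2) powr ((q - 1) / 2) = x powr (q - 1)" .
      then show ?thesis using x by (simp add: s(2) powr_divide powr_minus_divide)
    qed
    have e2: "x powr (q - 1) * x = x powr q" using x powr_add[of x "q - 1" 1] by simp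
    have e3: "2 powr (- ((q - 1) / 2)) = 2 powr (- (q / 2)) * sqrt 2"
    proof -
      have "- ((q - 1) / 2) = - (q / 2) + 1 / 2" by (simp add: field_simps)
      then show ?thesis by (simp only: powr_add powr_half_sqrt zero_le_numeral)
    qed
    show ?thesis
    proof -
      have "f (x\<^sup>2 / 2) * x = 2 powr (- (q / 2)) * sqrt 2 * (x powr (q - 1) * x) / exp (x\<^sup>2 / 2)"
        unfolding f_def e1 e3 by simp
      also have "\<dots> = 2 powr (- (q / 2)) * sqrt 2 * x powr q / exp (x\<^sup>2 / 2)" by (simp only: e2)
      also have "\<dots> = 2 * sqrt pi * 2 powr (- (q / 2)) * (std_normal_density x * \<bar>x\<bar> powr q)"
      proof -
        have "b * r * c / e = 2 * q * b * (1 / (r * q) * (1 / e) * c)" if "r * r = 2" "q \<noteq> 0" for b r c e q :: real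
        proof -
          have "r \<noteq> 0" using that by auto
          then have "b * r * c / e = (r * r) * q * b * (1 / (r * q) * (1 / e) * c)" using that(2) by simp
          then show ?thesis by (simp only: that(1))
        qed
        from this[of "sqrt 2" "sqrt pi"] show ?thesis
          using x by (simp add: std_normal_density_def exp_minus real_sqrt_mult inverse_eq_divide)
      qed
      finally show ?thesis .
    qed
  qed
  have intl: "integrable lborel (\<lambda>x. std_normal_density x * \<bar>x\<bar> powr q)"
    using int by (subst (asm) integrable_density) auto
  have int0: "set_integrable lborel (einterval (ereal 0) \<infinity>) (\<lambda>x. f (x\<^sup>2 / 2) * x)"
  proof -
    have "set_integrable lborel {0<..} (\<lambda>x. 2 * sqrt pi * 2 powr (- (q / 2)) * (std_normal_density x * \<bar>x\<bar> powr q))"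
      unfolding set_integrable_def by (intro integrable_mult_indicator integrable_mult_right intl) auto
    then show ?thesis unfolding einterval_eq
      by (subst set_integrable_cong[OF refl refl sub]) auto
  qed
  note S = interval_integral_substitution_nonneg[of "ereal 0" "\<infinity>" "\<lambda>x. x\<^sup>2 / 2" "\<lambda>x. x" f "ereal 0" "\<infinity>"]
  have A: "((ereal \<circ> (\<lambda>x. x\<^sup>2 / 2) \<circ> real_of_ereal) \<longlongrightarrow> ereal 0) (at_right (ereal 0))"
  proof -
    have "((\<lambda>x::real. x\<^sup>2 / 2) \<longlongrightarrow> 0\<^sup>2 / 2) (at_right 0)" by (intro tendsto_intros) auto
    then show ?thesis by (simp add: ereal_tendsto_simps)
  qed
  have B: "((ereal \<circ> (\<lambda>x. x\<^sup>2 / 2) \<circ> real_of_ereal) \<longlongrightarrow> \<infinity>) (at_left \<infinity>)"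
  proof -
    have "filterlim (\<lambda>x::real. (1 / 2) * x ^ 2) at_top at_top"
      by (intro filterlim_tendsto_pos_mult_at_top[OF tendsto_const] filterlim_pow_at_top filterlim_ident) auto
    then have "filterlim (\<lambda>x::real. x ^ 2 / 2) at_top at_top" by simp
    then show ?thesis by (simp add: ereal_tendsto_simps tendsto_PInfty_eq_at_top)
  qed
  have cf: "isCont f u" if "u > 0" for u
    unfolding f_def[abs_def] using that by (intro continuous_intros) auto
  have fn: "f u \<ge> 0" for u by (simp add: f_def)
  have S': "set_integrable lborel (einterval (ereal 0) \<infinity>) f"
      "(LBINT x=ereal 0..\<infinity>. f x) = (LBINT x=ereal 0..\<infinity>. f (x\<^sup>2 / 2) * x)"
    by (rule S; use A B int0 in \<open>auto intro!: derivative_eq_intros cf fn\<close>)+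
  have G: "(LBINT x=ereal 0..\<infinity>. f x) = Gamma s"
  proof -
    have "(LBINT x=ereal 0..\<infinity>. f x) = integral {0<..} f"
      using S'(1) set_borel_integral_eq_integral(2)[of "{0<..}" f] by (simp add: interval_lebesgue_integral_def)
    also have "(f has_integral Gamma s) {0<..}"
    proof (rule has_integral_spike_set_eq[THEN iffD1, OF _ _ Gamma_integral_real[OF s(1), folded f_def]])
      have "{x \<in> {0..} - {0<..}. f x \<noteq> 0} \<subseteq> {0}" by auto
      then show "negligible {x \<in> {0..} - {0<..}. f x \<noteq> 0}" using negligible_sing negligible_subset by blast
      have "{x \<in> {0<..} - {0..}. f x \<noteq> 0} = {}" by auto
      then show "negligible {x \<in> {0<..} - {0..}. f x \<noteq> 0}" by (simp only: negligible_empty)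
    qed
    then have "integral {0<..} f = Gamma s" by (rule integral_unique)
    finally show ?thesis .
  qed
  have "(LBINT x=ereal 0..\<infinity>. f (x\<^sup>2 / 2) * x) = (LINT x:{0<..}|lborel. 2 * sqrt pi * 2 powr (- (q / 2)) * (std_normal_density x * \<bar>x\<bar> powr q))"
  proof -
    have "(LBINT x=ereal 0..\<infinity>. f (x\<^sup>2 / 2) * x) = (LINT x:{0<..}|lborel. f (x\<^sup>2 / 2) * x)"
      by (simp add: interval_lebesgue_integral_def)
    also have "\<dots> = (LINT x:{0<..}|lborel. 2 * sqrt pi * 2 powr (- (q / 2)) * (std_normal_density x * \<bar>x\<bar> powr q))"
      by (rule set_lebesgue_integral_cong) (simp, use sub in blast)
    finally show ?thesis .
  qed
  also have "\<dots> = 2 * sqrt pi * 2 powr (- (q / 2)) * (LINT x:{0<..}|lborel. std_normal_density x * \<bar>x\<bar> powr q)" by simp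
  finally have half: "(LINT x:{0<..}|lborel. std_normal_density x * \<bar>x\<bar> powr q) = 2 powr (q / 2) * Gamma s / sqrt pi / 2"
    using S'(2) G by (simp add: powr_minus field_simps)
  let ?h = "\<lambda>x. std_normal_density x * \<bar>x\<bar> powr q"
  have "(\<integral>\<xi>. \<bar>\<xi>\<bar> powr q \<partial>std_normal_distribution) = (\<integral>x. ?h x \<partial>lborel)"
    by (subst integral_density) auto
  also have "\<dots> = (LINT x:{..<0} \<union> {0<..}|lborel. ?h x)"
    unfolding set_lebesgue_integral_def by (intro Bochner_Integration.integral_cong) (auto simp: indicator_def q)
  also have "\<dots> = (LINT x:{..<0}|lborel. ?h x) + (LINT x:{0<..}|lborel. ?h x)"
    unfolding set_integrable_def[symmetric]
    by (rule set_integral_Un) (auto simp: set_integrable_def intl intro!: integrable_mult_indicator simp del: real_scaleR_def)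
  also have "(LINT x:{..<0}|lborel. ?h x) = (LINT x:{0<..}|lborel. ?h x)"
    unfolding set_lebesgue_integral_def
    by (subst lborel_integral_real_affine[of "-1" _ 0]) (auto simp: indicator_def std_normal_density_def cong: if_cong)
  finally show "(\<integral>\<xi>. \<bar>\<xi>\<bar> powr q \<partial>std_normal_distribution) = 2 powr (q / 2) * Gamma ((q + 1) / 2) / sqrt pi"
    using half by (simp add: s_def)
qed

lemma indicator_pair_measurable:
  assumes [measurable]: "g \<in> borel_measurable borel"
  shows "(\<lambda>p. g (fst p) * indicat_real {0..<sqrt t * \<bar>snd p\<bar>} (fst p)) \<in> borel_measurable (lborel \<Otimes>\<^sub>M std_normal_distribution)"
proof -
  have "(\<lambda>p. g (fst p) * indicat_real {0..<sqrt t * \<bar>snd p\<bar>} (fst p)) = (\<lambda>p. g (fst p) * (if 0 \<le> fst p \<and> fst p < sqrt t * \<bar>snd p\<bar> then 1 else 0))"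
    by (auto simp: indicator_def)
  then show ?thesis by simp
qed

text \<open>The layer-cake formula: the weight at v is the probability that sqrt t |\<xi>| exceeds
  v, so Fubini leaves the integral of \<open>g\<close> from 0 to sqrt t |\<xi>|.\<close>

lemma integral_heat_weight:
  assumes t: "t \<ge> 0" and F: "\<And>y. (F has_real_derivative g y) (at y)" and g: "continuous_on UNIV g"
    and b: "\<And>y. y \<ge> 0 \<Longrightarrow> \<bar>g y\<bar> \<le> C * (1 + \<bar>y\<bar>) ^ m"
  shows "(\<integral>v. g v * heat_weight t v \<partial>lborel) = (\<integral>\<xi>. F (sqrt t * \<bar>\<xi>\<bar>) - F 0 \<partial>std_normal_distribution)"
proof -
  interpret P: pair_sigma_finite lborel std_normal_distribution
    by (intro pair_sigma_finite.intro) (auto intro: lborel.sigma_finite_measure_axioms N.sigma_finite_measure_axioms)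
  have [measurable]: "g \<in> borel_measurable borel" using g by (rule borel_measurable_continuous_onI)
  define f where "f v \<xi> = g v * indicat_real {0..<sqrt t * \<bar>\<xi>\<bar>} v" for v \<xi>
  have in_f: "integrable std_normal_distribution (f v)" for v
  proof (rule N.integrable_const_bound[of _ "\<bar>g v\<bar>"])
    have "f v = (\<lambda>\<xi>. g v * (if 0 \<le> v \<and> v < sqrt t * \<bar>\<xi>\<bar> then 1 else 0))" by (auto simp: f_def indicator_def)
    then show "f v \<in> borel_measurable std_normal_distribution" by simp
  qed (auto simp: f_def indicator_def)
  have hw: "(\<integral>\<xi>. c * indicat_real {0..<sqrt t * \<bar>\<xi>\<bar>} v \<partial>std_normal_distribution) = c * heat_weight t v" for c v
    unfolding heat_weight_eq_integral by simp
  have "integrable (lborel \<Otimes>\<^sub>M std_normal_distribution) (case_prod f)"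
  proof (rule P.Fubini_integrable)
    show "case_prod f \<in> borel_measurable (lborel \<Otimes>\<^sub>M std_normal_distribution)"
      using indicator_pair_measurable[of g t] by (simp add: f_def case_prod_beta')
    have "(\<lambda>v. \<integral>\<xi>. norm (case_prod f (v, \<xi>)) \<partial>std_normal_distribution) = (\<lambda>v. \<bar>g v\<bar> * heat_weight t v)"
    proof
      fix v
      have "(\<integral>\<xi>. norm (case_prod f (v, \<xi>)) \<partial>std_normal_distribution) = (\<integral>\<xi>. \<bar>g v\<bar> * indicat_real {0..<sqrt t * \<bar>\<xi>\<bar>} v \<partial>std_normal_distribution)"
        by (intro Bochner_Integration.integral_cong) (auto simp: f_def indicator_def)
      then show "(\<integral>\<xi>. norm (case_prod f (v, \<xi>)) \<partial>std_normal_distribution) = \<bar>g v\<bar> * heat_weight t v" unfolding hw .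
    qed
    moreover have "integrable lborel (\<lambda>v. \<bar>g v\<bar> * heat_weight t v)"
      by (rule heat_weight_integrable_bound[where m=m and C=C]) (simp, simp only: abs_idempotent b)
    ultimately show "integrable lborel (\<lambda>v. \<integral>\<xi>. norm (case_prod f (v, \<xi>)) \<partial>std_normal_distribution)" by simp
  qed (use in_f in auto)
  from P.Fubini_integral[OF this]
  have "(\<integral>v. (\<integral>\<xi>. f v \<xi> \<partial>std_normal_distribution) \<partial>lborel) = (\<integral>\<xi>. (\<integral>v. f v \<xi> \<partial>lborel) \<partial>std_normal_distribution)" ..
  also have "(\<integral>v. (\<integral>\<xi>. f v \<xi> \<partial>std_normal_distribution) \<partial>lborel) = (\<integral>v. g v * heat_weight t v \<partial>lborel)"
    unfolding f_def hw ..
  also have "(\<lambda>\<xi>. \<integral>v. f v \<xi> \<partial>lborel) = (\<lambda>\<xi>. F (sqrt t * \<bar>\<xi>\<bar>) - F 0)"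
  proof
    fix \<xi> :: real
    let ?a = "sqrt t * \<bar>\<xi>\<bar>"
    have "(\<integral>v. f v \<xi> \<partial>lborel) = (\<integral>v. indicat_real {0..?a} v *\<^sub>R g v \<partial>lborel)"
    proof (rule integral_cong_AE)
      show "AE v in lborel. f v \<xi> = indicat_real {0..?a} v *\<^sub>R g v"
        using AE_lborel_singleton[of ?a] by eventually_elim (auto simp: f_def indicator_def)
    qed (auto simp: f_def)
    also have "\<dots> = F ?a - F 0"
    proof (rule integral_FTC_atLeastAtMost)
      show "0 \<le> ?a" using t by simp
      show "(F has_vector_derivative g x) (at x within {0..?a})" for x
        using F[of x] unfolding has_real_derivative_iff_has_vector_derivative by (rule has_vector_derivative_at_within)
      show "continuous_on {0..?a} g" using g by (rule continuous_on_subset) auto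
    qed
    finally show "(\<integral>v. f v \<xi> \<partial>lborel) = F ?a - F 0" .
  qed
  finally show ?thesis .
qed

lemma centred_normal_std_normal: "centred_normal std_normal_distribution (\<lambda>x. c * x) (c\<^sup>2)"
proof (rule centred_normal_charI)
  show "prob_space std_normal_distribution" by (rule N.prob_space_axioms)
  show "(\<integral>x. iexp (\<theta> * (c * x)) \<partial>std_normal_distribution) = exp (- (\<theta>\<^sup>2 * c\<^sup>2 / 2))" for \<theta>
    using fun_cong[OF char_std_normal_distribution, of "\<theta> * c"] by (simp add: char_def power_mult_distrib mult.assoc)
qed auto

lemma centred_normal_abs_moment:
  assumes X: "centred_normal M X v" and q: "q > 0"
  shows "integrable M (\<lambda>\<omega>. \<bar>X \<omega>\<bar> powr q)"
    and "(\<integral>\<omega>. \<bar>X \<omega>\<bar> powr q \<partial>M) = v powr (q / 2) * (2 powr (q / 2) * Gamma ((q + 1) / 2) / sqrt pi)"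
proof -
  have e: "\<bar>sqrt v * x\<bar> powr q = v powr (q / 2) * \<bar>x\<bar> powr q" for x
    using centred_normalD(2)[OF X] by (simp add: abs_mult powr_mult powr_powr powr_half_sqrt[symmetric])
  show "integrable M (\<lambda>\<omega>. \<bar>X \<omega>\<bar> powr q)"
    using std_normal_abs_moment(1)[OF q] by (subst centred_normal_integrable[OF X]) (simp_all add: e)
  show "(\<integral>\<omega>. \<bar>X \<omega>\<bar> powr q \<partial>M) = v powr (q / 2) * (2 powr (q / 2) * Gamma ((q + 1) / 2) / sqrt pi)"
    using std_normal_abs_moment(2)[OF q] by (subst centred_normal_integral[OF X]) (simp_all add: e)
qed

lemma centred_normal_pair_comb:
  "centred_normal (std_normal_distribution \<Otimes>\<^sub>M std_normal_distribution) (\<lambda>p. c * fst p + d * snd p) (c\<^sup>2 + d\<^sup>2)"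
proof -
  interpret P: pair_prob_space std_normal_distribution std_normal_distribution ..
  show ?thesis
  proof (rule centred_normal_charI)
    show "prob_space (std_normal_distribution \<Otimes>\<^sub>M std_normal_distribution)" by (rule P.prob_space_axioms)
    fix \<theta> :: real
    let ?f = "\<lambda>p. iexp (\<theta> * (c * fst p + d * snd p))"
    have "integrable (std_normal_distribution \<Otimes>\<^sub>M std_normal_distribution) ?f"
      by (rule P.integrable_const_bound[of _ 1]) auto
    from P.integral_fst'[OF this]
    have "(\<integral>p. ?f p \<partial>(std_normal_distribution \<Otimes>\<^sub>M std_normal_distribution)) =
      (\<integral>x. (\<integral>y. iexp (\<theta> * (c * x)) * iexp (\<theta> * (d * y)) \<partial>std_normal_distribution) \<partial>std_normal_distribution)"
      by (simp add: distrib_left exp_add)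
    also have "\<dots> = exp (- (\<theta>\<^sup>2 * c\<^sup>2 / 2)) * exp (- (\<theta>\<^sup>2 * d\<^sup>2 / 2))"
      using centred_normal_char[OF centred_normal_std_normal[of c], of \<theta>] centred_normal_char[OF centred_normal_std_normal[of d], of \<theta>]
      by (simp add: mult_ac)
    also have "\<dots> = exp (- (\<theta>\<^sup>2 * (c\<^sup>2 + d\<^sup>2) / 2))"
      by (simp add: exp_add[symmetric] field_simps)
    finally show "(\<integral>p. ?f p \<partial>(std_normal_distribution \<Otimes>\<^sub>M std_normal_distribution)) = exp (- (\<theta>\<^sup>2 * (c\<^sup>2 + d\<^sup>2) / 2))"
      by (simp add: exp_of_real)
  qed auto
qed

text \<open>Two applications of \<open>integral_heat_weight\<close> replace \<open>|\<cdot>| powr p\<close> by its second primitive \<open>\<psi>\<close>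
  and express the variance through \<open>\<psi>\<close> at sums and differences of two independent normal variables,
  which are again normal.\<close>

lemma mild_cov_diagonal:
  assumes H: "0 < H" "H < 1" and t: "t > 0"
  shows "mild_cov (2 * H) t t 0 = fbm_var t H"
proof -
  define p where "p = 2 * H"
  have p: "0 < p" "p < 2" using H by (auto simp: p_def)
  define b where "b = sqrt t"
  \<comment> \<open>\<open>\<phi>\<close> and \<open>\<psi>\<close> are the first and second
    primitives of |y|^p that vanish at 0. One is odd and the other even, which later allows |\<xi>|
    to be replaced by \<xi>.\<close>
  define \<phi> where "\<phi> y = sgn y * \<bar>y\<bar> powr (p + 1) / (p + 1)" for y :: real
  define \<psi> where "\<psi> y = \<bar>y\<bar> powr (p + 2) / ((p + 1) * (p + 2))" for y :: real
  have d\<phi>: "(\<phi> has_real_derivative \<bar>y\<bar> powr p) (at y)" for y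
    using DERIV_cdivide[OF abs_powr_has_derivative(2)[of "p + 1" y], of "p + 1"] p unfolding \<phi>_def by simp
  have d\<psi>: "(\<psi> has_real_derivative \<phi> y) (at y)" for y
    using DERIV_cdivide[OF abs_powr_has_derivative(1)[of "p + 2" y], of "(p + 1) * (p + 2)"] p unfolding \<psi>_def \<phi>_def by (simp add: add.commute[of 1])
  have \<phi>_odd: "\<phi> (- y) = - \<phi> y" for y by (simp add: \<phi>_def sgn_minus)
  have \<psi>_even: "\<psi> (- y) = \<psi> y" for y by (simp add: \<psi>_def)
  have c\<phi>: "continuous_on UNIV \<phi>" using d\<phi> by (intro DERIV_continuous_on[of UNIV \<phi>]) (auto intro: has_field_derivative_at_within)
  have [measurable]: "\<phi> \<in> borel_measurable borel" "\<psi> \<in> borel_measurable borel" by (auto simp: \<phi>_def[abs_def] \<psi>_def[abs_def])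
  have \<phi>_le: "\<bar>\<phi> y\<bar> \<le> (1 + \<bar>y\<bar>) ^ 3" for y
  proof -
    have "\<bar>\<phi> y\<bar> \<le> \<bar>y\<bar> powr (p + 1)" using p by (auto simp: \<phi>_def abs_mult abs_sgn_eq field_simps)
    also have "\<dots> \<le> (1 + \<bar>y\<bar>) ^ 3" using p by (intro abs_powr_le_power) auto
    finally show ?thesis .
  qed
  have cube: "(1 + \<bar>z + y\<bar>) ^ 3 \<le> (1 + \<bar>z\<bar>) ^ 3 * (1 + \<bar>y\<bar>) ^ 3" "(1 + \<bar>z - y\<bar>) ^ 3 \<le> (1 + \<bar>z\<bar>) ^ 3 * (1 + \<bar>y\<bar>) ^ 3" for z y :: real
    using one_plus_abs_cube[of z y] one_plus_abs_cube[of z "- y"] by auto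
  \<comment> \<open>With y = sqrt t |\<xi>|, this is what \<open>integral_heat_weight\<close> leaves
    of the inner integral; it is even in y.\<close>
  define G where "G z y = \<phi> (z + y) + \<phi> (z - y) - 2 * \<phi> z" for z y
  have G_even: "G z (- y) = G z y" for z y by (simp add: G_def)
  have G_abs: "G z (c * \<bar>y\<bar>) = G z (c * y)" for z c y using G_even[of z "c * y"] by (auto simp: abs_if)
  have G_le: "\<bar>G z y\<bar> \<le> 4 * (1 + \<bar>y\<bar>) ^ 3 * (1 + \<bar>z\<bar>) ^ 3" for z y
  proof -
    have "(1 + \<bar>z\<bar>) ^ 3 * 1 \<le> (1 + \<bar>z\<bar>) ^ 3 * (1 + \<bar>y\<bar>) ^ 3" by (intro mult_left_mono) (auto simp: one_le_power)
    then have "\<bar>G z y\<bar> \<le> 4 * ((1 + \<bar>z\<bar>) ^ 3 * (1 + \<bar>y\<bar>) ^ 3)"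
      unfolding G_def using cube[of z y] \<phi>_le[of z] \<phi>_le[of "z + y"] \<phi>_le[of "z - y"] by linarith
    then show ?thesis by (simp add: mult_ac)
  qed
  have inner: "(\<integral>v. mixed_difference p 0 z v * heat_weight t v \<partial>lborel) = (\<integral>\<xi>. G z (b * \<xi>) \<partial>std_normal_distribution)" for z
  proof -
    have md: "mixed_difference p 0 z v = \<bar>z + v\<bar> powr p - \<bar>z - v\<bar> powr p" for v
    proof -
      have "\<bar>0 - z - v\<bar> = \<bar>z + v\<bar>" "\<bar>0 - z + v\<bar> = \<bar>z - v\<bar>" by auto
      then show ?thesis unfolding mixed_difference_def by simp
    qed
    have "(\<integral>v. (\<bar>z + v\<bar> powr p - \<bar>z - v\<bar> powr p) * heat_weight t v \<partial>lborel) =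
      (\<integral>\<xi>. (\<phi> (z + sqrt t * \<bar>\<xi>\<bar>) + \<phi> (z - sqrt t * \<bar>\<xi>\<bar>)) - (\<phi> (z + 0) + \<phi> (z - 0)) \<partial>std_normal_distribution)"
    proof (rule integral_heat_weight[where m=3 and C="2 * (1 + \<bar>z\<bar>) ^ 3"])
      show "((\<lambda>v. \<phi> (z + v) + \<phi> (z - v)) has_real_derivative \<bar>z + y\<bar> powr p - \<bar>z - y\<bar> powr p) (at y)" for y
      proof -
        have "((\<lambda>v. \<phi> (z + v)) has_real_derivative \<bar>z + y\<bar> powr p * 1) (at y)"
          by (rule DERIV_chain2[OF d\<phi>]) (auto intro!: derivative_eq_intros)
        moreover have "((\<lambda>v. \<phi> (z - v)) has_real_derivative \<bar>z - y\<bar> powr p * - 1) (at y)"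
          by (rule DERIV_chain2[OF d\<phi>]) (auto intro!: derivative_eq_intros)
        ultimately show ?thesis using DERIV_add by fastforce
      qed
      show "continuous_on UNIV (\<lambda>v. \<bar>z + v\<bar> powr p - \<bar>z - v\<bar> powr p)"
        using p by (intro continuous_on_diff continuous_on_powr' continuous_intros) auto
      show "\<bar>\<bar>z + y\<bar> powr p - \<bar>z - y\<bar> powr p\<bar> \<le> 2 * (1 + \<bar>z\<bar>) ^ 3 * (1 + \<bar>y\<bar>) ^ 3" for y
      proof -
        have "\<bar>z + y\<bar> powr p \<le> (1 + \<bar>z + y\<bar>) ^ 3" "\<bar>z - y\<bar> powr p \<le> (1 + \<bar>z - y\<bar>) ^ 3"
          using p by (auto intro!: abs_powr_le_power)
        moreover have "\<bar>z + y\<bar> powr p \<ge> 0" "\<bar>z - y\<bar> powr p \<ge> 0" by auto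
        ultimately have "\<bar>\<bar>z + y\<bar> powr p - \<bar>z - y\<bar> powr p\<bar> \<le> 2 * ((1 + \<bar>z\<bar>) ^ 3 * (1 + \<bar>y\<bar>) ^ 3)" using cube[of z y] by linarith
        then show ?thesis by (simp add: mult.assoc)
      qed
    qed (use t in simp)
    also have "\<dots> = (\<integral>\<xi>. G z (b * \<bar>\<xi>\<bar>) \<partial>std_normal_distribution)"
      by (rule Bochner_Integration.integral_cong[OF refl]) (simp add: G_def b_def)
    also have "\<dots> = (\<integral>\<xi>. G z (b * \<xi>) \<partial>std_normal_distribution)" unfolding G_abs ..
    finally show ?thesis unfolding md .
  qed
  have outer: "(\<integral>z. G z y * heat_weight t z \<partial>lborel) =
      (\<integral>\<xi>. \<psi> (b * \<xi> + y) + \<psi> (b * \<xi> - y) - 2 * \<psi> (b * \<xi>) - 2 * \<psi> y \<partial>std_normal_distribution)" for y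
  proof -
    have "(\<integral>z. G z y * heat_weight t z \<partial>lborel) =
      (\<integral>\<xi>. (\<psi> (sqrt t * \<bar>\<xi>\<bar> + y) + \<psi> (sqrt t * \<bar>\<xi>\<bar> - y) - 2 * \<psi> (sqrt t * \<bar>\<xi>\<bar>)) - (\<psi> (0 + y) + \<psi> (0 - y) - 2 * \<psi> 0) \<partial>std_normal_distribution)"
    proof (rule integral_heat_weight[where m=3 and C="4 * (1 + \<bar>y\<bar>) ^ 3"])
      show "((\<lambda>z. \<psi> (z + y) + \<psi> (z - y) - 2 * \<psi> z) has_real_derivative G z y) (at z)" for z
      proof -
        have "((\<lambda>z. \<psi> (z + y)) has_real_derivative \<phi> (z + y) * 1) (at z)"
          by (rule DERIV_chain2[OF d\<psi>]) (auto intro!: derivative_eq_intros)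
        moreover have "((\<lambda>z. \<psi> (z - y)) has_real_derivative \<phi> (z - y) * 1) (at z)"
          by (rule DERIV_chain2[OF d\<psi>]) (auto intro!: derivative_eq_intros)
        ultimately have "((\<lambda>z. \<psi> (z + y) + \<psi> (z - y) - 2 * \<psi> z) has_real_derivative \<phi> (z + y) * 1 + \<phi> (z - y) * 1 - 2 * \<phi> z) (at z)"
          by (intro DERIV_add DERIV_diff DERIV_cmult d\<psi>)
        then show ?thesis by (simp add: G_def)
      qed
      show "continuous_on UNIV (\<lambda>z. G z y)" unfolding G_def
        by (intro continuous_intros continuous_on_compose2[OF c\<phi>]) auto
    qed (use t in simp, rule G_le)
    also have "\<dots> = (\<integral>\<xi>. \<psi> (b * \<xi> + y) + \<psi> (b * \<xi> - y) - 2 * \<psi> (b * \<xi>) - 2 * \<psi> y \<partial>std_normal_distribution)"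
    proof (rule Bochner_Integration.integral_cong[OF refl])
      fix \<xi> :: real
      have "\<psi> (- (b * \<xi>) + y) = \<psi> (b * \<xi> - y)" "\<psi> (- (b * \<xi>) - y) = \<psi> (b * \<xi> + y)"
      proof -
        have "- (b * \<xi>) + y = - (b * \<xi> - y)" "- (b * \<xi>) - y = - (b * \<xi> + y)" by simp_all
        then show "\<psi> (- (b * \<xi>) + y) = \<psi> (b * \<xi> - y)" "\<psi> (- (b * \<xi>) - y) = \<psi> (b * \<xi> + y)"
          by (simp_all only: \<psi>_even)
      qed
      moreover have "\<psi> 0 = 0" by (simp add: \<psi>_def)
      ultimately show "(\<psi> (sqrt t * \<bar>\<xi>\<bar> + y) + \<psi> (sqrt t * \<bar>\<xi>\<bar> - y) - 2 * \<psi> (sqrt t * \<bar>\<xi>\<bar>)) - (\<psi> (0 + y) + \<psi> (0 - y) - 2 * \<psi> 0) =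
        \<psi> (b * \<xi> + y) + \<psi> (b * \<xi> - y) - 2 * \<psi> (b * \<xi>) - 2 * \<psi> y"
        unfolding b_def[symmetric] by (cases "\<xi> \<ge> 0") (simp_all add: \<psi>_even)
    qed
    finally show ?thesis .
  qed
  interpret P: pair_sigma_finite lborel std_normal_distribution
    by (intro pair_sigma_finite.intro) (auto intro: lborel.sigma_finite_measure_axioms N.sigma_finite_measure_axioms)
  define f where "f z \<xi> = G z (b * \<xi>) * heat_weight t z" for z \<xi>
  have ib: "integrable std_normal_distribution (\<lambda>\<xi>. (1 + \<bar>b * \<xi>\<bar>) ^ 3)"
    using integrable_std_normal_power[of 1 "\<bar>b\<bar>" 3] by (simp add: abs_mult)
  have fm[measurable]: "case_prod f \<in> borel_measurable (lborel \<Otimes>\<^sub>M std_normal_distribution)"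
    unfolding f_def G_def by measurable
  have f_le: "norm (f z \<xi>) \<le> 4 * (1 + \<bar>b * \<xi>\<bar>) ^ 3 * ((1 + \<bar>z\<bar>) ^ 3 * heat_weight t z)" for z \<xi>
    using mult_right_mono[OF G_le[of z "b * \<xi>"] heat_weight_bounds(1)[of t z]] by (simp add: f_def abs_mult heat_weight_bounds mult_ac)
  have f_int: "integrable std_normal_distribution (f z)" for z
  proof (rule Bochner_Integration.integrable_bound)
    show "integrable std_normal_distribution (\<lambda>\<xi>. (4 * ((1 + \<bar>z\<bar>) ^ 3 * heat_weight t z)) * (1 + \<bar>b * \<xi>\<bar>) ^ 3)"
      by (intro integrable_mult_right ib)
    show "AE \<xi> in std_normal_distribution. norm (f z \<xi>) \<le> norm ((4 * ((1 + \<bar>z\<bar>) ^ 3 * heat_weight t z)) * (1 + \<bar>b * \<xi>\<bar>) ^ 3)"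
      using f_le[of z] by (intro AE_I2) (simp add: abs_mult heat_weight_bounds mult_ac)
  qed (simp add: f_def G_def)
  have "integrable (lborel \<Otimes>\<^sub>M std_normal_distribution) (case_prod f)"
  proof (rule P.Fubini_integrable[OF fm])
    show "integrable lborel (\<lambda>z. \<integral>\<xi>. norm (case_prod f (z, \<xi>)) \<partial>std_normal_distribution)"
    proof (rule Bochner_Integration.integrable_bound)
      let ?B = "\<integral>\<xi>. (1 + \<bar>b * \<xi>\<bar>) ^ 3 \<partial>std_normal_distribution"
      show "integrable lborel (\<lambda>z. 4 * ?B * ((1 + \<bar>z\<bar>) ^ 3 * heat_weight t z))"
        by (intro integrable_mult_right heat_weight_integrable_power)
      show "(\<lambda>z. \<integral>\<xi>. norm (case_prod f (z, \<xi>)) \<partial>std_normal_distribution) \<in> borel_measurable lborel"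
      proof -
        have "(\<lambda>(z, \<xi>). norm (case_prod f (z, \<xi>))) \<in> borel_measurable (lborel \<Otimes>\<^sub>M std_normal_distribution)"
          using measurable_compose[OF fm borel_measurable_norm] by (simp add: case_prod_beta')
        then show ?thesis by (rule N.borel_measurable_lebesgue_integral)
      qed
      have B0: "0 \<le> ?B" by (intro Bochner_Integration.integral_nonneg) auto
      show "AE z in lborel. norm (\<integral>\<xi>. norm (case_prod f (z, \<xi>)) \<partial>std_normal_distribution) \<le> norm (4 * ?B * ((1 + \<bar>z\<bar>) ^ 3 * heat_weight t z))"
      proof (intro AE_I2)
        fix z
        have "(\<integral>\<xi>. norm (f z \<xi>) \<partial>std_normal_distribution) \<le> (\<integral>\<xi>. 4 * (1 + \<bar>b * \<xi>\<bar>) ^ 3 * ((1 + \<bar>z\<bar>) ^ 3 * heat_weight t z) \<partial>std_normal_distribution)"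
          using f_int[of z] ib f_le[of z] by (intro Bochner_Integration.integral_mono) auto
        also have "\<dots> = 4 * ?B * ((1 + \<bar>z\<bar>) ^ 3 * heat_weight t z)" by simp
        finally show "norm (\<integral>\<xi>. norm (case_prod f (z, \<xi>)) \<partial>std_normal_distribution) \<le> norm (4 * ?B * ((1 + \<bar>z\<bar>) ^ 3 * heat_weight t z))"
          using B0 by (simp add: abs_mult heat_weight_bounds)
      qed
    qed
  qed (use f_int in auto)
  note fub = P.Fubini_integral[OF this]
  have "mild_cov p t t 0 = (\<integral>z. (\<integral>\<xi>. f z \<xi> \<partial>std_normal_distribution) \<partial>lborel)"
    unfolding mild_cov_def inner f_def by simp
  also have "\<dots> = (\<integral>\<xi>. (\<integral>z. f z \<xi> \<partial>lborel) \<partial>std_normal_distribution)" using fub ..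
  also have "\<dots> = (\<integral>x. (\<integral>\<xi>. \<psi> (b * \<xi> + b * x) + \<psi> (b * \<xi> - b * x) - 2 * \<psi> (b * \<xi>) - 2 * \<psi> (b * x) \<partial>std_normal_distribution) \<partial>std_normal_distribution)"
    unfolding f_def outer ..
  \<comment> \<open>The zero coefficients bring all four terms into the shape treated by
    \<open>centred_normal_pair_comb\<close>.\<close>
  also have "\<dots> = (\<integral>q. \<psi> (b * fst q + b * snd q) + \<psi> ((- b) * fst q + b * snd q) - 2 * \<psi> (0 * fst q + b * snd q) - 2 * \<psi> (b * fst q + 0 * snd q) \<partial>(std_normal_distribution \<Otimes>\<^sub>M std_normal_distribution))"
    (is "_ = integral\<^sup>L ?N ?h")
  proof -
    interpret Q: pair_prob_space std_normal_distribution std_normal_distribution ..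
    have "integrable ?N (\<lambda>q. \<psi> (c * fst q + d * snd q))" for c d
      unfolding \<psi>_def using centred_normal_abs_moment(1)[OF centred_normal_pair_comb[of c d], of "p + 2"] p by simp
    then have "integrable ?N ?h" by (intro Bochner_Integration.integrable_add Bochner_Integration.integrable_diff integrable_mult_right)
    from Q.integral_fst'[OF this] show ?thesis by (simp add: add.commute)
  qed
  \<comment> \<open>The four normal arguments have variances 2t, 2t, t and t, so the moments combine
    to 2 (2t)^(H+1) - 4 t^(H+1) = 4 (2^H - 1) t^(H+1) times the common factor
    \<open>m\<close>.\<close>
  also have "\<dots> = fbm_var t H"
  proof -
    define m where "m = 2 powr ((p + 2) / 2) * Gamma ((p + 2 + 1) / 2) / sqrt pi / ((p + 1) * (p + 2))"
    have int: "integrable ?N (\<lambda>q. \<psi> (c * fst q + d * snd q))"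
      and val: "(\<integral>q. \<psi> (c * fst q + d * snd q) \<partial>?N) = (c\<^sup>2 + d\<^sup>2) powr ((p + 2) / 2) * m" for c d
      unfolding \<psi>_def m_def using centred_normal_abs_moment[OF centred_normal_pair_comb[of c d], of "p + 2"] p by simp_all
    have "integral\<^sup>L ?N ?h = (b\<^sup>2 + b\<^sup>2) powr ((p + 2) / 2) * m + ((- b)\<^sup>2 + b\<^sup>2) powr ((p + 2) / 2) * m
       - 2 * ((0\<^sup>2 + b\<^sup>2) powr ((p + 2) / 2) * m) - 2 * ((b\<^sup>2 + 0\<^sup>2) powr ((p + 2) / 2) * m)"
    proof -
      have "(\<integral>q. h1 q + h2 q - 2 * h3 q - 2 * h4 q \<partial>?N) = integral\<^sup>L ?N h1 + integral\<^sup>L ?N h2 - 2 * integral\<^sup>L ?N h3 - 2 * integral\<^sup>L ?N h4"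
        if "integrable ?N h1" "integrable ?N h2" "integrable ?N h3" "integrable ?N h4" for h1 h2 h3 h4 :: "real \<times> real \<Rightarrow> real"
        using that by simp
      from this[OF int int int int] show ?thesis unfolding val .
    qed
    also have "\<dots> = (2 * (2 * t) powr (H + 1) - 4 * t powr (H + 1)) * m"
    proof -
      have e: "b\<^sup>2 = t" "(- b)\<^sup>2 = t" "0\<^sup>2 + t = t" "t + 0\<^sup>2 = t" "t + t = 2 * t" "(p + 2) / 2 = H + 1" using t by (auto simp: b_def p_def)
      show ?thesis unfolding e by (simp add: left_diff_distrib)
    qed
    also have "\<dots> = 4 * (2 powr H - 1) * t powr (H + 1) * m"
      using t by (simp add: powr_mult powr_add algebra_simps)
    \<comment> \<open>The recursion of Gamma at H + 1/2 releases a factor that cancels against p + 1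
      = 2 (H + 1/2).\<close>
    also have "m = 2 powr (H + 1) * Gamma (H + 1 / 2) / (4 * (sqrt pi * (H + 1)))"
    proof -
      have e1: "Gamma ((p + 2 + 1) / 2) = (H + 1 / 2) * Gamma (H + 1 / 2)"
        using Gamma_plus1[of "H + 1 / 2"] H by (simp add: p_def add_divide_distrib nonpos_Ints_def)
      have e2: "(p + 1) * (p + 2) = 4 * ((H + 1 / 2) * (H + 1))" by (simp add: p_def algebra_simps)
      have e3: "(p + 2) / 2 = H + 1" by (simp add: p_def)
      have "x * (a * g) / s / (4 * (a * c)) = x * g / (4 * (s * c))" if "a \<noteq> 0" for x a g s c :: real
        using that by simp
      then show ?thesis unfolding m_def e1 e2 e3 using H by simp
    qed
    also have "4 * (2 powr H - 1) * t powr (H + 1) * (2 powr (H + 1) * Gamma (H + 1 / 2) / (4 * (sqrt pi * (H + 1)))) = fbm_var t H"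
    proof -
      have "4 * a * x * (c * g / (4 * e)) = c * a * g / e * x" for a x c g e :: real by simp
      then show ?thesis unfolding fbm_var_def fbm_const_def .
    qed
    finally show ?thesis .
  qed
  finally show ?thesis by (simp add: p_def)
qed

section \<open>Gaussianity and covariance of the mild solution\<close>

text \<open>The mass that the weight gives to the cell from j/(n+1) to (j+1)/(n+1).\<close>

definition step_weight :: "real \<Rightarrow> nat \<Rightarrow> nat \<Rightarrow> real" where
  "step_weight t n j = (\<integral>z. (if 0 \<le> z \<and> nat \<lfloor>real (Suc n) * z\<rfloor> = j then heat_weight t z else 0) \<partial>lborel)"

lemma heat_weight_integrable: "integrable lborel (heat_weight t)"
  using heat_weight_integrable_power[of 0 t] by simp

text \<open>The (n+1)^2 cells of mesh 1/(n+1) cover [0, n+1), so mesh and cutoff improve together.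
  Reading the path at the left end of a cell keeps the cubic majorant at z valid for dominated
  convergence.\<close>

lemma (in tempered_path) step_sum_tendsto_mild:
  "(\<lambda>n. \<Sum>j<(Suc n)\<^sup>2. step_weight t n j * (w (x + real j / real (Suc n)) - w (x - real j / real (Suc n)))) \<longlonglongrightarrow> mild t x w"
proof -
  define D where "D z = w (x + z) - w (x - z)" for z
  define g where "g n z = (if 0 \<le> z \<and> nat \<lfloor>real (Suc n) * z\<rfloor> < (Suc n)\<^sup>2
     then D (real (nat \<lfloor>real (Suc n) * z\<rfloor>) / real (Suc n)) * heat_weight t z else 0)" for n z
  have step_int: "integrable lborel (\<lambda>z. if 0 \<le> z \<and> nat \<lfloor>real (Suc n) * z\<rfloor> = j then heat_weight t z else 0)" for n j
    by (rule Bochner_Integration.integrable_bound[OF heat_weight_integrable[of t]]) (auto simp: heat_weight_bounds)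
  have eq: "(\<Sum>j<(Suc n)\<^sup>2. step_weight t n j * (w (x + real j / real (Suc n)) - w (x - real j / real (Suc n)))) = (\<integral>z. g n z \<partial>lborel)" for n
  proof -
    have "(\<Sum>j<(Suc n)\<^sup>2. step_weight t n j * (w (x + real j / real (Suc n)) - w (x - real j / real (Suc n)))) =
      (\<Sum>j<(Suc n)\<^sup>2. \<integral>z. D (real j / real (Suc n)) * (if 0 \<le> z \<and> nat \<lfloor>real (Suc n) * z\<rfloor> = j then heat_weight t z else 0) \<partial>lborel)"
      by (simp add: step_weight_def D_def mult.commute del: of_nat_Suc)
    also have "\<dots> = (\<integral>z. (\<Sum>j<(Suc n)\<^sup>2. D (real j / real (Suc n)) * (if 0 \<le> z \<and> nat \<lfloor>real (Suc n) * z\<rfloor> = j then heat_weight t z else 0)) \<partial>lborel)"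
      by (rule Bochner_Integration.integral_sum[symmetric]) (intro integrable_mult_right step_int)
    also have "\<dots> = (\<integral>z. g n z \<partial>lborel)"
    proof (rule Bochner_Integration.integral_cong[OF refl])
      fix z
      show "(\<Sum>j<(Suc n)\<^sup>2. D (real j / real (Suc n)) * (if 0 \<le> z \<and> nat \<lfloor>real (Suc n) * z\<rfloor> = j then heat_weight t z else 0)) = g n z"
      proof (cases "0 \<le> z")
        case True
        have "(\<Sum>j<(Suc n)\<^sup>2. D (real j / real (Suc n)) * (if 0 \<le> z \<and> nat \<lfloor>real (Suc n) * z\<rfloor> = j then heat_weight t z else 0)) =
          (\<Sum>j<(Suc n)\<^sup>2. if nat \<lfloor>real (Suc n) * z\<rfloor> = j then D (real j / real (Suc n)) * heat_weight t z else 0)"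
          using True by (intro sum.cong[OF refl]) (simp del: of_nat_Suc)
        also have "\<dots> = g n z" using True by (subst sum.delta') (simp_all add: g_def del: of_nat_Suc)
        finally show ?thesis .
      qed (simp add: g_def)
    qed
    finally show ?thesis .
  qed
  have isD: "isCont D z" for z
  proof -
    have "continuous_on UNIV D" unfolding D_def by (intro continuous_intros continuous_on_compose2[OF cont]) auto
    then show ?thesis by (simp add: continuous_on_eq_continuous_at)
  qed
  have fl: "0 \<le> real (nat \<lfloor>real (Suc n) * z\<rfloor>) / real (Suc n)" "real (nat \<lfloor>real (Suc n) * z\<rfloor>) / real (Suc n) \<le> z"
      "z - 1 / real (Suc n) \<le> real (nat \<lfloor>real (Suc n) * z\<rfloor>) / real (Suc n)" if z: "z \<ge> 0" for n z
  proof -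
    have "0 \<le> real (Suc n) * z" using z by simp
    then have f: "real (nat \<lfloor>real (Suc n) * z\<rfloor>) \<le> real (Suc n) * z" "real (Suc n) * z - 1 \<le> real (nat \<lfloor>real (Suc n) * z\<rfloor>)" by linarith+
    show "0 \<le> real (nat \<lfloor>real (Suc n) * z\<rfloor>) / real (Suc n)" by simp
    show "real (nat \<lfloor>real (Suc n) * z\<rfloor>) / real (Suc n) \<le> z"
      using f(1) by (simp add: pos_divide_le_eq mult.commute del: of_nat_Suc)
    have "z - 1 / real (Suc n) = (real (Suc n) * z - 1) / real (Suc n)" by (simp add: diff_divide_distrib del: of_nat_Suc)
    then show "z - 1 / real (Suc n) \<le> real (nat \<lfloor>real (Suc n) * z\<rfloor>) / real (Suc n)"
      using divide_right_mono[OF f(2), of "real (Suc n)"] by (simp del: of_nat_Suc)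
  qed
  have Dm[measurable]: "D \<in> borel_measurable borel" unfolding D_def by measurable
  have gm[measurable]: "g n \<in> borel_measurable borel" for n unfolding g_def by measurable
  have "(\<lambda>n. \<integral>z. g n z \<partial>lborel) \<longlonglongrightarrow> (\<integral>z. D z * heat_weight t z \<partial>lborel)"
  proof (rule integral_dominated_convergence[where w="\<lambda>z. 2 * (C * (1 + \<bar>x\<bar>) ^ 3) * ((1 + \<bar>z\<bar>) ^ 3 * heat_weight t z)"])
    show "integrable lborel (\<lambda>z. 2 * (C * (1 + \<bar>x\<bar>) ^ 3) * ((1 + \<bar>z\<bar>) ^ 3 * heat_weight t z))"
      by (intro integrable_mult_right heat_weight_integrable_power)
    show "AE z in lborel. (\<lambda>n. g n z) \<longlonglongrightarrow> D z * heat_weight t z"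
    proof (intro AE_I2)
      fix z
      show "(\<lambda>n. g n z) \<longlonglongrightarrow> D z * heat_weight t z"
      proof (cases "z < 0")
        case False
        have "(\<lambda>n. real (nat \<lfloor>real (Suc n) * z\<rfloor>) / real (Suc n)) \<longlonglongrightarrow> z"
        proof (rule tendsto_sandwich)
          show "(\<lambda>n. z - 1 / real (Suc n)) \<longlonglongrightarrow> z"
            using tendsto_diff[OF tendsto_const LIMSEQ_inverse_real_of_nat, of z] by (simp add: inverse_eq_divide)
        qed (use fl False in \<open>auto simp del: of_nat_Suc\<close>)
        from tendsto_mult[OF isCont_tendsto_compose[OF isD this] tendsto_const]
        have "(\<lambda>n. D (real (nat \<lfloor>real (Suc n) * z\<rfloor>) / real (Suc n)) * heat_weight t z) \<longlonglongrightarrow> D z * heat_weight t z" .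
        moreover have "\<forall>\<^sub>F n in sequentially. D (real (nat \<lfloor>real (Suc n) * z\<rfloor>) / real (Suc n)) * heat_weight t z = g n z"
        proof (rule eventually_sequentiallyI)
          fix n assume n: "nat \<lceil>z\<rceil> \<le> n"
          then have "z < real (Suc n)" by linarith
          then have "real (nat \<lfloor>real (Suc n) * z\<rfloor>) / real (Suc n) < real (Suc n)" using fl(2)[of z n] False by linarith
          then have "real (nat \<lfloor>real (Suc n) * z\<rfloor>) < real (Suc n) * real (Suc n)"
            by (simp add: pos_divide_less_eq del: of_nat_Suc)
          then have "real (nat \<lfloor>real (Suc n) * z\<rfloor>) < real ((Suc n)\<^sup>2)"
            by (simp only: power2_eq_square of_nat_mult)
          then have "nat \<lfloor>real (Suc n) * z\<rfloor> < (Suc n)\<^sup>2" by (simp only: of_nat_less_iff)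
          then show "D (real (nat \<lfloor>real (Suc n) * z\<rfloor>) / real (Suc n)) * heat_weight t z = g n z"
            using False by (simp add: g_def del: of_nat_Suc)
        qed
        ultimately show ?thesis by (rule Lim_transform_eventually)
      qed (simp add: g_def heat_weight_def)
    qed
    show "AE z in lborel. norm (g n z) \<le> 2 * (C * (1 + \<bar>x\<bar>) ^ 3) * ((1 + \<bar>z\<bar>) ^ 3 * heat_weight t z)" for n
    proof (intro AE_I2)
      fix z
      let ?y = "real (nat \<lfloor>real (Suc n) * z\<rfloor>) / real (Suc n)"
      show "norm (g n z) \<le> 2 * (C * (1 + \<bar>x\<bar>) ^ 3) * ((1 + \<bar>z\<bar>) ^ 3 * heat_weight t z)"
      proof (cases "0 \<le> z \<and> nat \<lfloor>real (Suc n) * z\<rfloor> < (Suc n)\<^sup>2")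
        case True
        have "\<bar>D ?y\<bar> \<le> 2 * (C * (1 + \<bar>x\<bar>) ^ 3) * (1 + \<bar>?y\<bar>) ^ 3" unfolding D_def by (rule difference_growth)
        also have "\<dots> \<le> 2 * (C * (1 + \<bar>x\<bar>) ^ 3) * (1 + \<bar>z\<bar>) ^ 3"
          using fl(1,2)[of z n] True C by (intro mult_left_mono power_mono add_left_mono) (auto simp del: of_nat_Suc)
        finally have "\<bar>D ?y\<bar> * heat_weight t z \<le> 2 * (C * (1 + \<bar>x\<bar>) ^ 3) * (1 + \<bar>z\<bar>) ^ 3 * heat_weight t z"
          by (rule mult_right_mono) (rule heat_weight_bounds)
        then show ?thesis using True by (simp add: g_def abs_mult heat_weight_bounds mult.assoc del: of_nat_Suc)
      next
        case False
        then have "g n z = 0" unfolding g_def by (rule if_not_P)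
        then show ?thesis using C by (simp add: heat_weight_bounds)
      qed
    qed
  qed auto
  then show ?thesis unfolding eq mild_def D_def .
qed

section \<open>The mild solution driven by a single noise\<close>

context fractional_brownian_motion
begin

text \<open>Almost every path is tempered, so the deterministic lemmas apply to it. The second
  conjunct puts the mild solution into the closure of the span of path values.\<close>

lemma time_space_integral_AE:
  assumes t: "t > 0"
  shows "AE \<omega> in M. time_space_integral W t x \<omega> = mild t x (\<lambda>y. W y \<omega>) \<and>
    (\<lambda>n. \<Sum>j<(Suc n)\<^sup>2. step_weight t n j * (W (x + real j / real (Suc n)) \<omega> - W (x - real j / real (Suc n)) \<omega>)) \<longlonglongrightarrow> mild t x (\<lambda>y. W y \<omega>)"
  using path_growth AE_space[of M]
proof eventually_elim
  case (elim \<omega>)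
  then obtain C where "C \<ge> 0" "\<And>y. \<bar>W y \<omega>\<bar> \<le> C * (1 + \<bar>y\<bar>) ^ 3" by blast
  then interpret tempered_path "\<lambda>y. W y \<omega>" C using W_continuous[OF elim(2)] by unfold_locales
  show ?case using time_integral_eq_mild[OF t] step_sum_tendsto_mild unfolding time_space_integral_def by blast
qed

lemma W_square_integrable: "integrable M (\<lambda>\<omega>. (W y \<omega> - W x \<omega>)\<^sup>2)"
  by (rule centred_normal_power_integrable[OF increment_normal])

text \<open>\<open>Y\<close> is arbitrary so that a covariance results from two applications, with
  \<open>Y\<close> a mild solution and then with \<open>Y\<close> an increment of a path. Joint
  integrability follows from |D Y| <= D^2 + Y^2, as the second moment of the increment
  \<open>D z\<close> grows at most quadratically.\<close>

lemma time_space_integral_mult: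
  assumes t: "t > 0" and Y[measurable]: "Y \<in> borel_measurable M" and Y2: "integrable M (\<lambda>\<omega>. (Y \<omega>)\<^sup>2)"
  shows "(\<integral>\<omega>. time_space_integral W t x \<omega> * Y \<omega> \<partial>M) = (\<integral>z. (\<integral>\<omega>. (W (x + z) \<omega> - W (x - z) \<omega>) * Y \<omega> \<partial>M) * heat_weight t z \<partial>lborel)"
proof -
  interpret P: pair_sigma_finite lborel M
    by (intro pair_sigma_finite.intro) (auto intro: lborel.sigma_finite_measure_axioms sigma_finite_measure_axioms)
  define D where "D z \<omega> = W (x + z) \<omega> - W (x - z) \<omega>" for z \<omega>
  define f where "f z \<omega> = D z \<omega> * Y \<omega> * heat_weight t z" for z \<omega>
  have Dm[measurable]: "D z \<in> borel_measurable M" for z unfolding D_def by measurable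
  have [measurable]: "(\<lambda>p. W (x + fst p) (snd p)) \<in> borel_measurable (borel \<Otimes>\<^sub>M M)" "(\<lambda>p. W (x - fst p) (snd p)) \<in> borel_measurable (borel \<Otimes>\<^sub>M M)"
    using measurable_compose[OF _ W_joint_measurable, of "\<lambda>p. (x + fst p, snd p)" "borel \<Otimes>\<^sub>M M"]
      measurable_compose[OF _ W_joint_measurable, of "\<lambda>p. (x - fst p, snd p)" "borel \<Otimes>\<^sub>M M"] by simp_all
  have "(\<lambda>p. f (fst p) (snd p)) \<in> borel_measurable (borel \<Otimes>\<^sub>M M)" unfolding f_def D_def by measurable
  then have fm[measurable]: "case_prod f \<in> borel_measurable (lborel \<Otimes>\<^sub>M M)" by (simp add: case_prod_beta')
  have D2: "integrable M (\<lambda>\<omega>. (D z \<omega>)\<^sup>2)" "(\<integral>\<omega>. (D z \<omega>)\<^sup>2 \<partial>M) \<le> 4 * (1 + \<bar>z\<bar>)\<^sup>2" for z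
  proof -
    show "integrable M (\<lambda>\<omega>. (D z \<omega>)\<^sup>2)" unfolding D_def by (rule W_square_integrable)
    have "(\<integral>\<omega>. (D z \<omega>)\<^sup>2 \<partial>M) = \<bar>2 * z\<bar> powr (2 * H)"
      unfolding D_def using centred_normal_variance[OF increment_normal[of "x + z" "x - z"]] by simp
    also have "\<dots> \<le> (1 + \<bar>2 * z\<bar>)\<^sup>2" using H by (intro abs_powr_le_power) auto
    also have "\<dots> \<le> (2 * (1 + \<bar>z\<bar>))\<^sup>2" by (intro power_mono) auto
    finally show "(\<integral>\<omega>. (D z \<omega>)\<^sup>2 \<partial>M) \<le> 4 * (1 + \<bar>z\<bar>)\<^sup>2" by (simp only: power_mult_distrib) simp
  qed
  have DY: "integrable M (\<lambda>\<omega>. D z \<omega> * Y \<omega>)" for z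
    by (intro integrable_mult_squares D2 Y2) auto
  let ?K = "4 + (\<integral>\<omega>. (Y \<omega>)\<^sup>2 \<partial>M)"
  have Y0: "0 \<le> (\<integral>\<omega>. (Y \<omega>)\<^sup>2 \<partial>M)" by (intro Bochner_Integration.integral_nonneg) auto
  have "integrable (lborel \<Otimes>\<^sub>M M) (case_prod f)"
  proof (rule P.Fubini_integrable[OF fm])
    show "integrable lborel (\<lambda>z. \<integral>\<omega>. norm (case_prod f (z, \<omega>)) \<partial>M)"
    proof (rule Bochner_Integration.integrable_bound)
      show "integrable lborel (\<lambda>z. ?K * ((1 + \<bar>z\<bar>)\<^sup>2 * heat_weight t z))"
        by (intro integrable_mult_right heat_weight_integrable_power)
      show "(\<lambda>z. \<integral>\<omega>. norm (case_prod f (z, \<omega>)) \<partial>M) \<in> borel_measurable lborel"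
      proof -
        have "(\<lambda>(z, \<omega>). norm (case_prod f (z, \<omega>))) \<in> borel_measurable (lborel \<Otimes>\<^sub>M M)"
          using measurable_compose[OF fm borel_measurable_norm] by (simp add: case_prod_beta')
        then show ?thesis by (rule borel_measurable_lebesgue_integral)
      qed
      show "AE z in lborel. norm (\<integral>\<omega>. norm (case_prod f (z, \<omega>)) \<partial>M) \<le> norm (?K * ((1 + \<bar>z\<bar>)\<^sup>2 * heat_weight t z))"
      proof (intro AE_I2)
        fix z
        have "(\<integral>\<omega>. norm (f z \<omega>) \<partial>M) \<le> (\<integral>\<omega>. ((D z \<omega>)\<^sup>2 + (Y \<omega>)\<^sup>2) * heat_weight t z \<partial>M)"
        proof (rule Bochner_Integration.integral_mono)
          show "integrable M (\<lambda>\<omega>. norm (f z \<omega>))" unfolding f_def by (intro integrable_norm integrable_mult_left DY)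
          show "integrable M (\<lambda>\<omega>. ((D z \<omega>)\<^sup>2 + (Y \<omega>)\<^sup>2) * heat_weight t z)"
            by (intro integrable_mult_left Bochner_Integration.integrable_add D2 Y2)
          show "norm (f z \<omega>) \<le> ((D z \<omega>)\<^sup>2 + (Y \<omega>)\<^sup>2) * heat_weight t z" for \<omega>
            using mult_right_mono[OF abs_mult_le_squares heat_weight_bounds(1)[of t z]] by (simp add: f_def abs_mult heat_weight_bounds)
        qed
        also have "\<dots> = ((\<integral>\<omega>. (D z \<omega>)\<^sup>2 \<partial>M) + (\<integral>\<omega>. (Y \<omega>)\<^sup>2 \<partial>M)) * heat_weight t z"
          using D2(1) Y2 by simp
        also have "\<dots> \<le> (?K * (1 + \<bar>z\<bar>)\<^sup>2) * heat_weight t z"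
        proof (rule mult_right_mono)
          have "(\<integral>\<omega>. (Y \<omega>)\<^sup>2 \<partial>M) * 1 \<le> (\<integral>\<omega>. (Y \<omega>)\<^sup>2 \<partial>M) * (1 + \<bar>z\<bar>)\<^sup>2"
            using Y0 by (intro mult_left_mono) (auto simp: one_le_power)
          then show "(\<integral>\<omega>. (D z \<omega>)\<^sup>2 \<partial>M) + (\<integral>\<omega>. (Y \<omega>)\<^sup>2 \<partial>M) \<le> ?K * (1 + \<bar>z\<bar>)\<^sup>2"
            using D2(2)[of z] unfolding distrib_right by linarith
        qed (rule heat_weight_bounds)
        finally show "norm (\<integral>\<omega>. norm (case_prod f (z, \<omega>)) \<partial>M) \<le> norm (?K * ((1 + \<bar>z\<bar>)\<^sup>2 * heat_weight t z))"
          using Y0 by (simp add: abs_mult heat_weight_bounds mult.assoc)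
      qed
    qed
  qed (use DY in \<open>auto simp: f_def\<close>)
  note fub = P.Fubini_integral[OF this]
  have "(\<integral>\<omega>. time_space_integral W t x \<omega> * Y \<omega> \<partial>M) = (\<integral>\<omega>. (\<integral>z. f z \<omega> \<partial>lborel) \<partial>M)"
  proof (rule integral_cong_AE)
    show "AE \<omega> in M. time_space_integral W t x \<omega> * Y \<omega> = (\<integral>z. f z \<omega> \<partial>lborel)"
      using time_space_integral_AE[OF t, of x]
    proof eventually_elim
      case (elim \<omega>)
      have "(\<integral>z. f z \<omega> \<partial>lborel) = (\<integral>z. Y \<omega> * (D z \<omega> * heat_weight t z) \<partial>lborel)" by (simp add: f_def mult_ac)
      then show ?case using elim unfolding mild_def D_def by (simp add: mult.commute)
    qed
    have "(\<lambda>(\<omega>, z). f z \<omega>) \<in> borel_measurable (M \<Otimes>\<^sub>M lborel)"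
      using measurable_compose[OF measurable_pair_swap' fm] by (simp add: case_prod_beta')
    then show "(\<lambda>\<omega>. \<integral>z. f z \<omega> \<partial>lborel) \<in> borel_measurable M" by (rule lborel.borel_measurable_lebesgue_integral)
  qed measurable
  also have "\<dots> = (\<integral>z. (\<integral>\<omega>. f z \<omega> \<partial>M) \<partial>lborel)" by (rule fub)
  also have "\<dots> = (\<integral>z. (\<integral>\<omega>. D z \<omega> * Y \<omega> \<partial>M) * heat_weight t z \<partial>lborel)" by (simp add: f_def)
  finally show ?thesis unfolding D_def .
qed

lemma W_integrable: "integrable M (W y)" "integrable M (\<lambda>\<omega>. W x \<omega> * W y \<omega>)"
proof -
  have c: "\<exists>v. centred_normal M (W y) v" for y using W_comb_normal[of "{y}" "\<lambda>_. 1"] by simp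
  show "integrable M (W y)" using c centred_normal_integrableI by blast
  have "integrable M (\<lambda>\<omega>. (W y \<omega>)\<^sup>2)" for y using c[of y] centred_normal_power_integrable by blast
  then show "integrable M (\<lambda>\<omega>. W x \<omega> * W y \<omega>)" by (intro integrable_mult_squares) auto
qed

lemma increment_product:
  "(\<integral>\<omega>. (W (y + v) \<omega> - W (y - v) \<omega>) * (W (x + z) \<omega> - W (x - z) \<omega>) \<partial>M) = mixed_difference (2 * H) (x - y) z v"
proof -
  have "(\<integral>\<omega>. (W b \<omega> - W a \<omega>) * (W d \<omega> - W c \<omega>) \<partial>M) = fbm_cov b d - fbm_cov b c - fbm_cov a d + fbm_cov a c" for a b c d
  proof -
    have "(\<integral>\<omega>. (W b \<omega> - W a \<omega>) * (W d \<omega> - W c \<omega>) \<partial>M) = (\<integral>\<omega>. W b \<omega> * W d \<omega> - W b \<omega> * W c \<omega> - W a \<omega> * W d \<omega> + W a \<omega> * W c \<omega> \<partial>M)"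
      by (intro Bochner_Integration.integral_cong) (auto simp: algebra_simps)
    then show ?thesis using W_integrable(2) by (simp add: W_product)
  qed
  moreover have "fbm_cov (y + v) (x + z) - fbm_cov (y + v) (x - z) - fbm_cov (y - v) (x + z) + fbm_cov (y - v) (x - z) = mixed_difference (2 * H) (x - y) z v"
  proof -
    have "\<bar>y + v - (x + z)\<bar> = \<bar>x - y + z - v\<bar>" "\<bar>y + v - (x - z)\<bar> = \<bar>x - y - z - v\<bar>"
      "\<bar>y - v - (x + z)\<bar> = \<bar>x - y + z + v\<bar>" "\<bar>y - v - (x - z)\<bar> = \<bar>x - y - z + v\<bar>" by auto
    then show ?thesis unfolding fbm_cov_def mixed_difference_def by (simp add: field_simps)
  qed
  ultimately show ?thesis by simp
qed

lemma time_space_integral_product: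
  assumes t: "t > 0" "s > 0" and T: "integrable M (\<lambda>\<omega>. (time_space_integral W s y \<omega>)\<^sup>2)"
  shows "(\<integral>\<omega>. time_space_integral W t x \<omega> * time_space_integral W s y \<omega> \<partial>M) = mild_cov (2 * H) t s (x - y)"
proof -
  have "(\<integral>\<omega>. (W (x + z) \<omega> - W (x - z) \<omega>) * time_space_integral W s y \<omega> \<partial>M) = (\<integral>v. mixed_difference (2 * H) (x - y) z v * heat_weight s v \<partial>lborel)" for z
  proof -
    have "(\<integral>\<omega>. (W (x + z) \<omega> - W (x - z) \<omega>) * time_space_integral W s y \<omega> \<partial>M) = (\<integral>\<omega>. time_space_integral W s y \<omega> * (W (x + z) \<omega> - W (x - z) \<omega>) \<partial>M)"
      by (simp only: mult.commute)
    also have "\<dots> = (\<integral>v. mixed_difference (2 * H) (x - y) z v * heat_weight s v \<partial>lborel)"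
      using time_space_integral_mult[OF t(2) _ W_square_integrable, of "x + z" "x - z" y] unfolding increment_product by simp
    finally show ?thesis .
  qed
  then show ?thesis
    using time_space_integral_mult[OF t(1) _ T, of x] by (simp add: mild_cov_def)
qed

end

lemma summable_on_int_powr:
  fixes \<beta> :: real
  assumes "\<beta> > 1"
  shows "(\<lambda>m. real_of_int \<bar>m\<bar> powr (- \<beta>)) summable_on (UNIV :: int set)"
proof -
  have n: "(\<lambda>n. real n powr (- \<beta>)) summable_on (UNIV :: nat set)"
    using assms by (intro norm_summable_imp_summable_on) (simp add: summable_real_powr_iff)
  have "(\<lambda>m. real_of_int \<bar>m\<bar> powr (- \<beta>)) summable_on (int ` UNIV)"
    by (subst summable_on_reindex) (use n in \<open>auto simp: o_def\<close>)
  moreover have "(\<lambda>m. real_of_int \<bar>m\<bar> powr (- \<beta>)) summable_on ((\<lambda>n. - int n) ` UNIV)"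
    by (subst summable_on_reindex) (use n in \<open>auto simp: o_def inj_on_def\<close>)
  ultimately have "(\<lambda>m. real_of_int \<bar>m\<bar> powr (- \<beta>)) summable_on (int ` UNIV \<union> (\<lambda>n. - int n) ` UNIV)"
    by (rule summable_on_union)
  moreover have "int ` UNIV \<union> (\<lambda>n. - int n) ` UNIV = UNIV"
  proof -
    have "m \<in> int ` UNIV \<union> (\<lambda>n. - int n) ` UNIV" for m
    proof (cases "m \<ge> 0")
      case True
      then have "m = int (nat m)" by simp
      then show ?thesis by blast
    next
      case False
      then have "m = - int (nat (- m))" by simp
      then show ?thesis by blast
    qed
    then show ?thesis by blast
  qed
  ultimately show ?thesis by simp
qed

section \<open>Superposition of two independent noises\<close>

locale independent_fbm_pair =
  B1: fractional_brownian_motion M H1 W1 + B2: fractional_brownian_motion M H2 W2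
  for M :: "'a measure" and H1 H2 and W1 W2 +
  fixes \<sigma>1 \<sigma>2 :: real
  assumes indep: "indep_processes M W1 W2"
begin

text \<open>One finite index set serves both processes; coefficients may vanish, so this is no
  restriction.\<close>

definition noise_span :: "('a \<Rightarrow> real) set" where
  "noise_span = {(\<lambda>\<omega>. (\<Sum>i\<in>S. a i * W1 i \<omega>) + (\<Sum>i\<in>S. b i * W2 i \<omega>)) | S a b. finite S}"

lemma noise_spanI: "finite S \<Longrightarrow> (\<lambda>\<omega>. (\<Sum>i\<in>S. a i * W1 i \<omega>) + (\<Sum>i\<in>S. b i * W2 i \<omega>)) \<in> noise_span"
  unfolding noise_span_def mem_Collect_eq by (rule exI[of _ S], rule exI[of _ a], rule exI[of _ b]) simp

lemma indep_functionals:
  assumes f: "f \<in> borel_measurable (Pi\<^sub>M UNIV (\<lambda>_. borel))" and g: "g \<in> borel_measurable (Pi\<^sub>M UNIV (\<lambda>_. borel))"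
  shows "B1.indep_var borel (\<lambda>\<omega>. f (\<lambda>i. W1 i \<omega>)) borel (\<lambda>\<omega>. g (\<lambda>i. W2 i \<omega>))"
  using B1.indep_var_compose[OF indep[unfolded indep_processes_def] f g] by (simp add: o_def)

text \<open>Independence factors the characteristic function, so the variances of the two parts add.
  For closure, coefficients are extended by 0 to the union of the index sets.\<close>

lemma gaussian_noise_span: "gaussian_space M noise_span"
  unfolding gaussian_space_def
proof (intro conjI ballI allI)
  show "noise_span \<noteq> {}" unfolding noise_span_def by blast
next
  fix X assume "X \<in> noise_span"
  then obtain S a b where S: "finite S" and X: "X = (\<lambda>\<omega>. (\<Sum>i\<in>S. a i * W1 i \<omega>) + (\<Sum>i\<in>S. b i * W2 i \<omega>))"
    unfolding noise_span_def by blast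
  obtain v1 v2 where v: "centred_normal M (\<lambda>\<omega>. \<Sum>i\<in>S. a i * W1 i \<omega>) v1" "centred_normal M (\<lambda>\<omega>. \<Sum>i\<in>S. b i * W2 i \<omega>) v2"
    using B1.W_comb_normal[OF S, of a] B2.W_comb_normal[OF S, of b] by blast
  have i: "B1.indep_var borel (\<lambda>\<omega>. iexp (\<theta> * (\<Sum>i\<in>S. a i * W1 i \<omega>))) borel (\<lambda>\<omega>. iexp (\<theta> * (\<Sum>i\<in>S. b i * W2 i \<omega>)))" for \<theta>
  proof -
    have "B1.indep_var borel (\<lambda>\<omega>. \<Sum>i\<in>S. a i * W1 i \<omega>) borel (\<lambda>\<omega>. \<Sum>i\<in>S. b i * W2 i \<omega>)"
      using indep_functionals[of "\<lambda>w. \<Sum>i\<in>S. a i * w i" "\<lambda>w. \<Sum>i\<in>S. b i * w i"] by simp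
    from B1.indep_var_compose[OF this, of "\<lambda>x. iexp (\<theta> * x)" borel "\<lambda>x. iexp (\<theta> * x)" borel]
    show ?thesis by (simp add: o_def)
  qed
  have "centred_normal M X (v1 + v2)"
  proof (rule centred_normal_charI)
    show "X \<in> borel_measurable M" unfolding X by simp
    show "0 \<le> v1 + v2" using centred_normalD(2)[OF v(1)] centred_normalD(2)[OF v(2)] by simp
    fix \<theta> :: real
    have "(\<integral>\<omega>. iexp (\<theta> * X \<omega>) \<partial>M) = (\<integral>\<omega>. iexp (\<theta> * (\<Sum>i\<in>S. a i * W1 i \<omega>)) * iexp (\<theta> * (\<Sum>i\<in>S. b i * W2 i \<omega>)) \<partial>M)"
      unfolding X by (simp add: exp_add distrib_left)
    also have "\<dots> = (\<integral>\<omega>. iexp (\<theta> * (\<Sum>i\<in>S. a i * W1 i \<omega>)) \<partial>M) * (\<integral>\<omega>. iexp (\<theta> * (\<Sum>i\<in>S. b i * W2 i \<omega>)) \<partial>M)"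
      by (rule B1.indep_var_lebesgue_integral[OF i]) (rule B1.integrable_const_bound[of _ 1]; simp)+
    also have "\<dots> = exp (- (\<theta>\<^sup>2 * v1 / 2)) * exp (- (\<theta>\<^sup>2 * v2 / 2))"
      using centred_normal_char[OF v(1), of \<theta>] centred_normal_char[OF v(2), of \<theta>] by simp
    also have "\<dots> = exp (- (\<theta>\<^sup>2 * (v1 + v2) / 2))"
      unfolding of_real_mult[symmetric] exp_add[symmetric] by (simp add: field_simps)
    finally show "(\<integral>\<omega>. iexp (\<theta> * X \<omega>) \<partial>M) = exp (- (\<theta>\<^sup>2 * (v1 + v2) / 2))" by simp
  qed (rule B1.prob_space_axioms)
  then show "\<exists>v. centred_normal M X v" by blast
next
  fix X Y and c d :: real assume "X \<in> noise_span" "Y \<in> noise_span"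
  then obtain S a b T a' b' where S: "finite S" "finite T"
    and X: "X = (\<lambda>\<omega>. (\<Sum>i\<in>S. a i * W1 i \<omega>) + (\<Sum>i\<in>S. b i * W2 i \<omega>))"
    and Y: "Y = (\<lambda>\<omega>. (\<Sum>i\<in>T. a' i * W1 i \<omega>) + (\<Sum>i\<in>T. b' i * W2 i \<omega>))"
    unfolding noise_span_def by blast
  have ext: "(\<Sum>i\<in>S. e i * w i) = (\<Sum>i\<in>S \<union> T. (if i \<in> S then e i else 0) * w i)"
       "(\<Sum>i\<in>T. e i * w i) = (\<Sum>i\<in>S \<union> T. (if i \<in> T then e i else 0) * w i)" for e w :: "real \<Rightarrow> real"
    using S by (auto intro!: sum.mono_neutral_cong_left)
  have "(\<lambda>\<omega>. c * X \<omega> + d * Y \<omega>) = (\<lambda>\<omega>. (\<Sum>i\<in>S \<union> T. (c * (if i \<in> S then a i else 0) + d * (if i \<in> T then a' i else 0)) * W1 i \<omega>)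
      + (\<Sum>i\<in>S \<union> T. (c * (if i \<in> S then b i else 0) + d * (if i \<in> T then b' i else 0)) * W2 i \<omega>))"
    unfolding X Y ext by (simp only: distrib_left distrib_right sum.distrib sum_distrib_left mult.assoc add_ac)
  then show "(\<lambda>\<omega>. c * X \<omega> + d * Y \<omega>) \<in> noise_span" using S by (simp only: noise_spanI finite_UnI)
qed

definition noise_space :: "('a \<Rightarrow> real) set" where
  "noise_space = {L \<in> borel_measurable M. \<exists>X. (\<forall>n. X n \<in> noise_span) \<and> (AE \<omega> in M. (\<lambda>n. X n \<omega>) \<longlonglongrightarrow> L \<omega>)}"

lemma noise_spaceI:
  "L \<in> borel_measurable M \<Longrightarrow> (\<And>n. X n \<in> noise_span) \<Longrightarrow> AE \<omega> in M. (\<lambda>n. X n \<omega>) \<longlonglongrightarrow> L \<omega> \<Longrightarrow> L \<in> noise_space"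
  unfolding noise_space_def by blast

lemma gaussian_noise_space: "gaussian_space M noise_space"
  unfolding noise_space_def by (rule gaussian_space_AE_closure[OF B1.prob_space_axioms gaussian_noise_span])

lemma W_in_noise_span: "W1 y \<in> noise_span" "W2 y \<in> noise_span"
  using noise_spanI[of "{y}" "\<lambda>_. 1" "\<lambda>_. 0"] noise_spanI[of "{y}" "\<lambda>_. 0" "\<lambda>_. 1"] by simp_all

lemma time_space_integral_in_noise_space:
  assumes t: "t > 0"
  shows "time_space_integral W1 t x \<in> noise_space" "time_space_integral W2 t x \<in> noise_space"
proof -
  note V = gaussian_noise_span
  let ?X = "\<lambda>W n \<omega>. \<Sum>j<(Suc n)\<^sup>2. step_weight t n j * (W (x + real j / real (Suc n)) \<omega> - W (x - real j / real (Suc n)) \<omega> :: real)"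
  have "?X W1 n \<in> noise_span" "?X W2 n \<in> noise_span" for n
    by (intro gaussian_space_sum[OF V] gaussian_space_diff[OF V] W_in_noise_span finite_lessThan)+
  moreover have "AE \<omega> in M. (\<lambda>n. ?X W1 n \<omega>) \<longlonglongrightarrow> time_space_integral W1 t x \<omega>"
    using B1.time_space_integral_AE[OF t, of x] by (rule eventually_mono) auto
  moreover have "AE \<omega> in M. (\<lambda>n. ?X W2 n \<omega>) \<longlonglongrightarrow> time_space_integral W2 t x \<omega>"
    using B2.time_space_integral_AE[OF t, of x] by (rule eventually_mono) auto
  ultimately show "time_space_integral W1 t x \<in> noise_space" "time_space_integral W2 t x \<in> noise_space"
    by (auto intro: noise_spaceI[where X="?X W1"] noise_spaceI[where X="?X W2"])
qed

text \<open>One application of \<open>time_space_integral_mult\<close> for each process reduces the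
  claim to values of the two paths, which are independent and centred.\<close>

lemma cross_zero:
  assumes t: "t > 0" "s > 0"
  shows "(\<integral>\<omega>. time_space_integral W1 t x \<omega> * time_space_integral W2 s y \<omega> \<partial>M) = 0"
proof -
  have i: "integrable M (\<lambda>\<omega>. W1 a \<omega> * W2 b \<omega>)" and z: "(\<integral>\<omega>. W1 a \<omega> * W2 b \<omega> \<partial>M) = 0" for a b
  proof -
    have "B1.indep_var borel (W1 a) borel (W2 b)"
      using indep_functionals[of "\<lambda>w. w a" "\<lambda>w. w b"] by simp
    from B1.indep_var_lebesgue_integral[OF this] B1.indep_var_integrable[OF this]
    show "integrable M (\<lambda>\<omega>. W1 a \<omega> * W2 b \<omega>)" "(\<integral>\<omega>. W1 a \<omega> * W2 b \<omega> \<partial>M) = 0"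
      using B1.W_integrable(1) B2.W_integrable(1) B1.W_mean by auto
  qed
  have d: "(\<integral>\<omega>. (W2 b \<omega> - W2 b' \<omega>) * (W1 a \<omega> - W1 a' \<omega>) \<partial>M) = 0" for a a' b b'
  proof -
    have "(\<integral>\<omega>. (W2 b \<omega> - W2 b' \<omega>) * (W1 a \<omega> - W1 a' \<omega>) \<partial>M) =
      (\<integral>\<omega>. W1 a \<omega> * W2 b \<omega> - W1 a \<omega> * W2 b' \<omega> - W1 a' \<omega> * W2 b \<omega> + W1 a' \<omega> * W2 b' \<omega> \<partial>M)"
      by (intro Bochner_Integration.integral_cong) (auto simp: algebra_simps)
    then show ?thesis using i z by simp
  qed
  have T2: "integrable M (\<lambda>\<omega>. (time_space_integral W2 s y \<omega>)\<^sup>2)"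
    by (rule gaussian_space_power_integrable[OF gaussian_noise_space time_space_integral_in_noise_space(2)[OF t(2)]])
  have "(\<integral>\<omega>. (W1 (x + z) \<omega> - W1 (x - z) \<omega>) * time_space_integral W2 s y \<omega> \<partial>M) = 0" for z
  proof -
    have "(\<integral>\<omega>. (W1 (x + z) \<omega> - W1 (x - z) \<omega>) * time_space_integral W2 s y \<omega> \<partial>M) = (\<integral>\<omega>. time_space_integral W2 s y \<omega> * (W1 (x + z) \<omega> - W1 (x - z) \<omega>) \<partial>M)"
      by (simp only: mult.commute)
    also have "\<dots> = 0"
      using B2.time_space_integral_mult[OF t(2) _ B1.W_square_integrable, of "x + z" "x - z" y] unfolding d by simp
    finally show ?thesis .
  qed
  then show ?thesis using B1.time_space_integral_mult[OF t(1) _ T2, of x] by simp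
qed

definition field :: "real \<Rightarrow> real \<Rightarrow> 'a \<Rightarrow> real" where
  "field t x \<omega> = \<sigma>1 * time_space_integral W1 t x \<omega> + \<sigma>2 * time_space_integral W2 t x \<omega>"

definition field_cov :: "real \<Rightarrow> real \<Rightarrow> real \<Rightarrow> real" where
  "field_cov t s d = \<sigma>1\<^sup>2 * mild_cov (2 * H1) t s d + \<sigma>2\<^sup>2 * mild_cov (2 * H2) t s d"

lemma field_in_noise_space: "t > 0 \<Longrightarrow> field t x \<in> noise_space"
  unfolding field_def[abs_def]
  by (intro gaussian_space_comb[OF gaussian_noise_space] time_space_integral_in_noise_space)

lemma field_product:
  assumes t: "t > 0" "s > 0"
  shows "(\<integral>\<omega>. field t x \<omega> * field s y \<omega> \<partial>M) = field_cov t s (x - y)"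
proof -
  let ?T1 = "time_space_integral W1" and ?T2 = "time_space_integral W2"
  note I = gaussian_space_mult_integrable[OF gaussian_noise_space]
  note m = time_space_integral_in_noise_space
  have i: "integrable M (\<lambda>\<omega>. ?T1 t x \<omega> * ?T1 s y \<omega>)" "integrable M (\<lambda>\<omega>. ?T1 t x \<omega> * ?T2 s y \<omega>)"
    "integrable M (\<lambda>\<omega>. ?T1 s y \<omega> * ?T2 t x \<omega>)" "integrable M (\<lambda>\<omega>. ?T2 t x \<omega> * ?T2 s y \<omega>)"
    by (intro I m t)+
  have "(\<integral>\<omega>. field t x \<omega> * field s y \<omega> \<partial>M) = (\<integral>\<omega>. \<sigma>1\<^sup>2 * (?T1 t x \<omega> * ?T1 s y \<omega>) + \<sigma>1 * \<sigma>2 * (?T1 t x \<omega> * ?T2 s y \<omega>)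
     + \<sigma>1 * \<sigma>2 * (?T1 s y \<omega> * ?T2 t x \<omega>) + \<sigma>2\<^sup>2 * (?T2 t x \<omega> * ?T2 s y \<omega>) \<partial>M)"
    by (intro Bochner_Integration.integral_cong) (auto simp: field_def power2_eq_square algebra_simps)
  also have "\<dots> = \<sigma>1\<^sup>2 * (\<integral>\<omega>. ?T1 t x \<omega> * ?T1 s y \<omega> \<partial>M) + \<sigma>1 * \<sigma>2 * (\<integral>\<omega>. ?T1 t x \<omega> * ?T2 s y \<omega> \<partial>M)
     + \<sigma>1 * \<sigma>2 * (\<integral>\<omega>. ?T1 s y \<omega> * ?T2 t x \<omega> \<partial>M) + \<sigma>2\<^sup>2 * (\<integral>\<omega>. ?T2 t x \<omega> * ?T2 s y \<omega> \<partial>M)"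
    using i by simp
  also have "\<dots> = field_cov t s (x - y)"
    unfolding cross_zero[OF t] cross_zero[OF t(2,1)]
    using B1.time_space_integral_product[OF t gaussian_space_power_integrable[OF gaussian_noise_space m(1)[OF t(2)]]]
      B2.time_space_integral_product[OF t gaussian_space_power_integrable[OF gaussian_noise_space m(2)[OF t(2)]]]
    by (simp add: field_cov_def)
  finally show ?thesis .
qed

text \<open>For |m| >= 1 both exponents may be raised to the larger one,
  \<open>2 * max H1 H2 - 2\<close>, and squaring doubles it.\<close>

lemma field_cov_decay:
  assumes \<delta>: "\<delta> > 0"
  obtains C where "\<And>m::int. m \<noteq> 0 \<Longrightarrow> (field_cov t s (real_of_int m * \<delta>))\<^sup>2 \<le> C * real_of_int \<bar>m\<bar> powr (- (4 - 4 * max H1 H2))"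
proof -
  have H: "0 < 2 * H1" "2 * H1 < 2" "0 < 2 * H2" "2 * H2 < 2" using B1.H B2.H by auto
  obtain C1 C2 where C: "\<And>d. d \<noteq> 0 \<Longrightarrow> \<bar>mild_cov (2 * H1) t s d\<bar> \<le> C1 * \<bar>d\<bar> powr (2 * H1 - 2)"
    "\<And>d. d \<noteq> 0 \<Longrightarrow> \<bar>mild_cov (2 * H2) t s d\<bar> \<le> C2 * \<bar>d\<bar> powr (2 * H2 - 2)"
    using mild_cov_bound[OF H(1,2)] mild_cov_bound[OF H(3,4)] by metis
  define K where "K = \<sigma>1\<^sup>2 * (\<bar>C1\<bar> * \<delta> powr (2 * H1 - 2)) + \<sigma>2\<^sup>2 * (\<bar>C2\<bar> * \<delta> powr (2 * H2 - 2))"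
  have one: "\<bar>k\<bar> \<le> \<bar>c\<bar> * \<delta> powr (2 * h - 2) * real_of_int \<bar>m\<bar> powr (2 * max H1 H2 - 2)"
    if m: "m \<noteq> 0" and h: "h \<le> max H1 H2" and k: "\<bar>k\<bar> \<le> c * \<bar>real_of_int m * \<delta>\<bar> powr (2 * h - 2)" for m :: int and h k c :: real
  proof -
    have m1: "1 \<le> real_of_int \<bar>m\<bar>" using m by linarith
    have "\<bar>real_of_int m * \<delta>\<bar> powr (2 * h - 2) = \<delta> powr (2 * h - 2) * real_of_int \<bar>m\<bar> powr (2 * h - 2)"
      using \<delta> by (simp add: abs_mult powr_mult)
    moreover have "\<delta> powr (2 * h - 2) * real_of_int \<bar>m\<bar> powr (2 * h - 2) \<le> \<delta> powr (2 * h - 2) * real_of_int \<bar>m\<bar> powr (2 * max H1 H2 - 2)"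
      using h m1 by (intro mult_left_mono powr_mono) auto
    ultimately have b: "\<bar>real_of_int m * \<delta>\<bar> powr (2 * h - 2) \<le> \<delta> powr (2 * h - 2) * real_of_int \<bar>m\<bar> powr (2 * max H1 H2 - 2)" by simp
    have "c * \<bar>real_of_int m * \<delta>\<bar> powr (2 * h - 2) \<le> \<bar>c\<bar> * \<bar>real_of_int m * \<delta>\<bar> powr (2 * h - 2)"
      by (intro mult_right_mono) auto
    also have "\<dots> \<le> \<bar>c\<bar> * (\<delta> powr (2 * h - 2) * real_of_int \<bar>m\<bar> powr (2 * max H1 H2 - 2))" by (rule mult_left_mono[OF b]) simp
    finally show ?thesis using k by (simp only: mult.assoc)
  qed
  show ?thesis
  proof (rule that[of "K\<^sup>2"])
    fix m :: int assume m: "m \<noteq> 0"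
    then have "real_of_int m * \<delta> \<noteq> 0" using \<delta> by simp
    note b = one[OF m max.cobounded1 C(1)[OF this]] one[OF m max.cobounded2 C(2)[OF this]]
    let ?p = "real_of_int \<bar>m\<bar> powr (2 * max H1 H2 - 2)"
    have "\<bar>field_cov t s (real_of_int m * \<delta>)\<bar> \<le> \<sigma>1\<^sup>2 * \<bar>mild_cov (2 * H1) t s (real_of_int m * \<delta>)\<bar> + \<sigma>2\<^sup>2 * \<bar>mild_cov (2 * H2) t s (real_of_int m * \<delta>)\<bar>"
      unfolding field_cov_def by (rule order_trans[OF abs_triangle_ineq]) (simp add: abs_mult)
    also have "\<dots> \<le> \<sigma>1\<^sup>2 * (\<bar>C1\<bar> * \<delta> powr (2 * H1 - 2) * ?p) + \<sigma>2\<^sup>2 * (\<bar>C2\<bar> * \<delta> powr (2 * H2 - 2) * ?p)"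
      by (intro add_mono mult_left_mono b) auto
    also have "\<dots> = K * ?p" by (simp add: K_def algebra_simps)
    finally have "\<bar>field_cov t s (real_of_int m * \<delta>)\<bar>\<^sup>2 \<le> (K * ?p)\<^sup>2" by (intro power_mono) auto
    also have "(K * ?p)\<^sup>2 = K\<^sup>2 * real_of_int \<bar>m\<bar> powr (- (4 - 4 * max H1 H2))"
    proof -
      have "?p\<^sup>2 = real_of_int \<bar>m\<bar> powr (- (4 - 4 * max H1 H2))"
        unfolding power2_eq_square powr_add[symmetric] by (rule arg_cong[where f="\<lambda>e. _ powr e"]) simp
      then show ?thesis by (simp only: power_mult_distrib)
    qed
    finally show "(field_cov t s (real_of_int m * \<delta>))\<^sup>2 \<le> K\<^sup>2 * real_of_int \<bar>m\<bar> powr (- (4 - 4 * max H1 H2))" by simp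
  qed
qed

lemma stationary:
  fixes t :: "'n::finite \<Rightarrow> real"
  assumes "\<And>i. t i > 0"
  shows "stationary_gaussian M noise_space (\<lambda>k i. field (t i) (real k * \<delta>)) (\<lambda>i j m. field_cov (t i) (t j) (real_of_int m * \<delta>))"
proof (rule stationary_gaussian.intro)
  show "prob_space M" by (rule B1.prob_space_axioms)
  show "gaussian_space M noise_space" by (rule gaussian_noise_space)
  show "field (t i) (real k * \<delta>) \<in> noise_space" for k i by (rule field_in_noise_space[OF assms])
  show "(\<integral>\<omega>. field (t i) (real k * \<delta>) \<omega> * field (t j) (real l * \<delta>) \<omega> \<partial>M) = field_cov (t i) (t j) (real_of_int (int k - int l) * \<delta>)" for k l i j
    using field_product[OF assms assms] by (simp add: left_diff_distrib)
qed

lemma field_cov_0: "t > 0 \<Longrightarrow> field_cov t t 0 = \<sigma>1\<^sup>2 * fbm_var t H1 + \<sigma>2\<^sup>2 * fbm_var t H2"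
  unfolding field_cov_def using mild_cov_diagonal[OF B1.H] mild_cov_diagonal[OF B2.H] by simp

lemma cov_field:
  assumes "t > 0" "s > 0" shows "cov M (field t x) (field s y) = field_cov t s (x - y)"
  unfolding cov_def using gaussian_space_mean[OF gaussian_noise_space field_in_noise_space] field_product assms by simp

text \<open>The exponent \<open>4 - 4 * max H1 H2\<close> exceeds 1 exactly when both Hurst indices
  are below 3/4. The lag 0, where the decay bound is silent, is put back as a single term.\<close>

lemma field_cov_summable:
  assumes "\<delta> > 0" "max H1 H2 < 3 / 4"
  shows "(\<lambda>m::int. (field_cov t s (real_of_int m * \<delta>))\<^sup>2) summable_on UNIV"
proof -
  obtain C where C: "\<And>m::int. m \<noteq> 0 \<Longrightarrow> (field_cov t s (real_of_int m * \<delta>))\<^sup>2 \<le> C * real_of_int \<bar>m\<bar> powr (- (4 - 4 * max H1 H2))"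
    using field_cov_decay[OF assms(1)] by blast
  have "(\<lambda>m. C * real_of_int \<bar>m\<bar> powr (- (4 - 4 * max H1 H2))) summable_on (UNIV :: int set)"
    using assms(2) by (intro summable_on_cmult_right summable_on_int_powr) auto
  then have "(\<lambda>m. C * real_of_int \<bar>m\<bar> powr (- (4 - 4 * max H1 H2))) summable_on (UNIV - {0 :: int})"
    by (rule summable_on_subset_banach) auto
  then have "(\<lambda>m::int. (field_cov t s (real_of_int m * \<delta>))\<^sup>2) summable_on (UNIV - {0})"
    by (rule summable_on_comparison_test) (use C in auto)
  then have "(\<lambda>m::int. (field_cov t s (real_of_int m * \<delta>))\<^sup>2) summable_on insert 0 (UNIV - {0})"
    by (simp only: summable_on_insert_iff)
  then show ?thesis by (simp add: insert_UNIV)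
qed

end

theorem theorem2p2:
  fixes M :: "'a measure"
    and W1 W2 :: "real \<Rightarrow> 'a \<Rightarrow> real"
    and H1 H2 \<sigma>1 \<sigma>2 \<delta> :: real
    and u :: "real \<Rightarrow> real \<Rightarrow> 'a \<Rightarrow> real"
    and V :: "nat \<Rightarrow> real \<Rightarrow> 'a \<Rightarrow> real"
    and \<mu> :: "real \<Rightarrow> real"
    and \<rho> :: "real \<Rightarrow> real \<Rightarrow> int \<Rightarrow> real"
    and r :: "real \<Rightarrow> real \<Rightarrow> real"
  assumes "prob_space M"
    and "0 < H1" "H1 < 1" "0 < H2" "H2 < 1"
    and "\<sigma>1 > 0" "\<sigma>2 > 0" "\<delta> > 0"
    and "two_sided_fBm M H1 W1" "two_sided_fBm M H2 W2"
    and "indep_processes M W1 W2"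
    and u_def: "\<And>t x \<omega>. u t x \<omega> =
      \<sigma>1 * time_space_integral W1 t x \<omega> + \<sigma>2 * time_space_integral W2 t x \<omega>"
    and V_def: "\<And>N t \<omega>. V N t \<omega> = 1 / real N * (\<Sum>k=1..N. (u t (real k * \<delta>) \<omega>)\<^sup>2)"
    and \<mu>_def: "\<And>t. \<mu> t = \<sigma>1\<^sup>2 * fbm_var t H1 + \<sigma>2\<^sup>2 * fbm_var t H2"
    and \<rho>_def: "\<And>t s k. \<rho> t s k = cov M (u t (of_int k * \<delta>)) (u s 0)"
    and r_def: "\<And>t s. r t s = 2 * (\<Sum>\<^sub>\<infinity>k\<in>UNIV. (\<rho> t s k)\<^sup>2)"
  shows
    "(\<forall>t>0. AE \<omega> in M. (\<lambda>N. V N t \<omega>) \<longlonglongrightarrow> \<mu> t) \<and>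
     (H1 < 3 / 4 \<and> H2 < 3 / 4 \<longrightarrow>
        (\<forall>t :: 'n::finite \<Rightarrow> real. inj t \<and> (\<forall>i. t i > 0) \<longrightarrow>
           (\<forall>i j. (\<lambda>k. (\<rho> (t i) (t j) k)\<^sup>2) summable_on UNIV) \<and>
           (\<exists>Q :: (real ^ 'n) measure.
              multivariate_normal Q 0 (\<chi> i j. r (t i) (t j)) \<and>
              converges_in_law M
                (\<lambda>N \<omega>. \<chi> i. sqrt (real N) * (V N (t i) \<omega> - \<mu> (t i))) Q)))"
proof -
  interpret independent_fbm_pair M H1 H2 W1 W2 \<sigma>1 \<sigma>2
    using assms(1-5,9-11)
    by (intro independent_fbm_pair.intro independent_fbm_pair_axioms.intro fractional_brownian_motion.intro)
  have u: "u = field" by (intro ext) (simp add: u_def field_def)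
  have \<rho>: "\<rho> t s k = field_cov t s (real_of_int k * \<delta>)" if "t > 0" "s > 0" for t s k
    unfolding \<rho>_def u using cov_field[OF that] by simp
  have \<mu>: "\<mu> t = field_cov t t (real_of_int 0 * \<delta>)" if "t > 0" for t
    unfolding \<mu>_def using field_cov_0[OF that] by simp
  show ?thesis
  proof (intro conjI allI impI)
    fix t :: real assume t: "t > 0"
    \<comment> \<open>A single time is handled by the one-point index type.\<close>
    interpret S: stationary_gaussian M noise_space "\<lambda>k (i::unit). field t (real k * \<delta>)" "\<lambda>i j m. field_cov t t (real_of_int m * \<delta>)"
      by (rule stationary) (rule t)
    obtain C where C: "\<And>m::int. m \<noteq> 0 \<Longrightarrow> (field_cov t t (real_of_int m * \<delta>))\<^sup>2 \<le> C * real_of_int \<bar>m\<bar> powr (- (4 - 4 * max H1 H2))"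
      using field_cov_decay[OF \<open>\<delta> > 0\<close>] by blast
    \<comment> \<open>The strong law takes rates up to 1, hence the cap; positivity holds because
      both Hurst indices are below 1.\<close>
    define \<alpha> where "\<alpha> = min 1 (4 - 4 * max H1 H2)"
    have \<alpha>: "0 < \<alpha>" "\<alpha> \<le> 1" using assms(3,5) by (auto simp: \<alpha>_def)
    have "(field_cov t t (real_of_int m * \<delta>))\<^sup>2 \<le> \<bar>C\<bar> * real_of_int \<bar>m\<bar> powr (- \<alpha>)" if m: "m \<noteq> 0" for m :: int
    proof -
      have "1 \<le> real_of_int \<bar>m\<bar>" using m by linarith
      then have "real_of_int \<bar>m\<bar> powr (- (4 - 4 * max H1 H2)) \<le> real_of_int \<bar>m\<bar> powr (- \<alpha>)"
        by (intro powr_mono) (auto simp: \<alpha>_def)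
      then have "C * real_of_int \<bar>m\<bar> powr (- (4 - 4 * max H1 H2)) \<le> \<bar>C\<bar> * real_of_int \<bar>m\<bar> powr (- \<alpha>)"
        by (intro mult_mono) auto
      then show ?thesis using C[OF m] by linarith
    qed
    from S.average_square_AE_tendsto[OF \<alpha> this]
    show "AE \<omega> in M. (\<lambda>N. V N t \<omega>) \<longlonglongrightarrow> \<mu> t" unfolding V_def u \<mu>[OF t] .
  next
    fix t :: "'n \<Rightarrow> real" and i j
    assume "H1 < 3 / 4 \<and> H2 < 3 / 4" and t: "inj t \<and> (\<forall>i. t i > 0)"
    then have "max H1 H2 < 3 / 4" "\<And>i. t i > 0" by auto
    then show "(\<lambda>k. (\<rho> (t i) (t j) k)\<^sup>2) summable_on UNIV"
      using field_cov_summable[OF \<open>\<delta> > 0\<close>] by (simp only: \<rho>)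
  next
    fix t :: "'n \<Rightarrow> real"
    assume H: "H1 < 3 / 4 \<and> H2 < 3 / 4" and t: "inj t \<and> (\<forall>i. t i > 0)"
    then have pos: "\<And>i. t i > 0" by simp
    interpret S: stationary_gaussian M noise_space "\<lambda>k i. field (t i) (real k * \<delta>)" "\<lambda>i j m. field_cov (t i) (t j) (real_of_int m * \<delta>)"
      by (rule stationary) (rule pos)
    have "(\<lambda>m. (field_cov (t i) (t j) (real_of_int m * \<delta>))\<^sup>2) summable_on UNIV" for i j
      by (rule field_cov_summable[OF \<open>\<delta> > 0\<close>]) (use H in auto)
    from S.fluctuation_clt[OF this] obtain Q :: "(real ^ 'n) measure" where
      Q: "multivariate_normal Q 0 (\<chi> i j. S.limit_cov i j)" "converges_in_law M (\<lambda>N \<omega>. \<chi> i. S.fluctuation N i \<omega>) Q" by blast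
    have "S.limit_cov i j = r (t i) (t j)" for i j
      unfolding S.limit_cov_def r_def by (simp add: \<rho> pos)
    moreover have "S.fluctuation N i \<omega> = sqrt (real N) * (V N (t i) \<omega> - \<mu> (t i))" for N i \<omega>
      unfolding S.fluctuation_def V_def u \<mu>[OF pos] ..
    ultimately show "\<exists>Q :: (real ^ 'n) measure. multivariate_normal Q 0 (\<chi> i j. r (t i) (t j)) \<and>
        converges_in_law M (\<lambda>N \<omega>. \<chi> i. sqrt (real N) * (V N (t i) \<omega> - \<mu> (t i))) Q"
      using Q by auto
  qed
qed

end
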